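(* Assume (A$_1$) and (A$_2$), and that there is a nonrandom integer $M$ with $\mathbb{P}(S_{M+1}=\infty)=1$. Then the solution $Y$ of the BSDE $$Y_t+\int_{(t,T]}\int_E Z(s,x)\,\mu(ds,dx)=\xi+\int_{(t,T]}\int_E f\bigl(\cdot,s,x,Y_{s-},Z_s(\cdot)\bigr)\,\nu(ds,dx),\qquad t\in[0,T],$$ if it exists, is unique up to null sets (among all possible solutions). Moreover, if the random variable $A_T$ is bounded and if $$\mathbb{E}(|\xi|)<\infty,\qquad \mathbb{E}\Bigl(\int_0^T\!\int_E|f(s,x,0,0)|\,\nu(ds,dx)\Bigr)<\infty,$$ then the solution exists and satisfies $\mathbb{E}\bigl(\int_0^T|Y_t|\,dA_t\bigr)<\infty$ and $\mathbb{E}\bigl(\int_0^T\int_E|Z(t,x)|\,\nu(dt,dx)\bigr)<\infty$.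
   Context: Point process. $(\Omega,\mathcal{F},\mathbb{P})$ is a probability space, $T\in(0,\infty)$ is fixed, $(E,\mathcal{E})$ is a Lusin space with its Borel $\sigma$-field, $\Delta\in E$ a distinguished point. $(S_n,X_n)_{n\ge1}$ is a nonexplosive multivariate point process: $S_n$ takes values in $(0,T]\cup\{\infty\}$, $X_n$ in $E$, $S_n\le S_{n+1}$ everywhere, $S_n<S_{n+1}$ if $S_n\le T$, $X_n=\Delta$ if $S_n=\infty$, and $\Omega=\bigcup_n\{S_n>T\}$; put $S_0=0$. The associated random measure is $\mu(dt,dx)=\sum_{n\ge1:\,S_n\le T}\varepsilon_{(S_n,X_n)}(dt,dx)$ ($\varepsilon$ = Dirac measure), and $N_t=\mu([0,t]\times E)$. $(\mathcal{F}_t)_{t\ge0}$ is the filtration generated by the point process (the smallest one for which each $S_n$ is a stopping time and $X_n$ is $\mathcal{F}_{S_n}$-measurable). A function on $\Omega\times[0,T]\times G$, with $(G,\mathcal{G})$ measurable, is called predictable if it is measurable with respect to $\mathcal{P}\otimes\mathcal{G}$, $\mathcal{P}$ being the predictable $\sigma$-field on $\Omega\times[0,T]$. $\nu$ is the predictable compensator of $\mu$, disintegrated as $\nu(\omega,dt,dx)=dA_t(\omega)\,\phi_{\omega,t}(dx)$, where $\phi$ is a transition probability from $(\Omega\times[0,T],\mathcal{P})$ into $(E,\mathcal{E})$ and $A$ is increasing, c\`adl\`ag, predictable, $A_0=0$ ($A$ is the compensator of $N$). Assumptions: (A$_1$) the process $A$ is continuous (equivalently, the jump times $S_n$ are totally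 inaccessible); (A$_2$) $\mathbb{P}(S_{n+1}>T\mid\mathcal{F}_{S_n})>0$ for all $n\ge0$. BSDE. The terminal condition $\xi$ is an $\mathcal{F}_T$-measurable real random variable. $\mathcal{B}(E)$ is the set of Borel real functions on $E$; for a function $Z$ on $\Omega\times[0,T]\times E$ write $Z_{\omega,t}(x)=Z(\omega,t,x)$, $Z_t(\cdot)=Z_{\omega,t}\in\mathcal{B}(E)$. The generator $f$ is a real function on $\Omega\times[0,T]\times E\times\mathbb{R}\times\mathcal{B}(E)$ such that $f(\omega,t,x,y,Z_{\omega,t}(\cdot))$ is predictable for every predictable $Z$ on $\Omega\times[0,T]\times E$, and for some constants $L,L'\ge0$: $|f(\omega,t,x,y',\zeta)-f(\omega,t,x,y,\zeta)|\le L'|y'-y|$; $\int_E|f(\omega,t,x,y,\zeta)-f(\omega,t,x,y,\zeta')|\,\phi_{\omega,t}(dx)\le L\int_E|\zeta'(x)-\zeta(x)|\,\phi_{\omega,t}(dx)$; and $\int_0^T\int_E|f(t,x,0,0)|\,\nu(dt,dx)<\infty$ a.s. (the last $0$ being the zero function of $\mathcal{B}(E)$). A solution is a pair $(Y,Z)$ with $Y$ adapted c\`adl\`ag and $Z$ predictable on $\Omega\times[0,T]\times E$ with $\int_0^T\int_E|Z(t,x)|\,\nu(dt,dx)<\infty$ a.s., such that the equation holds for all $t\in[0,T]$ outside a $\mathbb{P}$-null set. One also calls $Y$ itself a solution if such a $Z$ exists ($Z$ is then determined by $Y$ up to a $\mathbb{P}(d\omega)\nu(\omega,dt,dx)$-null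 set). Uniqueness up to null sets means: any two solutions $Y,Y'$ satisfy $Y_t=Y'_t$ for all $t\in[0,T]$ outside a $\mathbb{P}$-null set. *)

theory Defs
  imports "HOL-Probability.Probability"
begin

text \<open>
  Time runs through \<^term>\<open>{0..T}\<close> with \<^term>\<open>T :: real\<close>. The jump times may be infinite and are
  therefore of type \<^typ>\<open>ennreal\<close>; so filtrations are indexed by \<^typ>\<open>ennreal\<close>, which lets
  the library notions \<^const>\<open>stopping_time\<close> and \<open>filtration.pre_sigma\<close> apply directly.
  Processes take the sample point first and the time second; only their values on
  \<^term>\<open>space M\<close> and \<^term>\<open>{0..T}\<close> matter.
\<close>

text \<open>
  A topological space is Lusin if it is homeomorphic to a Borel subset of a Polish space. The
  Polish space is a type variable, so a statement assuming \<open>lusin_embedding \<iota>\<close> is about every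
  Lusin space.
\<close>

definition lusin_embedding :: "('e::topological_space \<Rightarrow> 'p::polish_space) \<Rightarrow> bool" where
  "lusin_embedding \<iota> \<longleftrightarrow>
     range \<iota> \<in> sets borel \<and> (\<exists>\<kappa>. homeomorphism UNIV (range \<iota>) \<iota> \<kappa>)"

subsection \<open>Multivariate point processes and their filtration\<close>

text \<open>The index \<open>0\<close> only carries the convention \<open>S 0 = 0\<close>; the mark \<open>X 0\<close> is never used.\<close>

definition multivariate_point_process ::
  "'w measure \<Rightarrow> real \<Rightarrow> 'e::topological_space \<Rightarrow> (nat \<Rightarrow> 'w \<Rightarrow> ennreal) \<Rightarrow> (nat \<Rightarrow> 'w \<Rightarrow> 'e) \<Rightarrow> bool"
where
  "multivariate_point_process M T \<Delta> S X \<longleftrightarrow>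
     (\<forall>n. S n \<in> borel_measurable M) \<and>
     (\<forall>n\<ge>1. X n \<in> borel_measurable M) \<and>
     (\<forall>\<omega>\<in>space M.
        S 0 \<omega> = 0 \<and>
        (\<forall>n\<ge>1. S n \<omega> \<in> ennreal ` {0<..T} \<union> {\<infinity>}) \<and>
        (\<forall>n. S n \<omega> \<le> S (Suc n) \<omega>) \<and>
        (\<forall>n. S n \<omega> \<le> ennreal T \<longrightarrow> S n \<omega> < S (Suc n) \<omega>) \<and>
        (\<forall>n\<ge>1. S n \<omega> = \<infinity> \<longrightarrow> X n \<omega> = \<Delta>) \<and>
        (\<exists>n. S n \<omega> > ennreal T))"

definition adapts_points ::
  "'w set \<Rightarrow> (nat \<Rightarrow> 'w \<Rightarrow> ennreal) \<Rightarrow> (nat \<Rightarrow> 'w \<Rightarrow> 'e::topological_space) \<Rightarrow> (ennreal \<Rightarrow> 'w measure) \<Rightarrow> bool"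
where
  "adapts_points \<Omega> S X F \<longleftrightarrow>
     filtration \<Omega> F \<and>
     (\<forall>n\<ge>1. stopping_time F (S n) \<and> X n \<in> borel_measurable (filtration.pre_sigma \<Omega> F (S n)))"

definition generated_filtration ::
  "'w set \<Rightarrow> (nat \<Rightarrow> 'w \<Rightarrow> ennreal) \<Rightarrow> (nat \<Rightarrow> 'w \<Rightarrow> 'e::topological_space) \<Rightarrow> (ennreal \<Rightarrow> 'w measure) \<Rightarrow> bool"
where
  "generated_filtration \<Omega> S X F \<longleftrightarrow>
     adapts_points \<Omega> S X F \<and>
     (\<forall>G. adapts_points \<Omega> S X G \<longrightarrow> (\<forall>t. sets (F t) \<subseteq> sets (G t)))"

text \<open>
  The sum of the Dirac measures at the points \<open>(S n \<omega>, X n \<omega>)\<close> with \<open>n \<ge> 1\<close> and \<open>S n \<omega> \<le> T\<close>, as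
  the image of a counting measure.
\<close>

definition jump_measure ::
  "real \<Rightarrow> (nat \<Rightarrow> 'w \<Rightarrow> ennreal) \<Rightarrow> (nat \<Rightarrow> 'w \<Rightarrow> 'e::topological_space) \<Rightarrow> 'w \<Rightarrow> (real \<times> 'e) measure"
where
  "jump_measure T S X \<omega> =
     distr (count_space {n. 1 \<le> n \<and> S n \<omega> \<le> ennreal T}) (borel \<Otimes>\<^sub>M borel)
       (\<lambda>n. (enn2real (S n \<omega>), X n \<omega>))"

subsection \<open>Predictability and adaptedness on \<open>[0, T]\<close>\<close>

definition predictable_sigma :: "'w set \<Rightarrow> (ennreal \<Rightarrow> 'w measure) \<Rightarrow> real \<Rightarrow> ('w \<times> real) measure" where
  "predictable_sigma \<Omega> F T =
     sigma (\<Omega> \<times> {0..T})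
       ({B \<times> {0} | B. B \<in> sets (F 0)} \<union>
        {B \<times> {s<..t} | B s t. 0 \<le> s \<and> s < t \<and> t \<le> T \<and> B \<in> sets (F (ennreal s))})"

definition predictable ::
  "'w set \<Rightarrow> (ennreal \<Rightarrow> 'w measure) \<Rightarrow> real \<Rightarrow> 'g measure \<Rightarrow> ('w \<Rightarrow> real \<Rightarrow> 'g \<Rightarrow> 'b::topological_space) \<Rightarrow> bool"
where
  "predictable \<Omega> F T G H \<longleftrightarrow>
     (\<lambda>((\<omega>, t), g). H \<omega> t g) \<in> borel_measurable (predictable_sigma \<Omega> F T \<Otimes>\<^sub>M G)"

definition adapted :: "(ennreal \<Rightarrow> 'w measure) \<Rightarrow> real \<Rightarrow> ('w \<Rightarrow> real \<Rightarrow> real) \<Rightarrow> bool" where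
  "adapted F T Y \<longleftrightarrow> (\<forall>t\<in>{0..T}. (\<lambda>\<omega>. Y \<omega> t) \<in> borel_measurable (F (ennreal t)))"

definition cadlag :: "real \<Rightarrow> (real \<Rightarrow> real) \<Rightarrow> bool" where
  "cadlag T y \<longleftrightarrow>
     (\<forall>t\<in>{0..<T}. (y \<longlongrightarrow> y t) (at_right t)) \<and>
     (\<forall>t\<in>{0<..T}. \<exists>l. (y \<longlongrightarrow> l) (at_left t))"

definition left_limit :: "(real \<Rightarrow> real) \<Rightarrow> real \<Rightarrow> real" where
  "left_limit y t = Lim (at_left t) y"

subsection \<open>The compensator\<close>

text \<open>
  The Stieltjes measure on \<^term>\<open>{0..T}\<close> of a path \<open>a\<close>. Extending \<open>a\<close> by constants outside
  \<^term>\<open>{0..T}\<close> means that \<open>{0}\<close> gets no mass, in agreement with \<open>a 0 = 0\<close>.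
\<close>

definition stieltjes :: "real \<Rightarrow> (real \<Rightarrow> real) \<Rightarrow> real measure" where
  "stieltjes T a = restrict_space (interval_measure (\<lambda>t. a (max 0 (min T t)))) {0..T}"

definition disintegrated_measure ::
  "real \<Rightarrow> ('w \<Rightarrow> real \<Rightarrow> real) \<Rightarrow> ('w \<Rightarrow> real \<Rightarrow> 'e::topological_space measure) \<Rightarrow> 'w \<Rightarrow> (real \<times> 'e) measure"
where
  "disintegrated_measure T A \<phi> \<omega> =
     stieltjes T (A \<omega>) \<bind> (\<lambda>t. distr (\<phi> \<omega> t) (borel \<Otimes>\<^sub>M borel) (Pair t))"

text \<open>
  \<open>disintegrated_measure T A \<phi>\<close> is the predictable compensator of the jump measure: it is a
  predictable random measure that has the same expected integrals of nonnegative predictable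
  functions.
\<close>

definition disintegrated_compensator ::
  "'w measure \<Rightarrow> real \<Rightarrow> (nat \<Rightarrow> 'w \<Rightarrow> ennreal) \<Rightarrow> (nat \<Rightarrow> 'w \<Rightarrow> 'e::topological_space) \<Rightarrow>
   (ennreal \<Rightarrow> 'w measure) \<Rightarrow> ('w \<Rightarrow> real \<Rightarrow> real) \<Rightarrow> ('w \<Rightarrow> real \<Rightarrow> 'e measure) \<Rightarrow> bool"
where
  "disintegrated_compensator M T S X F A \<phi> \<longleftrightarrow>
     (\<forall>\<omega>\<in>space M. A \<omega> 0 = 0 \<and> mono_on {0..T} (A \<omega>) \<and> cadlag T (A \<omega>)) \<and>
     (\<lambda>(\<omega>, t). A \<omega> t) \<in> borel_measurable (predictable_sigma (space M) F T) \<and>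
     (\<lambda>(\<omega>, t). \<phi> \<omega> t) \<in> predictable_sigma (space M) F T \<rightarrow>\<^sub>M prob_algebra borel \<and>
     (\<forall>H :: 'w \<Rightarrow> real \<Rightarrow> 'e \<Rightarrow> ennreal. predictable (space M) F T borel H \<longrightarrow>
        (\<integral>\<^sup>+\<omega>. (\<integral>\<^sup>+(t, x). H \<omega> t x \<partial>jump_measure T S X \<omega>) \<partial>M) =
        (\<integral>\<^sup>+\<omega>. (\<integral>\<^sup>+(t, x). H \<omega> t x \<partial>disintegrated_measure T A \<phi> \<omega>) \<partial>M))"

subsection \<open>The BSDE\<close>

definition bsde_generator ::
  "'w measure \<Rightarrow> real \<Rightarrow> (ennreal \<Rightarrow> 'w measure) \<Rightarrow> ('w \<Rightarrow> real \<Rightarrow> real) \<Rightarrow>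
   ('w \<Rightarrow> real \<Rightarrow> 'e::topological_space measure) \<Rightarrow>
   real \<Rightarrow> real \<Rightarrow> ('w \<Rightarrow> real \<Rightarrow> 'e \<Rightarrow> real \<Rightarrow> ('e \<Rightarrow> real) \<Rightarrow> real) \<Rightarrow> bool"
where
  "bsde_generator M T F A \<phi> L L' f \<longleftrightarrow>
     (\<forall>Z :: 'w \<Rightarrow> real \<Rightarrow> 'e \<Rightarrow> real. predictable (space M) F T borel Z \<longrightarrow>
        predictable (space M) F T (borel \<Otimes>\<^sub>M borel) (\<lambda>\<omega> t (x, y). f \<omega> t x y (Z \<omega> t))) \<and>
     (\<forall>\<omega>\<in>space M. \<forall>t\<in>{0..T}. \<forall>x y y'. \<forall>\<zeta>\<in>borel_measurable borel.
        \<bar>f \<omega> t x y' \<zeta> - f \<omega> t x y \<zeta>\<bar> \<le> L' * \<bar>y' - y\<bar>) \<and>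
     (\<forall>\<omega>\<in>space M. \<forall>t\<in>{0..T}. \<forall>y. \<forall>\<zeta>\<in>borel_measurable borel. \<forall>\<zeta>'\<in>borel_measurable borel.
        (\<integral>\<^sup>+x. ennreal \<bar>f \<omega> t x y \<zeta> - f \<omega> t x y \<zeta>'\<bar> \<partial>\<phi> \<omega> t) \<le>
        ennreal L * (\<integral>\<^sup>+x. ennreal \<bar>\<zeta>' x - \<zeta> x\<bar> \<partial>\<phi> \<omega> t)) \<and>
     (AE \<omega> in M. (\<integral>\<^sup>+(t, x). ennreal \<bar>f \<omega> t x 0 (\<lambda>_. 0)\<bar> \<partial>disintegrated_measure T A \<phi> \<omega>) < \<infinity>)"

definition bsde_solution ::
  "'w measure \<Rightarrow> real \<Rightarrow> (nat \<Rightarrow> 'w \<Rightarrow> ennreal) \<Rightarrow> (nat \<Rightarrow> 'w \<Rightarrow> 'e::topological_space) \<Rightarrow>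
   (ennreal \<Rightarrow> 'w measure) \<Rightarrow> ('w \<Rightarrow> real \<Rightarrow> real) \<Rightarrow> ('w \<Rightarrow> real \<Rightarrow> 'e measure) \<Rightarrow>
   ('w \<Rightarrow> real \<Rightarrow> 'e \<Rightarrow> real \<Rightarrow> ('e \<Rightarrow> real) \<Rightarrow> real) \<Rightarrow> ('w \<Rightarrow> real) \<Rightarrow>
   ('w \<Rightarrow> real \<Rightarrow> real) \<Rightarrow> ('w \<Rightarrow> real \<Rightarrow> 'e \<Rightarrow> real) \<Rightarrow> bool"
where
  "bsde_solution M T S X F A \<phi> f \<xi> Y Z \<longleftrightarrow>
     adapted F T Y \<and> (\<forall>\<omega>\<in>space M. cadlag T (Y \<omega>)) \<and>
     predictable (space M) F T borel Z \<and>
     (AE \<omega> in M. (\<integral>\<^sup>+(t, x). ennreal \<bar>Z \<omega> t x\<bar> \<partial>disintegrated_measure T A \<phi> \<omega>) < \<infinity>) \<and>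
     (AE \<omega> in M. \<forall>t\<in>{0..T}.
        Y \<omega> t + (LINT (s, x):{t<..T} \<times> UNIV|jump_measure T S X \<omega>. Z \<omega> s x) =
        \<xi> \<omega> + (LINT (s, x):{t<..T} \<times> UNIV|disintegrated_measure T A \<phi> \<omega>.
                 f \<omega> s x (left_limit (Y \<omega>) s) (Z \<omega> s)))"

end

theory Submission
  imports Defs
begin

text \<open>
  Between two jumps the equation is an ordinary integral equation driven by the continuous increasing
  process \<open>A\<close>, and at a jump \<open>Z\<close>, taken at the new point, is the jump of \<open>Y\<close>. Since almost surely at
  most \<open>m\<close> jumps occur, it suffices to pass from solutions of the equation on the times from \<open>S (n + 1)\<close>
  on to solutions on the times from \<open>S n\<close> on (\<open>solution_from\<close>, \<open>path_between_jumps\<close>).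

  Such a step is possible because \<open>r = Z + Y\<^sub>-\<close> is the value to which \<open>Y\<close> would jump and therefore is
  determined by \<open>Y\<close> at the next jump: by the compensator formula, predictable functions that agree at the
  next point agree almost everywhere up to it (\<open>step_compensator\<close>). Inserting \<open>Z = r - Y\<^sub>-\<close> leaves a
  driver that is Lipschitz in \<open>Y\<^sub>-\<close> alone (\<open>mean_driver_difference\<close>, \<open>jump_driver_lipschitz\<close>).

  Uniqueness. Let two solutions agree at \<open>S (n + 1)\<close>. On the paths without a further jump both end in
  \<open>\<xi>\<close>, and Gronwall's inequality, run backwards, shows that they agree at \<open>S n\<close>. Whether they agree at
  \<open>S n\<close> is known at \<open>S n\<close>, and by (A2) the absence of a further jump has positive conditional
  probability; hence they agree at \<open>S n\<close> almost surely, also if a jump follows. Gronwall's inequality, run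
  forwards, extends this up to \<open>S (n + 1)\<close> (\<open>unique_between_jumps\<close>, \<open>unique_from\<close>).

  Integrability. If \<open>A T \<le> C\<close>, condition (A2) becomes quantitative: after \<open>S n\<close>, no further jump
  occurs with conditional probability at least \<open>exp (- C)\<close> (\<open>survival\<close>). So the mean of \<open>\<bar>Y\<bar>\<close> at \<open>S n\<close> is
  controlled by its mean over the paths without a further jump, where the backward Gronwall inequality
  bounds it by \<open>\<bar>\<xi>\<bar>\<close> and integrals of \<open>\<bar>r\<bar>\<close> and \<open>\<bar>f(\<cdot>, 0, 0)\<bar>\<close>; the mean of the integral of \<open>\<bar>r\<bar>\<close> is
  the mean of \<open>\<bar>Y\<bar>\<close> at the next jump (\<open>estimate_between_jumps\<close>).

  Existence. The value of \<open>Y\<close> at \<open>S n\<close> can only be the one at which the equation arrives when it is solved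
  backwards from \<open>\<xi>\<close> as if no jump followed. This solution looks into the future; but the filtration is
  generated by the points, so that on the paths without a further jump everything that is known at \<open>T\<close> is
  a function of the first \<open>n\<close> points (\<open>F_subset_trace\<close>, \<open>trace_function\<close>). This function of the points is
  taken as the value at \<open>S n\<close> for all paths, and the forward equation started there has a predictable
  solution (\<open>extend_solution\<close>). To have integrable drivers on every path they are cut off at a
  predictable time, which survival shows to have no effect almost surely (\<open>cutoff_driver\<close>).

  All of this is done for an \<open>A\<close> whose paths are all continuous and, in the second part, bounded by \<open>C\<close>.
  In general \<open>A\<close> is replaced by its continuous part, capped at \<open>C\<close>, which almost surely has the same
  Stieltjes measures (\<open>continuous_part\<close>).
\<close>

section \<open>Cadlag paths\<close>

text \<open>
  Near every point a cadlag path is bounded by its one-sided limits; bisection makes this global.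
\<close>

lemma cadlag_bounded:
  assumes "cadlag T y" obtains B where "\<And>t. t \<in> {0..T} \<Longrightarrow> \<bar>y t\<bar> \<le> B"
proof (cases "0 \<le> T")
  case True
  let ?P = "\<lambda>u v. \<exists>B. \<forall>t\<in>{u..v} \<inter> {0..T}. \<bar>y t\<bar> \<le> B"
  have "?P 0 T"
  proof (rule Bolzano[where P="?P", OF True])
    fix a b c assume "?P a b" "?P b c" "a \<le> b" "b \<le> c"
    then obtain B B' where B: "\<forall>t\<in>{a..b} \<inter> {0..T}. \<bar>y t\<bar> \<le> B" "\<forall>t\<in>{b..c} \<inter> {0..T}. \<bar>y t\<bar> \<le> B'" by blast
    have "\<bar>y t\<bar> \<le> max B B'" if "t \<in> {a..c} \<inter> {0..T}" for t
    proof (cases "t \<le> b")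
      case True
      then have "t \<in> {a..b} \<inter> {0..T}" using that by simp
      with B(1) have "\<bar>y t\<bar> \<le> B" by blast
      then show ?thesis by linarith
    next
      case False
      then have "t \<in> {b..c} \<inter> {0..T}" using that by simp
      with B(2) have "\<bar>y t\<bar> \<le> B'" by blast
      then show ?thesis by linarith
    qed
    then show "?P a c" by blast
  next
    fix x assume x: "0 \<le> x" "x \<le> T"
    have near: "\<exists>B d. 0 < d \<and> (\<forall>t. t \<in> D \<longrightarrow> t \<noteq> x \<longrightarrow> \<bar>t - x\<bar> < d \<longrightarrow> \<bar>y t\<bar> \<le> B)"
      if "(y \<longlongrightarrow> l) (at x within D)" for l D
    proof -
      have "\<forall>\<^sub>F t in at x within D. dist (y t) l < 1" using tendstoD[OF that, of 1] by simp
      then obtain d where "0 < d" "\<forall>t\<in>D. t \<noteq> x \<and> dist t x < d \<longrightarrow> dist (y t) l < 1"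
        by (auto simp: eventually_at)
      then show ?thesis by (intro exI[of _ "\<bar>l\<bar> + 1"] exI[of _ d]) (force simp: dist_real_def)
    qed
    have "\<exists>B d. 0 < d \<and> (\<forall>t. t \<in> {x<..} \<longrightarrow> t \<noteq> x \<longrightarrow> \<bar>t - x\<bar> < d \<longrightarrow> t \<le> T \<longrightarrow> \<bar>y t\<bar> \<le> B)"
    proof (cases "x < T")
      case True
      then have "(y \<longlongrightarrow> y x) (at x within {x<..})" using assms x by (auto simp: cadlag_def)
      from near[OF this] show ?thesis by blast
    next
      case False then show ?thesis by (intro exI[of _ 0] exI[of _ 1]) auto
    qed
    then obtain B d where r: "0 < d" "\<And>t. x < t \<Longrightarrow> \<bar>t - x\<bar> < d \<Longrightarrow> t \<le> T \<Longrightarrow> \<bar>y t\<bar> \<le> B" by fastforce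
    have "\<exists>B d. 0 < d \<and> (\<forall>t. t \<in> {..<x} \<longrightarrow> t \<noteq> x \<longrightarrow> \<bar>t - x\<bar> < d \<longrightarrow> 0 \<le> t \<longrightarrow> \<bar>y t\<bar> \<le> B)"
    proof (cases "0 < x")
      case True
      then have "x \<in> {0<..T}" using x by simp
      then obtain l where "(y \<longlongrightarrow> l) (at x within {..<x})" using assms unfolding cadlag_def by blast
      from near[OF this] show ?thesis by blast
    next
      case False then show ?thesis by (intro exI[of _ 0] exI[of _ 1]) auto
    qed
    then obtain B' d' where l: "0 < d'" "\<And>t. t < x \<Longrightarrow> \<bar>t - x\<bar> < d' \<Longrightarrow> 0 \<le> t \<Longrightarrow> \<bar>y t\<bar> \<le> B'" by fastforce
    show "\<exists>d>0. \<forall>a b. a \<le> x \<and> x \<le> b \<and> b - a < d \<longrightarrow> ?P a b"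
    proof (rule exI[of _ "min d d'"], intro conjI allI impI, goal_cases)
      case (2 a b)
      show ?case
      proof (rule exI[of _ "max (max B B') \<bar>y x\<bar>"], rule ballI)
      fix t assume "t \<in> {a..b} \<inter> {0..T}"
      with 2 have *: "a \<le> x \<and> x \<le> b \<and> b - a < min d d'" "t \<in> {a..b} \<inter> {0..T}" by auto
      consider "t = x" | "x < t" | "t < x" by linarith
      then show "\<bar>y t\<bar> \<le> max (max B B') \<bar>y x\<bar>"
      proof cases
        case 2
        then have "\<bar>y t\<bar> \<le> B" using * by (intro r(2)) auto
        then show ?thesis by simp
      next
        case 3
        then have "\<bar>y t\<bar> \<le> B'" using * by (intro l(2)) auto
        then show ?thesis by simp
      qed simp
      qed
    qed (use r l in simp)
  qed
  then show thesis using that by (metis Int_iff inf_idem)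
next
  case False then show thesis using that[of 0] by auto
qed

lemma continuous_at_left:
  fixes y :: "real \<Rightarrow> real"
  assumes "continuous_on {0..T} y" "t \<in> {0<..T}" shows "(y \<longlongrightarrow> y t) (at_left t)"
proof -
  have "continuous (at t within {0..T}) y" using assms by (auto simp: continuous_on_eq_continuous_within)
  then have "continuous (at t within {0..<t}) y" by (rule continuous_within_subset) (use assms in auto)
  moreover have "at t within {0..<t} = at_left t" by (rule at_within_nhd[of _ "{0<..}"]) (use assms in auto)
  ultimately show ?thesis by (simp add: continuous_within)
qed

lemma continuous_cadlag: assumes "continuous_on {0..T} y" shows "cadlag T y"
  unfolding cadlag_def
proof (intro conjI ballI)
  fix t assume t: "t \<in> {0..<T}"
  then have "continuous (at t within {0..T}) y" using assms by (auto simp: continuous_on_eq_continuous_within)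
  then have "continuous (at t within {t<..T}) y" by (rule continuous_within_subset) (use t in auto)
  moreover have "at t within {t<..T} = at_right t" by (rule at_within_nhd[of _ "{..<T}"]) (use t in auto)
  ultimately show "(y \<longlongrightarrow> y t) (at_right t)" by (simp add: continuous_within)
qed (use continuous_at_left[OF assms] in blast)

lemma eventually_at_left_before:
  fixes s :: ennreal assumes "0 < t" "ennreal t \<le> s" shows "\<forall>\<^sub>F u in at_left t. ennreal u < s"
proof -
  have "\<forall>\<^sub>F u in at_left t. u \<in> {0<..<t}" using assms(1) by (intro eventually_at_leftI[of 0]) auto
  then show ?thesis
  proof eventually_elim
    case (elim u)
    then have "ennreal u < ennreal t" by (intro ennreal_lessI) auto
    then show ?case using assms(2) by (rule less_le_trans)
  qed
qed

lemma cadlag_switch: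
  fixes s :: ennreal
  assumes y: "cadlag T y" and z: "cadlag T z"
  shows "cadlag T (\<lambda>t. if s \<le> ennreal t then z t else y t)"
  unfolding cadlag_def
proof (intro conjI ballI)
  fix t assume t: "t \<in> {0..<T}"
  show "((\<lambda>t. if s \<le> ennreal t then z t else y t) \<longlongrightarrow> (if s \<le> ennreal t then z t else y t)) (at_right t)"
  proof (cases "s \<le> ennreal t")
    case True
    have "\<forall>\<^sub>F u in at_right t. z u = (if s \<le> ennreal u then z u else y u)"
      using eventually_at_right_less[of t]
    proof eventually_elim
      case (elim u)
      then have "ennreal t \<le> ennreal u" by (intro ennreal_leI) simp
      with True have "s \<le> ennreal u" by (rule order_trans)
      then show ?case by simp
    qed
    moreover have "(z \<longlongrightarrow> z t) (at_right t)" using z t by (simp add: cadlag_def)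
    ultimately show ?thesis using True by (auto elim: Lim_transform_eventually)
  next
    case False
    have "((\<lambda>u. ennreal u) \<longlongrightarrow> ennreal t) (at_right t)" by (intro tendsto_ennrealI tendsto_ident_at)
    then have "\<forall>\<^sub>F u in at_right t. ennreal u < s" using False by (intro order_tendstoD) (auto simp: not_le)
    then have "\<forall>\<^sub>F u in at_right t. y u = (if s \<le> ennreal u then z u else y u)"
      by eventually_elim (auto dest: leD)
    moreover have "(y \<longlongrightarrow> y t) (at_right t)" using y t by (simp add: cadlag_def)
    ultimately show ?thesis using False by (auto elim: Lim_transform_eventually)
  qed
next
  fix t assume t: "t \<in> {0<..T}"
  show "\<exists>l. ((\<lambda>t. if s \<le> ennreal t then z t else y t) \<longlongrightarrow> l) (at_left t)"
  proof (cases "s < ennreal t")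
    case True
    have "((\<lambda>u. ennreal u) \<longlongrightarrow> ennreal t) (at_left t)" by (intro tendsto_ennrealI tendsto_ident_at)
    then have "\<forall>\<^sub>F u in at_left t. s < ennreal u" using True by (intro order_tendstoD)
    then have "\<forall>\<^sub>F u in at_left t. z u = (if s \<le> ennreal u then z u else y u)"
      by eventually_elim (auto dest: less_imp_le)
    moreover obtain l where "(z \<longlongrightarrow> l) (at_left t)" using z t unfolding cadlag_def by blast
    ultimately show ?thesis by (blast intro: Lim_transform_eventually)
  next
    case False
    then have "\<forall>\<^sub>F u in at_left t. ennreal u < s" using t by (intro eventually_at_left_before) auto
    then have "\<forall>\<^sub>F u in at_left t. y u = (if s \<le> ennreal u then z u else y u)"
      by eventually_elim (auto dest: less_imp_le)
    moreover obtain l where "(y \<longlongrightarrow> l) (at_left t)" using y t unfolding cadlag_def by blast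
    ultimately show ?thesis by (blast intro: Lim_transform_eventually)
  qed
qed

lemma left_limit_eq: "(y \<longlongrightarrow> l) (at_left s) \<Longrightarrow> left_limit y s = l"
  unfolding left_limit_def by (intro tendsto_Lim) auto

lemma left_limit_cong:
  assumes "cadlag T y" "t \<in> {0<..T}" "\<forall>\<^sub>F u in at_left t. y u = y' u"
  shows "left_limit y' t = left_limit y t"
proof -
  obtain l where l: "(y \<longlongrightarrow> l) (at_left t)" using assms(1,2) unfolding cadlag_def by blast
  then have "(y' \<longlongrightarrow> l) (at_left t)" using assms(3) by (rule Lim_transform_eventually)
  then show ?thesis using l by (simp add: left_limit_eq)
qed

section \<open>Stieltjes measures of continuous increasing paths\<close>

locale increasing_path =
  fixes T :: real and a :: "real \<Rightarrow> real"
  assumes T_pos: "0 < T" and a_0: "a 0 = 0" and a_mono: "mono_on {0..T} a" and a_cadlag: "cadlag T a"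
begin

abbreviation "clamped t \<equiv> a (max 0 (min T t))"

lemma clamped_mono: "x \<le> y \<Longrightarrow> clamped x \<le> clamped y"
  using T_pos by (intro mono_onD[OF a_mono]) auto

lemma clamped_right_continuous: "continuous (at_right t) clamped"
proof -
  consider "t < 0" | "T \<le> t" | "0 \<le> t" "t < T" by linarith
  then show ?thesis
  proof cases
    case 1
    have "\<forall>\<^sub>F s in at_right t. s < 0" using 1 by (rule order_tendstoD[OF tendsto_ident_at])
    then have "\<forall>\<^sub>F s in at_right t. clamped s = a 0"
      by eventually_elim (use T_pos in auto)
    moreover have "clamped t = a 0" using 1 T_pos by auto
    ultimately show ?thesis unfolding continuous_within by (simp add: tendsto_eventually)
  next
    case 2
    have "\<forall>\<^sub>F s in at_right t. clamped s = a T"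
      using eventually_at_right_less[of t] by eventually_elim (use 2 T_pos in auto)
    moreover have "clamped t = a T" using 2 T_pos by auto
    ultimately show ?thesis unfolding continuous_within by (simp add: tendsto_eventually)
  next
    case 3
    have "(a \<longlongrightarrow> a t) (at_right t)" using a_cadlag 3 by (auto simp: cadlag_def)
    moreover have "\<forall>\<^sub>F s in at_right t. s < T" using 3(2) by (rule order_tendstoD[OF tendsto_ident_at])
    then have "\<forall>\<^sub>F s in at_right t. a s = clamped s"
      using eventually_at_right_less[of t] by eventually_elim (use 3 in auto)
    ultimately have "(clamped \<longlongrightarrow> a t) (at_right t)" by (rule Lim_transform_eventually)
    moreover have "clamped t = a t" using 3 by auto
    ultimately show ?thesis unfolding continuous_within by simp
  qed
qed

lemma space_stieltjes [simp]: "space (stieltjes T a) = {0..T}"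
  by (simp add: stieltjes_def space_restrict_space)

lemma sets_stieltjes [measurable_cong, simp]: "sets (stieltjes T a) = sets (restrict_space borel {0..T})"
  by (simp add: stieltjes_def sets_restrict_space)

lemma Ioc_sets_stieltjes [measurable, simp]:
  "0 \<le> u \<Longrightarrow> v \<le> T \<Longrightarrow> {u<..v} \<in> sets (stieltjes T a)"
  by (auto simp: sets_restrict_space_iff)

lemma emeasure_stieltjes_Ioc:
  assumes "0 \<le> u" "u \<le> v" "v \<le> T"
  shows "emeasure (stieltjes T a) {u<..v} = ennreal (a v - a u)"
proof -
  have "emeasure (stieltjes T a) {u<..v} = emeasure (interval_measure clamped) {u<..v}"
    unfolding stieltjes_def using assms by (intro emeasure_restrict_space) auto
  also have "\<dots> = clamped v - clamped u"
    by (intro emeasure_interval_measure_Ioc clamped_mono clamped_right_continuous assms)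
  finally show ?thesis using assms by simp
qed

lemma emeasure_stieltjes_0: "emeasure (stieltjes T a) {0} = 0"
proof -
  have "emeasure (interval_measure clamped) {0} \<le> emeasure (interval_measure clamped) {-1<..0}"
    by (intro emeasure_mono) auto
  also have "\<dots> = clamped 0 - clamped (-1)"
    by (intro emeasure_interval_measure_Ioc clamped_mono clamped_right_continuous) auto
  also have "\<dots> = 0" using T_pos by auto
  finally have "emeasure (interval_measure clamped) {0} = 0" by simp
  then show ?thesis
    unfolding stieltjes_def using T_pos by (subst emeasure_restrict_space) auto
qed

lemma AE_stieltjes_pos: "AE t in stieltjes T a. 0 < t"
proof (rule AE_I')
  show "{0} \<in> null_sets (stieltjes T a)"
    using emeasure_stieltjes_0 T_pos by (auto simp: null_sets_def sets_restrict_space_iff)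
qed auto

lemma emeasure_stieltjes_space: "emeasure (stieltjes T a) {0..T} = ennreal (a T)"
proof -
  have "emeasure (stieltjes T a) {0..T} = emeasure (stieltjes T a) {0<..T}"
    by (rule emeasure_eq_AE) (use AE_stieltjes_pos T_pos in \<open>auto simp: sets_restrict_space_iff\<close>)
  then show ?thesis using T_pos by (simp add: emeasure_stieltjes_Ioc a_0)
qed

sublocale stieltjes: finite_measure "stieltjes T a"
  by standard (simp add: emeasure_stieltjes_space)

lemma a_nonneg: "0 \<le> t \<Longrightarrow> t \<le> T \<Longrightarrow> 0 \<le> a t"
  using mono_onD[OF a_mono, of 0 t] a_0 by auto

lemma a_le: "0 \<le> s \<Longrightarrow> s \<le> t \<Longrightarrow> t \<le> T \<Longrightarrow> a s \<le> a t"
  using mono_onD[OF a_mono, of s t] by auto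

end

locale continuous_increasing_path = increasing_path +
  assumes a_cont: "continuous_on {0..T} a"
begin

text \<open>
  A continuous increasing path takes every value of \<open>{0..a T}\<close>, and the set where it exceeds
  \<open>x\<close> is an interval with left end point at level \<open>x\<close>. So the path maps its own Stieltjes measure
  to Lebesgue measure, which turns integrals \<open>g (a s) da(s)\<close> into ordinary ones.
\<close>

lemma a_measurable: "a \<in> borel_measurable (stieltjes T a)"
  using borel_measurable_continuous_on_restrict[OF a_cont] by (simp cong: measurable_cong_sets)

lemma distr_stieltjes: "distr (stieltjes T a) borel a = density lborel (indicator {0..a T})"
proof (rule measure_eqI_lessThan)
  note [measurable] = a_measurable
  fix x :: real
  have *: "emeasure (distr (stieltjes T a) borel a) {x<..} = emeasure (stieltjes T a) {s\<in>{0..T}. x < a s}"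
    by (subst emeasure_distr) (auto intro!: arg_cong[where f="emeasure _"])
  show "emeasure (distr (stieltjes T a) borel a) {x<..} < \<infinity>"
    unfolding * by (simp add: stieltjes.emeasure_finite less_top[symmetric])
  have r: "emeasure (density lborel (indicator {0..a T})) {x<..} = emeasure lborel ({0..a T} \<inter> {x<..})"
    by (subst emeasure_density) (auto simp: indicator_inter_arith[symmetric] intro!: nn_integral_indicator)
  consider "x < 0" | "a T \<le> x" | "0 \<le> x" "x < a T" by linarith
  then show "emeasure (distr (stieltjes T a) borel a) {x<..} = emeasure (density lborel (indicator {0..a T})) {x<..}"
  proof cases
    case 1
    then have "{s\<in>{0..T}. x < a s} = {0..T}" "{0..a T} \<inter> {x<..} = {0..a T}"
      using a_nonneg by force+
    then show ?thesis using a_nonneg[of T] T_pos unfolding * r by (simp add: emeasure_stieltjes_space)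
  next
    case 2
    then have "{s\<in>{0..T}. x < a s} = {}" "{0..a T} \<inter> {x<..} = {}"
      using a_le[of _ T] by force+
    then show ?thesis unfolding * r by (simp only: emeasure_empty)
  next
    case 3
    let ?B = "{s\<in>{0..T}. a s \<le> x}"
    have "closed ?B" using a_cont by (intro continuous_on_closed_Collect_le) auto
    then have "compact ({0..T} \<inter> ?B)" by (intro compact_Int_closed) auto
    then have cB: "compact ?B" by (auto intro: back_subst[of compact])
    have "0 \<in> ?B" using 3 a_0 T_pos by auto
    then have "?B \<noteq> {}" by blast
    from compact_attains_sup[OF cB this] obtain p where p: "p \<in> ?B" "\<And>s. s \<in> ?B \<Longrightarrow> s \<le> p"
      by blast
    have "\<exists>s\<ge>0. s \<le> T \<and> a s = x"
      using 3 a_0 T_pos by (intro IVT') (auto simp: a_cont)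
    then have "a p = x" using p a_le[of _ p] by force
    have "{s\<in>{0..T}. x < a s} = {p<..T}"
    proof (intro set_eqI iffI)
      fix s assume "s \<in> {s\<in>{0..T}. x < a s}"
      then show "s \<in> {p<..T}" using a_le[of s p] p \<open>a p = x\<close> by force
    next
      fix s assume s: "s \<in> {p<..T}"
      then have "s \<notin> ?B" using p(2) by fastforce
      then show "s \<in> {s\<in>{0..T}. x < a s}" using s p by auto
    qed
    moreover have "{0..a T} \<inter> {x<..} = {x<..a T}" using 3 by auto
    ultimately show ?thesis unfolding * r using p 3 \<open>a p = x\<close> by (simp add: emeasure_stieltjes_Ioc)
  qed
qed auto

lemma AE_stieltjes_level: "AE s in stieltjes T a. a s \<noteq> x"
proof -
  have "AE y in density lborel (indicator {0..a T}). y \<noteq> x"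
    by (subst AE_density) (auto intro: AE_mp[OF AE_lborel_singleton])
  then show ?thesis
    unfolding distr_stieltjes[symmetric] by (subst (asm) AE_distr_iff) (auto intro: a_measurable)
qed

lemma AE_stieltjes_singleton: "AE s in stieltjes T a. s \<noteq> x"
  using AE_stieltjes_level[of "a x"] by eventually_elim auto

lemma nn_integral_stieltjes_derivative:
  assumes g: "\<And>x. (G has_real_derivative g x) (at x)" "\<And>x. 0 \<le> g x" "g \<in> borel_measurable borel"
    and uv: "0 \<le> u" "u \<le> v" "v \<le> T"
  shows "(\<integral>\<^sup>+s\<in>{u<..v}. ennreal (g (a s)) \<partial>stieltjes T a) = ennreal (G (a v) - G (a u))"
proof -
  have "(\<integral>\<^sup>+s\<in>{u<..v}. ennreal (g (a s)) \<partial>stieltjes T a)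
      = (\<integral>\<^sup>+s. ennreal (g (a s)) * indicator {a u..a v} (a s) \<partial>stieltjes T a)"
  proof (rule nn_integral_cong_AE)
    have "AE s in stieltjes T a. s \<in> {0..T}" by (rule AE_I2) simp
    then show "AE s in stieltjes T a. ennreal (g (a s)) * indicator {u<..v} s
       = ennreal (g (a s)) * indicator {a u..a v} (a s)"
      using AE_stieltjes_level[of "a u"] AE_stieltjes_level[of "a v"]
    proof eventually_elim
      case (elim s)
      then have "s \<in> {u<..v} \<longleftrightarrow> a s \<in> {a u..a v}"
        using a_le[of s u] a_le[of v s] a_le[of u s] a_le[of s v] uv by force
      then show ?case by (simp add: indicator_def)
    qed
  qed
  also have "\<dots> = (\<integral>\<^sup>+x. ennreal (g x) * indicator {a u..a v} x \<partial>distr (stieltjes T a) borel a)"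
    using a_measurable g by (subst nn_integral_distr) auto
  also have "\<dots> = (\<integral>\<^sup>+x. indicator {0..a T} x * (ennreal (g x) * indicator {a u..a v} x) \<partial>lborel)"
    unfolding distr_stieltjes using g by (subst nn_integral_density) auto
  also have "\<dots> = (\<integral>\<^sup>+x. ennreal (g x) * indicator {a u..a v} x \<partial>lborel)"
    using a_nonneg[of u] a_le[of v T] uv by (intro nn_integral_cong) (auto simp: indicator_def)
  also have "\<dots> = G (a v) - G (a u)"
    using a_le[of u v] uv g by (intro nn_integral_FTC_Icc) (auto intro: has_field_derivative_at_within simp flip: has_real_derivative_iff_has_vector_derivative)
  finally show ?thesis .
qed

text \<open>
  For functions bounded by such an exponential weight, integration against \<open>K da\<close> halves the bound.
  This drives both Gronwall's inequality and the convergence of Picard's iteration, for every \<open>K\<close> and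
  without splitting the time interval.
\<close>

lemma exp_forward_weight:
  assumes "0 \<le> K" "0 \<le> u" "u \<le> v" "v \<le> T"
  shows "ennreal K * (\<integral>\<^sup>+s\<in>{u<..v}. ennreal (exp (2 * K * a s)) \<partial>stieltjes T a) \<le> ennreal (exp (2 * K * a v) / 2)"
proof -
  have "ennreal K * (\<integral>\<^sup>+s\<in>{u<..v}. ennreal (exp (2 * K * a s)) \<partial>stieltjes T a)
     = (\<integral>\<^sup>+s\<in>{u<..v}. ennreal (K * exp (2 * K * a s)) \<partial>stieltjes T a)"
    using assms a_measurable by (subst nn_integral_cmult[symmetric]) (auto simp: ennreal_mult' ac_simps)
  also have "\<dots> = ennreal (exp (2 * K * a v) / 2 - exp (2 * K * a u) / 2)"
    using assms by (intro nn_integral_stieltjes_derivative[where G="\<lambda>x. exp (2 * K * x) / 2" and g="\<lambda>x. K * exp (2 * K * x)"])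
      (auto intro!: derivative_eq_intros)
  also have "\<dots> \<le> ennreal (exp (2 * K * a v) / 2)" by (intro ennreal_leI) simp
  finally show ?thesis .
qed

lemma exp_backward_weight:
  assumes "0 \<le> K" "0 \<le> u" "u \<le> v" "v \<le> T"
  shows "ennreal K * (\<integral>\<^sup>+s\<in>{u<..v}. ennreal (exp (2 * K * (a T - a s))) \<partial>stieltjes T a)
    \<le> ennreal (exp (2 * K * (a T - a u)) / 2)"
proof -
  have "ennreal K * (\<integral>\<^sup>+s\<in>{u<..v}. ennreal (exp (2 * K * (a T - a s))) \<partial>stieltjes T a)
     = (\<integral>\<^sup>+s\<in>{u<..v}. ennreal (K * exp (2 * K * (a T - a s))) \<partial>stieltjes T a)"
    using assms a_measurable by (subst nn_integral_cmult[symmetric]) (auto simp: ennreal_mult' ac_simps)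
  also have "\<dots> = ennreal (- exp (2 * K * (a T - a v)) / 2 - - exp (2 * K * (a T - a u)) / 2)"
    using assms by (intro nn_integral_stieltjes_derivative[where G="\<lambda>x. - exp (2 * K * (a T - x)) / 2" and g="\<lambda>x. K * exp (2 * K * (a T - x))"])
      (auto intro!: derivative_eq_intros)
  also have "\<dots> \<le> ennreal (exp (2 * K * (a T - a u)) / 2)" by (intro ennreal_leI) simp
  finally show ?thesis .
qed

end

context continuous_increasing_path
begin

text \<open>
  Cutting an integrand off where its running integral exceeds \<open>c\<close> leaves an integral of at most \<open>c\<close>,
  even if the running integral explodes instead of crossing the level \<open>c\<close>.
\<close>

lemma nn_integral_below_level:
  fixes g :: "real \<Rightarrow> ennreal"
  assumes g: "g \<in> borel_measurable (stieltjes T a)"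
  defines "V \<equiv> \<lambda>s. \<integral>\<^sup>+r\<in>{0<..s}. g r \<partial>stieltjes T a"
  shows "(\<integral>\<^sup>+s. g s * indicator {s. V s \<le> c} s \<partial>stieltjes T a) \<le> c"
proof -
  let ?N = "stieltjes T a"
  define U where "U = {s\<in>{0..T}. V s \<le> c}"
  have V_mono: "V s \<le> V t" if "s \<le> t" for s t
    unfolding V_def using that by (intro nn_integral_mono) (auto simp: indicator_def)
  show ?thesis
  proof (cases "U = {}")
    case True
    then have "(\<integral>\<^sup>+s. g s * indicator {s. V s \<le> c} s \<partial>?N) = (\<integral>\<^sup>+s. 0 \<partial>?N)"
      by (intro nn_integral_cong) (auto simp: U_def indicator_def)
    then show ?thesis by simp
  next
    case False
    \<comment> \<open>The level is respected before \<open>p\<close>, and \<open>p\<close> itself carries no mass.\<close>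
    define p where "p = Sup U"
    have bdd: "bdd_above U" by (auto simp: U_def intro: bdd_aboveI[of _ T])
    have up: "s \<le> p" if "s \<in> U" for s unfolding p_def using that bdd by (rule cSup_upper)
    have p: "0 \<le> p" "p \<le> T"
    proof -
      obtain s where s: "s \<in> U" using False by auto
      then have "0 \<le> s" by (simp add: U_def)
      then show "0 \<le> p" using up[OF s] by linarith
      show "p \<le> T" unfolding p_def using False by (intro cSup_least) (auto simp: U_def)
    qed
    have below: "V s \<le> c" if s: "s < p" for s
    proof -
      obtain t where "t \<in> U" "s < t" using less_cSupD[OF False s[unfolded p_def]] by auto
      then show ?thesis using V_mono[of s t] by (auto simp: U_def intro: order_trans)
    qed
    define u where "u k = p - 1 / real (Suc k)" for k
    have up_lim: "\<exists>k. s \<le> u k" if s: "s < p" for s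
    proof -
      obtain k where "1 / real (Suc k) < p - s" using reals_Archimedean[of "p - s"] s by (auto simp: inverse_eq_divide)
      then show ?thesis by (intro exI[of _ k]) (simp add: u_def)
    qed
    have I: "(\<lambda>s. g s * indicator {0<..u k} s) \<in> borel_measurable ?N" for k
    proof -
      have "u k \<le> T" using p by (simp add: u_def) (smt (verit) divide_nonneg_nonneg of_nat_0_le_iff)
      then have "{0<..u k} \<in> sets ?N" by (intro Ioc_sets_stieltjes) auto
      then show ?thesis using g by measurable
    qed
    have "AE s in ?N. g s * indicator {s. V s \<le> c} s = (SUP k. g s * indicator {0<..u k} s)"
      using AE_stieltjes_singleton[of p] AE_stieltjes_pos AE_space
    proof eventually_elim
      case (elim s)
      show ?case
      proof (cases "s < p")
        case True
        obtain k where k: "s \<le> u k" using up_lim[OF True] by auto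
        have "(SUP k. g s * indicator {0<..u k} s) = g s"
        proof (rule antisym)
          show "(SUP k. g s * indicator {0<..u k} s) \<le> g s" by (rule SUP_least) (simp add: indicator_def)
          show "g s \<le> (SUP k. g s * indicator {0<..u k} s)" using k elim by (intro SUP_upper2[of k]) auto
        qed
        then show ?thesis using below[OF True] by simp
      next
        case False
        then have "p < s" using elim by simp
        then have "s \<notin> U" using up[of s] by auto
        then have "\<not> V s \<le> c" using elim by (simp add: U_def)
        moreover have "\<not> s \<le> u k" for k using \<open>p < s\<close> by (simp add: u_def) (smt (verit) divide_nonneg_nonneg of_nat_0_le_iff)
        ultimately show ?thesis by simp
      qed
    qed
    then have "(\<integral>\<^sup>+s. g s * indicator {s. V s \<le> c} s \<partial>?N) = (\<integral>\<^sup>+s. (SUP k. g s * indicator {0<..u k} s) \<partial>?N)"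
      by (rule nn_integral_cong_AE)
    also have "\<dots> = (SUP k. V (u k))"
      unfolding V_def
    proof (rule nn_integral_monotone_convergence_SUP[OF _ I])
      have "u k \<le> u (Suc k)" for k unfolding u_def by (intro diff_left_mono divide_left_mono) auto
      then show "incseq (\<lambda>k s. g s * indicator {0<..u k} s)"
        by (intro incseq_SucI le_funI mult_left_mono) (auto simp: indicator_def intro: order_trans)
    qed
    also have "\<dots> \<le> c" by (intro SUP_least below) (simp add: u_def)
    finally show ?thesis .
  qed
qed

lemma integral_until_continuous:
  fixes k :: "real \<Rightarrow> real"
  assumes k: "integrable (stieltjes T a) k"
  shows "continuous_on {0..T} (\<lambda>t. LINT s:{0<..t}|stieltjes T a. k s)"
proof -
  have m: "{0<..t} \<in> sets (stieltjes T a)" if "t \<in> {0..T}" for t using that by (intro Ioc_sets_stieltjes) auto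
  show ?thesis
    unfolding continuous_on_sequentially
  proof (intro allI ballI impI, elim conjE)
    fix u t assume t: "t \<in> {0..T}" and u: "\<forall>i. u i \<in> {0..T}" "u \<longlonglongrightarrow> t"
    have "(\<lambda>i. LINT s|stieltjes T a. indicator {0<..u i} s *\<^sub>R k s) \<longlonglongrightarrow> (LINT s|stieltjes T a. indicator {0<..t} s *\<^sub>R k s)"
    proof (rule integral_dominated_convergence)
      show "integrable (stieltjes T a) (\<lambda>s. norm (k s))" using k by simp
      show "(\<lambda>s. indicator {0<..t} s *\<^sub>R k s) \<in> borel_measurable (stieltjes T a)"
        using k m[OF t] by (intro borel_measurable_scaleR borel_measurable_indicator) auto
      show "(\<lambda>s. indicator {0<..u i} s *\<^sub>R k s) \<in> borel_measurable (stieltjes T a)" for i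
        using k m[of "u i"] u(1) by (intro borel_measurable_scaleR borel_measurable_indicator) auto
      show "AE s in stieltjes T a. norm (indicator {0<..u i} s *\<^sub>R k s) \<le> norm (k s)" for i
        by (rule AE_I2) (simp add: indicator_def)
      show "AE s in stieltjes T a. (\<lambda>i. indicator {0<..u i} s *\<^sub>R k s) \<longlonglongrightarrow> indicator {0<..t} s *\<^sub>R k s"
        using AE_stieltjes_singleton[of t]
      proof eventually_elim
        case (elim s)
        have "\<forall>\<^sub>F i in sequentially. indicator {0<..u i} s *\<^sub>R k s = indicator {0<..t} s *\<^sub>R k s"
        proof (cases "s < t")
          case True
          then have "\<forall>\<^sub>F i in sequentially. s < u i" using u(2) by (rule order_tendstoD[rotated])
          then show ?thesis by eventually_elim (use True in \<open>simp add: indicator_def\<close>)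
        next
          case False
          then have "t < s" using elim by simp
          then have "\<forall>\<^sub>F i in sequentially. u i < s" using u(2) by (rule order_tendstoD[rotated])
          then show ?thesis by eventually_elim (use \<open>t < s\<close> in \<open>simp add: indicator_def\<close>)
        qed
        then show ?case by (rule tendsto_eventually)
      qed
    qed
    then show "((\<lambda>t. LINT s:{0<..t}|stieltjes T a. k s) \<circ> u) \<longlonglongrightarrow> (LINT s:{0<..t}|stieltjes T a. k s)"
      by (simp add: set_lebesgue_integral_def comp_def)
  qed
qed

end

section \<open>Gronwall's inequality and random integral equations\<close>

text \<open>
  The supremum \<open>\<sigma>\<close> of \<open>\<bar>y\<bar> / E\<close> satisfies \<open>\<sigma> \<le> \<alpha> + \<sigma> / 2\<close>. The set \<open>U t\<close> of times on which the bound at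
  \<open>t\<close> depends lies before \<open>t\<close> in the forward and after \<open>t\<close> in the backward version.
\<close>

lemma weighted_gronwall:
  fixes y E :: "real \<Rightarrow> real"
  assumes U: "\<And>t. t \<in> D \<Longrightarrow> U t \<subseteq> D" and E: "\<And>t. t \<in> D \<Longrightarrow> 1 \<le> E t"
    and weight: "\<And>t. t \<in> D \<Longrightarrow> ennreal K * (\<integral>\<^sup>+s\<in>U t. ennreal (E s) \<partial>N) \<le> ennreal (E t / 2)"
    and y: "\<And>t. t \<in> D \<Longrightarrow> ennreal \<bar>y t\<bar> \<le> ennreal \<alpha> + ennreal K * (\<integral>\<^sup>+s\<in>U t. ennreal \<bar>y s\<bar> \<partial>N)"
    and bdd: "\<And>t. t \<in> D \<Longrightarrow> \<bar>y t\<bar> \<le> B" and \<alpha>: "0 \<le> \<alpha>" and K: "0 \<le> K"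
    and meas: "\<And>t. t \<in> D \<Longrightarrow> (\<lambda>s. ennreal (E s) * indicator (U t) s) \<in> borel_measurable N"
    and t: "t \<in> D"
  shows "\<bar>y t\<bar> \<le> 2 * \<alpha> * E t"
proof -
  define \<sigma> where "\<sigma> = (SUP t\<in>D. \<bar>y t\<bar> / E t)"
  have bd: "bdd_above ((\<lambda>t. \<bar>y t\<bar> / E t) ` D)"
  proof (rule bdd_aboveI2)
    fix t assume t: "t \<in> D"
    have "\<bar>y t\<bar> / E t \<le> \<bar>y t\<bar> / 1" using E[OF t] by (intro divide_left_mono) auto
    then show "\<bar>y t\<bar> / E t \<le> B" using bdd[OF t] by simp
  qed
  have le: "\<bar>y t\<bar> \<le> \<sigma> * E t" if "t \<in> D" for t
  proof -
    have "\<bar>y t\<bar> / E t \<le> \<sigma>" unfolding \<sigma>_def using that bd by (rule cSUP_upper)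
    then show ?thesis using E[OF that] by (simp add: divide_le_eq)
  qed
  have \<sigma>0: "0 \<le> \<sigma>"
  proof -
    have "0 \<le> \<bar>y t\<bar> / E t" using E[OF t] by simp
    also have "\<dots> \<le> \<sigma>" unfolding \<sigma>_def using t bd by (rule cSUP_upper)
    finally show ?thesis .
  qed
  have "\<sigma> \<le> \<alpha> + \<sigma> / 2"
    unfolding \<sigma>_def
  proof (rule cSUP_least, fold \<sigma>_def)
    show "D \<noteq> {}" using t by auto
    fix t assume t: "t \<in> D"
    have "ennreal \<bar>y t\<bar> \<le> ennreal \<alpha> + ennreal K * (\<integral>\<^sup>+s\<in>U t. ennreal \<bar>y s\<bar> \<partial>N)" using y[OF t] .
    also have "(\<integral>\<^sup>+s\<in>U t. ennreal \<bar>y s\<bar> \<partial>N) \<le> (\<integral>\<^sup>+s. ennreal \<sigma> * (ennreal (E s) * indicator (U t) s) \<partial>N)"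
    proof (rule nn_integral_mono)
      fix s show "ennreal \<bar>y s\<bar> * indicator (U t) s \<le> ennreal \<sigma> * (ennreal (E s) * indicator (U t) s)"
        using le[of s] U[OF t] \<sigma>0 E[of s] by (auto simp: indicator_def ennreal_mult'[symmetric] intro!: ennreal_leI)
    qed
    also have "\<dots> = ennreal \<sigma> * (\<integral>\<^sup>+s\<in>U t. ennreal (E s) \<partial>N)" using meas[OF t] by (rule nn_integral_cmult)
    also have "ennreal K * \<dots> = ennreal \<sigma> * (ennreal K * (\<integral>\<^sup>+s\<in>U t. ennreal (E s) \<partial>N))" by (simp add: ac_simps)
    also have "\<dots> \<le> ennreal \<sigma> * ennreal (E t / 2)" using weight[OF t] by (intro mult_left_mono) auto
    finally have "ennreal \<bar>y t\<bar> \<le> ennreal (\<alpha> + \<sigma> * (E t / 2))"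
      using \<sigma>0 \<alpha> E[OF t] by (simp add: ennreal_mult'[symmetric] ennreal_plus[symmetric] mult_left_mono
          del: ennreal_plus)
    then have "\<bar>y t\<bar> \<le> \<alpha> + \<sigma> * (E t / 2)"
      using \<sigma>0 \<alpha> E[OF t] by (subst (asm) ennreal_le_iff) auto
    also have "\<dots> \<le> (\<alpha> + \<sigma> / 2) * E t"
      using \<alpha> E[OF t] mult_left_mono[of 1 "E t" \<alpha>] by (simp add: algebra_simps)
    finally show "\<bar>y t\<bar> / E t \<le> \<alpha> + \<sigma> / 2" using E[OF t] by (simp add: divide_le_eq)
  qed
  then have "\<sigma> \<le> 2 * \<alpha>" by simp
  then have "\<sigma> * E t \<le> 2 * \<alpha> * E t" using E[OF t] by (intro mult_right_mono) auto
  with le[OF t] show ?thesis by linarith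
qed

context continuous_increasing_path
begin

lemma forward_gronwall:
  assumes "0 \<le> u" "v \<le> T" "0 \<le> \<alpha>" "0 \<le> K"
    and y: "\<And>t. t \<in> {u<..v} \<Longrightarrow> ennreal \<bar>y t\<bar> \<le> ennreal \<alpha> + ennreal K * (\<integral>\<^sup>+s\<in>{u<..t}. ennreal \<bar>y s\<bar> \<partial>stieltjes T a)"
    and bdd: "\<And>t. t \<in> {u<..v} \<Longrightarrow> \<bar>y t\<bar> \<le> B"
    and t: "t \<in> {u<..v}"
  shows "\<bar>y t\<bar> \<le> 2 * \<alpha> * exp (2 * K * a T)"
proof -
  have "\<bar>y t\<bar> \<le> 2 * \<alpha> * exp (2 * K * a t)"
    using assms a_measurable
    by (intro weighted_gronwall[where D="{u<..v}" and U="\<lambda>t. {u<..t}" and E="\<lambda>t. exp (2 * K * a t)" and N="stieltjes T a" and B=B and K=K]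
        exp_forward_weight y bdd t borel_measurable_times borel_measurable_indicator Ioc_sets_stieltjes)
      (auto intro!: a_nonneg mult_nonneg_nonneg)
  also have "\<dots> \<le> 2 * \<alpha> * exp (2 * K * a T)"
    using assms t a_le[of t T] by (intro mult_left_mono) (auto intro!: mult_left_mono)
  finally show ?thesis .
qed

lemma backward_gronwall:
  assumes "0 \<le> u" "v \<le> T" "0 \<le> \<alpha>" "0 \<le> K"
    and y: "\<And>t. t \<in> {u..v} \<Longrightarrow> ennreal \<bar>y t\<bar> \<le> ennreal \<alpha> + ennreal K * (\<integral>\<^sup>+s\<in>{t<..v}. ennreal \<bar>y s\<bar> \<partial>stieltjes T a)"
    and bdd: "\<And>t. t \<in> {u..v} \<Longrightarrow> \<bar>y t\<bar> \<le> B"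
    and t: "t \<in> {u..v}"
  shows "\<bar>y t\<bar> \<le> 2 * \<alpha> * exp (2 * K * a T)"
proof -
  have "\<bar>y t\<bar> \<le> 2 * \<alpha> * exp (2 * K * (a T - a t))"
    using assms a_measurable
    by (intro weighted_gronwall[where D="{u..v}" and U="\<lambda>t. {t<..v}" and E="\<lambda>t. exp (2 * K * (a T - a t))" and N="stieltjes T a" and B=B and K=K]
        exp_backward_weight y bdd t borel_measurable_times borel_measurable_indicator Ioc_sets_stieltjes)
      (auto intro!: a_le mult_nonneg_nonneg)
  also have "\<dots> \<le> 2 * \<alpha> * exp (2 * K * a T)"
    using assms t a_nonneg[of t] by (intro mult_left_mono) (auto intro!: mult_left_mono)
  finally show ?thesis .
qed

end

text \<open>
  Picard's iteration, carried out for all \<open>w\<close> at once so that measurability in \<open>(w, t)\<close> passes to the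
  limit; in the norm weighted by \<open>E\<close> successive differences are halved. Forward and backward equations
  differ in \<open>U\<close>, and in the sigma-field \<open>Q\<close> with respect to which integral processes are measurable.
\<close>

lemma random_integral_equation:
  fixes Q :: "('w \<times> real) measure" and h :: "('w \<times> real) \<times> real \<Rightarrow> real"
    and \<eta> :: "'w \<times> real \<Rightarrow> real" and E :: "'w \<Rightarrow> real \<Rightarrow> real"
  assumes spQ: "space Q = \<Omega> \<times> {0..T}"
    and N: "\<And>w. w \<in> \<Omega> \<Longrightarrow> finite_measure (N w)" "\<And>w. w \<in> \<Omega> \<Longrightarrow> sets (N w) = sets (restrict_space borel {0..T})"
    and pair_meas: "\<And>w. w \<in> \<Omega> \<Longrightarrow> Pair w \<in> restrict_space borel {0..T} \<rightarrow>\<^sub>M Q"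
    and U: "\<And>t. t \<in> {0..T} \<Longrightarrow> U t \<in> sets (restrict_space borel {0..T})"
    and clos: "\<And>k::'w \<times> real \<Rightarrow> real. k \<in> borel_measurable Q \<Longrightarrow>
       (\<And>w. w \<in> \<Omega> \<Longrightarrow> integrable (N w) (\<lambda>s. k (w, s))) \<Longrightarrow>
       (\<lambda>(w, t). LINT s:U t|N w. k (w, s)) \<in> borel_measurable Q"
    and h: "h \<in> borel_measurable (Q \<Otimes>\<^sub>M borel)" and K: "0 \<le> K"
    and lipschitz: "\<And>w s v v'. w \<in> \<Omega> \<Longrightarrow> s \<in> {0..T} \<Longrightarrow> \<bar>h ((w, s), v) - h ((w, s), v')\<bar> \<le> K * \<bar>v - v'\<bar>"
    and h0: "\<And>w. w \<in> \<Omega> \<Longrightarrow> integrable (N w) (\<lambda>s. h ((w, s), 0))"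
    and E: "\<And>w t. w \<in> \<Omega> \<Longrightarrow> t \<in> {0..T} \<Longrightarrow> 1 \<le> E w t \<and> E w t \<le> e w"
      "\<And>w. w \<in> \<Omega> \<Longrightarrow> E w \<in> borel_measurable (restrict_space borel {0..T})"
    and weight: "\<And>w t. w \<in> \<Omega> \<Longrightarrow> t \<in> {0..T} \<Longrightarrow>
       ennreal K * (\<integral>\<^sup>+s\<in>U t. ennreal (E w s) \<partial>N w) \<le> ennreal (E w t / 2)"
    and \<eta>: "\<eta> \<in> borel_measurable Q" "\<And>w t. w \<in> \<Omega> \<Longrightarrow> t \<in> {0..T} \<Longrightarrow> \<bar>\<eta> (w, t)\<bar> \<le> b w"
  obtains y :: "'w \<times> real \<Rightarrow> real" and B where "y \<in> borel_measurable Q"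
    "\<And>w t. w \<in> \<Omega> \<Longrightarrow> t \<in> {0..T} \<Longrightarrow> \<bar>y (w, t)\<bar> \<le> B w"
    "\<And>w. w \<in> \<Omega> \<Longrightarrow> integrable (N w) (\<lambda>s. h ((w, s), y (w, s)))"
    "\<And>w t. w \<in> \<Omega> \<Longrightarrow> t \<in> {0..T} \<Longrightarrow> y (w, t) = \<eta> (w, t) + (LINT s:U t|N w. h ((w, s), y (w, s)))"
proof -
  note [measurable] = h \<eta>(1)
  define Y where "Y = rec_nat \<eta> (\<lambda>_ z (w, t). \<eta> (w, t) + (LINT s:U t|N w. h ((w, s), z (w, s))))"
  have Y0: "Y 0 = \<eta>" by (simp add: Y_def)
  have YS: "Y (Suc k) (w, t) = \<eta> (w, t) + (LINT s:U t|N w. h ((w, s), Y k (w, s)))" for k w t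
    by (simp add: Y_def)
  have secm: "(\<lambda>s. z (w, s)) \<in> borel_measurable (N w)" if "w \<in> \<Omega>" "z \<in> borel_measurable Q" for w and z :: "_ \<Rightarrow> real"
    using measurable_compose[OF pair_meas[OF that(1)] that(2)] N(2)[OF that(1)] by (simp cong: measurable_cong_sets)
  have spN: "space (N w) = {0..T}" if "w \<in> \<Omega>" for w
    using sets_eq_imp_space_eq[OF N(2)[OF that]] by (simp add: space_restrict_space)
  have int: "integrable (N w) (\<lambda>s. h ((w, s), z (w, s)))"
    if "w \<in> \<Omega>" and zm: "z \<in> borel_measurable Q" and B: "\<And>s. s \<in> {0..T} \<Longrightarrow> \<bar>z (w, s)\<bar> \<le> B" for w z B
  proof (rule Bochner_Integration.integrable_bound)
    interpret finite_measure "N w" using N that by auto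
    show "integrable (N w) (\<lambda>s. \<bar>h ((w, s), 0)\<bar> + K * B)"
      using h0[OF that(1)] by auto
    have "(\<lambda>x. h (x, z x)) \<in> borel_measurable Q" using zm by measurable
    then show "(\<lambda>s. h ((w, s), z (w, s))) \<in> borel_measurable (N w)"
      using secm[OF that(1), of "\<lambda>x. h (x, z x)"] by simp
    show "AE s in N w. norm (h ((w, s), z (w, s))) \<le> norm (\<bar>h ((w, s), 0)\<bar> + K * B)"
    proof (rule AE_I2)
      fix s assume "s \<in> space (N w)"
      then have s: "s \<in> {0..T}" using spN that by simp
      have "\<bar>h ((w, s), z (w, s))\<bar> \<le> \<bar>h ((w, s), 0)\<bar> + K * \<bar>z (w, s)\<bar>"
        using lipschitz[OF that(1) s, of "z (w, s)" 0] by auto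
      also have "\<dots> \<le> \<bar>h ((w, s), 0)\<bar> + K * B" using B[OF s] K by (auto intro: mult_left_mono)
      finally show "norm (h ((w, s), z (w, s))) \<le> norm (\<bar>h ((w, s), 0)\<bar> + K * B)" by simp
    qed
  qed
  have sint: "set_integrable (N w) (U t) (\<lambda>s. h ((w, s), z (w, s)))"
    if "w \<in> \<Omega>" "t \<in> {0..T}" and "z \<in> borel_measurable Q" and "\<And>s. s \<in> {0..T} \<Longrightarrow> \<bar>z (w, s)\<bar> \<le> B" for w z B t
    unfolding set_integrable_def using int[of w z B] that U[OF that(2)] N(2)[OF that(1)]
    by (intro integrable_mult_indicator) auto
  have inv: "Y k \<in> borel_measurable Q \<and> (\<forall>w\<in>\<Omega>. \<exists>B. \<forall>t\<in>{0..T}. \<bar>Y k (w, t)\<bar> \<le> B)" for k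
  proof (induction k)
    case 0
    have "\<exists>B. \<forall>t\<in>{0..T}. \<bar>\<eta> (w, t)\<bar> \<le> B" if "w \<in> \<Omega>" for w using \<eta>(2)[OF that] by blast
    then show ?case using \<eta>(1) unfolding Y0 by blast
  next
    case (Suc k)
    then have [measurable]: "Y k \<in> borel_measurable Q" and "\<exists>B. \<forall>w\<in>\<Omega>. \<forall>t\<in>{0..T}. \<bar>Y k (w, t)\<bar> \<le> B w"
      by (auto intro!: bchoice)
    then obtain B where B: "\<And>w t. w \<in> \<Omega> \<Longrightarrow> t \<in> {0..T} \<Longrightarrow> \<bar>Y k (w, t)\<bar> \<le> B w" by blast
    let ?h = "\<lambda>w s. h ((w, s), Y k (w, s))"
    have i: "integrable (N w) (?h w)" if "w \<in> \<Omega>" for w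
      using that B by (intro int[where B="B w"]) auto
    then have "(\<lambda>(w, t). LINT s:U t|N w. (\<lambda>x. h (x, Y k x)) (w, s)) \<in> borel_measurable Q"
      by (intro clos) measurable
    then have "(\<lambda>x. \<eta> x + (\<lambda>(w, t). LINT s:U t|N w. ?h w s) x) \<in> borel_measurable Q"
      by simp
    also have "(\<lambda>x. \<eta> x + (\<lambda>(w, t). LINT s:U t|N w. ?h w s) x) = Y (Suc k)"
      by (auto simp: YS fun_eq_iff)
    finally have "Y (Suc k) \<in> borel_measurable Q" .
    moreover have "\<bar>Y (Suc k) (w, t)\<bar> \<le> b w + (LINT s|N w. \<bar>?h w s\<bar>)" if w: "w \<in> \<Omega>" and t: "t \<in> {0..T}" for w t
    proof -
      have "\<bar>LINT s:U t|N w. ?h w s\<bar> \<le> (LINT s|N w. \<bar>indicator (U t) s *\<^sub>R ?h w s\<bar>)"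
        unfolding set_lebesgue_integral_def by (rule integral_abs_bound)
      also have "\<dots> \<le> (LINT s|N w. \<bar>?h w s\<bar>)"
        using sint[OF w t \<open>Y k \<in> borel_measurable Q\<close> B[OF w]] i[OF w]
        by (intro integral_mono) (auto simp: indicator_def set_integrable_def)
      finally show ?thesis using \<eta>(2)[OF w t] unfolding YS by linarith
    qed
    then have "\<exists>B. \<forall>t\<in>{0..T}. \<bar>Y (Suc k) (w, t)\<bar> \<le> B" if "w \<in> \<Omega>" for w using that by blast
    ultimately show ?case by blast
  qed
  then have Ym [measurable]: "Y k \<in> borel_measurable Q" for k by blast
  have Ybound: "\<exists>B. \<forall>t\<in>{0..T}. \<bar>Y k (w, t)\<bar> \<le> B" if "w \<in> \<Omega>" for k w using inv that by blast
  define D where "D w = (LINT s|N w. \<bar>h ((w, s), \<eta> (w, s))\<bar>)" for w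
  have D0: "0 \<le> D w" for w by (simp add: D_def)
  have step: "\<bar>Y (Suc k) (w, t) - Y k (w, t)\<bar> \<le> D w * (1/2)^k * E w t" if w: "w \<in> \<Omega>" and t: "t \<in> {0..T}" for k w t
    using t
  proof (induction k arbitrary: t)
    case (0 t)
    let ?h = "\<lambda>s. h ((w, s), \<eta> (w, s))"
    have "\<bar>LINT s:U t|N w. ?h s\<bar> \<le> (LINT s|N w. \<bar>indicator (U t) s *\<^sub>R ?h s\<bar>)"
      unfolding set_lebesgue_integral_def by (rule integral_abs_bound)
    also have "\<dots> \<le> D w"
      unfolding D_def using sint[OF w 0 \<eta>(1) \<eta>(2)[OF w]] int[OF w \<eta>(1) \<eta>(2)[OF w]]
      by (intro integral_mono) (auto simp: indicator_def set_integrable_def)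
    also have "\<dots> \<le> D w * E w t" using E(1)[OF w 0] D0[of w] mult_left_mono[of 1 "E w t" "D w"] by auto
    finally show ?case by (simp add: YS Y0)
  next
    case (Suc k t)
    obtain B where B: "\<And>t. t \<in> {0..T} \<Longrightarrow> \<bar>Y k (w, t)\<bar> \<le> B" using Ybound[OF w] by blast
    obtain B' where B': "\<And>t. t \<in> {0..T} \<Longrightarrow> \<bar>Y (Suc k) (w, t)\<bar> \<le> B'" using Ybound[OF w] by blast
    let ?f = "\<lambda>s. indicator (U t) s *\<^sub>R (h ((w, s), Y (Suc k) (w, s)) - h ((w, s), Y k (w, s)))"
    let ?c = "D w * (1/2)^k"
    have c0: "0 \<le> ?c" using D0 by simp
    have "Y (Suc (Suc k)) (w, t) - Y (Suc k) (w, t) = (LINT s|N w. ?f s)"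
      unfolding YS[of "Suc k"] YS[of k] set_integral_diff(2)[OF sint[OF w Suc.prems Ym B'] sint[OF w Suc.prems Ym B], symmetric]
        set_lebesgue_integral_def[symmetric]
      using set_integral_diff(2)[OF sint[OF w Suc.prems Ym B'] sint[OF w Suc.prems Ym B]] YS by simp
    then have "ennreal \<bar>Y (Suc (Suc k)) (w, t) - Y (Suc k) (w, t)\<bar> \<le> (\<integral>\<^sup>+s. ennreal \<bar>?f s\<bar> \<partial>N w)"
      using integral_norm_bound_ennreal[of "N w" ?f] set_integral_diff(1)[OF sint[OF w Suc.prems Ym B'] sint[OF w Suc.prems Ym B]]
      by (simp add: set_integrable_def)
    also have "\<dots> \<le> (\<integral>\<^sup>+s. ennreal ?c * (ennreal K * (ennreal (E w s) * indicator (U t) s)) \<partial>N w)"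
    proof (rule nn_integral_mono)
      fix s assume "s \<in> space (N w)"
      then have s: "s \<in> {0..T}" using spN w by simp
      have "\<bar>h ((w, s), Y (Suc k) (w, s)) - h ((w, s), Y k (w, s))\<bar> \<le> K * \<bar>Y (Suc k) (w, s) - Y k (w, s)\<bar>"
        by (rule lipschitz[OF w s])
      also have "\<dots> \<le> K * (?c * E w s)" using Suc.IH[OF s] K by (intro mult_left_mono) auto
      finally have "ennreal \<bar>h ((w, s), Y (Suc k) (w, s)) - h ((w, s), Y k (w, s))\<bar> \<le> ennreal ?c * (ennreal K * ennreal (E w s))"
        using c0 K E(1)[OF w s] by (simp add: ennreal_mult'[symmetric] ennreal_leI ac_simps)
      then show "ennreal \<bar>?f s\<bar> \<le> ennreal ?c * (ennreal K * (ennreal (E w s) * indicator (U t) s))"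
        by (auto simp: indicator_def)
    qed
    also have "\<dots> = ennreal ?c * (ennreal K * (\<integral>\<^sup>+s\<in>U t. ennreal (E w s) \<partial>N w))"
    proof -
      have [measurable]: "E w \<in> borel_measurable (N w)" "U t \<in> sets (N w)"
        using E(2)[OF w] U[OF Suc.prems] N(2)[OF w] by (auto cong: measurable_cong_sets)
      show ?thesis by (simp add: nn_integral_cmult)
    qed
    also have "\<dots> \<le> ennreal ?c * ennreal (E w t / 2)"
      using weight[OF w Suc.prems] by (intro mult_left_mono) auto
    also have "\<dots> = ennreal (D w * (1/2)^Suc k * E w t)"
      using c0 by (subst ennreal_mult'[symmetric]) (auto simp: ac_simps)
    finally show ?case using c0 E(1)[OF w Suc.prems] D0 by (subst (asm) ennreal_le_iff) auto
  qed
  have D_e: "\<bar>Y (k + j) (w, t) - Y k (w, t)\<bar> \<le> 2 * D w * e w * (1/2)^k * (1 - (1/2)^j)"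
    if w: "w \<in> \<Omega>" and t: "t \<in> {0..T}" for k j w t
  proof (induction j)
    case (Suc j)
    have "\<bar>Y (Suc (k + j)) (w, t) - Y (k + j) (w, t)\<bar> \<le> D w * (1/2)^(k + j) * e w"
      using step[OF that, of "k + j"] E(1)[OF that] D0[of w]
      by (smt (verit) mult_left_mono mult_nonneg_nonneg zero_le_power zero_le_divide_1_iff)
    with Suc show ?case by (simp add: algebra_simps power_add)
  qed simp
  have e1: "0 \<le> e w" if "w \<in> \<Omega>" "t \<in> {0..T}" for w t using E(1)[OF that] by auto
  have D_e': "\<bar>Y (k + j) (w, t) - Y k (w, t)\<bar> \<le> 2 * D w * e w * (1/2)^k"
    if w: "w \<in> \<Omega>" and t: "t \<in> {0..T}" for k j w t
  proof -
    have "2 * D w * e w * (1/2)^k * (1 - (1/2)^j) \<le> 2 * D w * e w * (1/2)^k * 1"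
      using D0[of w] e1[OF that] by (intro mult_left_mono) auto
    then show ?thesis using D_e[OF that, of k j] by linarith
  qed
  have conv: "convergent (\<lambda>k. Y k (w, t))" if w: "w \<in> \<Omega>" and t: "t \<in> {0..T}" for w t
  proof -
    have "Cauchy (\<lambda>k. Y k (w, t))"
    proof (rule metric_CauchyI)
      fix \<epsilon> :: real assume \<epsilon>: "0 < \<epsilon>"
      have "(\<lambda>k. 2 * (2 * D w * e w * (1/2)^k)) \<longlonglongrightarrow> 2 * (2 * D w * e w * 0)"
        by (intro tendsto_intros LIMSEQ_power_zero) auto
      then have "\<forall>\<^sub>F k in sequentially. 2 * (2 * D w * e w * (1/2)^k) < \<epsilon>"
        using \<epsilon> by (auto intro!: order_tendstoD)
      then obtain k where k: "2 * (2 * D w * e w * (1/2)^k) < \<epsilon>" by (auto simp: eventually_sequentially)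
      have *: "\<bar>Y i (w, t) - Y k (w, t)\<bar> \<le> 2 * D w * e w * (1/2)^k" if "k \<le> i" for i
        using D_e'[OF w t, of k "i - k"] that by simp
      have "dist (Y i (w, t)) (Y j (w, t)) < \<epsilon>" if "k \<le> i" "k \<le> j" for i j
        using *[OF that(1)] *[OF that(2)] k unfolding dist_real_def by linarith
      then show "\<exists>M. \<forall>m\<ge>M. \<forall>n\<ge>M. dist (Y m (w, t)) (Y n (w, t)) < \<epsilon>" by blast
    qed
    then show ?thesis by (simp add: Cauchy_convergent)
  qed
  define y where "y x = lim (\<lambda>k. Y k x)" for x
  have ylim: "(\<lambda>k. Y k (w, t)) \<longlonglongrightarrow> y (w, t)" if "w \<in> \<Omega>" "t \<in> {0..T}" for w t
    unfolding y_def using conv[OF that] by (simp add: convergent_LIMSEQ_iff)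
  have ym [measurable]: "y \<in> borel_measurable Q" unfolding y_def[abs_def] by measurable
  have Yb: "\<bar>Y k (w, t)\<bar> \<le> b w + 2 * D w * e w" if "w \<in> \<Omega>" "t \<in> {0..T}" for k w t
    using D_e'[OF that, of 0 k] \<eta>(2)[OF that] by (simp add: Y0)
  have yb: "\<bar>y (w, t)\<bar> \<le> b w + 2 * D w * e w" if "w \<in> \<Omega>" "t \<in> {0..T}" for w t
    using tendsto_rabs[OF ylim[OF that]] by (rule LIMSEQ_le_const2) (use Yb[OF that] in auto)
  show thesis
  proof (rule that[OF ym yb int[OF _ ym yb]])
    fix w t assume w: "w \<in> \<Omega>" and t: "t \<in> {0..T}"
    let ?B = "b w + 2 * D w * e w"
    interpret finite_measure "N w" using N w by auto
    have "(\<lambda>k. LINT s|N w. indicator (U t) s *\<^sub>R h ((w, s), Y k (w, s)))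
       \<longlonglongrightarrow> (LINT s|N w. indicator (U t) s *\<^sub>R h ((w, s), y (w, s)))"
    proof (rule integral_dominated_convergence)
      show "(\<lambda>s. indicator (U t) s *\<^sub>R h ((w, s), y (w, s))) \<in> borel_measurable (N w)"
        using sint[OF w t ym yb[OF w]] by (auto simp: set_integrable_def)
      show "(\<lambda>s. indicator (U t) s *\<^sub>R h ((w, s), Y k (w, s))) \<in> borel_measurable (N w)" for k
        using sint[OF w t Ym Yb[OF w]] by (auto simp: set_integrable_def)
      show "integrable (N w) (\<lambda>s. \<bar>h ((w, s), 0)\<bar> + K * ?B)" using h0[OF w] by auto
      show "AE s in N w. (\<lambda>k. indicator (U t) s *\<^sub>R h ((w, s), Y k (w, s))) \<longlonglongrightarrow> indicator (U t) s *\<^sub>R h ((w, s), y (w, s))"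
      proof (intro AE_I2 tendsto_intros)
        fix s assume "s \<in> space (N w)"
        then have s: "s \<in> {0..T}" using spN w by simp
        have "(\<lambda>k. K * \<bar>Y k (w, s) - y (w, s)\<bar>) \<longlonglongrightarrow> K * \<bar>y (w, s) - y (w, s)\<bar>"
          by (intro tendsto_intros ylim w s)
        then have "(\<lambda>k. K * \<bar>Y k (w, s) - y (w, s)\<bar>) \<longlonglongrightarrow> 0" by simp
        then show "(\<lambda>k. h ((w, s), Y k (w, s))) \<longlonglongrightarrow> h ((w, s), y (w, s))"
          by (rule LIM_zero_cancel[OF Lim_null_comparison[rotated]]) (auto intro!: always_eventually lipschitz[OF w s])
      qed
      show "AE s in N w. norm (indicator (U t) s *\<^sub>R h ((w, s), Y k (w, s))) \<le> \<bar>h ((w, s), 0)\<bar> + K * ?B" for k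
      proof (rule AE_I2)
        fix s assume "s \<in> space (N w)"
        then have s: "s \<in> {0..T}" using spN w by simp
        have "\<bar>h ((w, s), Y k (w, s))\<bar> \<le> \<bar>h ((w, s), 0)\<bar> + K * \<bar>Y k (w, s)\<bar>"
          using lipschitz[OF w s, of "Y k (w, s)" 0] by auto
        also have "\<dots> \<le> \<bar>h ((w, s), 0)\<bar> + K * ?B" using Yb[OF w s, of k] K by (auto intro: mult_left_mono)
        finally show "norm (indicator (U t) s *\<^sub>R h ((w, s), Y k (w, s))) \<le> \<bar>h ((w, s), 0)\<bar> + K * ?B"
          by (auto simp: indicator_def)
      qed
    qed
    then have "(\<lambda>k. Y (Suc k) (w, t)) \<longlonglongrightarrow> \<eta> (w, t) + (LINT s:U t|N w. h ((w, s), y (w, s)))"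
      unfolding YS set_lebesgue_integral_def by (intro tendsto_intros)
    moreover have "(\<lambda>k. Y (Suc k) (w, t)) \<longlonglongrightarrow> y (w, t)" using ylim[OF w t] by (rule LIMSEQ_Suc)
    ultimately show "y (w, t) = \<eta> (w, t) + (LINT s:U t|N w. h ((w, s), y (w, s)))"
      by (rule LIMSEQ_unique[rotated])
  qed
qed

section \<open>The predictable sigma-field\<close>

locale filtered_space = filtration \<Omega> F for \<Omega> :: "'w set" and F :: "ennreal \<Rightarrow> 'w measure" +
  fixes T :: real
  assumes T_pos: "0 < T"
begin

abbreviation "PRE \<equiv> predictable_sigma \<Omega> F T"

definition "rectangles =
  {B \<times> {0::real} | B. B \<in> sets (F 0)} \<union>
  {B \<times> {s<..t} | B s t. 0 \<le> s \<and> s < t \<and> t \<le> T \<and> B \<in> sets (F (ennreal s))}"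

lemma F_subset: "B \<in> sets (F s) \<Longrightarrow> B \<subseteq> \<Omega>"
  using sets.sets_into_space[of B "F s"] space_F by simp

lemma F_mono: "B \<in> sets (F s) \<Longrightarrow> s \<le> t \<Longrightarrow> B \<in> sets (F t)"
  using sets_F_mono by blast

lemma F_measurable_mono: "f \<in> F s \<rightarrow>\<^sub>M N \<Longrightarrow> s \<le> t \<Longrightarrow> f \<in> F t \<rightarrow>\<^sub>M N"
  by (auto simp: measurable_def space_F intro: F_mono)

lemma rectangles_subset: "rectangles \<subseteq> Pow (\<Omega> \<times> {0..T})"
  using T_pos by (auto simp: rectangles_def dest: F_subset)

lemma PRE_eq: "PRE = sigma (\<Omega> \<times> {0..T}) rectangles"
  by (simp add: predictable_sigma_def rectangles_def)

lemma space_PRE [simp]: "space PRE = \<Omega> \<times> {0..T}"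
  unfolding PRE_eq using rectangles_subset by (rule space_measure_of)

lemma sets_PRE: "sets PRE = sigma_sets (\<Omega> \<times> {0..T}) rectangles"
  unfolding PRE_eq using rectangles_subset by (rule sets_measure_of)

lemma PRE_zero: "B \<in> sets (F 0) \<Longrightarrow> B \<times> {0} \<in> sets PRE"
  unfolding sets_PRE by (intro sigma_sets.Basic) (auto simp: rectangles_def)

lemma PRE_Ioc:
  assumes "B \<in> sets (F (ennreal s))" "0 \<le> s" "t \<le> T" shows "B \<times> {s<..t} \<in> sets PRE"
proof (cases "s < t")
  case True then show ?thesis unfolding sets_PRE using assms
    by (intro sigma_sets.Basic) (auto simp: rectangles_def)
qed simp

lemma PRE_top: "\<Omega> \<times> {0..T} \<in> sets PRE"
  using sets.top[of PRE] by simp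

lemma Int_stable_rectangles: "Int_stable rectangles"
proof (rule Int_stableI)
  fix a b assume "a \<in> rectangles" "b \<in> rectangles"
  have empty: "{} \<in> rectangles" by (auto simp: rectangles_def intro!: exI[of _ "{}"])
  have *: "B \<times> {s<..t} \<inter> B' \<times> {s'<..t'} \<in> rectangles"
    if "0 \<le> s" "s < t" "t \<le> T" "B \<in> sets (F (ennreal s))" "0 \<le> s'" "s' < t'" "t' \<le> T" "B' \<in> sets (F (ennreal s'))"
    for B B' s s' t t'
  proof (cases "max s s' < min t t'")
    case True
    have "B \<times> {s<..t} \<inter> B' \<times> {s'<..t'} = (B \<inter> B') \<times> {max s s'<..min t t'}" by auto
    moreover have "B \<inter> B' \<in> sets (F (ennreal (max s s')))"
      by (intro sets.Int F_mono[OF that(4)] F_mono[OF that(8)] ennreal_leI) auto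
    moreover have "0 \<le> max s s'" "min t t' \<le> T" using that by auto
    ultimately show ?thesis using True unfolding rectangles_def by blast
  next
    case False
    then have "B \<times> {s<..t} \<inter> B' \<times> {s'<..t'} = {}" by auto
    then show ?thesis using empty by simp
  qed
  have e1: "B \<times> {0} \<inter> B' \<times> {s'<..t'} = {}" "B' \<times> {s'<..t'} \<inter> B \<times> {0} = {}" if "0 \<le> s'" for B B' :: "'w set" and s' t' :: real
    using that by auto
  have e2: "B \<times> {0} \<inter> B' \<times> {0} \<in> rectangles" if "B \<in> sets (F 0)" "B' \<in> sets (F 0)" for B B'
  proof -
    have "B \<times> {0} \<inter> B' \<times> {0} = (B \<inter> B') \<times> {0::real}" by auto
    then show ?thesis using that by (auto simp: rectangles_def intro!: exI[of _ "B \<inter> B'"])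
  qed
  have cases: "(\<exists>B. R = B \<times> {0} \<and> B \<in> sets (F 0)) \<or>
      (\<exists>B s t. R = B \<times> {s<..t} \<and> 0 \<le> s \<and> s < t \<and> t \<le> T \<and> B \<in> sets (F (ennreal s)))"
    if "R \<in> rectangles" for R
    using that by (auto simp: rectangles_def)
  show "a \<inter> b \<in> rectangles"
    using cases[OF \<open>a \<in> rectangles\<close>] cases[OF \<open>b \<in> rectangles\<close>]
    by (elim disjE exE conjE) (simp_all only: * e1 e2 empty)
qed

lemma Pair_measurable_PRE:
  assumes "w \<in> \<Omega>" shows "Pair w \<in> restrict_space borel {0..T} \<rightarrow>\<^sub>M PRE"
  unfolding PRE_eq
proof (rule measurable_measure_of[OF rectangles_subset])
  show "Pair w \<in> space (restrict_space borel {0..T}) \<rightarrow> \<Omega> \<times> {0..T}"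
    using assms by (auto simp: space_restrict_space)
  fix R assume "R \<in> rectangles"
  then obtain B D where R: "R = B \<times> D" and D: "D \<in> sets borel" by (auto simp: rectangles_def)
  have "Pair w -` R \<inter> space (restrict_space borel {0..T}) = (if w \<in> B then D \<inter> {0..T} else {})"
    by (auto simp: R space_restrict_space)
  then show "Pair w -` R \<inter> space (restrict_space borel {0..T}) \<in> sets (restrict_space borel {0..T})"
    using D by (auto simp: sets_restrict_space)
qed

lemma slice_measurable_PRE:
  assumes "0 \<le> t" "t \<le> T" shows "(\<lambda>w. (w, t)) \<in> F (ennreal t) \<rightarrow>\<^sub>M PRE"
  unfolding PRE_eq
proof (rule measurable_measure_of[OF rectangles_subset])
  show "(\<lambda>w. (w, t)) \<in> space (F (ennreal t)) \<rightarrow> \<Omega> \<times> {0..T}"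
    using assms by (auto simp: space_F)
  fix R assume R: "R \<in> rectangles"
  then consider B where "R = B \<times> {0}" "B \<in> sets (F 0)"
    | B s u where "R = B \<times> {s<..u}" "0 \<le> s" "B \<in> sets (F (ennreal s))"
    by (auto simp: rectangles_def)
  then show "(\<lambda>w. (w, t)) -` R \<inter> space (F (ennreal t)) \<in> sets (F (ennreal t))"
  proof cases
    case 1
    then have "(\<lambda>w. (w, t)) -` R \<inter> space (F (ennreal t)) = (if t = 0 then B else {})"
      using F_subset by (auto simp: space_F)
    then show ?thesis using 1 by (cases "t = 0") simp_all
  next
    case 2
    then have "(\<lambda>w. (w, t)) -` R \<inter> space (F (ennreal t)) = (if s < t \<and> t \<le> u then B else {})"
      using F_subset by (auto simp: space_F)
    moreover have "B \<in> sets (F (ennreal t))" if "s < t"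
      using that by (intro F_mono[OF 2(3)] ennreal_leI) simp
    ultimately show ?thesis by auto
  qed
qed

lemma snd_measurable_PRE [measurable]: "snd \<in> borel_measurable PRE"
proof (rule borel_measurableI_le)
  fix y :: real
  show "{x \<in> space PRE. snd x \<le> y} \<in> sets PRE"
  proof (cases "0 \<le> y")
    case True
    have "{x \<in> space PRE. snd x \<le> y} = \<Omega> \<times> {0} \<union> \<Omega> \<times> {0<..min y T}" using True T_pos by auto
    then show ?thesis using PRE_zero[of \<Omega>] PRE_Ioc[of \<Omega> 0 "min y T"] sets.top[of "F 0"] by (auto simp: space_F)
  next
    case False
    then have "{x \<in> space PRE. snd x \<le> y} = {}" by auto
    then show ?thesis by (simp only: sets.empty_sets)
  qed
qed

lemma PRE_section:
  assumes "k \<in> PRE \<rightarrow>\<^sub>M N" "w \<in> \<Omega>" shows "(\<lambda>s. k (w, s)) \<in> restrict_space borel {0..T} \<rightarrow>\<^sub>M N"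
  using measurable_compose[OF Pair_measurable_PRE assms(1)] assms(2) by simp

lemma PRE_slice:
  assumes "k \<in> PRE \<rightarrow>\<^sub>M N" "0 \<le> t" "t \<le> T" shows "(\<lambda>w. k (w, t)) \<in> F (ennreal t) \<rightarrow>\<^sub>M N"
  using measurable_compose[OF slice_measurable_PRE assms(1)] assms(2,3) by simp

text \<open>
  An event known at a stopping time \<open>\<tau>\<close> gives a predictable set once it is cut down to times after
  \<open>\<tau>\<close>: at a time \<open>s > \<tau>\<close> it was already known at a rational time between \<open>\<tau>\<close> and \<open>s\<close>.
\<close>

lemma after_stopping_time_PRE:
  assumes \<tau>: "stopping_time F \<tau>" and B: "B \<in> sets (pre_sigma \<tau>)"
  shows "{(w, s). w \<in> B \<and> 0 \<le> s \<and> s \<le> T \<and> \<tau> w < ennreal s} \<in> sets PRE"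
proof -
  have "{(w, s). w \<in> B \<and> 0 \<le> s \<and> s \<le> T \<and> \<tau> w < ennreal s}
    = (\<Union>q\<in>{q\<in>\<rat>. 0 \<le> q}. {w\<in>B. \<tau> w \<le> ennreal q} \<times> {q<..T})" (is "?L = ?R")
  proof (intro set_eqI iffI)
    fix p assume "p \<in> ?L"
    then obtain w s where p: "p = (w, s)" "w \<in> B" "0 \<le> s" "s \<le> T" "\<tau> w < ennreal s" by auto
    have fin: "\<tau> w < \<infinity>" using p(5) by (metis ennreal_less_top infinity_ennreal_def less_trans)
    then have e: "ennreal (enn2real (\<tau> w)) = \<tau> w" by (simp add: less_top[symmetric])
    then have "enn2real (\<tau> w) < s" using p(3,5) by (metis enn2real_nonneg ennreal_less_iff)
    then obtain q where q: "q \<in> \<rat>" "enn2real (\<tau> w) < q" "q < s" using Rats_dense_in_real by blast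
    have "0 \<le> q" using q(2) enn2real_nonneg[of "\<tau> w"] by linarith
    moreover have "\<tau> w \<le> ennreal q" using e q(2) by (metis ennreal_leI less_imp_le)
    ultimately show "p \<in> ?R" using p q by auto
  next
    fix p assume "p \<in> ?R"
    then obtain q w s where "0 \<le> q" and p: "p = (w, s)" "w \<in> B" "\<tau> w \<le> ennreal q" "q < s" "s \<le> T" by auto
    then have "\<tau> w < ennreal s" by (meson ennreal_lessI le_less_trans less_le_trans order_le_less_trans)
    then show "p \<in> ?L" using p \<open>0 \<le> q\<close> by auto
  qed
  moreover have "{w\<in>B. \<tau> w \<le> ennreal q} \<times> {q<..T} \<in> sets PRE" if "0 \<le> q" for q
    using sets_pre_sigmaD[OF \<tau> B] that by (intro PRE_Ioc) auto
  moreover have "countable {q\<in>\<rat>. 0 \<le> (q::real)}" using countable_rat by (rule countable_subset[rotated]) auto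
  ultimately show ?thesis by (auto intro!: sets.countable_UN')
qed

definition "after \<tau> = {(w, s). w \<in> \<Omega> \<and> 0 \<le> s \<and> s \<le> T \<and> \<tau> w < ennreal s}"

lemma after_PRE [measurable]: "stopping_time F \<tau> \<Longrightarrow> after \<tau> \<in> sets PRE"
  using after_stopping_time_PRE[of \<tau> \<Omega>] sets.top[of "pre_sigma \<tau>"] by (simp add: after_def space_pre_sigma)

lemma fst_after_measurable:
  assumes \<tau>: "stopping_time F \<tau>"
  shows "fst \<in> restrict_space PRE (after \<tau>) \<rightarrow>\<^sub>M pre_sigma \<tau>"
proof (rule measurableI)
  fix x assume "x \<in> space (restrict_space PRE (after \<tau>))"
  then show "fst x \<in> space (pre_sigma \<tau>)" by (auto simp: space_restrict_space space_pre_sigma)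
next
  fix B assume B: "B \<in> sets (pre_sigma \<tau>)"
  then have "B \<subseteq> \<Omega>" using sets.sets_into_space space_pre_sigma by metis
  then have "fst -` B \<inter> space (restrict_space PRE (after \<tau>)) = {(w, s). w \<in> B \<and> 0 \<le> s \<and> s \<le> T \<and> \<tau> w < ennreal s}"
    by (auto simp: space_restrict_space after_def)
  also have "\<dots> \<in> sets (restrict_space PRE (after \<tau>))"
    using after_stopping_time_PRE[OF \<tau> B] after_PRE[OF \<tau>] \<open>B \<subseteq> \<Omega>\<close>
    by (subst sets_restrict_space_iff) (auto simp: after_def[symmetric] intro!: sets.Int PRE_top, auto simp: after_def)
  finally show "fst -` B \<inter> space (restrict_space PRE (after \<tau>)) \<in> sets (restrict_space PRE (after \<tau>))" .
qed

lemma after_measurable: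
  assumes \<tau>: "stopping_time F \<tau>" and W: "W \<in> pre_sigma \<tau> \<rightarrow>\<^sub>M N" and c: "c \<in> space N"
  shows "(\<lambda>x. if x \<in> after \<tau> then W (fst x) else c) \<in> PRE \<rightarrow>\<^sub>M N"
  using measurable_compose[OF fst_after_measurable[OF \<tau>] W] after_PRE[OF \<tau>] c
  by (subst measurable_restrict_space_iff[symmetric]) (auto intro!: sets.Int PRE_top)

lemma after_const_measurable:
  assumes W: "W \<in> F (ennreal b) \<rightarrow>\<^sub>M N" and b: "0 \<le> b" and c: "c \<in> space N"
  shows "(\<lambda>x. if b < snd x then W (fst x) else c) \<in> PRE \<rightarrow>\<^sub>M N"
proof -
  let ?\<tau> = "\<lambda>_::'w. ennreal b"
  have \<tau>: "stopping_time F ?\<tau>" by (rule stopping_time_const)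
  have "sets (F (ennreal b)) \<subseteq> sets (pre_sigma ?\<tau>)"
  proof
    fix B assume B: "B \<in> sets (F (ennreal b))"
    show "B \<in> sets (pre_sigma ?\<tau>)"
    proof (rule sets_pre_sigmaI[OF \<tau>])
      fix t show "{w \<in> B. ennreal b \<le> t} \<in> sets (F t)"
        using F_mono[OF B, of t] by (cases "ennreal b \<le> t") simp_all
    qed
  qed
  then have "W \<in> pre_sigma ?\<tau> \<rightarrow>\<^sub>M N"
    using W by (simp add: measurable_def space_F space_pre_sigma subset_iff)
  from after_measurable[OF \<tau> this c] show ?thesis
    by (rule measurable_cong[THEN iffD1, rotated]) (use b in \<open>auto simp: after_def ennreal_less_iff\<close>)
qed

text \<open>The last grid point before a time, for the left limits of adapted processes.\<close>

definition before_grid :: "nat \<Rightarrow> real \<Rightarrow> real" where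
  "before_grid k s = real (nat (\<lceil>2 ^ k * s\<rceil> - 1)) / 2 ^ k"

lemma before_grid:
  assumes "0 < s" shows "0 \<le> before_grid k s" "before_grid k s < s" "s - before_grid k s \<le> 1 / 2 ^ k"
proof -
  have "0 < \<lceil>2 ^ k * s\<rceil>" using assms by simp
  then have e: "real (nat (\<lceil>2 ^ k * s\<rceil> - 1)) = of_int \<lceil>2 ^ k * s\<rceil> - 1" by simp
  have "2 ^ k * s \<le> of_int \<lceil>2 ^ k * s\<rceil>" "of_int \<lceil>2 ^ k * s\<rceil> - 1 < 2 ^ k * s" by linarith+
  then show "0 \<le> before_grid k s" "before_grid k s < s" "s - before_grid k s \<le> 1 / 2 ^ k"
    unfolding before_grid_def e using assms by (auto simp: field_simps)
qed

lemma before_grid_at_left: "0 < s \<Longrightarrow> filterlim (\<lambda>k. before_grid k s) (at_left s) sequentially"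
  unfolding filterlim_at
proof
  assume s: "0 < s"
  show "\<forall>\<^sub>F k in sequentially. before_grid k s \<in> {..<s} \<and> before_grid k s \<noteq> s"
    using before_grid(2)[OF s] by (auto simp: less_imp_neq)
  have l: "(\<lambda>k. s - (1/2) ^ k) \<longlonglongrightarrow> s - 0"
    by (intro tendsto_intros LIMSEQ_power_zero) auto
  show "(\<lambda>k. before_grid k s) \<longlonglongrightarrow> s"
    by (rule tendsto_sandwich[where f="\<lambda>k. s - (1/2) ^ k" and h="\<lambda>_. s"])
      (use l before_grid[OF s] in \<open>auto simp: power_one_over algebra_simps less_imp_le intro!: always_eventually\<close>)
qed

definition "left_process Y x = (if 0 < snd x then left_limit (Y (fst x)) (snd x) else (0::real))"

text \<open>
  The left limit at \<open>s\<close> is the limit of values at grid points before \<open>s\<close>, and each of these is known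
  before \<open>s\<close>.
\<close>

lemma left_process_measurable:
  assumes adapted: "adapted F T Y" and cadlag: "\<And>w. w \<in> \<Omega> \<Longrightarrow> cadlag T (Y w)"
  shows "left_process Y \<in> borel_measurable PRE"
proof (rule borel_measurable_LIMSEQ_real)
  define Yk where "Yk k x = (if 0 < snd x then Y (fst x) (before_grid k (snd x)) else 0)" for k x
  fix x assume "x \<in> space PRE"
  then obtain w s where x: "x = (w, s)" "w \<in> \<Omega>" "0 \<le> s" "s \<le> T" by auto
  show "(\<lambda>k. Yk k x) \<longlonglongrightarrow> left_process Y x"
  proof (cases "0 < s")
    case True
    then have "s \<in> {0<..T}" using x by simp
    then obtain l where l: "(Y w \<longlongrightarrow> l) (at_left s)" using cadlag[OF x(2)] unfolding cadlag_def by blast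
    then have "(\<lambda>k. Y w (before_grid k s)) \<longlonglongrightarrow> l"
      using before_grid_at_left[OF True] by (rule filterlim_compose)
    then show ?thesis using True by (simp add: x Yk_def left_process_def left_limit_eq[OF l])
  qed (simp add: x Yk_def left_process_def)
next
  fix k
  let ?j = "\<lambda>x::'w \<times> real. nat (\<lceil>2 ^ k * snd x\<rceil> - 1)"
  let ?g = "\<lambda>(j::nat) x. if real j / 2 ^ k < snd x then (if real j / 2 ^ k \<le> T then Y (fst x) (real j / 2 ^ k) else 0) else 0"
  have "?g j \<in> borel_measurable PRE" for j
  proof (rule after_const_measurable)
    show "(\<lambda>w. if real j / 2 ^ k \<le> T then Y w (real j / 2 ^ k) else 0) \<in> borel_measurable (F (ennreal (real j / 2 ^ k)))"
      using adapted by (cases "real j / 2 ^ k \<le> T") (auto simp: adapted_def)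
  qed auto
  then have m: "(\<lambda>x. ?g (?j x) x) \<in> borel_measurable PRE"
    by (rule measurable_compose_countable) measurable
  show "(\<lambda>x. if 0 < snd x then Y (fst x) (before_grid k (snd x)) else 0) \<in> borel_measurable PRE"
  proof (rule measurable_cong[THEN iffD2, OF _ m])
    fix x assume x: "x \<in> space PRE"
    show "(if 0 < snd x then Y (fst x) (before_grid k (snd x)) else 0) = ?g (?j x) x"
    proof (cases "0 < snd x")
      case True
      then show ?thesis using before_grid(2)[OF True, of k] x by (auto simp: before_grid_def)
    qed (use x in auto)
  qed
qed

text \<open>
  Between a stopping time \<open>\<tau> \<le> t\<close> and \<open>t\<close> one can approximate \<open>\<tau>\<close> from the right by grid points that
  do not exceed \<open>t\<close>, where the process is known at \<open>t\<close>. So the value at \<open>\<tau>\<close> is known at \<open>\<tau>\<close> itself, not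
  only immediately after it.
\<close>

lemma value_at_stopping_time_F:
  assumes adapted: "adapted F T Y" and cadlag: "\<And>w. w \<in> \<Omega> \<Longrightarrow> cadlag T (Y w)"
    and \<tau>: "stopping_time F \<tau>" and t: "0 \<le> t" "t \<le> T"
  shows "(\<lambda>w. Y w (enn2real (min (\<tau> w) (ennreal t)))) \<in> borel_measurable (F (ennreal t))"
proof -
  let ?s = "\<lambda>w. enn2real (min (\<tau> w) (ennreal t))"
  let ?g = "\<lambda>k s. min t (real (nat (\<lfloor>2 ^ k * s\<rfloor> + 1)) / 2 ^ k)"
  have s: "0 \<le> ?s w" "?s w \<le> t" for w
    using t by (auto intro!: enn2real_leI simp: min_def)
  have "(\<lambda>w. min (\<tau> w) (ennreal t)) \<in> borel_measurable (F (ennreal t))"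
  proof (rule borel_measurableI_le)
    fix c
    have "{w \<in> space (F (ennreal t)). min (\<tau> w) (ennreal t) \<le> c}
      = (if ennreal t \<le> c then space (F (ennreal t)) else {w \<in> space (F (ennreal t)). \<tau> w \<le> c})"
      by (auto simp: min_le_iff_disj)
    then show "{w \<in> space (F (ennreal t)). min (\<tau> w) (ennreal t) \<le> c} \<in> sets (F (ennreal t))"
      using stopping_time_le_const[OF \<tau>, of c "ennreal t"] by (auto simp: pred_def)
  qed
  then have [measurable]: "?s \<in> borel_measurable (F (ennreal t))" by measurable
  show ?thesis
  proof (rule borel_measurable_LIMSEQ_real)
    fix w assume "w \<in> space (F (ennreal t))"
    then have w: "w \<in> \<Omega>" by (simp add: space_F)
    show "(\<lambda>k. Y w (?g k (?s w))) \<longlonglongrightarrow> Y w (?s w)"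
    proof (cases "?s w < t")
      case True
      let ?u = "?s w"
      have e: "real (nat (\<lfloor>2 ^ k * ?u\<rfloor> + 1)) = of_int \<lfloor>2 ^ k * ?u\<rfloor> + 1" for k :: nat
        using s(1)[of w] by (simp add: nat_add_distrib)
      have b: "?u < ?g k ?u" "?g k ?u \<le> ?u + (1/2) ^ k" for k
      proof -
        have "2 ^ k * ?u < of_int \<lfloor>2 ^ k * ?u\<rfloor> + 1" "of_int \<lfloor>2 ^ k * ?u\<rfloor> \<le> 2 ^ k * ?u" by linarith+
        then show "?u < ?g k ?u" "?g k ?u \<le> ?u + (1/2) ^ k"
          unfolding e using True by (auto simp: field_simps min_le_iff_disj power_one_over)
      qed
      have l: "(\<lambda>k. ?u + (1/2) ^ k) \<longlonglongrightarrow> ?u + 0"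
        by (intro tendsto_intros LIMSEQ_power_zero) auto
      have "(\<lambda>k. ?g k ?u) \<longlonglongrightarrow> ?u"
        by (rule tendsto_sandwich[where f="\<lambda>_. ?u" and h="\<lambda>k. ?u + (1/2) ^ k"])
          (use l b in \<open>auto intro!: always_eventually less_imp_le\<close>)
      then have "filterlim (\<lambda>k. ?g k ?u) (at_right ?u) sequentially"
        unfolding filterlim_at using b(1) by (auto intro!: always_eventually simp: less_imp_neq[symmetric])
      moreover have "(Y w \<longlongrightarrow> Y w ?u) (at_right ?u)"
        using cadlag[OF w] s[of w] True t by (auto simp: cadlag_def)
      ultimately show ?thesis by (rule filterlim_compose[rotated])
    next
      case False
      then have st: "?s w = t" using s(2)[of w] by linarith
      have "?g k t = t" for k
      proof -
        have "2 ^ k * t < of_int (\<lfloor>2 ^ k * t\<rfloor> + 1)" by linarith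
        moreover have "of_int (\<lfloor>2 ^ k * t\<rfloor> + 1) = real (nat (\<lfloor>2 ^ k * t\<rfloor> + 1))" using t by simp
        ultimately have "2 ^ k * t < real (nat (\<lfloor>2 ^ k * t\<rfloor> + 1))" by linarith
        then show ?thesis by (auto simp: field_simps min_def)
      qed
      then show ?thesis by (simp add: st)
    qed
  next
    fix k
    have "(\<lambda>w. Y w (min t (real j / 2 ^ k))) \<in> borel_measurable (F (ennreal t))" for j :: nat
    proof (rule F_measurable_mono)
      show "(\<lambda>w. Y w (min t (real j / 2 ^ k))) \<in> borel_measurable (F (ennreal (min t (real j / 2 ^ k))))"
        using adapted t by (auto simp: adapted_def)
      show "ennreal (min t (real j / 2 ^ k)) \<le> ennreal t" by (intro ennreal_leI) simp
    qed
    then show "(\<lambda>w. Y w (?g k (?s w))) \<in> borel_measurable (F (ennreal t))"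
      by (rule measurable_compose_countable) measurable
  qed
qed

lemma value_at_stopping_time:
  assumes adapted: "adapted F T Y" and cadlag: "\<And>w. w \<in> \<Omega> \<Longrightarrow> cadlag T (Y w)"
    and \<tau>: "stopping_time F \<tau>"
  shows "(\<lambda>w. if \<tau> w \<le> ennreal T then Y w (enn2real (\<tau> w)) else 0) \<in> borel_measurable (pre_sigma \<tau>)"
    (is "?W \<in> _")
proof (rule borel_measurableI_le, rule sets_pre_sigmaI[OF \<tau>])
  fix c :: real and t :: ennreal
  have *: "{w \<in> \<Omega>. Y w (enn2real (\<tau> w)) \<le> c \<and> \<tau> w \<le> ennreal r} \<in> sets (F (ennreal r))"
    if r: "0 \<le> r" "r \<le> T" for r
  proof -
    have "{w \<in> space (F (ennreal r)). Y w (enn2real (min (\<tau> w) (ennreal r))) \<le> c} \<inter> {w \<in> space (F (ennreal r)). \<tau> w \<le> ennreal r} \<in> sets (F (ennreal r))" (is "?S \<in> _")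
      using value_at_stopping_time_F[OF adapted cadlag \<tau> r] stopping_timeD[OF \<tau>, of "ennreal r"]
      by (intro sets.Int) (auto simp: pred_def)
    also have "?S = {w \<in> \<Omega>. Y w (enn2real (\<tau> w)) \<le> c \<and> \<tau> w \<le> ennreal r}"
      by (auto simp: space_F min_absorb1)
    finally show ?thesis .
  qed
  show "{w \<in> {x \<in> space (pre_sigma \<tau>). ?W x \<le> c}. \<tau> w \<le> t} \<in> sets (F t)"
  proof (cases "t \<le> ennreal T")
    case True
    then obtain r where r: "t = ennreal r" "0 \<le> r" "r \<le> T"
      using T_pos by (cases t) (auto simp: ennreal_le_iff2 top_unique)
    have "{w \<in> {x \<in> space (pre_sigma \<tau>). ?W x \<le> c}. \<tau> w \<le> t} = {w \<in> \<Omega>. Y w (enn2real (\<tau> w)) \<le> c \<and> \<tau> w \<le> ennreal r}"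
    proof -
      have "\<tau> w \<le> ennreal T" if "\<tau> w \<le> ennreal r" for w
        using order_trans[OF that ennreal_leI[OF r(3)]] .
      then show ?thesis using r(1) by (auto simp: space_pre_sigma)
    qed
    then show ?thesis using * r by simp
  next
    case False
    then have le: "ennreal T \<le> t" by simp
    have "{w \<in> \<Omega>. Y w (enn2real (\<tau> w)) \<le> c \<and> \<tau> w \<le> ennreal T} \<in> sets (F t)"
      using F_mono[OF *[of T] le] T_pos by simp
    moreover have "{w \<in> \<Omega>. \<tau> w \<le> ennreal T} \<in> sets (F t)" "{w \<in> \<Omega>. \<tau> w \<le> t} \<in> sets (F t)"
      using stopping_time_le_const[OF \<tau> le] stopping_timeD[OF \<tau>, of t] by (auto simp: pred_def space_F)
    moreover have "{w \<in> {x \<in> space (pre_sigma \<tau>). ?W x \<le> c}. \<tau> w \<le> t} =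
      {w \<in> \<Omega>. Y w (enn2real (\<tau> w)) \<le> c \<and> \<tau> w \<le> ennreal T} \<union>
      (if 0 \<le> c then {w \<in> \<Omega>. \<tau> w \<le> t} - {w \<in> \<Omega>. \<tau> w \<le> ennreal T} else {})"
      using le by (auto simp: space_pre_sigma split: if_splits)
    ultimately show ?thesis by auto
  qed
qed

end

locale increasing_process = filtered_space +
  fixes A :: "'a \<Rightarrow> real \<Rightarrow> real"
  assumes A_path: "w \<in> \<Omega> \<Longrightarrow> increasing_path T (A w)"
    and A_predictable: "(\<lambda>(w, t). A w t) \<in> borel_measurable PRE"
begin

abbreviation "dA w \<equiv> stieltjes T (A w)"

lemma space_dA: "w \<in> \<Omega> \<Longrightarrow> space (dA w) = {0..T}"
  and sets_dA: "w \<in> \<Omega> \<Longrightarrow> sets (dA w) = sets (restrict_space borel {0..T})"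
  and emeasure_dA_Ioc: "w \<in> \<Omega> \<Longrightarrow> 0 \<le> u \<Longrightarrow> u \<le> v \<Longrightarrow> v \<le> T \<Longrightarrow> emeasure (dA w) {u<..v} = ennreal (A w v - A w u)"
  and finite_dA: "w \<in> \<Omega> \<Longrightarrow> finite_measure (dA w)"
  and dA_pos: "w \<in> \<Omega> \<Longrightarrow> AE s in dA w. 0 < s"
  and A_nonneg: "w \<in> \<Omega> \<Longrightarrow> 0 \<le> t \<Longrightarrow> t \<le> T \<Longrightarrow> 0 \<le> A w t"
  and A_le: "w \<in> \<Omega> \<Longrightarrow> 0 \<le> s \<Longrightarrow> s \<le> t \<Longrightarrow> t \<le> T \<Longrightarrow> A w s \<le> A w t"
  and A_zero: "w \<in> \<Omega> \<Longrightarrow> A w 0 = 0"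
proof -
  assume "w \<in> \<Omega>"
  then interpret increasing_path T "A w" by (rule A_path)
  show "space (dA w) = {0..T}" "sets (dA w) = sets (restrict_space borel {0..T})"
    "0 \<le> u \<Longrightarrow> u \<le> v \<Longrightarrow> v \<le> T \<Longrightarrow> emeasure (dA w) {u<..v} = ennreal (A w v - A w u)"
    "finite_measure (dA w)" "AE s in dA w. 0 < s"
    "0 \<le> t \<Longrightarrow> t \<le> T \<Longrightarrow> 0 \<le> A w t" "0 \<le> s \<Longrightarrow> s \<le> t \<Longrightarrow> t \<le> T \<Longrightarrow> A w s \<le> A w t" "A w 0 = 0"
    by (auto simp: emeasure_stieltjes_Ioc AE_stieltjes_pos a_nonneg a_le a_0 stieltjes.finite_measure_axioms)
qed

lemma dA_measurable: "w \<in> \<Omega> \<Longrightarrow> k \<in> PRE \<rightarrow>\<^sub>M N \<Longrightarrow> (\<lambda>s. k (w, s)) \<in> dA w \<rightarrow>\<^sub>M N"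
  using PRE_section sets_dA by (metis measurable_cong_sets)

lemma Ioc_dA: "w \<in> \<Omega> \<Longrightarrow> 0 \<le> u \<Longrightarrow> v \<le> T \<Longrightarrow> {u<..v} \<in> sets (dA w)"
  using sets_dA by (auto simp: sets_restrict_space_iff)

lemma A_stopped_measurable:
  assumes "0 \<le> b" "b \<le> T" shows "(\<lambda>(w, t). A w (min b t)) \<in> borel_measurable PRE"
proof -
  have "(\<lambda>w. A w b) \<in> borel_measurable (F (ennreal b))"
    using PRE_slice[OF A_predictable assms] by simp
  then have [measurable]: "(\<lambda>x. if b < snd x then A (fst x) b else 0) \<in> borel_measurable PRE"
    using assms by (intro after_const_measurable) auto
  note [measurable] = A_predictable
  have "(\<lambda>x. if b < snd x then (if b < snd x then A (fst x) b else 0) else (case x of (w, t) \<Rightarrow> A w t)) \<in> borel_measurable PRE"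
    by measurable
  also have "(\<lambda>x. if b < snd x then (if b < snd x then A (fst x) b else 0) else (case x of (w, t) \<Rightarrow> A w t)) = (\<lambda>(w, t). A w (min b t))"
    by (auto simp: fun_eq_iff min_def)
  finally show ?thesis .
qed

lemma dA_measurable_until:
  fixes u :: "_ \<Rightarrow> ennreal"
  assumes "w \<in> \<Omega>" "u \<in> borel_measurable PRE" "t \<le> T"
  shows "(\<lambda>s. u (w, s) * indicator {0<..t} s) \<in> borel_measurable (dA w)"
  using assms by (intro borel_measurable_times_ennreal borel_measurable_indicator Ioc_dA dA_measurable) auto

text \<open>
  The value at \<open>t\<close> of an integral process only uses the integrand up to \<open>t\<close>; for a rectangle
  \<open>B \<times> {s<..u}\<close> this is visible because the integral is \<open>A (min u t) - A s\<close> on \<open>B\<close>, once \<open>s < t\<close>.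
\<close>

lemma nn_integral_process_set:
  assumes "D \<in> sets PRE"
  shows "(\<lambda>(w, t). \<integral>\<^sup>+s\<in>{0<..t}. indicator D (w, s) \<partial>dA w) \<in> borel_measurable PRE"
proof -
  let ?I = "\<lambda>D (w, t). (\<integral>\<^sup>+s\<in>{0<..t}. indicator D (w, s) \<partial>dA w)"
  note sect = PRE_section[where N=borel] and [measurable] = A_predictable
  have Im: "(\<lambda>s. indicator D (w, s) * indicator {0<..t} s :: ennreal) \<in> borel_measurable (dA w)"
    if "D \<in> sets PRE" "w \<in> \<Omega>" "t \<le> T" for D w t
    using dA_measurable_until[of w "indicator D" t] that by simp
  have "D \<in> sigma_sets (\<Omega> \<times> {0..T}) rectangles" using assms by (simp add: sets_PRE)
  with Int_stable_rectangles rectangles_subset show ?thesis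
  proof (induction rule: sigma_sets_induct_disjoint)
    case (basic R)
    then consider B where "R = B \<times> {0}" "B \<in> sets (F 0)"
      | B s u where "R = B \<times> {s<..u}" "0 \<le> s" "s < u" "u \<le> T" "B \<in> sets (F (ennreal s))"
      by (auto simp: rectangles_def)
    then show ?case
    proof cases
      case 1
      have "?I R x = 0" for x
        by (cases x) (auto simp: 1 indicator_def intro!: nn_integral_zero')
      then show ?thesis by simp
    next
      case 2
      have [measurable]: "(\<lambda>(w, t). A w (min u t)) \<in> borel_measurable PRE" "(\<lambda>(w, t). A w (min s t)) \<in> borel_measurable PRE"
        using 2 by (auto intro!: A_stopped_measurable)
      have "indicator B \<in> borel_measurable (F (ennreal s))" using 2 by simp
      then have [measurable]: "(\<lambda>x. if s < snd x then indicator B (fst x) else 0 :: ennreal) \<in> borel_measurable PRE"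
        using 2 by (intro after_const_measurable) auto
      have "(\<lambda>x. (if s < snd x then indicator B (fst x) else 0) *
          ennreal ((case x of (w, t) \<Rightarrow> A w (min u t)) - (case x of (w, t) \<Rightarrow> A w (min s t)))) \<in> borel_measurable PRE"
        by measurable
      then show ?thesis
      proof (rule measurable_cong[THEN iffD1, rotated])
        fix x assume "x \<in> space PRE"
        then obtain w t where x: "x = (w, t)" "w \<in> \<Omega>" "0 \<le> t" "t \<le> T" by auto
        have "?I R x = (\<integral>\<^sup>+r. indicator B w * indicator {s<..min u t} r \<partial>dA w)"
          unfolding x case_prod_conv using 2 by (intro nn_integral_cong) (auto simp: indicator_def)
        also have "\<dots> = indicator B w * emeasure (dA w) {s<..min u t}"
          using Ioc_dA[OF x(2) \<open>0 \<le> s\<close>, of "min u t"] x 2 by (subst nn_integral_cmult_indicator) auto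
        also have "\<dots> = (if s < t then indicator B w else 0) * ennreal (A w (min u t) - A w (min s t))"
          using emeasure_dA_Ioc[OF x(2) \<open>0 \<le> s\<close>, of "min u t"] x 2 by (cases "s < t") auto
        finally show "(if s < snd x then indicator B (fst x) else 0) *
          ennreal ((case x of (w, t) \<Rightarrow> A w (min u t)) - (case x of (w, t) \<Rightarrow> A w (min s t))) = ?I R x"
          using x by simp
      qed
    qed
  next
    case empty then show ?case by simp
  next
    case (compl D)
    then have D: "D \<in> sets PRE" by (simp add: sets_PRE)
    note [measurable] = compl.IH
    have "(\<lambda>x. ennreal (case x of (w, t) \<Rightarrow> A w t) - ?I D x) \<in> borel_measurable PRE" by measurable
    then show ?case
    proof (rule measurable_cong[THEN iffD1, rotated])
      fix x assume "x \<in> space PRE"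
      then obtain w t where x: "x = (w, t)" "w \<in> \<Omega>" "0 \<le> t" "t \<le> T" by auto
      interpret finite_measure "dA w" using finite_dA x by simp
      have D': "\<Omega> \<times> {0..T} - D \<in> sets PRE" using D PRE_top by auto
      have "?I D x + ?I (\<Omega> \<times> {0..T} - D) x = (\<integral>\<^sup>+s. indicator {0<..t} s \<partial>dA w)"
        unfolding x case_prod_conv using x Im[OF D x(2) x(4)] Im[OF D' x(2) x(4)]
        by (subst nn_integral_add[symmetric]) (auto simp: indicator_def space_dA intro!: nn_integral_cong)
      also have "\<dots> = ennreal (A w t)"
        using x Ioc_dA[OF x(2), of 0 t] A_zero[OF x(2)] by (subst nn_integral_indicator) (auto simp: emeasure_dA_Ioc)
      finally have sum: "?I D x + ?I (\<Omega> \<times> {0..T} - D) x = ennreal (A w t)" .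
      then have "?I D x \<noteq> \<top>" by (metis ennreal_add_eq_top ennreal_neq_top)
      with sum[symmetric] show "ennreal (case x of (w, t) \<Rightarrow> A w t) - ?I D x = ?I (\<Omega> \<times> {0..T} - D) x"
        by (simp add: x)
    qed
  next
    case (union D)
    then have D: "D i \<in> sets PRE" for i by (auto simp: sets_PRE)
    note [measurable] = union.IH
    have "(\<lambda>x. \<Sum>i. ?I (D i) x) \<in> borel_measurable PRE" by measurable
    then show ?case
    proof (rule measurable_cong[THEN iffD1, rotated])
      fix x assume "x \<in> space PRE"
      then obtain w t where x: "x = (w, t)" "w \<in> \<Omega>" "0 \<le> t" "t \<le> T" by auto
      have "(\<Sum>i. ?I (D i) x) = (\<integral>\<^sup>+s. (\<Sum>i. indicator (D i) (w, s) * indicator {0<..t} s) \<partial>dA w)"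
        unfolding x case_prod_conv using Im[OF D x(2) x(4)] by (rule nn_integral_suminf[symmetric])
      also have "\<dots> = ?I (\<Union>i. D i) x"
        unfolding x case_prod_conv
        by (intro nn_integral_cong) (simp add: suminf_indicator[OF union.hyps(1), symmetric])
      finally show "(\<Sum>i. ?I (D i) x) = ?I (\<Union>i. D i) x" .
    qed
  qed
qed

lemma nn_integral_process:
  fixes k :: "_ \<Rightarrow> ennreal"
  assumes "k \<in> borel_measurable PRE"
  shows "(\<lambda>(w, t). \<integral>\<^sup>+s\<in>{0<..t}. k (w, s) \<partial>dA w) \<in> borel_measurable PRE"
  using assms
proof (induction rule: borel_measurable_induct)
  case (cong f g)
  show ?case
  proof (rule measurable_cong[THEN iffD2, OF _ cong(4)])
    fix x assume "x \<in> space PRE"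
    then show "(case x of (w, t) \<Rightarrow> \<integral>\<^sup>+s\<in>{0<..t}. f (w, s) \<partial>dA w) = (case x of (w, t) \<Rightarrow> \<integral>\<^sup>+s\<in>{0<..t}. g (w, s) \<partial>dA w)"
      using cong(3) by (auto simp: space_dA intro!: nn_integral_cong)
  qed
next
  case (set D) then show ?case by (rule nn_integral_process_set)
next
  case (mult u c)
  note [measurable] = mult.IH
  have "(\<lambda>x. c * (case x of (w, t) \<Rightarrow> \<integral>\<^sup>+s\<in>{0<..t}. u (w, s) \<partial>dA w)) \<in> borel_measurable PRE" by measurable
  then show ?case
  proof (rule measurable_cong[THEN iffD1, rotated])
    fix x assume "x \<in> space PRE"
    then obtain w t where x: "x = (w, t)" "w \<in> \<Omega>" "0 \<le> t" "t \<le> T" by auto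
    have "(\<lambda>s. u (w, s) * indicator {0<..t} s) \<in> borel_measurable (dA w)"
      using x mult(2) by (intro dA_measurable_until) auto
    then show "c * (case x of (w, t) \<Rightarrow> \<integral>\<^sup>+s\<in>{0<..t}. u (w, s) \<partial>dA w) = (case x of (w, t) \<Rightarrow> \<integral>\<^sup>+s\<in>{0<..t}. c * u (w, s) \<partial>dA w)"
      by (simp add: x nn_integral_cmult[symmetric] ac_simps)
  qed
next
  case (add u v)
  note [measurable] = add.IH
  have "(\<lambda>x. (case x of (w, t) \<Rightarrow> \<integral>\<^sup>+s\<in>{0<..t}. v (w, s) \<partial>dA w) + (case x of (w, t) \<Rightarrow> \<integral>\<^sup>+s\<in>{0<..t}. u (w, s) \<partial>dA w)) \<in> borel_measurable PRE"
    by measurable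
  then show ?case
  proof (rule measurable_cong[THEN iffD1, rotated])
    fix x assume "x \<in> space PRE"
    then obtain w t where x: "x = (w, t)" "w \<in> \<Omega>" "0 \<le> t" "t \<le> T" by auto
    have "(\<lambda>s. u (w, s) * indicator {0<..t} s) \<in> borel_measurable (dA w)" "(\<lambda>s. v (w, s) * indicator {0<..t} s) \<in> borel_measurable (dA w)"
      using x add by (auto intro!: dA_measurable_until)
    then show "(case x of (w, t) \<Rightarrow> \<integral>\<^sup>+s\<in>{0<..t}. v (w, s) \<partial>dA w) + (case x of (w, t) \<Rightarrow> \<integral>\<^sup>+s\<in>{0<..t}. u (w, s) \<partial>dA w) = (case x of (w, t) \<Rightarrow> \<integral>\<^sup>+s\<in>{0<..t}. (v (w, s) + u (w, s)) \<partial>dA w)"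
      by (simp add: x nn_integral_add[symmetric] distrib_right)
  qed
next
  case (seq U)
  note [measurable] = seq.IH
  have "(\<lambda>x. SUP i. (case x of (w, t) \<Rightarrow> \<integral>\<^sup>+s\<in>{0<..t}. U i (w, s) \<partial>dA w)) \<in> borel_measurable PRE" by measurable
  then show ?case
  proof (rule measurable_cong[THEN iffD1, rotated])
    fix x assume "x \<in> space PRE"
    then obtain w t where x: "x = (w, t)" "w \<in> \<Omega>" "0 \<le> t" "t \<le> T" by auto
    have m: "(\<lambda>s. U i (w, s) * indicator {0<..t} s) \<in> borel_measurable (dA w)" for i
      using x seq(1) by (intro dA_measurable_until) auto
    have "(SUP i. (\<integral>\<^sup>+s\<in>{0<..t}. U i (w, s) \<partial>dA w)) = (\<integral>\<^sup>+s. (SUP i. U i (w, s) * indicator {0<..t} s) \<partial>dA w)"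
    proof (rule nn_integral_monotone_convergence_SUP[symmetric, OF _ m])
      show "incseq (\<lambda>i s. U i (w, s) * indicator {0<..t} s)"
        using seq(3) by (auto simp: incseq_def le_fun_def intro!: mult_right_mono)
    qed
    also have "\<dots> = (\<integral>\<^sup>+s\<in>{0<..t}. (SUP i. U i (w, s)) \<partial>dA w)"
      by (simp add: SUP_mult_right_ennreal)
    finally show "(SUP i. (case x of (w, t) \<Rightarrow> \<integral>\<^sup>+s\<in>{0<..t}. U i (w, s) \<partial>dA w)) = (case x of (w, t) \<Rightarrow> \<integral>\<^sup>+s\<in>{0<..t}. (SUP i. U i) (w, s) \<partial>dA w)"
      by (simp add: x image_image)
  qed
qed

lemma integral_process:
  fixes k :: "_ \<Rightarrow> real"
  assumes k: "k \<in> borel_measurable PRE"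
  shows "(\<lambda>(w, t). LINT s:{0<..t}|dA w. k (w, s)) \<in> borel_measurable PRE"
proof -
  let ?N = "\<lambda>f (w, t). (\<integral>\<^sup>+s\<in>{0<..t}. ennreal (f (k (w, s))) \<partial>dA w)"
  have [measurable]: "?N abs \<in> borel_measurable PRE" "?N id \<in> borel_measurable PRE" "?N uminus \<in> borel_measurable PRE"
    using k by (auto intro!: nn_integral_process)
  have "(\<lambda>x. if ?N abs x < \<infinity> then enn2real (?N id x) - enn2real (?N uminus x) else 0) \<in> borel_measurable PRE"
    by measurable
  then show ?thesis
  proof (rule measurable_cong[THEN iffD1, rotated])
    fix x assume "x \<in> space PRE"
    then obtain w t where x: "x = (w, t)" "w \<in> \<Omega>" "0 \<le> t" "t \<le> T" by auto
    let ?f = "\<lambda>s. indicator {0<..t} s *\<^sub>R k (w, s)"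
    have m: "?f \<in> borel_measurable (dA w)"
      using x k Ioc_dA[OF x(2), of 0 t] by (intro borel_measurable_scaleR dA_measurable) auto
    have e: "?N abs x = (\<integral>\<^sup>+s. ennreal (norm (?f s)) \<partial>dA w)" "?N id x = (\<integral>\<^sup>+s. ennreal (?f s) \<partial>dA w)"
      "?N uminus x = (\<integral>\<^sup>+s. ennreal (- ?f s) \<partial>dA w)"
      unfolding x case_prod_conv by (auto intro!: nn_integral_cong simp: indicator_def)
    show "(if ?N abs x < \<infinity> then enn2real (?N id x) - enn2real (?N uminus x) else 0) = (case x of (w, t) \<Rightarrow> LINT s:{0<..t}|dA w. k (w, s))"
    proof (cases "integrable (dA w) ?f")
      case True
      then have "?N abs x < \<infinity>" unfolding e by (simp add: integrable_iff_bounded)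
      moreover have "integral\<^sup>L (dA w) ?f = enn2real (?N id x) - enn2real (?N uminus x)"
        unfolding e by (rule real_lebesgue_integral_def[OF True])
      ultimately show ?thesis by (simp add: x set_lebesgue_integral_def)
    next
      case False
      then have "\<not> ?N abs x < \<infinity>" unfolding e using m by (simp add: integrable_iff_bounded)
      then show ?thesis using False by (simp add: x set_lebesgue_integral_def not_integrable_integral_eq)
    qed
  qed
qed

end

section \<open>Multivariate point processes and their history\<close>

text \<open>
  A real function \<open>g\<close> on a set \<open>D\<close> all of whose rational level sets are pulled back along \<open>\<Phi>\<close> factors
  through \<open>\<Phi>\<close>. The infimum of the rational levels defines a factor on the whole target space, so that
  \<open>D\<close> and the range of \<open>\<Phi>\<close> may be arbitrary sets.
\<close>

lemma measurable_factor:
  fixes g :: "'w \<Rightarrow> real"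
  assumes "\<And>q::rat. \<exists>Q\<in>sets N. \<forall>w\<in>D. g w \<le> of_rat q \<longleftrightarrow> \<Phi> w \<in> Q"
  obtains h where "h \<in> borel_measurable N" "\<And>w. w \<in> D \<Longrightarrow> g w = h (\<Phi> w)"
proof -
  obtain Q where Q: "\<And>q::rat. Q q \<in> sets N" "\<And>q w. w \<in> D \<Longrightarrow> g w \<le> of_rat q \<longleftrightarrow> \<Phi> w \<in> Q q"
    using assms by metis
  define h where "h z = real_of_ereal (INF q::rat. if z \<in> Q q then ereal (of_rat q) else \<infinity>)" for z
  have "h \<in> borel_measurable N"
    unfolding h_def using Q(1) by (intro borel_measurable_real_of_ereal borel_measurable_INF measurable_If_set) auto
  moreover have "g w = h (\<Phi> w)" if w: "w \<in> D" for w
  proof -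
    have "(INF q::rat. if \<Phi> w \<in> Q q then ereal (of_rat q) else \<infinity>) = ereal (g w)"
    proof (rule antisym)
      show "ereal (g w) \<le> (INF q::rat. if \<Phi> w \<in> Q q then ereal (of_rat q) else \<infinity>)"
        using Q(2)[OF w] by (intro INF_greatest) auto
      show "(INF q::rat. if \<Phi> w \<in> Q q then ereal (of_rat q) else \<infinity>) \<le> ereal (g w)"
      proof (rule dense_ge)
        fix y assume y: "ereal (g w) < y"
        then obtain x where x: "g w < x" "ereal x \<le> y"
          using ereal_dense2[OF y] by (auto intro: less_imp_le)
        then obtain q where q: "g w < of_rat q" "of_rat q < x" using of_rat_dense by blast
        then have "(INF q::rat. if \<Phi> w \<in> Q q then ereal (of_rat q) else \<infinity>) \<le> ereal (of_rat q)"
          using Q(2)[OF w, of q] by (intro INF_lower2[of q]) auto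
        also have "\<dots> \<le> y" using q x by (meson ereal_less_eq(3) less_imp_le order_trans)
        finally show "(INF q::rat. if \<Phi> w \<in> Q q then ereal (of_rat q) else \<infinity>) \<le> y" .
      qed
    qed
    then show ?thesis by (simp add: h_def)
  qed
  ultimately show thesis by (rule that)
qed

text \<open>
  The sigma-field generated by the first \<open>n\<close> points. In the recursive form, functions of \<open>n + 1\<close> points
  are functions of the first \<open>n\<close> points and the next one by definition.
\<close>

primrec history :: "'w set \<Rightarrow> (nat \<Rightarrow> 'w \<Rightarrow> ennreal) \<Rightarrow> (nat \<Rightarrow> 'w \<Rightarrow> 'e::topological_space) \<Rightarrow> nat \<Rightarrow> 'w measure"
where
  "history \<Omega> S X 0 = sigma \<Omega> {}"
| "history \<Omega> S X (Suc n) =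
     vimage_algebra \<Omega> (\<lambda>w. (w, S (Suc n) w, X (Suc n) w)) (history \<Omega> S X n \<Otimes>\<^sub>M (borel \<Otimes>\<^sub>M borel))"

locale point_process = prob_space M for M :: "'w measure" +
  fixes T :: real and \<Delta> :: "'e::topological_space"
    and S :: "nat \<Rightarrow> 'w \<Rightarrow> ennreal" and X :: "nat \<Rightarrow> 'w \<Rightarrow> 'e" and F :: "ennreal \<Rightarrow> 'w measure"
  assumes T_pos: "0 < T"
    and mpp: "multivariate_point_process M T \<Delta> S X"
    and gen: "generated_filtration (space M) S X F"
begin

abbreviation "\<Omega> \<equiv> space M"
abbreviation "H \<equiv> history \<Omega> S X"

sublocale filtered_space \<Omega> F T
  using gen T_pos by (simp add: generated_filtration_def adapts_points_def filtered_space_def filtered_space_axioms_def)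

lemma S_0: "w \<in> \<Omega> \<Longrightarrow> S 0 w = 0"
  using mpp by (auto simp: multivariate_point_process_def)

lemma S_Suc: "w \<in> \<Omega> \<Longrightarrow> S n w \<le> S (Suc n) w"
  using mpp by (simp only: multivariate_point_process_def)

lemma S_less: "w \<in> \<Omega> \<Longrightarrow> S n w \<le> ennreal T \<Longrightarrow> S n w < S (Suc n) w"
  using mpp by (simp only: multivariate_point_process_def)

lemma S_measurable_M: "S n \<in> borel_measurable M"
  using mpp by (simp only: multivariate_point_process_def)

lemma X_measurable_M: "1 \<le> n \<Longrightarrow> X n \<in> borel_measurable M"
  using mpp by (simp only: multivariate_point_process_def)

lemma S_mono: "w \<in> \<Omega> \<Longrightarrow> i \<le> j \<Longrightarrow> S i w \<le> S j w"
  using S_Suc by (induction j rule: nat_induct) (auto simp: le_Suc_eq intro: order_trans)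

lemma S_strict: assumes "w \<in> \<Omega>" "i < j" "S i w \<le> ennreal T" shows "S i w < S j w"
  using S_less[OF assms(1,3)] S_mono[OF assms(1), of "Suc i" j] assms(2) by auto

lemma stopping_time_S: "stopping_time F (S n)"
proof (cases "n = 0")
  case True
  have "stopping_time F (S 0) \<longleftrightarrow> stopping_time F (\<lambda>_. 0)"
    by (rule stopping_time_cong) (auto simp: space_F S_0)
  then show ?thesis using True stopping_time_const by simp
next
  case False then show ?thesis using gen by (auto simp: generated_filtration_def adapts_points_def)
qed

lemma X_pre_sigma: "1 \<le> n \<Longrightarrow> X n \<in> borel_measurable (pre_sigma (S n))"
  using gen by (auto simp: generated_filtration_def adapts_points_def)

lemma generated_minimal: "adapts_points \<Omega> S X G \<Longrightarrow> sets (F t) \<subseteq> sets (G t)"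
  using gen by (auto simp: generated_filtration_def)

lemma F_subset_M: "sets (F t) \<subseteq> sets M"
proof (rule generated_minimal)
  interpret M: filtration \<Omega> "\<lambda>_::ennreal. M" by standard auto
  have st: "stopping_time (\<lambda>_. M) (S n)" for n
    using S_measurable_M by (intro stopping_timeI) measurable
  have "sets M \<subseteq> sets (M.pre_sigma (S n))" for n
  proof
    fix B assume [measurable]: "B \<in> sets M"
    note [measurable] = S_measurable_M
    have "{w \<in> B. S n w \<le> t} = B \<inter> {w \<in> space M. S n w \<le> t}" for t
      using sets.sets_into_space[of B M] by auto
    then show "B \<in> sets (M.pre_sigma (S n))" by (intro M.sets_pre_sigmaI[OF st]) simp
  qed
  then have "X n \<in> borel_measurable (M.pre_sigma (S n))" if "1 \<le> n" for n
    using X_measurable_M[OF that] by (auto simp: measurable_def M.space_pre_sigma)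
  then show "adapts_points \<Omega> S X (\<lambda>_. M)"
    using st M.filtration_axioms by (simp add: adapts_points_def)
qed

lemma F_measurable_M: "f \<in> F t \<rightarrow>\<^sub>M N \<Longrightarrow> f \<in> M \<rightarrow>\<^sub>M N"
  using F_subset_M by (auto simp: measurable_def space_F)

lemma pre_sigma_subset_M: "sets (pre_sigma (S n)) \<subseteq> sets M"
proof
  fix B assume B: "B \<in> sets (pre_sigma (S n))"
  then have "{w \<in> B. S n w \<le> \<top>} \<in> sets (F \<top>)" by (rule sets_pre_sigmaD[OF stopping_time_S])
  then show "B \<in> sets M" using F_subset_M by auto
qed

lemma space_H [simp]: "space (H n) = \<Omega>"
  by (cases n) simp_all

lemma sets_H_Suc: "sets (H (Suc n)) =
    {(\<lambda>w. (w, S (Suc n) w, X (Suc n) w)) -` Q \<inter> \<Omega> | Q. Q \<in> sets (H n \<Otimes>\<^sub>M (borel \<Otimes>\<^sub>M borel))}"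
  by (simp, subst sets_vimage_algebra2) (auto simp: space_pair_measure)

lemma point_measurable_H: "(\<lambda>w. (w, S (Suc n) w, X (Suc n) w)) \<in> H (Suc n) \<rightarrow>\<^sub>M H n \<Otimes>\<^sub>M (borel \<Otimes>\<^sub>M borel)"
  by (simp, rule measurable_vimage_algebra1) (auto simp: space_pair_measure)

lemma H_Suc: "sets (H n) \<subseteq> sets (H (Suc n))"
proof
  fix B assume B: "B \<in> sets (H n)"
  then have "B \<subseteq> \<Omega>" using sets.sets_into_space[of B "H n"] by simp
  have "(\<lambda>w. w) \<in> H (Suc n) \<rightarrow>\<^sub>M H n"
    using measurable_compose[OF point_measurable_H measurable_fst] by simp
  from measurable_sets[OF this B] show "B \<in> sets (H (Suc n))"
    using \<open>B \<subseteq> \<Omega>\<close> by (simp add: Int_absorb2)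
qed

lemma H_mono: "i \<le> j \<Longrightarrow> sets (H i) \<subseteq> sets (H j)"
  using H_Suc by (rule lift_Suc_mono_le)

lemma S_H: "k \<le> n \<Longrightarrow> S k \<in> borel_measurable (H n)"
proof (cases k)
  case 0
  then show ?thesis using S_0 by (auto intro: measurable_cong[THEN iffD2, OF _ measurable_const[of 0]])
next
  case (Suc j)
  assume "k \<le> n"
  have "S k \<in> borel_measurable (H k)"
    using measurable_compose[OF measurable_compose[OF point_measurable_H measurable_snd] measurable_fst] Suc by simp
  then show ?thesis using H_mono[OF \<open>k \<le> n\<close>] by (auto simp: measurable_def)
qed

lemma X_H: "1 \<le> k \<Longrightarrow> k \<le> n \<Longrightarrow> X k \<in> borel_measurable (H n)"
proof (cases k)
  case (Suc j)
  assume "k \<le> n"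
  have "X k \<in> borel_measurable (H k)"
    using measurable_compose[OF measurable_compose[OF point_measurable_H measurable_snd] measurable_snd] Suc by simp
  then show ?thesis using H_mono[OF \<open>k \<le> n\<close>] by (auto simp: measurable_def)
qed simp

lemma H_pre_sigma: "sets (H n) \<subseteq> sets (pre_sigma (S n))"
proof (induction n)
  case 0
  have "sigma_sets \<Omega> {} = {{}, \<Omega>}" by (rule sigma_sets_empty_eq)
  then show ?case using sets.top[of "pre_sigma (S 0)"] by (simp add: space_pre_sigma)
next
  case (Suc n)
  have "sets (H n) \<subseteq> sets (pre_sigma (S (Suc n)))"
    using Suc mono_pre_sigma[OF stopping_time_S stopping_time_S S_Suc] by blast
  then have "(\<lambda>w. w) \<in> pre_sigma (S (Suc n)) \<rightarrow>\<^sub>M H n"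
    using sets.sets_into_space[of _ "H n"] by (auto intro!: measurableI simp: space_pre_sigma Int_absorb2)
  then have *: "(\<lambda>w. (w, S (Suc n) w, X (Suc n) w)) \<in> pre_sigma (S (Suc n)) \<rightarrow>\<^sub>M H n \<Otimes>\<^sub>M (borel \<Otimes>\<^sub>M borel)"
    using measurable_stopping_time_pre_sigma[OF stopping_time_S, of "Suc n"] X_pre_sigma[of "Suc n"]
    by (intro measurable_Pair) auto
  show ?case
    unfolding sets_H_Suc using measurable_sets[OF *] by (auto simp: space_pre_sigma)
qed

lemma H_measurable_pre_sigma: "f \<in> H n \<rightarrow>\<^sub>M N \<Longrightarrow> f \<in> pre_sigma (S n) \<rightarrow>\<^sub>M N"
  using H_pre_sigma by (auto simp: measurable_def space_pre_sigma)

definition "gap n t = {w \<in> \<Omega>. S n w \<le> t \<and> t < S (Suc n) w}"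

lemma gap_exists: "w \<in> \<Omega> \<Longrightarrow> t < S (Suc n) w \<Longrightarrow> \<exists>j\<le>n. w \<in> gap j t"
proof (induction n)
  case 0 then show ?case using S_0 by (auto simp: gap_def)
next
  case (Suc n) then show ?case by (cases "t < S (Suc n) w") (auto simp: gap_def intro: le_SucI)
qed

definition "trace_events t = {B. B \<subseteq> \<Omega> \<and> (\<forall>n. \<exists>C\<in>sets (H n). B \<inter> gap n t = C \<inter> gap n t)}"

lemma sigma_algebra_trace_events: "sigma_algebra \<Omega> (trace_events t)"
  unfolding sigma_algebra_iff2
proof (intro conjI ballI allI impI)
  show "trace_events t \<subseteq> Pow \<Omega>" by (auto simp: trace_events_def)
  show "{} \<in> trace_events t" by (auto simp: trace_events_def intro!: bexI[of _ "{}"])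
next
  fix B assume B: "B \<in> trace_events t"
  show "\<Omega> - B \<in> trace_events t"
    unfolding trace_events_def
  proof (intro CollectI conjI allI)
    fix n
    obtain C where "C \<in> sets (H n)" "B \<inter> gap n t = C \<inter> gap n t" using B unfolding trace_events_def by blast
    then show "\<exists>C\<in>sets (H n). (\<Omega> - B) \<inter> gap n t = C \<inter> gap n t"
      using sets.compl_sets[of C "H n"] by (intro bexI[of _ "\<Omega> - C"]) auto
  qed auto
next
  fix B :: "nat \<Rightarrow> 'w set" assume B: "range B \<subseteq> trace_events t"
  show "(\<Union>i. B i) \<in> trace_events t"
    unfolding trace_events_def
  proof (intro CollectI conjI allI)
    show "(\<Union>i. B i) \<subseteq> \<Omega>" using B by (auto simp: trace_events_def)
    fix n
    have "\<exists>C. C \<in> sets (H n) \<and> B i \<inter> gap n t = C \<inter> gap n t" for i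
    proof -
      have "B i \<in> trace_events t" using B by auto
      then show ?thesis unfolding trace_events_def by blast
    qed
    then have "\<exists>C. \<forall>i. C i \<in> sets (H n) \<and> B i \<inter> gap n t = C i \<inter> gap n t" by (intro choice allI)
    then obtain C where C: "\<And>i. C i \<in> sets (H n)" "\<And>i. B i \<inter> gap n t = C i \<inter> gap n t" by blast
    show "\<exists>C\<in>sets (H n). (\<Union>i. B i) \<inter> gap n t = C \<inter> gap n t"
    proof (rule bexI)
      show "(\<Union>i. B i) \<inter> gap n t = (\<Union>i. C i) \<inter> gap n t"
        unfolding Int_UN_distrib2[symmetric] using C(2) by (simp only: Int_commute[of _ "gap n t"] Int_UN_distrib)
      show "(\<Union>i. C i) \<in> sets (H n)" using C(1) by (intro sets.countable_UN) auto
    qed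
  qed
qed

lemma sets_trace: "sets (sigma \<Omega> (trace_events t)) = trace_events t"
  by (rule sigma_algebra.sets_measure_of_eq[OF sigma_algebra_trace_events])

text \<open>
  While no further point arrives, nothing new is learnt: on \<open>{S n \<le> t < S (n + 1)}\<close> every event of
  \<open>F t\<close> is an event of the first \<open>n\<close> points. Indeed the events with this property for all \<open>n\<close> form a
  filtration that makes the points adapted, and the generated filtration is the smallest one.
\<close>

lemma F_subset_trace: "sets (F t) \<subseteq> trace_events t"
proof -
  let ?G = "\<lambda>t. sigma \<Omega> (trace_events t)"
  interpret G: filtration \<Omega> ?G
  proof
    show "space (?G t) = \<Omega>" for t by (rule space_measure_of) (auto simp: trace_events_def)
    fix s t :: ennreal assume st: "s \<le> t"
    have "B \<in> trace_events t" if B: "B \<in> trace_events s" for B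
      unfolding trace_events_def
    proof (intro CollectI conjI allI)
      show "B \<subseteq> \<Omega>" using B by (auto simp: trace_events_def)
      fix n
      obtain C where C: "\<And>j. C j \<in> sets (H j)" "\<And>j. B \<inter> gap j s = C j \<inter> gap j s"
        using B unfolding trace_events_def by (auto, metis)
      let ?C = "(\<Union>j<n. C j \<inter> {w \<in> \<Omega>. S j w \<le> s \<and> s < S (Suc j) w}) \<union> C n \<inter> {w \<in> \<Omega>. S n w \<le> s}"
      have "{w \<in> \<Omega>. S j w \<le> s} \<in> sets (H n)" if "j \<le> n" for j
        using borel_measurable_le[OF S_H[OF that] measurable_const[of s]] by simp
      moreover have "{w \<in> \<Omega>. s < S (Suc j) w} \<in> sets (H n)" if "j < n" for j
        using borel_measurable_less[OF measurable_const[of s] S_H[of "Suc j" n]] that by simp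
      moreover have "C j \<in> sets (H n)" if "j \<le> n" for j using C(1)[of j] H_mono[OF that] by auto
      moreover have "{w \<in> \<Omega>. S j w \<le> s \<and> s < S (Suc j) w} = {w \<in> \<Omega>. S j w \<le> s} \<inter> {w \<in> \<Omega>. s < S (Suc j) w}" for j
        by auto
      ultimately have "?C \<in> sets (H n)" by (auto intro!: sets.Un sets.finite_UN sets.Int)
      moreover have "B \<inter> gap n t = ?C \<inter> gap n t"
      proof (intro set_eqI iffI)
        fix w assume w: "w \<in> B \<inter> gap n t"
        then have "w \<in> \<Omega>" "s < S (Suc n) w" using st by (auto simp: gap_def)
        from gap_exists[OF this] obtain j where j: "j \<le> n" "w \<in> gap j s" by auto
        then have "w \<in> C j" using C(2)[of j] w by blast
        then show "w \<in> ?C \<inter> gap n t" using j w by (cases "j = n") (auto simp: gap_def)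
      next
        fix w assume w: "w \<in> ?C \<inter> gap n t"
        then obtain j where "w \<in> C j" "w \<in> gap j s" using st by (auto simp: gap_def)
        then show "w \<in> B \<inter> gap n t" using C(2)[of j] w by blast
      qed
      ultimately show "\<exists>C\<in>sets (H n). B \<inter> gap n t = C \<inter> gap n t" by blast
    qed
    then show "sets (?G s) \<le> sets (?G t)" unfolding sets_trace by auto
  qed
  have st: "stopping_time ?G (S k)" for k
  proof (rule stopping_timeI, unfold pred_def sets_trace G.space_F)
    fix t show "{w \<in> \<Omega>. S k w \<le> t} \<in> trace_events t"
      unfolding trace_events_def
    proof (intro CollectI conjI allI)
      fix n show "\<exists>C\<in>sets (H n). {w \<in> \<Omega>. S k w \<le> t} \<inter> gap n t = C \<inter> gap n t"
      proof (cases "k \<le> n")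
        case True
        then show ?thesis using S_mono[OF _ True] sets.top[of "H n"]
          by (intro bexI[of _ \<Omega>]) (auto simp: gap_def intro: order_trans)
      next
        case False
        then have "Suc n \<le> k" by simp
        have "\<not> S k w \<le> t" if "w \<in> gap n t" for w
          using S_mono[OF _ \<open>Suc n \<le> k\<close>, of w] that unfolding gap_def not_le by (blast intro: less_le_trans)
        then show ?thesis by (intro bexI[of _ "{}"]) auto
      qed
    qed auto
  qed
  have "X k \<in> borel_measurable (G.pre_sigma (S k))" if k: "1 \<le> k" for k
  proof (rule measurableI)
    fix B :: "'e set" assume B: "B \<in> sets borel"
    show "X k -` B \<inter> space (G.pre_sigma (S k)) \<in> sets (G.pre_sigma (S k))"
    proof (rule G.sets_pre_sigmaI[OF st], unfold sets_trace G.space_pre_sigma)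
      fix t show "{w \<in> X k -` B \<inter> \<Omega>. S k w \<le> t} \<in> trace_events t"
        unfolding trace_events_def
      proof (intro CollectI conjI allI)
        fix n show "\<exists>C\<in>sets (H n). {w \<in> X k -` B \<inter> \<Omega>. S k w \<le> t} \<inter> gap n t = C \<inter> gap n t"
        proof (cases "k \<le> n")
          case True
          then show ?thesis using S_mono[OF _ True] measurable_sets[OF X_H[OF k True] B]
            by (intro bexI[of _ "X k -` B \<inter> \<Omega>"]) (auto simp: gap_def intro: order_trans)
        next
          case False
          then have "Suc n \<le> k" by simp
          have "\<not> S k w \<le> t" if "w \<in> gap n t" for w
            using S_mono[OF _ \<open>Suc n \<le> k\<close>, of w] that unfolding gap_def not_le by (blast intro: less_le_trans)
          then show ?thesis by (intro bexI[of _ "{}"]) auto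
        qed
      qed auto
    qed
  qed auto
  then have "adapts_points \<Omega> S X ?G"
    using st G.filtration_axioms by (simp add: adapts_points_def)
  from generated_minimal[OF this, of t] show ?thesis by (simp only: sets_trace)
qed

text \<open>
  The sets \<open>{g \<le> q}\<close> are trace events, so that \<open>g\<close> factors through the history on the gap.
\<close>

lemma trace_function:
  fixes g :: "'w \<Rightarrow> real"
  assumes g: "g \<in> borel_measurable (F t)"
  obtains h where "h \<in> borel_measurable (H n)" "\<And>w. w \<in> gap n t \<Longrightarrow> g w = h w"
proof (rule measurable_factor[of "H n" "gap n t" g "\<lambda>w. w"])
  fix q :: rat
  have "{w \<in> space (F t). g w \<le> of_rat q} \<in> sets (F t)" using g by measurable
  then have "{w \<in> \<Omega>. g w \<le> of_rat q} \<in> trace_events t" using F_subset_trace by (auto simp: space_F)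
  then obtain C where "C \<in> sets (H n)" "{w \<in> \<Omega>. g w \<le> of_rat q} \<inter> gap n t = C \<inter> gap n t"
    unfolding trace_events_def by blast
  then show "\<exists>Q\<in>sets (H n). \<forall>w\<in>gap n t. (g w \<le> real_of_rat q) = (w \<in> Q)"
    by (intro bexI[of _ C]) (auto simp: gap_def)
qed (rule that)

lemma next_point_function:
  fixes c :: "'w \<Rightarrow> real"
  assumes c: "c \<in> borel_measurable (H (Suc n))"
  obtains r where "r \<in> borel_measurable (H n \<Otimes>\<^sub>M (borel \<Otimes>\<^sub>M borel))"
    "\<And>w. w \<in> \<Omega> \<Longrightarrow> c w = r (w, S (Suc n) w, X (Suc n) w)"
proof (rule measurable_factor[of "H n \<Otimes>\<^sub>M (borel \<Otimes>\<^sub>M borel)" \<Omega> c "\<lambda>w. (w, S (Suc n) w, X (Suc n) w)"])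
  fix q :: rat
  have "{w \<in> space (H (Suc n)). c w \<le> of_rat q} \<in> sets (H (Suc n))" using c by measurable
  then have "{w \<in> \<Omega>. c w \<le> of_rat q} \<in> sets (H (Suc n))" by (simp only: space_H)
  then obtain Q where "Q \<in> sets (H n \<Otimes>\<^sub>M (borel \<Otimes>\<^sub>M borel))"
    "{w \<in> \<Omega>. c w \<le> of_rat q} = (\<lambda>w. (w, S (Suc n) w, X (Suc n) w)) -` Q \<inter> \<Omega>"
    unfolding sets_H_Suc by auto
  then show "\<exists>Q\<in>sets (H n \<Otimes>\<^sub>M (borel \<Otimes>\<^sub>M borel)). \<forall>w\<in>\<Omega>. (c w \<le> real_of_rat q) = ((w, S (Suc n) w, X (Suc n) w) \<in> Q)"
    by (intro bexI[of _ Q]) auto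
qed (rule that)

end

section \<open>Integral equations driven by a continuous increasing process\<close>

locale continuous_process = increasing_process +
  assumes A_cont: "w \<in> \<Omega> \<Longrightarrow> continuous_on {0..T} (A w)"
begin

lemma continuous_A_path: "w \<in> \<Omega> \<Longrightarrow> continuous_increasing_path T (A w)"
  using A_path A_cont by (simp add: continuous_increasing_path_def continuous_increasing_path_axioms_def)

lemma A_section_measurable: "w \<in> \<Omega> \<Longrightarrow> A w \<in> borel_measurable (restrict_space borel {0..T})"
  using PRE_section[OF A_predictable] by simp

lemma forward_equation:
  fixes h :: "('a \<times> real) \<times> real \<Rightarrow> real"
  assumes h: "h \<in> borel_measurable (PRE \<Otimes>\<^sub>M borel)" and K: "0 \<le> K"
    and lipschitz: "\<And>w s v v'. w \<in> \<Omega> \<Longrightarrow> s \<in> {0..T} \<Longrightarrow> \<bar>h ((w, s), v) - h ((w, s), v')\<bar> \<le> K * \<bar>v - v'\<bar>"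
    and h0: "\<And>w. w \<in> \<Omega> \<Longrightarrow> integrable (dA w) (\<lambda>s. h ((w, s), 0))"
    and \<eta>: "\<eta> \<in> borel_measurable PRE" "\<And>w t. w \<in> \<Omega> \<Longrightarrow> t \<in> {0..T} \<Longrightarrow> \<bar>\<eta> (w, t)\<bar> \<le> b w"
  obtains y B where "y \<in> borel_measurable PRE"
    "\<And>w t. w \<in> \<Omega> \<Longrightarrow> t \<in> {0..T} \<Longrightarrow> \<bar>y (w, t)\<bar> \<le> B w"
    "\<And>w. w \<in> \<Omega> \<Longrightarrow> integrable (dA w) (\<lambda>s. h ((w, s), y (w, s)))"
    "\<And>w t. w \<in> \<Omega> \<Longrightarrow> t \<in> {0..T} \<Longrightarrow> y (w, t) = \<eta> (w, t) + (LINT s:{0<..t}|dA w. h ((w, s), y (w, s)))"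
proof (rule random_integral_equation[of PRE \<Omega> T dA "\<lambda>t. {0<..t}" h K "\<lambda>w t. exp (2 * K * A w t)" "\<lambda>w. exp (2 * K * A w T)" \<eta> b])
  show "Pair w \<in> restrict_space borel {0..T} \<rightarrow>\<^sub>M PRE" if "w \<in> \<Omega>" for w using Pair_measurable_PRE[OF that] .
  show "(\<lambda>(w, t). LINT s:{0<..t}|dA w. k (w, s)) \<in> borel_measurable PRE" if "k \<in> borel_measurable PRE" for k :: "'a \<times> real \<Rightarrow> real"
    using integral_process[OF that] .
  show "1 \<le> exp (2 * K * A w t) \<and> exp (2 * K * A w t) \<le> exp (2 * K * A w T)" if "w \<in> \<Omega>" "t \<in> {0..T}" for w t
    using that K A_nonneg[of w t] A_le[of w t T] by (auto intro!: mult_left_mono mult_nonneg_nonneg)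
  show "(\<lambda>t. exp (2 * K * A w t)) \<in> borel_measurable (restrict_space borel {0..T})" if "w \<in> \<Omega>" for w
    using A_section_measurable[OF that] by measurable
  show "ennreal K * (\<integral>\<^sup>+s\<in>{0<..t}. ennreal (exp (2 * K * A w s)) \<partial>dA w) \<le> ennreal (exp (2 * K * A w t) / 2)"
    if "w \<in> \<Omega>" "t \<in> {0..T}" for w t
    using continuous_increasing_path.exp_forward_weight[OF continuous_A_path[OF that(1)] K, of 0 t] that by auto
qed (use assms finite_dA sets_dA in \<open>auto simp: sets_restrict_space_iff\<close>)

text \<open>
  Every \<open>F T\<close>-measurable function of \<open>w\<close> is predictable for the filtration that is constantly
  \<open>F T\<close>. This makes the results on predictable integral processes available for equations that are
  solved backwards from time \<open>T\<close>.
\<close>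

lemma backward_equation:
  fixes h :: "('a \<times> real) \<times> real \<Rightarrow> real"
  assumes h: "h \<in> borel_measurable (PRE \<Otimes>\<^sub>M borel)" and K: "0 \<le> K"
    and lipschitz: "\<And>w s v v'. w \<in> \<Omega> \<Longrightarrow> s \<in> {0..T} \<Longrightarrow> \<bar>h ((w, s), v) - h ((w, s), v')\<bar> \<le> K * \<bar>v - v'\<bar>"
    and h0: "\<And>w. w \<in> \<Omega> \<Longrightarrow> integrable (dA w) (\<lambda>s. h ((w, s), 0))"
    and \<xi>: "\<xi> \<in> borel_measurable (F (ennreal T))"
    and \<sigma>: "\<sigma> \<in> borel_measurable (F (ennreal T))" "\<And>w. w \<in> \<Omega> \<Longrightarrow> \<sigma> w \<in> {0..T}"
  obtains y :: "'a \<times> real \<Rightarrow> real" and B where "(\<lambda>w. y (w, \<sigma> w)) \<in> borel_measurable (F (ennreal T))"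
    "\<And>w t. w \<in> \<Omega> \<Longrightarrow> t \<in> {0..T} \<Longrightarrow> \<bar>y (w, t)\<bar> \<le> B w"
    "\<And>w. w \<in> \<Omega> \<Longrightarrow> integrable (dA w) (\<lambda>s. h ((w, s), y (w, s)))"
    "\<And>w t. w \<in> \<Omega> \<Longrightarrow> t \<in> {0..T} \<Longrightarrow> y (w, t) = \<xi> w + (LINT s:{t<..T}|dA w. h ((w, s), y (w, s)))"
proof -
  let ?F = "\<lambda>_::ennreal. F (ennreal T)"
  let ?Q = "predictable_sigma \<Omega> ?F T"
  interpret C: filtered_space \<Omega> ?F T
    using T_pos by unfold_locales (auto simp: space_F)
  have FT: "B \<in> sets (F (ennreal s)) \<Longrightarrow> s \<le> T \<Longrightarrow> B \<in> sets (F (ennreal T))" for B s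
    by (auto elim: F_mono intro: ennreal_leI)
  have id: "(\<lambda>x. x) \<in> ?Q \<rightarrow>\<^sub>M PRE"
    unfolding PRE_eq
  proof (rule measurable_measure_of[OF rectangles_subset])
    fix R assume R: "R \<in> rectangles"
    have "R \<in> C.rectangles"
      using R FT F_mono[of _ 0 "ennreal T"] unfolding rectangles_def C.rectangles_def by fastforce
    then show "(\<lambda>x. x) -` R \<inter> space ?Q \<in> sets ?Q"
      unfolding C.sets_PRE using C.rectangles_subset by (auto simp: Int_absorb2 intro: sigma_sets.Basic)
  qed auto
  have trans: "k \<in> ?Q \<rightarrow>\<^sub>M N" if "k \<in> PRE \<rightarrow>\<^sub>M N" for k :: "_ \<Rightarrow> real" and N
    using measurable_compose[OF id that] .
  interpret C: increasing_process \<Omega> ?F T A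
    by (intro increasing_process.intro increasing_process_axioms.intro C.filtered_space_axioms A_path trans[OF A_predictable])
  have hQ: "h \<in> borel_measurable (?Q \<Otimes>\<^sub>M borel)"
  proof -
    have "(\<lambda>z. (fst z, snd z)) \<in> ?Q \<Otimes>\<^sub>M borel \<rightarrow>\<^sub>M PRE \<Otimes>\<^sub>M (borel :: real measure)"
      by (intro measurable_Pair measurable_compose[OF measurable_fst id] measurable_snd)
    from measurable_compose[OF this h] show ?thesis by simp
  qed
  have const: "(\<lambda>x. g (fst x)) \<in> borel_measurable ?Q" if g: "g \<in> borel_measurable (F (ennreal T))" for g :: "'a \<Rightarrow> real"
  proof -
    have "(\<lambda>x. if 0 < snd x then g (fst x) else 0) \<in> borel_measurable ?Q"
      using g by (intro C.after_const_measurable) auto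
    moreover have "(\<lambda>x. if 0 < snd x then 0 else g (fst x)) \<in> borel_measurable ?Q"
    proof (rule borel_measurableI_le)
      fix c
      have "{x \<in> space ?Q. (if 0 < snd x then 0 else g (fst x)) \<le> c}
        = {w \<in> space (F (ennreal T)). g w \<le> c} \<times> {0} \<union> (if 0 \<le> c then \<Omega> \<times> {0<..T} else {})"
        using T_pos by (auto simp: space_F)
      moreover have "{w \<in> space (F (ennreal T)). g w \<le> c} \<in> sets (F (ennreal T))" using g by measurable
      ultimately show "{x \<in> space ?Q. (if 0 < snd x then 0 else g (fst x)) \<le> c} \<in> sets ?Q"
        using C.PRE_Ioc[of \<Omega> 0 T] C.PRE_zero sets.top[of "F (ennreal T)"] by (auto simp: space_F)
    qed
    ultimately have "(\<lambda>x. (if 0 < snd x then g (fst x) else 0) + (if 0 < snd x then 0 else g (fst x))) \<in> borel_measurable ?Q"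
      by (rule borel_measurable_add)
    also have "(\<lambda>x. (if 0 < snd x then g (fst x) else 0) + (if 0 < snd x then 0 else g (fst x))) = (\<lambda>x. g (fst x))" by auto
    finally show ?thesis .
  qed
  have eval: "(\<lambda>w. (w, \<sigma> w)) \<in> F (ennreal T) \<rightarrow>\<^sub>M ?Q"
    unfolding C.PRE_eq
  proof (rule measurable_measure_of[OF C.rectangles_subset])
    show "(\<lambda>w. (w, \<sigma> w)) \<in> space (F (ennreal T)) \<rightarrow> \<Omega> \<times> {0..T}" using \<sigma>(2) by (auto simp: space_F)
    fix R assume "R \<in> C.rectangles"
    then obtain D E where R: "R = D \<times> E" "D \<in> sets (F (ennreal T))" "E \<in> sets borel" by (auto simp: C.rectangles_def)
    have "(\<lambda>w. (w, \<sigma> w)) -` R \<inter> space (F (ennreal T)) = D \<inter> (\<sigma> -` E \<inter> space (F (ennreal T)))"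
      using R by auto
    then show "(\<lambda>w. (w, \<sigma> w)) -` R \<inter> space (F (ennreal T)) \<in> sets (F (ennreal T))"
      using R \<sigma>(1) by (auto intro!: sets.Int measurable_sets)
  qed
  have clos: "(\<lambda>(w, t). LINT s:{t<..T}|dA w. k (w, s)) \<in> borel_measurable ?Q"
    if k: "k \<in> borel_measurable ?Q" "\<And>w. w \<in> \<Omega> \<Longrightarrow> integrable (dA w) (\<lambda>s. k (w, s))" for k :: "'a \<times> real \<Rightarrow> real"
  proof -
    let ?I = "\<lambda>(w, t). LINT s:{0<..t}|dA w. k (w, s)"
    have I: "?I \<in> borel_measurable ?Q" by (rule C.integral_process[OF k(1)])
    have "(\<lambda>w. ?I (w, T)) \<in> borel_measurable (F (ennreal T))"
      using C.PRE_slice[OF I, of T] T_pos by simp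
    then have "(\<lambda>x. ?I (fst x, T) - ?I x) \<in> borel_measurable ?Q"
      using const[of "\<lambda>w. ?I (w, T)"] I by (intro borel_measurable_diff) auto
    then show ?thesis
    proof (rule measurable_cong[THEN iffD1, rotated])
      fix x assume "x \<in> space ?Q"
      then obtain w t where x: "x = (w, t)" "w \<in> \<Omega>" "0 \<le> t" "t \<le> T" by auto
      have "set_integrable (dA w) {0<..t} (\<lambda>s. k (w, s))" "set_integrable (dA w) {t<..T} (\<lambda>s. k (w, s))"
        using x k(2)[of w] Ioc_dA[OF x(2), of 0 t] Ioc_dA[OF x(2), of t T]
        unfolding set_integrable_def by (auto intro!: integrable_mult_indicator simp del: real_scaleR_def)
      then have "(LINT s:{0<..t} \<union> {t<..T}|dA w. k (w, s)) = (LINT s:{0<..t}|dA w. k (w, s)) + (LINT s:{t<..T}|dA w. k (w, s))"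
        by (intro set_integral_Un) auto
      moreover have "{0<..t} \<union> {t<..T} = {0<..T}" using x by auto
      ultimately show "?I (fst x, T) - ?I x = (case x of (w, t) \<Rightarrow> LINT s:{t<..T}|dA w. k (w, s))"
        by (simp add: x)
    qed
  qed
  obtain y B where y: "y \<in> borel_measurable ?Q"
    "\<And>w t. w \<in> \<Omega> \<Longrightarrow> t \<in> {0..T} \<Longrightarrow> \<bar>y (w, t)\<bar> \<le> B w"
    "\<And>w. w \<in> \<Omega> \<Longrightarrow> integrable (dA w) (\<lambda>s. h ((w, s), y (w, s)))"
    "\<And>w t. w \<in> \<Omega> \<Longrightarrow> t \<in> {0..T} \<Longrightarrow> y (w, t) = \<xi> (fst (w, t)) + (LINT s:{t<..T}|dA w. h ((w, s), y (w, s)))"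
  proof (rule random_integral_equation[of ?Q \<Omega> T dA "\<lambda>t. {t<..T}" h K "\<lambda>w t. exp (2 * K * (A w T - A w t))"
      "\<lambda>w. exp (2 * K * A w T)" "\<lambda>x. \<xi> (fst x)" "\<lambda>w. \<bar>\<xi> w\<bar>"])
    show "Pair w \<in> restrict_space borel {0..T} \<rightarrow>\<^sub>M ?Q" if "w \<in> \<Omega>" for w using C.Pair_measurable_PRE[OF that] .
    show "1 \<le> exp (2 * K * (A w T - A w t)) \<and> exp (2 * K * (A w T - A w t)) \<le> exp (2 * K * A w T)" if "w \<in> \<Omega>" "t \<in> {0..T}" for w t
      using that K A_nonneg[of w t] A_le[of w t T] by (auto intro!: mult_left_mono mult_nonneg_nonneg)
    show "(\<lambda>t. exp (2 * K * (A w T - A w t))) \<in> borel_measurable (restrict_space borel {0..T})" if "w \<in> \<Omega>" for w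
      using A_section_measurable[OF that] by measurable
    show "ennreal K * (\<integral>\<^sup>+s\<in>{t<..T}. ennreal (exp (2 * K * (A w T - A w s))) \<partial>dA w) \<le> ennreal (exp (2 * K * (A w T - A w t)) / 2)"
      if "w \<in> \<Omega>" "t \<in> {0..T}" for w t
      using continuous_increasing_path.exp_backward_weight[OF continuous_A_path[OF that(1)] K, of t T] that by auto
  qed (use assms finite_dA sets_dA hQ const[OF \<xi>] clos in \<open>auto simp: sets_restrict_space_iff\<close>)
  show thesis
  proof (rule that[of y B])
    show "(\<lambda>w. y (w, \<sigma> w)) \<in> borel_measurable (F (ennreal T))"
      using measurable_compose[OF eval y(1)] .
  qed (use y in auto)
qed

end

section \<open>Integrals against the jump measure and its compensator\<close>

locale compensated_point_process = point_process M T \<Delta> S X F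
  for M :: "'w measure" and T :: real and \<Delta> :: "'e::topological_space"
    and S :: "nat \<Rightarrow> 'w \<Rightarrow> ennreal" and X :: "nat \<Rightarrow> 'w \<Rightarrow> 'e" and F :: "ennreal \<Rightarrow> 'w measure" +
  fixes A :: "'w \<Rightarrow> real \<Rightarrow> real" and \<phi> :: "'w \<Rightarrow> real \<Rightarrow> 'e measure"
  assumes compensator: "disintegrated_compensator M T S X F A \<phi>"
begin

sublocale increasing_process \<Omega> F T A
  using compensator T_pos filtered_space_axioms
  by (auto simp: disintegrated_compensator_def increasing_path_def increasing_process_def increasing_process_axioms_def)

abbreviation "\<mu> \<equiv> jump_measure T S X"
abbreviation "\<nu> \<equiv> disintegrated_measure T A \<phi>"

lemma \<phi>_prob_algebra: "(\<lambda>x. \<phi> (fst x) (snd x)) \<in> PRE \<rightarrow>\<^sub>M prob_algebra borel"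
  using compensator by (simp add: disintegrated_compensator_def case_prod_unfold)

lemma \<phi>_kernel: "(\<lambda>x. \<phi> (fst x) (snd x)) \<in> PRE \<rightarrow>\<^sub>M subprob_algebra borel"
  using \<phi>_prob_algebra by (rule measurable_prob_algebraD)

lemma \<phi>_prob: "w \<in> \<Omega> \<Longrightarrow> s \<in> {0..T} \<Longrightarrow> prob_space (\<phi> w s)"
  and sets_\<phi>: "w \<in> \<Omega> \<Longrightarrow> s \<in> {0..T} \<Longrightarrow> sets (\<phi> w s) = sets borel"
  using measurable_space[OF \<phi>_prob_algebra, of "(w, s)"] by (auto simp: space_prob_algebra)

lemma \<phi>_nn_integral:
  fixes G :: "_ \<Rightarrow> ennreal"
  assumes "G \<in> borel_measurable (PRE \<Otimes>\<^sub>M borel)"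
  shows "(\<lambda>x. \<integral>\<^sup>+e. G (x, e) \<partial>\<phi> (fst x) (snd x)) \<in> borel_measurable PRE"
  using assms by (intro nn_integral_measurable_subprob_algebra2[OF _ \<phi>_kernel]) simp

lemma predictable_section:
  assumes G: "G \<in> PRE \<Otimes>\<^sub>M borel \<rightarrow>\<^sub>M N" and w: "w \<in> \<Omega>"
  shows "(\<lambda>p. G ((w, fst p), snd p)) \<in> restrict_space borel {0..T} \<Otimes>\<^sub>M borel \<rightarrow>\<^sub>M N"
proof -
  have "(\<lambda>p. ((w, fst p), snd p)) \<in> restrict_space borel {0..T} \<Otimes>\<^sub>M borel \<rightarrow>\<^sub>M PRE \<Otimes>\<^sub>M borel"
    by (intro measurable_Pair measurable_compose[OF measurable_fst Pair_measurable_PRE[OF w]] measurable_snd)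
  from measurable_compose[OF this G] show ?thesis .
qed

lemma predictable_mark_section:
  assumes G: "G \<in> PRE \<Otimes>\<^sub>M borel \<rightarrow>\<^sub>M N" and w: "w \<in> \<Omega>" and s: "s \<in> {0..T}"
  shows "(\<lambda>e. G ((w, s), e)) \<in> borel \<rightarrow>\<^sub>M N"
proof -
  have "(w, s) \<in> space PRE" using w s by simp
  from measurable_compose[OF measurable_Pair1'[OF this] G] show ?thesis .
qed

lemma extend_to_real_line:
  fixes g :: "real \<times> 'e \<Rightarrow> 'b::{topological_space, zero}"
  assumes g: "g \<in> borel_measurable (restrict_space borel {0..T} \<Otimes>\<^sub>M borel)"
  shows "(\<lambda>p. if p \<in> {0..T} \<times> UNIV then g p else 0) \<in> borel_measurable (borel \<Otimes>\<^sub>M borel)"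
proof -
  let ?R = "restrict_space (borel \<Otimes>\<^sub>M borel) ({0..T} \<times> (UNIV :: 'e set))"
  have R: "{0..T} \<times> UNIV \<in> sets (borel \<Otimes>\<^sub>M (borel :: 'e measure))" by auto
  have "(\<lambda>p. (fst p, snd p)) \<in> ?R \<rightarrow>\<^sub>M restrict_space borel {0..T} \<Otimes>\<^sub>M borel"
    by (intro measurable_Pair measurable_restrict_space2 measurable_restrict_space1 measurable_fst measurable_snd)
      (auto simp: space_restrict_space)
  from measurable_compose[OF this g] have "g \<in> borel_measurable ?R" by simp
  then show ?thesis
    using R by (subst measurable_restrict_space_iff[symmetric]) auto
qed

subsection \<open>The jump measure\<close>

text \<open>
  Capping the jump times at \<open>T\<close> makes \<open>{\<sigma> n w<..\<sigma> (Suc n) w}\<close> the stretch up to the next jump or up to \<open>T\<close>,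
  whether or not a jump follows.
\<close>

definition "\<sigma> n w = enn2real (min (S n w) (ennreal T))"

lemma \<sigma>_ennreal: "ennreal (\<sigma> n w) = min (S n w) (ennreal T)"
  unfolding \<sigma>_def by (rule ennreal_enn2real) (simp add: min_less_iff_disj)

lemma \<sigma>_range: "\<sigma> n w \<in> {0..T}" "0 \<le> \<sigma> n w" "\<sigma> n w \<le> T"
proof -
  have "ennreal (\<sigma> n w) \<le> ennreal T" by (simp add: \<sigma>_ennreal)
  then have "\<sigma> n w \<le> T" using T_pos by (simp add: ennreal_le_iff)
  then show "\<sigma> n w \<in> {0..T}" "0 \<le> \<sigma> n w" "\<sigma> n w \<le> T" by (auto simp: \<sigma>_def)
qed

lemma S_eq_\<sigma>: "S n w \<le> ennreal T \<Longrightarrow> S n w = ennreal (\<sigma> n w)"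
  and \<sigma>_eq_T: "ennreal T \<le> S n w \<Longrightarrow> \<sigma> n w = T"
  using T_pos by (auto simp: \<sigma>_ennreal min_absorb1) (simp add: \<sigma>_def min_absorb2)

lemma \<sigma>_0: "w \<in> \<Omega> \<Longrightarrow> \<sigma> 0 w = 0" by (simp add: \<sigma>_def S_0)

lemma \<sigma>_mono: "w \<in> \<Omega> \<Longrightarrow> i \<le> j \<Longrightarrow> \<sigma> i w \<le> \<sigma> j w"
proof -
  assume "w \<in> \<Omega>" "i \<le> j"
  then have "ennreal (\<sigma> i w) \<le> ennreal (\<sigma> j w)"
    unfolding \<sigma>_ennreal by (intro min.mono S_mono) auto
  then show ?thesis by (simp add: ennreal_le_iff \<sigma>_range)
qed

lemma \<sigma>_less_iff: "s \<in> {0..T} \<Longrightarrow> \<sigma> n w < s \<longleftrightarrow> S n w < ennreal s"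
proof -
  assume s: "s \<in> {0..T}"
  then have "\<sigma> n w < s \<longleftrightarrow> min (S n w) (ennreal T) < ennreal s"
    by (metis \<sigma>_ennreal \<sigma>_range(2) ennreal_less_iff)
  also have "\<dots> \<longleftrightarrow> S n w < ennreal s"
    using s by (auto simp: min_less_iff_disj dest: leD[OF ennreal_leI])
  finally show ?thesis .
qed

lemma \<sigma>_le_iff: "t \<in> {0..T} \<Longrightarrow> t < T \<or> S n w \<le> ennreal T \<Longrightarrow> \<sigma> n w \<le> t \<longleftrightarrow> S n w \<le> ennreal t"
proof -
  assume t: "t \<in> {0..T}" "t < T \<or> S n w \<le> ennreal T"
  then have "\<sigma> n w \<le> t \<longleftrightarrow> min (S n w) (ennreal T) \<le> ennreal t"
    by (metis \<sigma>_ennreal atLeastAtMost_iff ennreal_le_iff)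
  also have "\<dots> \<longleftrightarrow> S n w \<le> ennreal t"
    using t by (auto simp: min_le_iff_disj ennreal_le_iff)
  finally show ?thesis .
qed

lemma \<sigma>_strict: "w \<in> \<Omega> \<Longrightarrow> S n w < ennreal T \<Longrightarrow> \<sigma> n w < \<sigma> (Suc n) w"
proof -
  assume w: "w \<in> \<Omega>" and "S n w < ennreal T"
  then have "ennreal (\<sigma> n w) < ennreal (\<sigma> (Suc n) w)"
    using S_less[OF w, of n] by (auto simp: \<sigma>_ennreal min_def)
  then show ?thesis by (simp add: ennreal_less_iff \<sigma>_range)
qed

lemma \<sigma>_F: "\<sigma> n \<in> borel_measurable (F (ennreal T))"
proof -
  have "(\<lambda>w. min (S n w) (ennreal T)) \<in> borel_measurable (F (ennreal T))"
  proof (rule borel_measurableI_le)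
    fix c
    have "{w \<in> space (F (ennreal T)). min (S n w) (ennreal T) \<le> c}
      = (if ennreal T \<le> c then space (F (ennreal T)) else {w \<in> space (F (ennreal T)). S n w \<le> c})"
      by (auto simp: min_le_iff_disj)
    then show "{w \<in> space (F (ennreal T)). min (S n w) (ennreal T) \<le> c} \<in> sets (F (ennreal T))"
      using stopping_time_le_const[OF stopping_time_S, of c "ennreal T" n] by (auto simp: pred_def)
  qed
  then show ?thesis unfolding \<sigma>_def[abs_def] by measurable
qed

definition "jumps w = {n. 1 \<le> n \<and> S n w \<le> ennreal T}"

lemma finite_jumps: assumes "w \<in> \<Omega>" shows "finite (jumps w)"
proof -
  obtain n where n: "S n w > ennreal T" using mpp assms by (auto simp: multivariate_point_process_def)
  have "jumps w \<subseteq> {..<n}"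
  proof
    fix k assume "k \<in> jumps w"
    then have "S k w < S n w" using n by (auto simp: jumps_def)
    then show "k \<in> {..<n}" using S_mono[OF assms, of n k] by (meson lessThan_iff not_le)
  qed
  then show ?thesis by (rule finite_subset) simp
qed

lemma jump_measure_eq: "\<mu> w = distr (count_space (jumps w)) (borel \<Otimes>\<^sub>M borel) (\<lambda>n. (\<sigma> n w, X n w))"
  unfolding jump_measure_def jumps_def \<sigma>_def
  by (intro distr_cong) (auto simp: min_absorb1)

lemma AE_jump_measure: "w \<in> \<Omega> \<Longrightarrow> AE p in \<mu> w. p \<in> {0..T} \<times> UNIV"
  unfolding jump_measure_eq
  by (subst AE_distr_iff) (auto intro!: AE_I2 simp: \<sigma>_range space_pair_measure)

lemma nn_integral_jump_measure:
  fixes g :: "real \<times> 'e \<Rightarrow> ennreal"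
  assumes w: "w \<in> \<Omega>" and g: "g \<in> borel_measurable (restrict_space borel {0..T} \<Otimes>\<^sub>M borel)"
  shows "(\<integral>\<^sup>+p. g p \<partial>\<mu> w) = (\<Sum>n\<in>jumps w. g (\<sigma> n w, X n w))"
proof -
  let ?g = "\<lambda>p. if p \<in> {0..T} \<times> UNIV then g p else 0"
  have "(\<integral>\<^sup>+p. g p \<partial>\<mu> w) = (\<integral>\<^sup>+p. ?g p \<partial>\<mu> w)"
    by (rule nn_integral_cong_AE) (use AE_jump_measure[OF w] in \<open>auto elim: eventually_mono\<close>)
  also have "\<dots> = (\<integral>\<^sup>+n. ?g (\<sigma> n w, X n w) \<partial>count_space (jumps w))"
    unfolding jump_measure_eq using extend_to_real_line[OF g] by (subst nn_integral_distr) (auto simp: space_pair_measure)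
  also have "\<dots> = (\<Sum>n\<in>jumps w. ?g (\<sigma> n w, X n w))"
    using finite_jumps[OF w] by (rule nn_integral_count_space_finite)
  finally show ?thesis using \<sigma>_range by simp
qed

lemma integral_jump_measure:
  fixes g :: "real \<times> 'e \<Rightarrow> real"
  assumes w: "w \<in> \<Omega>" and g: "g \<in> borel_measurable (restrict_space borel {0..T} \<Otimes>\<^sub>M borel)" and t: "0 \<le> t"
  shows "(LINT p:{t<..T} \<times> UNIV|\<mu> w. g p) = (\<Sum>n\<in>{n\<in>jumps w. t < \<sigma> n w}. g (\<sigma> n w, X n w))"
proof -
  let ?g = "\<lambda>p. indicator ({t<..T} \<times> UNIV) p *\<^sub>R (if p \<in> {0..T} \<times> UNIV then g p else 0)"
  have m: "?g \<in> borel_measurable (borel \<Otimes>\<^sub>M borel)"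
    by (intro borel_measurable_scaleR borel_measurable_indicator extend_to_real_line[OF g] pair_measureI) auto
  have "(LINT p:{t<..T} \<times> UNIV|\<mu> w. g p) = (LINT p|\<mu> w. ?g p)"
    unfolding set_lebesgue_integral_def using t by (intro Bochner_Integration.integral_cong) (auto simp: indicator_def)
  also have "\<dots> = (LINT n|count_space (jumps w). ?g (\<sigma> n w, X n w))"
    unfolding jump_measure_eq by (rule integral_distr) (simp add: space_pair_measure, rule m)
  also have "\<dots> = (\<Sum>n\<in>jumps w. ?g (\<sigma> n w, X n w))"
    using finite_jumps[OF w] by (rule lebesgue_integral_count_space_finite)
  also have "\<dots> = (\<Sum>n\<in>{n\<in>jumps w. t < \<sigma> n w}. g (\<sigma> n w, X n w))"
    using \<sigma>_range finite_jumps[OF w] by (intro sum.mono_neutral_cong_right) (auto simp: indicator_def)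
  finally show ?thesis .
qed

subsection \<open>The compensator\<close>

lemma \<nu>_kernel:
  assumes w: "w \<in> \<Omega>"
  shows "(\<lambda>t. distr (\<phi> w t) (borel \<Otimes>\<^sub>M borel) (Pair t)) \<in> dA w \<rightarrow>\<^sub>M subprob_algebra (borel \<Otimes>\<^sub>M borel)"
proof (rule measurable_distr2)
  have "(\<lambda>t. t) \<in> dA w \<rightarrow>\<^sub>M borel"
    using measurable_restrict_space1[OF measurable_ident, of "borel :: real measure" "{0..T}"] sets_dA[OF w]
    by (simp add: id_def cong: measurable_cong_sets)
  from measurable_compose[OF measurable_fst this]
  show "case_prod Pair \<in> dA w \<Otimes>\<^sub>M borel \<rightarrow>\<^sub>M borel \<Otimes>\<^sub>M borel"
    unfolding case_prod_unfold by (rule measurable_Pair[OF _ measurable_snd])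
  show "\<phi> w \<in> dA w \<rightarrow>\<^sub>M subprob_algebra borel"
    using dA_measurable[OF w \<phi>_kernel] by simp
qed

lemma nn_integral_\<nu>:
  fixes g :: "real \<times> 'e \<Rightarrow> ennreal"
  assumes w: "w \<in> \<Omega>" and g: "g \<in> borel_measurable (restrict_space borel {0..T} \<Otimes>\<^sub>M borel)"
  shows "(\<integral>\<^sup>+p. g p \<partial>\<nu> w) = (\<integral>\<^sup>+t. \<integral>\<^sup>+x. g (t, x) \<partial>\<phi> w t \<partial>dA w)"
proof -
  let ?g = "\<lambda>p. if p \<in> {0..T} \<times> UNIV then g p else 0"
  note m [measurable] = extend_to_real_line[OF g]
  have inner: "(\<integral>\<^sup>+p. f p \<partial>distr (\<phi> w t) (borel \<Otimes>\<^sub>M borel) (Pair t)) = (\<integral>\<^sup>+x. f (t, x) \<partial>\<phi> w t)"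
    if "t \<in> {0..T}" "f \<in> borel_measurable (borel \<Otimes>\<^sub>M borel)" for t and f :: "real \<times> 'e \<Rightarrow> ennreal"
    using that sets_\<phi>[OF w that(1)] by (intro nn_integral_distr) (auto cong: measurable_cong_sets)
  have "AE p in \<nu> w. p \<in> {0..T} \<times> UNIV"
    unfolding disintegrated_measure_def
  proof (subst AE_bind[OF \<nu>_kernel[OF w]])
    show "AE t in dA w. AE p in distr (\<phi> w t) (borel \<Otimes>\<^sub>M borel) (Pair t). p \<in> {0..T} \<times> UNIV"
    proof (rule AE_I2)
      fix t assume "t \<in> space (dA w)"
      then have t: "t \<in> {0..T}" using space_dA[OF w] by simp
      show "AE p in distr (\<phi> w t) (borel \<Otimes>\<^sub>M borel) (Pair t). p \<in> {0..T} \<times> UNIV"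
        using t sets_\<phi>[OF w t] by (subst AE_distr_iff) (auto cong: measurable_cong_sets)
    qed
  qed auto
  then have "(\<integral>\<^sup>+p. g p \<partial>\<nu> w) = (\<integral>\<^sup>+p. ?g p \<partial>\<nu> w)"
    by (intro nn_integral_cong_AE) (auto elim: eventually_mono)
  also have "\<dots> = (\<integral>\<^sup>+t. \<integral>\<^sup>+p. ?g p \<partial>distr (\<phi> w t) (borel \<Otimes>\<^sub>M borel) (Pair t) \<partial>dA w)"
    unfolding disintegrated_measure_def by (rule nn_integral_bind[OF m \<nu>_kernel[OF w]])
  also have "\<dots> = (\<integral>\<^sup>+t. \<integral>\<^sup>+x. g (t, x) \<partial>\<phi> w t \<partial>dA w)"
    using inner[OF _ m] by (intro nn_integral_cong) (auto simp: space_dA[OF w])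
  finally show ?thesis .
qed

lemma section_nn_integral_measurable:
  fixes g :: "real \<times> 'e \<Rightarrow> ennreal"
  assumes w: "w \<in> \<Omega>" and g: "g \<in> borel_measurable (restrict_space borel {0..T} \<Otimes>\<^sub>M borel)"
  shows "(\<lambda>t. \<integral>\<^sup>+x. g (t, x) \<partial>\<phi> w t) \<in> borel_measurable (dA w)"
proof (rule nn_integral_measurable_subprob_algebra2)
  have "sets (dA w \<Otimes>\<^sub>M borel) = sets (restrict_space borel {0..T} \<Otimes>\<^sub>M (borel :: 'e measure))"
    using sets_dA[OF w] by (intro sets_pair_measure_cong) auto
  then show "(\<lambda>(t, x). g (t, x)) \<in> borel_measurable (dA w \<Otimes>\<^sub>M borel)"
    using g by (simp cong: measurable_cong_sets)
  show "\<phi> w \<in> dA w \<rightarrow>\<^sub>M subprob_algebra borel"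
    using dA_measurable[OF w \<phi>_kernel] by simp
qed

lemma integral_\<nu>:
  fixes g :: "real \<times> 'e \<Rightarrow> real"
  assumes w: "w \<in> \<Omega>" and g: "g \<in> borel_measurable (restrict_space borel {0..T} \<Otimes>\<^sub>M borel)"
    and fin: "(\<integral>\<^sup>+t. \<integral>\<^sup>+x. ennreal \<bar>g (t, x)\<bar> \<partial>\<phi> w t \<partial>dA w) < \<infinity>"
  shows "integrable (dA w) (\<lambda>t. LINT x|\<phi> w t. g (t, x))"
    and "(LINT p|\<nu> w. (if p \<in> {0..T} \<times> UNIV then g p else 0)) = (LINT t|dA w. LINT x|\<phi> w t. g (t, x))"
proof -
  let ?g = "\<lambda>p. if p \<in> {0..T} \<times> UNIV then g p else 0"
  let ?I = "\<lambda>f t. \<integral>\<^sup>+x. ennreal (f (g (t, x))) \<partial>\<phi> w t"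
  have fm: "(\<lambda>p. ennreal (f (g p))) \<in> borel_measurable (restrict_space borel {0..T} \<Otimes>\<^sub>M borel)"
    if "f \<in> borel_measurable borel" for f :: "real \<Rightarrow> real" using that g by measurable
  have Im [measurable]: "?I f \<in> borel_measurable (dA w)" if "f \<in> borel_measurable borel" for f
    using section_nn_integral_measurable[OF w fm[OF that]] .
  have gm: "(\<lambda>x. g (t, x)) \<in> borel_measurable (\<phi> w t)" if "t \<in> {0..T}" for t
  proof -
    have "(\<lambda>x. g (t, x)) \<in> borel_measurable borel"
      by (rule measurable_compose[OF measurable_Pair1' g]) (use that in \<open>simp add: space_restrict_space\<close>)
    then show ?thesis using sets_\<phi>[OF w that] by (simp cong: measurable_cong_sets)
  qed
  have sub: "?I f t \<le> ?I abs t" if "\<And>y. f y \<le> \<bar>y\<bar>" for f t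
    using that by (intro nn_integral_mono ennreal_leI) auto
  have "AE t in dA w. ?I abs t \<noteq> \<infinity>"
    using fin Im[of abs] by (intro nn_integral_noteq_infinite) auto
  then have inner: "AE t in dA w. (LINT x|\<phi> w t. g (t, x)) = enn2real (?I id t) - enn2real (?I uminus t)
      \<and> ?I id t < \<infinity> \<and> ?I uminus t < \<infinity>"
    using AE_space
  proof eventually_elim
    case (elim t)
    then have t: "t \<in> {0..T}" using space_dA[OF w] by simp
    have "integrable (\<phi> w t) (\<lambda>x. g (t, x))"
      using gm[OF t] elim by (simp add: integrable_iff_bounded less_top)
    then show ?case
      using real_lebesgue_integral_def[of "\<phi> w t" "\<lambda>x. g (t, x)"] elim sub[of id t] sub[of uminus t]
      by (auto simp: less_top[symmetric] top_unique)
  qed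
  have part: "integrable (dA w) (\<lambda>t. enn2real (?I f t))" "(LINT t|dA w. enn2real (?I f t)) = enn2real (\<integral>\<^sup>+t. ?I f t \<partial>dA w)"
    if f: "\<And>y. f y \<le> \<bar>y\<bar>" "f \<in> borel_measurable borel" for f
  proof -
    have le: "(\<integral>\<^sup>+t. ?I f t \<partial>dA w) \<le> (\<integral>\<^sup>+t. ?I abs t \<partial>dA w)" using sub[of f, OF f(1)] by (rule nn_integral_mono)
    then have "AE t in dA w. ?I f t \<noteq> \<infinity>"
      using fin Im[OF f(2)] by (intro nn_integral_noteq_infinite) auto
    then have *: "(\<integral>\<^sup>+t. ennreal (enn2real (?I f t)) \<partial>dA w) = (\<integral>\<^sup>+t. ?I f t \<partial>dA w)"
      by (intro nn_integral_cong_AE) (auto elim!: eventually_mono simp: less_top)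
    have "(\<integral>\<^sup>+t. ?I f t \<partial>dA w) < \<infinity>" using le fin by (simp add: le_less_trans)
    with * show "integrable (dA w) (\<lambda>t. enn2real (?I f t))"
      using Im[OF f(2)] by (intro integrableI_bounded) auto
    show "(LINT t|dA w. enn2real (?I f t)) = enn2real (\<integral>\<^sup>+t. ?I f t \<partial>dA w)"
      using Im[OF f(2)] by (subst integral_eq_nn_integral) (auto simp: *)
  qed
  have lm: "(\<lambda>t. LINT x|\<phi> w t. g (t, x)) \<in> borel_measurable (dA w)"
  proof -
    have [measurable]: "\<phi> w \<in> dA w \<rightarrow>\<^sub>M subprob_algebra borel"
      using dA_measurable[OF w \<phi>_kernel] by simp
    have "(\<lambda>t. LINT p|distr (\<phi> w t) (borel \<Otimes>\<^sub>M borel) (Pair t). ?g p) \<in> borel_measurable (dA w)"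
      using measurable_compose[OF \<nu>_kernel[OF w] integral_measurable_subprob_algebra[OF extend_to_real_line[OF g]]] .
    then show ?thesis
    proof (rule measurable_cong[THEN iffD1, rotated])
      fix t assume "t \<in> space (dA w)"
      then have t: "t \<in> {0..T}" using space_dA[OF w] by simp
      have "(LINT p|distr (\<phi> w t) (borel \<Otimes>\<^sub>M borel) (Pair t). ?g p) = (LINT x|\<phi> w t. ?g (t, x))"
        using sets_\<phi>[OF w t] extend_to_real_line[OF g] by (intro integral_distr) (auto cong: measurable_cong_sets)
      then show "(LINT p|distr (\<phi> w t) (borel \<Otimes>\<^sub>M borel) (Pair t). ?g p) = (LINT x|\<phi> w t. g (t, x))"
        using t by simp
    qed
  qed
  have ae: "AE t in dA w. enn2real (?I id t) - enn2real (?I uminus t) = (LINT x|\<phi> w t. g (t, x))"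
    using inner by eventually_elim simp
  have pid: "integrable (dA w) (\<lambda>t. enn2real (?I id t))" "integrable (dA w) (\<lambda>t. enn2real (?I uminus t))"
    by (intro part; simp)+
  show "integrable (dA w) (\<lambda>t. LINT x|\<phi> w t. g (t, x))"
    using integrable_cong_AE_imp[OF Bochner_Integration.integrable_diff[OF pid] lm] ae by (simp add: eq_commute)
  have "(LINT t|dA w. LINT x|\<phi> w t. g (t, x)) = (LINT t|dA w. enn2real (?I id t) - enn2real (?I uminus t))"
    using ae lm pid by (intro integral_cong_AE) (auto simp: eq_commute)
  also have "\<dots> = enn2real (\<integral>\<^sup>+t. ?I id t \<partial>dA w) - enn2real (\<integral>\<^sup>+t. ?I uminus t \<partial>dA w)"
    using pid part(2)[of id] part(2)[of uminus] by simp
  finally have rhs: "(LINT t|dA w. LINT x|\<phi> w t. g (t, x)) = enn2real (\<integral>\<^sup>+t. ?I id t \<partial>dA w) - enn2real (\<integral>\<^sup>+t. ?I uminus t \<partial>dA w)" .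
  have N: "(\<integral>\<^sup>+p. ennreal (f (?g p)) \<partial>\<nu> w) = (\<integral>\<^sup>+t. ?I f t \<partial>dA w)" if "f \<in> borel_measurable borel" "f 0 = 0" for f
  proof -
    have "(\<lambda>p. ennreal (f (?g p))) \<in> borel_measurable (restrict_space borel {0..T} \<Otimes>\<^sub>M borel)"
    proof (rule measurable_cong[THEN iffD1, OF _ fm[OF that(1)]])
      fix p assume "p \<in> space (restrict_space borel {0..T} \<Otimes>\<^sub>M (borel :: 'e measure))"
      then show "ennreal (f (g p)) = ennreal (f (?g p))" by (auto simp: space_pair_measure space_restrict_space)
    qed
    from nn_integral_\<nu>[OF w this] show ?thesis
      by (auto intro!: nn_integral_cong simp: space_dA[OF w])
  qed
  have sets_\<nu>: "sets (\<nu> w) = sets (borel \<Otimes>\<^sub>M borel)"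
    unfolding disintegrated_measure_def using space_dA[OF w] T_pos
    by (intro sets_bind) auto
  have "integrable (\<nu> w) ?g"
  proof (rule integrableI_bounded)
    show "?g \<in> borel_measurable (\<nu> w)" using extend_to_real_line[OF g] sets_\<nu> by (simp cong: measurable_cong_sets)
    show "(\<integral>\<^sup>+p. ennreal (norm (?g p)) \<partial>\<nu> w) < \<infinity>" using N[of abs] fin by simp
  qed
  then show "(LINT p|\<nu> w. ?g p) = (LINT t|dA w. LINT x|\<phi> w t. g (t, x))"
    unfolding rhs using N[of id] N[of uminus] by (subst real_lebesgue_integral_def) auto
qed

lemma set_integral_\<nu>:
  fixes g :: "real \<times> 'e \<Rightarrow> real"
  assumes w: "w \<in> \<Omega>" and g: "g \<in> borel_measurable (restrict_space borel {0..T} \<Otimes>\<^sub>M borel)"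
    and u: "0 \<le> u"
    and fin: "(\<integral>\<^sup>+t\<in>{u<..T}. (\<integral>\<^sup>+x. ennreal \<bar>g (t, x)\<bar> \<partial>\<phi> w t) \<partial>dA w) < \<infinity>"
  shows "set_integrable (dA w) {u<..T} (\<lambda>t. LINT x|\<phi> w t. g (t, x))"
    and "(LINT p:{u<..T} \<times> UNIV|\<nu> w. g p) = (LINT t:{u<..T}|dA w. LINT x|\<phi> w t. g (t, x))"
proof -
  let ?i = "\<lambda>p. indicator ({u<..T} \<times> UNIV) p *\<^sub>R g p"
  have "{u<..T} \<times> UNIV \<in> sets (restrict_space borel {0..T} \<Otimes>\<^sub>M (borel :: 'e measure))"
    using u by (intro pair_measureI) (auto simp: sets_restrict_space_iff)
  then have m: "?i \<in> borel_measurable (restrict_space borel {0..T} \<Otimes>\<^sub>M borel)"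
    using g by (intro borel_measurable_scaleR borel_measurable_indicator)
  have i: "indicator ({u<..T} \<times> UNIV) (t, x) = (indicator {u<..T} t :: real)" for t and x :: 'e
    by (simp add: indicator_def)
  have "(\<integral>\<^sup>+t. \<integral>\<^sup>+x. ennreal \<bar>?i (t, x)\<bar> \<partial>\<phi> w t \<partial>dA w) = (\<integral>\<^sup>+t\<in>{u<..T}. (\<integral>\<^sup>+x. ennreal \<bar>g (t, x)\<bar> \<partial>\<phi> w t) \<partial>dA w)"
    unfolding i by (intro nn_integral_cong) (simp add: indicator_def)
  with fin have fin': "(\<integral>\<^sup>+t. \<integral>\<^sup>+x. ennreal \<bar>?i (t, x)\<bar> \<partial>\<phi> w t \<partial>dA w) < \<infinity>" by simp
  have e: "(LINT x|\<phi> w t. ?i (t, x)) = indicator {u<..T} t *\<^sub>R (LINT x|\<phi> w t. g (t, x))" for t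
    unfolding i by simp
  from integral_\<nu>[OF w m fin', unfolded e]
  show "set_integrable (dA w) {u<..T} (\<lambda>t. LINT x|\<phi> w t. g (t, x))"
    and "(LINT p:{u<..T} \<times> UNIV|\<nu> w. g p) = (LINT t:{u<..T}|dA w. LINT x|\<phi> w t. g (t, x))"
    unfolding set_integrable_def set_lebesgue_integral_def
  proof -
    assume "(LINT p|\<nu> w. (if p \<in> {0..T} \<times> UNIV then ?i p else 0)) = (LINT t|dA w. indicator {u<..T} t *\<^sub>R (LINT x|\<phi> w t. g (t, x)))"
    moreover have "(LINT p|\<nu> w. (if p \<in> {0..T} \<times> UNIV then ?i p else 0)) = (LINT p|\<nu> w. ?i p)"
      using u by (intro Bochner_Integration.integral_cong) (auto simp: indicator_def)
    ultimately show "(LINT p|\<nu> w. ?i p) = (LINT t|dA w. indicator {u<..T} t *\<^sub>R (LINT x|\<phi> w t. g (t, x)))" by simp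
  qed
qed

subsection \<open>The compensator formula between two consecutive jumps\<close>

definition "step n = {x \<in> space PRE. snd x \<in> {\<sigma> n (fst x)<..\<sigma> (Suc n) (fst x)}}"

lemma step_eq: "step n = after (S n) - after (S (Suc n))"
proof (intro set_eqI)
  fix x :: "'w \<times> real" obtain w s where x: "x = (w, s)" by (cases x)
  show "x \<in> step n \<longleftrightarrow> x \<in> after (S n) - after (S (Suc n))"
    using \<sigma>_less_iff[of s n w] \<sigma>_less_iff[of s "Suc n" w] unfolding step_def after_def x
    by (auto simp: not_less)
qed

lemma step_PRE [measurable]: "step n \<in> sets PRE"
  unfolding step_eq by (intro sets.Diff after_PRE stopping_time_S)

lemma nn_integral_\<nu>_measurable:
  fixes G :: "_ \<Rightarrow> ennreal"
  assumes G: "G \<in> borel_measurable PRE"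
  shows "(\<lambda>w. \<integral>\<^sup>+s. G (w, s) \<partial>dA w) \<in> borel_measurable (F (ennreal T))"
proof -
  have "(\<lambda>w. (\<lambda>(w, t). \<integral>\<^sup>+s\<in>{0<..t}. G (w, s) \<partial>dA w) (w, T)) \<in> borel_measurable (F (ennreal T))"
    by (rule PRE_slice[OF nn_integral_process[OF G]]) (use T_pos in auto)
  then show ?thesis
  proof (rule measurable_cong[THEN iffD1, rotated])
    fix w assume "w \<in> space (F (ennreal T))"
    then have w: "w \<in> \<Omega>" by (simp add: space_F)
    have "AE s in dA w. G (w, s) * indicator {0<..T} s = G (w, s)"
      using dA_pos[OF w] AE_space by eventually_elim (simp add: space_dA[OF w])
    then have "(\<integral>\<^sup>+s\<in>{0<..T}. G (w, s) \<partial>dA w) = (\<integral>\<^sup>+s. G (w, s) \<partial>dA w)"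
      by (rule nn_integral_cong_AE)
    then show "(\<lambda>(w, t). \<integral>\<^sup>+s\<in>{0<..t}. G (w, s) \<partial>dA w) (w, T) = (\<integral>\<^sup>+s. G (w, s) \<partial>dA w)" by simp
  qed
qed

text \<open>
  Cutting a predictable integrand down to \<open>{S n<..S (n + 1)}\<close> leaves at most one point of \<open>\<mu>\<close>.
\<close>

lemma step_compensator:
  fixes G :: "('w \<times> real) \<times> 'e \<Rightarrow> ennreal"
  assumes G: "G \<in> borel_measurable (PRE \<Otimes>\<^sub>M borel)"
  shows "(\<integral>\<^sup>+w. (if S (Suc n) w \<le> ennreal T then G ((w, \<sigma> (Suc n) w), X (Suc n) w) else 0) \<partial>M)
    = (\<integral>\<^sup>+w. (\<integral>\<^sup>+s\<in>{\<sigma> n w<..\<sigma> (Suc n) w}. (\<integral>\<^sup>+x. G ((w, s), x) \<partial>\<phi> w s) \<partial>dA w) \<partial>M)"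
proof -
  let ?G = "\<lambda>z. indicator (step n) (fst z) * G z"
  have m: "?G \<in> borel_measurable (PRE \<Otimes>\<^sub>M borel)" using G by measurable
  have "predictable \<Omega> F T borel (\<lambda>w t x. ?G ((w, t), x))"
    using m by (simp add: predictable_def case_prod_unfold)
  then have eq: "(\<integral>\<^sup>+w. (\<integral>\<^sup>+(t, x). ?G ((w, t), x) \<partial>\<mu> w) \<partial>M) = (\<integral>\<^sup>+w. (\<integral>\<^sup>+(t, x). ?G ((w, t), x) \<partial>\<nu> w) \<partial>M)"
    using compensator unfolding disintegrated_compensator_def by blast
  have "(\<integral>\<^sup>+(t, x). ?G ((w, t), x) \<partial>\<mu> w) = (if S (Suc n) w \<le> ennreal T then G ((w, \<sigma> (Suc n) w), X (Suc n) w) else 0)"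
    if w: "w \<in> \<Omega>" for w
  proof -
    have "(\<integral>\<^sup>+(t, x). ?G ((w, t), x) \<partial>\<mu> w) = (\<Sum>k\<in>jumps w. ?G ((w, \<sigma> k w), X k w))"
      using nn_integral_jump_measure[OF w predictable_section[OF m w]] by (simp add: case_prod_unfold)
    also have "\<dots> = (\<Sum>k\<in>(if S (Suc n) w \<le> ennreal T then {Suc n} else {}). G ((w, \<sigma> k w), X k w))"
    proof (rule sum.mono_neutral_cong_right[OF finite_jumps[OF w]])
      show "(if S (Suc n) w \<le> ennreal T then {Suc n} else {}) \<subseteq> jumps w" by (auto simp: jumps_def)
      show "\<forall>k\<in>jumps w - (if S (Suc n) w \<le> ennreal T then {Suc n} else {}). ?G ((w, \<sigma> k w), X k w) = 0"
      proof
        fix k assume k: "k \<in> jumps w - (if S (Suc n) w \<le> ennreal T then {Suc n} else {})"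
        then have k': "S k w \<le> ennreal T" by (simp add: jumps_def)
        note k' = k' S_eq_\<sigma>[OF k']
        have "\<not> (S n w < S k w \<and> S k w \<le> S (Suc n) w)"
        proof
          assume *: "S n w < S k w \<and> S k w \<le> S (Suc n) w"
          then have "\<not> k \<le> n" using S_mono[OF w, of k n] by auto
          moreover have "k \<noteq> Suc n" using k by (auto simp: jumps_def)
          ultimately have "Suc n < k" by simp
          moreover have "S (Suc n) w \<le> ennreal T" using S_mono[OF w, of "Suc n" k] k' \<open>Suc n < k\<close> by simp
          ultimately have "S (Suc n) w < S k w" using S_strict[OF w \<open>Suc n < k\<close>] by blast
          then show False using * by (meson leD)
        qed
        then have "(w, \<sigma> k w) \<notin> step n"
          using \<sigma>_less_iff[OF \<sigma>_range(1), of n w k w] \<sigma>_less_iff[OF \<sigma>_range(1), of "Suc n" w k w] k'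
          by (auto simp: step_def not_less)
        then show "?G ((w, \<sigma> k w), X k w) = 0" by simp
      qed
      fix k assume k: "k \<in> (if S (Suc n) w \<le> ennreal T then {Suc n} else {})"
      then have "k = Suc n" "S (Suc n) w \<le> ennreal T" by (auto split: if_splits)
      moreover have "S n w < ennreal T" using S_strict[OF w, of n "Suc n"] S_mono[OF w, of n "Suc n"] calculation(2)
        by (metis le_SucI lessI less_le_trans order_refl order_trans)
      ultimately have "(w, \<sigma> k w) \<in> step n"
        using \<sigma>_strict[OF w, of n] \<sigma>_range(1)[of k w] w by (simp add: step_def)
      then show "?G ((w, \<sigma> k w), X k w) = G ((w, \<sigma> k w), X k w)" by simp
    qed
    finally show ?thesis by simp
  qed
  moreover have "(\<integral>\<^sup>+(t, x). ?G ((w, t), x) \<partial>\<nu> w)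
      = (\<integral>\<^sup>+s\<in>{\<sigma> n w<..\<sigma> (Suc n) w}. (\<integral>\<^sup>+x. G ((w, s), x) \<partial>\<phi> w s) \<partial>dA w)" if w: "w \<in> \<Omega>" for w
  proof -
    have "(\<integral>\<^sup>+(t, x). ?G ((w, t), x) \<partial>\<nu> w) = (\<integral>\<^sup>+s. \<integral>\<^sup>+x. ?G ((w, s), x) \<partial>\<phi> w s \<partial>dA w)"
      using nn_integral_\<nu>[OF w predictable_section[OF m w]] by (simp add: case_prod_unfold)
    also have "\<dots> = (\<integral>\<^sup>+s\<in>{\<sigma> n w<..\<sigma> (Suc n) w}. (\<integral>\<^sup>+x. G ((w, s), x) \<partial>\<phi> w s) \<partial>dA w)"
      using w by (intro nn_integral_cong) (auto simp: indicator_def step_def space_dA[OF w])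
    finally show ?thesis .
  qed
  ultimately show ?thesis using eq by (simp cong: nn_integral_cong_simp)
qed

end

section \<open>Bounds and measurability for integrals\<close>

lemma set_integral_diff_bound:
  fixes k k' :: "real \<Rightarrow> real"
  assumes "set_integrable N U k" "set_integrable N U k'"
  shows "ennreal \<bar>(LINT s:U|N. k s) - (LINT s:U|N. k' s)\<bar> \<le> (\<integral>\<^sup>+s\<in>U. ennreal \<bar>k s - k' s\<bar> \<partial>N)"
proof -
  have "ennreal \<bar>(LINT s:U|N. k s) - (LINT s:U|N. k' s)\<bar> = ennreal (norm (LINT s|N. indicator U s *\<^sub>R (k s - k' s)))"
    using set_integral_diff(2)[OF assms] by (simp add: set_lebesgue_integral_def)
  also have "\<dots> \<le> (\<integral>\<^sup>+s. ennreal (norm (indicator U s *\<^sub>R (k s - k' s))) \<partial>N)"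
    using set_integral_diff(1)[OF assms] unfolding set_integrable_def by (rule integral_norm_bound_ennreal)
  also have "\<dots> = (\<integral>\<^sup>+s\<in>U. ennreal \<bar>k s - k' s\<bar> \<partial>N)"
    by (intro nn_integral_cong) (auto simp: indicator_def)
  finally show ?thesis .
qed

lemma set_integral_bound:
  fixes k :: "real \<Rightarrow> real"
  assumes "set_integrable N U k"
  shows "ennreal \<bar>LINT s:U|N. k s\<bar> \<le> (\<integral>\<^sup>+s\<in>U. ennreal \<bar>k s\<bar> \<partial>N)"
  using set_integral_diff_bound[OF assms, of "\<lambda>_. 0"] by (simp add: set_integrable_def set_lebesgue_integral_def)

lemma ennreal_linear_combination:
  assumes "0 \<le> a" "0 \<le> b" "0 \<le> x"
  shows "ennreal (a * x) + ennreal b * ennreal x = ennreal (b + a) * ennreal x"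
proof -
  have "ennreal (a * x) = ennreal a * ennreal x" "ennreal (b + a) = ennreal b + ennreal a"
    using assms by (auto intro: ennreal_mult ennreal_plus)
  then show ?thesis by (simp only: distrib_right add.commute)
qed

lemma integral_measurable_kernel:
  fixes G :: "'q \<times> 'x \<Rightarrow> real"
  assumes G: "G \<in> borel_measurable (Q \<Otimes>\<^sub>M N)" and \<kappa>: "\<kappa> \<in> Q \<rightarrow>\<^sub>M subprob_algebra N"
  shows "(\<lambda>q. LINT x|\<kappa> q. G (q, x)) \<in> borel_measurable Q"
proof -
  have "(\<lambda>q. distr (\<kappa> q) (Q \<Otimes>\<^sub>M N) (Pair q)) \<in> Q \<rightarrow>\<^sub>M subprob_algebra (Q \<Otimes>\<^sub>M N)"
    by (rule measurable_distr2[OF _ \<kappa>]) simp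
  from measurable_compose[OF this integral_measurable_subprob_algebra[OF G]]
  show ?thesis
  proof (rule measurable_cong[THEN iffD1, rotated])
    fix q assume q: "q \<in> space Q"
    then have "sets (\<kappa> q) = sets N" using measurable_space[OF \<kappa>] by (auto simp: space_subprob_algebra)
    then have "Pair q \<in> \<kappa> q \<rightarrow>\<^sub>M Q \<Otimes>\<^sub>M N" using measurable_Pair1'[OF q, of N] by (simp cong: measurable_cong_sets)
    then show "(LINT z|distr (\<kappa> q) (Q \<Otimes>\<^sub>M N) (Pair q). G z) = (LINT x|\<kappa> q. G (q, x))"
      using G by (rule integral_distr)
  qed
qed

section \<open>The equation between two consecutive jumps\<close>

locale bsde = compensated_point_process M T \<Delta> S X F A \<phi>
  for M :: "'w measure" and T :: real and \<Delta> :: "'e::topological_space"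
    and S :: "nat \<Rightarrow> 'w \<Rightarrow> ennreal" and X :: "nat \<Rightarrow> 'w \<Rightarrow> 'e" and F :: "ennreal \<Rightarrow> 'w measure"
    and A :: "'w \<Rightarrow> real \<Rightarrow> real" and \<phi> :: "'w \<Rightarrow> real \<Rightarrow> 'e measure" +
  fixes f :: "'w \<Rightarrow> real \<Rightarrow> 'e \<Rightarrow> real \<Rightarrow> ('e \<Rightarrow> real) \<Rightarrow> real" and L L' :: real and \<xi> :: "'w \<Rightarrow> real"
  assumes A_continuous: "\<And>w. w \<in> space M \<Longrightarrow> continuous_on {0..T} (A w)"
    and generator: "bsde_generator M T F A \<phi> L L' f"
    and L_nonneg: "0 \<le> L" "0 \<le> L'"
    and \<xi>_F: "\<xi> \<in> borel_measurable (F (ennreal T))"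
begin

sublocale continuous_process \<Omega> F T A
  by (intro continuous_process.intro continuous_process_axioms.intro increasing_process_axioms A_continuous)

abbreviation pred_process :: "('w \<Rightarrow> real \<Rightarrow> 'e \<Rightarrow> real) \<Rightarrow> bool" where
  "pred_process Z \<equiv> predictable \<Omega> F T borel Z"

lemma predictableD: "pred_process Z \<Longrightarrow> (\<lambda>z. Z (fst (fst z)) (snd (fst z)) (snd z)) \<in> borel_measurable (PRE \<Otimes>\<^sub>M borel)"
  by (simp add: predictable_def case_prod_unfold)

lemma predictableI: "(\<lambda>z. Z (fst (fst z)) (snd (fst z)) (snd z)) \<in> borel_measurable (PRE \<Otimes>\<^sub>M borel) \<Longrightarrow> pred_process Z"
  by (simp add: predictable_def case_prod_unfold)

lemma predictable_mark_measurable: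
  "pred_process Z \<Longrightarrow> w \<in> \<Omega> \<Longrightarrow> s \<in> {0..T} \<Longrightarrow> Z w s \<in> borel_measurable borel"
  using predictable_mark_section[OF predictableD, of Z w s] by simp

definition driver :: "('w \<times> real \<Rightarrow> real) \<Rightarrow> ('w \<Rightarrow> real \<Rightarrow> 'e \<Rightarrow> real) \<Rightarrow> ('w \<times> real) \<times> 'e \<Rightarrow> real" where
  "driver y Z z = f (fst (fst z)) (snd (fst z)) (snd z) (y (fst z)) (Z (fst (fst z)) (snd (fst z)))"

lemma driver_measurable:
  assumes y: "y \<in> borel_measurable PRE" and Z: "pred_process Z"
  shows "driver y Z \<in> borel_measurable (PRE \<Otimes>\<^sub>M borel)"
proof -
  have "predictable \<Omega> F T (borel \<Otimes>\<^sub>M borel) (\<lambda>w t (x, y). f w t x y (Z w t))"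
    using generator Z by (simp add: bsde_generator_def)
  then have "(\<lambda>z. f (fst (fst z)) (snd (fst z)) (fst (snd z)) (snd (snd z)) (Z (fst (fst z)) (snd (fst z))))
      \<in> borel_measurable (PRE \<Otimes>\<^sub>M (borel \<Otimes>\<^sub>M borel))"
    by (simp add: predictable_def case_prod_unfold)
  moreover have "(\<lambda>z. (fst z, (snd z, y (fst z)))) \<in> PRE \<Otimes>\<^sub>M borel \<rightarrow>\<^sub>M PRE \<Otimes>\<^sub>M (borel \<Otimes>\<^sub>M borel)"
    using y by measurable
  ultimately have "(\<lambda>z. (\<lambda>z. f (fst (fst z)) (snd (fst z)) (fst (snd z)) (snd (snd z)) (Z (fst (fst z)) (snd (fst z)))) (fst z, (snd z, y (fst z))))
      \<in> borel_measurable (PRE \<Otimes>\<^sub>M borel)"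
    by (rule measurable_compose[rotated])
  then show ?thesis by (simp add: driver_def[abs_def])
qed

definition "mark_norm Z w s = (\<integral>\<^sup>+x. ennreal \<bar>Z w s x\<bar> \<partial>\<phi> w s)"

definition "f0 w s = (\<integral>\<^sup>+x. ennreal \<bar>f w s x 0 (\<lambda>_. 0)\<bar> \<partial>\<phi> w s)"

lemma mark_norm_measurable:
  assumes "pred_process Z" shows "(\<lambda>p. mark_norm Z (fst p) (snd p)) \<in> borel_measurable PRE"
  unfolding mark_norm_def using predictableD[OF assms] 
    \<phi>_nn_integral[of "\<lambda>z. ennreal \<bar>Z (fst (fst z)) (snd (fst z)) (snd z)\<bar>"] by simp

lemma zero_predictable: "pred_process (\<lambda>_ _ _. 0)"
  by (intro predictableI) simp

lemma f0_measurable: "(\<lambda>p. f0 (fst p) (snd p)) \<in> borel_measurable PRE"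
proof -
  have "(\<lambda>z. ennreal \<bar>driver (\<lambda>_. 0) (\<lambda>_ _ _. 0) z\<bar>) \<in> borel_measurable (PRE \<Otimes>\<^sub>M borel)"
    using driver_measurable[OF _ zero_predictable, of "\<lambda>_. 0"] by simp
  from \<phi>_nn_integral[OF this] show ?thesis by (simp add: driver_def f0_def)
qed

lemma driver_lipschitz:
  assumes w: "w \<in> \<Omega>" and s: "s \<in> {0..T}" and Z: "pred_process Z" "pred_process Z'"
    and y: "y \<in> borel_measurable PRE" "y' \<in> borel_measurable PRE"
  shows "(\<integral>\<^sup>+x. ennreal \<bar>driver y Z ((w, s), x) - driver y' Z' ((w, s), x)\<bar> \<partial>\<phi> w s)
    \<le> ennreal (L' * \<bar>y (w, s) - y' (w, s)\<bar>) + ennreal L * mark_norm (\<lambda>w s x. Z w s x - Z' w s x) w s"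
proof -
  interpret \<phi>: prob_space "\<phi> w s" using \<phi>_prob w s by simp
  note m = predictable_mark_measurable[OF Z(1) w s] predictable_mark_measurable[OF Z(2) w s]
  have lip: "\<bar>f w s x (y (w, s)) (Z w s) - f w s x (y' (w, s)) (Z w s)\<bar> \<le> L' * \<bar>y (w, s) - y' (w, s)\<bar>" for x
    using generator w s m unfolding bsde_generator_def by blast
  have lip2: "(\<integral>\<^sup>+x. ennreal \<bar>f w s x (y' (w, s)) (Z w s) - f w s x (y' (w, s)) (Z' w s)\<bar> \<partial>\<phi> w s)
     \<le> ennreal L * (\<integral>\<^sup>+x. ennreal \<bar>Z' w s x - Z w s x\<bar> \<partial>\<phi> w s)"
    using generator w s m unfolding bsde_generator_def by blast
  have dm: "(\<lambda>x. f w s x (v (w, s)) (W w s)) \<in> borel_measurable (\<phi> w s)"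
    if "pred_process W" "v \<in> borel_measurable PRE" for W v
    using predictable_mark_section[OF driver_measurable[OF that(2,1)] w s] sets_\<phi>[OF w s]
    by (simp add: driver_def cong: measurable_cong_sets)
  have "(\<integral>\<^sup>+x. ennreal \<bar>driver y Z ((w, s), x) - driver y' Z' ((w, s), x)\<bar> \<partial>\<phi> w s)
      \<le> (\<integral>\<^sup>+x. ennreal (L' * \<bar>y (w, s) - y' (w, s)\<bar>) + ennreal \<bar>f w s x (y' (w, s)) (Z w s) - f w s x (y' (w, s)) (Z' w s)\<bar> \<partial>\<phi> w s)"
  proof (rule nn_integral_mono)
    fix x
    have "\<bar>driver y Z ((w, s), x) - driver y' Z' ((w, s), x)\<bar>
      \<le> L' * \<bar>y (w, s) - y' (w, s)\<bar> + \<bar>f w s x (y' (w, s)) (Z w s) - f w s x (y' (w, s)) (Z' w s)\<bar>"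
      using lip[of x] unfolding driver_def by simp
    from ennreal_leI[OF this] show "ennreal \<bar>driver y Z ((w, s), x) - driver y' Z' ((w, s), x)\<bar>
      \<le> ennreal (L' * \<bar>y (w, s) - y' (w, s)\<bar>) + ennreal \<bar>f w s x (y' (w, s)) (Z w s) - f w s x (y' (w, s)) (Z' w s)\<bar>"
      using L_nonneg by (simp add: ennreal_plus)
  qed
  also have "\<dots> = ennreal (L' * \<bar>y (w, s) - y' (w, s)\<bar>) + (\<integral>\<^sup>+x. ennreal \<bar>f w s x (y' (w, s)) (Z w s) - f w s x (y' (w, s)) (Z' w s)\<bar> \<partial>\<phi> w s)"
    using dm[OF Z(1) y(2)] dm[OF Z(2) y(2)] by (subst nn_integral_add) (auto simp: \<phi>.emeasure_space_1)
  also have "\<dots> \<le> ennreal (L' * \<bar>y (w, s) - y' (w, s)\<bar>) + ennreal L * mark_norm (\<lambda>w s x. Z w s x - Z' w s x) w s"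
    using lip2 unfolding mark_norm_def by (intro add_left_mono) (simp add: abs_minus_commute)
  finally show ?thesis .
qed

lemma driver_bound:
  assumes w: "w \<in> \<Omega>" and s: "s \<in> {0..T}" and Z: "pred_process Z" and y: "y \<in> borel_measurable PRE"
  shows "(\<integral>\<^sup>+x. ennreal \<bar>driver y Z ((w, s), x)\<bar> \<partial>\<phi> w s)
    \<le> ennreal (L' * \<bar>y (w, s)\<bar>) + ennreal L * mark_norm Z w s + f0 w s"
proof -
  have m: "(\<lambda>x. driver v W ((w, s), x)) \<in> borel_measurable (\<phi> w s)" if "pred_process W" "v \<in> borel_measurable PRE" for W v
    using predictable_mark_section[OF driver_measurable[OF that(2,1)] w s] sets_\<phi>[OF w s]
    by (simp cong: measurable_cong_sets)
  let ?d = "driver y Z" and ?e = "driver (\<lambda>_. 0) (\<lambda>_ _ _. 0)"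
  let ?D = "\<integral>\<^sup>+x. ennreal \<bar>?d ((w, s), x) - ?e ((w, s), x)\<bar> \<partial>\<phi> w s"
  have 1: "(\<integral>\<^sup>+x. ennreal \<bar>?d ((w, s), x)\<bar> \<partial>\<phi> w s) \<le> (\<integral>\<^sup>+x. ennreal \<bar>?d ((w, s), x) - ?e ((w, s), x)\<bar> + ennreal \<bar>?e ((w, s), x)\<bar> \<partial>\<phi> w s)"
    by (intro nn_integral_mono) (auto simp: ennreal_plus[symmetric] simp del: ennreal_plus intro!: ennreal_leI)
  have 2: "(\<integral>\<^sup>+x. ennreal \<bar>?d ((w, s), x) - ?e ((w, s), x)\<bar> + ennreal \<bar>?e ((w, s), x)\<bar> \<partial>\<phi> w s)
      = ?D + (\<integral>\<^sup>+x. ennreal \<bar>?e ((w, s), x)\<bar> \<partial>\<phi> w s)"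
    using m[OF Z y] m[OF zero_predictable, of "\<lambda>_. 0"] by (intro nn_integral_add) auto
  have 3: "(\<integral>\<^sup>+x. ennreal \<bar>?e ((w, s), x)\<bar> \<partial>\<phi> w s) = f0 w s"
    by (simp add: f0_def driver_def)
  have 4: "?D + f0 w s \<le> (ennreal (L' * \<bar>y (w, s)\<bar>) + ennreal L * mark_norm Z w s) + f0 w s"
    using driver_lipschitz[OF w s Z zero_predictable y, of "\<lambda>_. 0"] by (intro add_right_mono) simp
  show ?thesis using order_trans[OF 1[unfolded 2 3] 4] .
qed

lemma nn_integral_f0:
  assumes w: "w \<in> \<Omega>"
  shows "(\<integral>\<^sup>+s. f0 w s \<partial>dA w) = (\<integral>\<^sup>+(t, x). ennreal \<bar>f w t x 0 (\<lambda>_. 0)\<bar> \<partial>\<nu> w)"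
proof -
  have "(\<lambda>z. ennreal \<bar>driver (\<lambda>_. 0) (\<lambda>_ _ _. 0) z\<bar>) \<in> borel_measurable (PRE \<Otimes>\<^sub>M borel)"
    using driver_measurable[OF _ zero_predictable, of "\<lambda>_. 0"] by simp
  from nn_integral_\<nu>[OF w predictable_section[OF this w]]
  show ?thesis by (simp add: f0_def driver_def case_prod_unfold)
qed

lemma AE_f0: "AE w in M. (\<integral>\<^sup>+s. f0 w s \<partial>dA w) < \<infinity>"
proof -
  have "AE w in M. (\<integral>\<^sup>+(t, x). ennreal \<bar>f w t x 0 (\<lambda>_. 0)\<bar> \<partial>\<nu> w) < \<infinity>"
    using generator by (simp add: bsde_generator_def)
  then show ?thesis using AE_space by eventually_elim (simp add: nn_integral_f0)
qed

lemma nn_integral_mark_norm: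
  assumes "pred_process Z" "w \<in> \<Omega>"
  shows "(\<integral>\<^sup>+(t, x). ennreal \<bar>Z w t x\<bar> \<partial>\<nu> w) = (\<integral>\<^sup>+s. mark_norm Z w s \<partial>dA w)"
proof -
  have "(\<lambda>z. ennreal \<bar>Z (fst (fst z)) (snd (fst z)) (snd z)\<bar>) \<in> borel_measurable (PRE \<Otimes>\<^sub>M borel)"
    using predictableD[OF assms(1)] by simp
  from nn_integral_\<nu>[OF assms(2) predictable_section[OF this assms(2)]]
  show ?thesis by (simp add: mark_norm_def case_prod_unfold)
qed

subsection \<open>Solutions from the \<open>n\<close>-th jump on\<close>

text \<open>
  The equation holds at the times \<open>t \<ge> S n\<close> only. This is imposed through the condition \<open>S n \<le> t\<close> for
  processes on all of \<open>{0..T}\<close>, so that a solution from \<open>S n\<close> on also is one from \<open>S (n + 1)\<close> on.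
\<close>

definition solution_from :: "nat \<Rightarrow> ('w \<Rightarrow> real \<Rightarrow> real) \<Rightarrow> ('w \<Rightarrow> real \<Rightarrow> 'e \<Rightarrow> real) \<Rightarrow> bool" where
  "solution_from n Y Z \<longleftrightarrow> adapted F T Y \<and> (\<forall>w\<in>\<Omega>. cadlag T (Y w)) \<and> pred_process Z \<and>
     (AE w in M. (\<integral>\<^sup>+s\<in>{\<sigma> n w<..T}. mark_norm Z w s \<partial>dA w) < \<infinity>) \<and>
     (AE w in M. \<forall>t\<in>{0..T}. S n w \<le> ennreal t \<longrightarrow>
        Y w t + (LINT (s, x):{t<..T} \<times> UNIV|\<mu> w. Z w s x) =
        \<xi> w + (LINT (s, x):{t<..T} \<times> UNIV|\<nu> w. f w s x (left_limit (Y w) s) (Z w s)))"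

lemma nn_integral_dA_pos: "w \<in> \<Omega> \<Longrightarrow> (\<integral>\<^sup>+s\<in>{0<..T}. G s \<partial>dA w) = (\<integral>\<^sup>+s. G s \<partial>dA w)"
proof (rule nn_integral_cong_AE)
  assume w: "w \<in> \<Omega>"
  show "AE s in dA w. G s * indicator {0<..T} s = G s"
    using dA_pos[OF w] AE_space by eventually_elim (simp add: space_dA[OF w])
qed

lemma solution_from_0: "solution_from 0 Y Z \<longleftrightarrow> bsde_solution M T S X F A \<phi> f \<xi> Y Z"
proof -
  have "(AE w in M. (\<integral>\<^sup>+s\<in>{\<sigma> 0 w<..T}. mark_norm Z w s \<partial>dA w) < \<infinity>) \<longleftrightarrow>
      (AE w in M. (\<integral>\<^sup>+(t, x). ennreal \<bar>Z w t x\<bar> \<partial>\<nu> w) < \<infinity>)" if "pred_process Z"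
    by (rule AE_cong) (simp add: nn_integral_mark_norm[OF that] \<sigma>_0 nn_integral_dA_pos)
  moreover have "(AE w in M. \<forall>t\<in>{0..T}. S 0 w \<le> ennreal t \<longrightarrow> P w t) \<longleftrightarrow> (AE w in M. \<forall>t\<in>{0..T}. P w t)" for P
    by (rule AE_cong) (simp add: S_0)
  ultimately show ?thesis unfolding solution_from_def bsde_solution_def by (cases "pred_process Z") simp_all
qed

lemma solution_from_Suc: "solution_from n Y Z \<Longrightarrow> solution_from (Suc n) Y Z"
  unfolding solution_from_def
proof (elim conjE, intro conjI)
  assume "AE w in M. (\<integral>\<^sup>+s\<in>{\<sigma> n w<..T}. mark_norm Z w s \<partial>dA w) < \<infinity>"
  then show "AE w in M. (\<integral>\<^sup>+s\<in>{\<sigma> (Suc n) w<..T}. mark_norm Z w s \<partial>dA w) < \<infinity>"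
    using AE_space
  proof eventually_elim
    case (elim w)
    have "(\<integral>\<^sup>+s\<in>{\<sigma> (Suc n) w<..T}. mark_norm Z w s \<partial>dA w) \<le> (\<integral>\<^sup>+s\<in>{\<sigma> n w<..T}. mark_norm Z w s \<partial>dA w)"
      using \<sigma>_mono[OF elim(2), of n "Suc n"] by (intro nn_integral_mono) (auto simp: indicator_def)
    with elim(1) show ?case by (simp add: le_less_trans)
  qed
next
  assume "AE w in M. \<forall>t\<in>{0..T}. S n w \<le> ennreal t \<longrightarrow>
        Y w t + (LINT (s, x):{t<..T} \<times> UNIV|\<mu> w. Z w s x) =
        \<xi> w + (LINT (s, x):{t<..T} \<times> UNIV|\<nu> w. f w s x (left_limit (Y w) s) (Z w s))"
  then show "AE w in M. \<forall>t\<in>{0..T}. S (Suc n) w \<le> ennreal t \<longrightarrow>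
        Y w t + (LINT (s, x):{t<..T} \<times> UNIV|\<mu> w. Z w s x) =
        \<xi> w + (LINT (s, x):{t<..T} \<times> UNIV|\<nu> w. f w s x (left_limit (Y w) s) (Z w s))"
    using AE_space by eventually_elim (meson S_Suc order_trans)
qed auto

definition "mean_driver Y Z w s = (LINT x|\<phi> w s. driver (left_process Y) Z ((w, s), x))"

lemma left_process_bounded:
  assumes "cadlag T (Y w)" and B: "\<And>t. t \<in> {0..T} \<Longrightarrow> \<bar>Y w t\<bar> \<le> B" and s: "s \<in> {0..T}"
  shows "\<bar>left_process Y (w, s)\<bar> \<le> \<bar>B\<bar>"
proof (cases "0 < s")
  case True
  then have "s \<in> {0<..T}" using s by simp
  then obtain l where l: "(Y w \<longlongrightarrow> l) (at_left s)" using assms(1) unfolding cadlag_def by blast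
  have "\<forall>\<^sub>F t in at_left s. t \<in> {0<..<s}" by (rule eventually_at_leftI[of 0]) (use True in auto)
  then have "\<forall>\<^sub>F t in at_left s. \<bar>Y w t\<bar> \<le> \<bar>B\<bar>"
  proof eventually_elim
    case (elim t)
    then show ?case using B[of t] s by auto
  qed
  then have "\<bar>l\<bar> \<le> \<bar>B\<bar>" using tendsto_rabs[OF l] by (intro tendsto_upperbound) auto
  then show ?thesis using True by (simp add: left_process_def left_limit_eq[OF l])
qed (simp add: left_process_def)

lemma driver_integral_finite:
  assumes w: "w \<in> \<Omega>" and u: "0 \<le> u" and Z: "pred_process Z" and y: "y \<in> borel_measurable PRE"
    and B: "\<And>s. s \<in> {0..T} \<Longrightarrow> \<bar>y (w, s)\<bar> \<le> B"
    and Zfin: "(\<integral>\<^sup>+s\<in>{u<..T}. mark_norm Z w s \<partial>dA w) < \<infinity>" and f0: "(\<integral>\<^sup>+s. f0 w s \<partial>dA w) < \<infinity>"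
  shows "(\<integral>\<^sup>+s\<in>{u<..T}. (\<integral>\<^sup>+x. ennreal \<bar>driver y Z ((w, s), x)\<bar> \<partial>\<phi> w s) \<partial>dA w) < \<infinity>"
proof -
  interpret finite_measure "dA w" using finite_dA[OF w] .
  have [measurable]: "{u<..T} \<in> sets (dA w)" using Ioc_dA[OF w u] by simp
  have [measurable]: "mark_norm Z w \<in> borel_measurable (dA w)" "f0 w \<in> borel_measurable (dA w)"
    using dA_measurable[OF w mark_norm_measurable[OF Z]] dA_measurable[OF w f0_measurable] by simp_all
  have "(\<integral>\<^sup>+s\<in>{u<..T}. (\<integral>\<^sup>+x. ennreal \<bar>driver y Z ((w, s), x)\<bar> \<partial>\<phi> w s) \<partial>dA w)
    \<le> (\<integral>\<^sup>+s. ennreal (L' * B) + (ennreal L * (mark_norm Z w s * indicator {u<..T} s) + f0 w s) \<partial>dA w)"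
  proof (rule nn_integral_mono)
    fix s assume "s \<in> space (dA w)"
    then have s: "s \<in> {0..T}" using space_dA[OF w] by simp
    have "(\<integral>\<^sup>+x. ennreal \<bar>driver y Z ((w, s), x)\<bar> \<partial>\<phi> w s) \<le> ennreal (L' * \<bar>y (w, s)\<bar>) + ennreal L * mark_norm Z w s + f0 w s"
      by (rule driver_bound[OF w s Z y])
    also have "\<dots> \<le> ennreal (L' * B) + ennreal L * mark_norm Z w s + f0 w s"
      using B[OF s] L_nonneg by (intro add_right_mono ennreal_leI mult_left_mono) auto
    finally show "(\<integral>\<^sup>+x. ennreal \<bar>driver y Z ((w, s), x)\<bar> \<partial>\<phi> w s) * indicator {u<..T} s
       \<le> ennreal (L' * B) + (ennreal L * (mark_norm Z w s * indicator {u<..T} s) + f0 w s)"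
      by (auto simp: indicator_def ac_simps)
  qed
  also have "\<dots> = ennreal (L' * B) * emeasure (dA w) (space (dA w)) + (ennreal L * (\<integral>\<^sup>+s\<in>{u<..T}. mark_norm Z w s \<partial>dA w) + (\<integral>\<^sup>+s. f0 w s \<partial>dA w))"
    by (simp add: nn_integral_add nn_integral_cmult)
  also have "\<dots> < \<infinity>"
  proof -
    have "emeasure (dA w) (space (dA w)) < \<top>"
      using emeasure_finite[of "space (dA w)"] by (simp only: less_top[symmetric] not_False_eq_True)
    then show ?thesis using Zfin f0 by (simp add: ennreal_mult_less_top)
  qed
  finally show ?thesis .
qed

lemma AE_driver_finite:
  assumes sol: "solution_from n Y Z"
  shows "AE w in M. (\<integral>\<^sup>+s\<in>{\<sigma> n w<..T}. (\<integral>\<^sup>+x. ennreal \<bar>driver (left_process Y) Z ((w, s), x)\<bar> \<partial>\<phi> w s) \<partial>dA w) < \<infinity>"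
proof -
  have Yl: "left_process Y \<in> borel_measurable PRE"
    using sol by (intro left_process_measurable) (auto simp: solution_from_def)
  have "AE w in M. (\<integral>\<^sup>+s\<in>{\<sigma> n w<..T}. mark_norm Z w s \<partial>dA w) < \<infinity>" using sol by (simp add: solution_from_def)
  then show ?thesis using AE_f0 AE_space
  proof eventually_elim
    case (elim w)
    have c: "cadlag T (Y w)" using sol elim by (simp add: solution_from_def)
    obtain B where B: "\<And>t. t \<in> {0..T} \<Longrightarrow> \<bar>Y w t\<bar> \<le> B" using cadlag_bounded[OF c] by blast
    show ?case
      using sol elim left_process_bounded[of Y w B, OF c B] Yl \<sigma>_range
      by (intro driver_integral_finite[where B="\<bar>B\<bar>"]) (auto simp: solution_from_def)
  qed
qed

lemma jumps_after_between:
  assumes w: "w \<in> \<Omega>" and t: "\<sigma> n w \<le> t" "t < \<sigma> (Suc n) w"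
  shows "{j\<in>jumps w. t < \<sigma> j w} = {j\<in>jumps w. Suc n \<le> j}"
proof (intro Collect_cong conj_cong refl)
  fix j show "t < \<sigma> j w \<longleftrightarrow> Suc n \<le> j"
    using \<sigma>_mono[OF w, of j n] \<sigma>_mono[OF w, of "Suc n" j] t by (cases "Suc n \<le> j") auto
qed

lemma jumps_from_next:
  assumes w: "w \<in> \<Omega>" and S': "S (Suc n) w \<le> ennreal T"
  shows "{j\<in>jumps w. Suc n \<le> j} = insert (Suc n) {j\<in>jumps w. \<sigma> (Suc n) w < \<sigma> j w}"
proof (intro set_eqI iffI)
  fix j assume j: "j \<in> {j\<in>jumps w. Suc n \<le> j}"
  show "j \<in> insert (Suc n) {j\<in>jumps w. \<sigma> (Suc n) w < \<sigma> j w}"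
  proof (cases "j = Suc n")
    case False
    then have "S (Suc n) w < S j w" using j S' by (intro S_strict w) auto
    then have "ennreal (\<sigma> (Suc n) w) < ennreal (\<sigma> j w)" using j S' by (simp add: jumps_def S_eq_\<sigma>[symmetric])
    then show ?thesis using j by (simp add: ennreal_less_iff \<sigma>_range)
  qed simp
next
  fix j assume j: "j \<in> insert (Suc n) {j\<in>jumps w. \<sigma> (Suc n) w < \<sigma> j w}"
  then show "j \<in> {j\<in>jumps w. Suc n \<le> j}"
    using \<sigma>_mono[OF w, of j "Suc n"] S' by (cases "Suc n \<le> j") (auto simp: jumps_def)
qed

lemma no_jumps_from_next:
  assumes w: "w \<in> \<Omega>" and S': "ennreal T < S (Suc n) w"
  shows "{j\<in>jumps w. Suc n \<le> j} = {}"
proof -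
  have "S (Suc n) w \<le> S j w" if "Suc n \<le> j" for j using S_mono[OF w that] .
  with S' show ?thesis by (auto simp: jumps_def dest: less_le_trans leD)
qed

text \<open>
  This reduces the two random measures in the equation to the finitely many later jumps of the path and to
  integration in time.
\<close>

lemma equation_integrals:
  assumes w: "w \<in> \<Omega>" and u: "0 \<le> u" "u \<le> t" and Yl: "left_process Y \<in> borel_measurable PRE" and Z: "pred_process Z"
    and fin: "(\<integral>\<^sup>+s\<in>{u<..T}. (\<integral>\<^sup>+x. ennreal \<bar>driver (left_process Y) Z ((w, s), x)\<bar> \<partial>\<phi> w s) \<partial>dA w) < \<infinity>"
  shows "set_integrable (dA w) {t<..T} (mean_driver Y Z w)"
    and "(LINT (s, x):{t<..T} \<times> UNIV|\<nu> w. f w s x (left_limit (Y w) s) (Z w s)) = (LINT s:{t<..T}|dA w. mean_driver Y Z w s)"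
    and "(LINT (s, x):{t<..T} \<times> UNIV|\<mu> w. Z w s x) = (\<Sum>j\<in>{j\<in>jumps w. t < \<sigma> j w}. Z w (\<sigma> j w) (X j w))"
proof -
  let ?d = "driver (left_process Y) Z"
  have t0: "0 \<le> t" using u by simp
  have dm: "(\<lambda>p. ?d ((w, fst p), snd p)) \<in> borel_measurable (restrict_space borel {0..T} \<Otimes>\<^sub>M borel)"
    by (rule predictable_section[OF driver_measurable[OF Yl Z] w])
  have "(\<integral>\<^sup>+s\<in>{t<..T}. (\<integral>\<^sup>+x. ennreal \<bar>?d ((w, s), x)\<bar> \<partial>\<phi> w s) \<partial>dA w)
    \<le> (\<integral>\<^sup>+s\<in>{u<..T}. (\<integral>\<^sup>+x. ennreal \<bar>?d ((w, s), x)\<bar> \<partial>\<phi> w s) \<partial>dA w)"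
    using u by (intro nn_integral_mono) (auto simp: indicator_def)
  with fin have "(\<integral>\<^sup>+s\<in>{t<..T}. (\<integral>\<^sup>+x. ennreal \<bar>?d ((w, s), x)\<bar> \<partial>\<phi> w s) \<partial>dA w) < \<infinity>" by (simp add: le_less_trans)
  note * = set_integral_\<nu>[OF w dm t0, simplified, OF this[simplified]]
  show "set_integrable (dA w) {t<..T} (mean_driver Y Z w)" using *(1) unfolding mean_driver_def .
  have "(LINT (s, x):{t<..T} \<times> UNIV|\<nu> w. f w s x (left_limit (Y w) s) (Z w s))
    = (LINT p:{t<..T} \<times> UNIV|\<nu> w. ?d ((w, fst p), snd p))"
    unfolding set_lebesgue_integral_def
    by (intro Bochner_Integration.integral_cong refl) (use t0 in \<open>auto simp: indicator_def driver_def left_process_def\<close>)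
  also have "\<dots> = (LINT s:{t<..T}|dA w. mean_driver Y Z w s)" unfolding mean_driver_def by (rule *(2))
  finally show "(LINT (s, x):{t<..T} \<times> UNIV|\<nu> w. f w s x (left_limit (Y w) s) (Z w s)) = (LINT s:{t<..T}|dA w. mean_driver Y Z w s)" .
  show "(LINT (s, x):{t<..T} \<times> UNIV|\<mu> w. Z w s x) = (\<Sum>j\<in>{j\<in>jumps w. t < \<sigma> j w}. Z w (\<sigma> j w) (X j w))"
    using integral_jump_measure[OF w predictable_section[OF predictableD[OF Z] w] t0]
    by (simp add: case_prod_unfold)
qed

text \<open>
  Between two jumps the solution follows the continuous path \<open>y\<close>, which is also its left limit at the
  later jump; there the jump of \<open>Y\<close> is \<open>Z\<close> at the new point.
\<close>

definition continuous_piece ::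
  "nat \<Rightarrow> ('w \<Rightarrow> real \<Rightarrow> real) \<Rightarrow> ('w \<Rightarrow> real \<Rightarrow> 'e \<Rightarrow> real) \<Rightarrow> 'w \<Rightarrow> (real \<Rightarrow> real) \<Rightarrow> real \<Rightarrow> bool"
where
  "continuous_piece n Y Z w y B \<longleftrightarrow>
      set_integrable (dA w) {\<sigma> n w<..T} (mean_driver Y Z w) \<and>
      (\<forall>t\<in>{\<sigma> n w..\<sigma> (Suc n) w}. \<bar>y t\<bar> \<le> B) \<and>
      (\<forall>t\<in>{\<sigma> n w..\<sigma> (Suc n) w}. y t = y (\<sigma> n w) - (LINT s:{\<sigma> n w<..t}|dA w. mean_driver Y Z w s)) \<and>
      (\<forall>t\<in>{\<sigma> n w..\<sigma> (Suc n) w}. y t = y (\<sigma> (Suc n) w) + (LINT s:{t<..\<sigma> (Suc n) w}|dA w. mean_driver Y Z w s)) \<and>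
      (\<forall>t\<in>{\<sigma> n w..<\<sigma> (Suc n) w}. Y w t = y t) \<and>
      (\<forall>t\<in>{\<sigma> n w<..\<sigma> (Suc n) w}. left_process Y (w, t) = y t) \<and>
      Y w (\<sigma> n w) = y (\<sigma> n w) \<and>
      (ennreal T < S (Suc n) w \<longrightarrow> y T = \<xi> w \<and> Y w T = \<xi> w) \<and>
      (S (Suc n) w \<le> ennreal T \<longrightarrow> Z w (\<sigma> (Suc n) w) (X (Suc n) w) = Y w (\<sigma> (Suc n) w) - y (\<sigma> (Suc n) w))"

lemma continuous_pieceD:
  assumes "continuous_piece n Y Z w y B"
  shows "set_integrable (dA w) {\<sigma> n w<..T} (mean_driver Y Z w)"
    "t \<in> {\<sigma> n w..\<sigma> (Suc n) w} \<Longrightarrow> \<bar>y t\<bar> \<le> B"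
    "t \<in> {\<sigma> n w..\<sigma> (Suc n) w} \<Longrightarrow> y t = y (\<sigma> n w) - (LINT s:{\<sigma> n w<..t}|dA w. mean_driver Y Z w s)"
    "t \<in> {\<sigma> n w..\<sigma> (Suc n) w} \<Longrightarrow> y t = y (\<sigma> (Suc n) w) + (LINT s:{t<..\<sigma> (Suc n) w}|dA w. mean_driver Y Z w s)"
    "t \<in> {\<sigma> n w..<\<sigma> (Suc n) w} \<Longrightarrow> Y w t = y t"
    "t \<in> {\<sigma> n w<..\<sigma> (Suc n) w} \<Longrightarrow> left_process Y (w, t) = y t"
    "Y w (\<sigma> n w) = y (\<sigma> n w)"
    "ennreal T < S (Suc n) w \<Longrightarrow> y T = \<xi> w" "ennreal T < S (Suc n) w \<Longrightarrow> Y w T = \<xi> w"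
    "S (Suc n) w \<le> ennreal T \<Longrightarrow> Z w (\<sigma> (Suc n) w) (X (Suc n) w) = Y w (\<sigma> (Suc n) w) - y (\<sigma> (Suc n) w)"
proof -
  note c = assms[unfolded continuous_piece_def]
  show "set_integrable (dA w) {\<sigma> n w<..T} (mean_driver Y Z w)" using c by (elim conjE)
  show "t \<in> {\<sigma> n w..\<sigma> (Suc n) w} \<Longrightarrow> \<bar>y t\<bar> \<le> B" using c by (elim conjE bspec)
  show "t \<in> {\<sigma> n w..\<sigma> (Suc n) w} \<Longrightarrow> y t = y (\<sigma> n w) - (LINT s:{\<sigma> n w<..t}|dA w. mean_driver Y Z w s)"
    using c by (elim conjE bspec)
  show "t \<in> {\<sigma> n w..\<sigma> (Suc n) w} \<Longrightarrow> y t = y (\<sigma> (Suc n) w) + (LINT s:{t<..\<sigma> (Suc n) w}|dA w. mean_driver Y Z w s)"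
    using c by (elim conjE bspec)
  show "t \<in> {\<sigma> n w..<\<sigma> (Suc n) w} \<Longrightarrow> Y w t = y t" using c by (elim conjE bspec)
  show "t \<in> {\<sigma> n w<..\<sigma> (Suc n) w} \<Longrightarrow> left_process Y (w, t) = y t" using c by (elim conjE bspec)
  show "Y w (\<sigma> n w) = y (\<sigma> n w)" using c by (elim conjE)
  show "ennreal T < S (Suc n) w \<Longrightarrow> y T = \<xi> w" "ennreal T < S (Suc n) w \<Longrightarrow> Y w T = \<xi> w"
    using c by blast+
  show "S (Suc n) w \<le> ennreal T \<Longrightarrow> Z w (\<sigma> (Suc n) w) (X (Suc n) w) = Y w (\<sigma> (Suc n) w) - y (\<sigma> (Suc n) w)"
    using c by blast
qed

lemma path_between_jumps:
  assumes sol: "solution_from n Y Z"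
  shows "AE w in M. S n w \<le> ennreal T \<longrightarrow> (\<exists>y B. continuous_piece n Y Z w y B)"
proof -
  have Yl: "left_process Y \<in> borel_measurable PRE" and Z: "pred_process Z"
    using sol by (auto simp: solution_from_def intro: left_process_measurable)
  have "AE w in M. \<forall>t\<in>{0..T}. S n w \<le> ennreal t \<longrightarrow>
        Y w t + (LINT (s, x):{t<..T} \<times> UNIV|\<mu> w. Z w s x) =
        \<xi> w + (LINT (s, x):{t<..T} \<times> UNIV|\<nu> w. f w s x (left_limit (Y w) s) (Z w s))"
    using sol by (simp add: solution_from_def)
  then show ?thesis using AE_driver_finite[OF sol] AE_space
  proof eventually_elim
    case (elim w)
    note w = elim(3)
    let ?k = "mean_driver Y Z w"
    let ?d = "driver (left_process Y) Z"
    let ?a = "\<sigma> n w" and ?b = "\<sigma> (Suc n) w"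
    define I where "I t = (LINT s:{t<..T}|dA w. ?k s)" for t
    define J where "J t = (\<Sum>j\<in>{j\<in>jumps w. t < \<sigma> j w}. Z w (\<sigma> j w) (X j w))" for t
    have ab: "?a \<le> ?b" using \<sigma>_mono[OF w, of n "Suc n"] by simp
    note ints = equation_integrals[OF w \<sigma>_range(2)[of n w] _ Yl Z elim(2)]
    have int: "set_integrable (dA w) {t<..T} ?k" if t: "?a \<le> t" for t using ints(1)[OF t] .
    have eq: "Y w t = \<xi> w - J t + I t" if t: "?a \<le> t" "t \<le> T" "S n w \<le> ennreal t" for t
    proof -
      have "t \<in> {0..T}" using t \<sigma>_range(2)[of n w] by auto
      with elim(1) t have "Y w t + (LINT (s, x):{t<..T} \<times> UNIV|\<mu> w. Z w s x) =
        \<xi> w + (LINT (s, x):{t<..T} \<times> UNIV|\<nu> w. f w s x (left_limit (Y w) s) (Z w s))" by blast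
      then show ?thesis unfolding ints(2)[OF t(1)] ints(3)[OF t(1)] by (simp add: I_def J_def)
    qed
    have split: "I u = (LINT s:{u<..v}|dA w. ?k s) + I v" if "?a \<le> u" "u \<le> v" "v \<le> T" for u v
    proof -
      have "{u<..v} \<in> sets (dA w)" "{v<..T} \<in> sets (dA w)"
        using that \<sigma>_range(2)[of n w] by (auto intro!: Ioc_dA[OF w])
      then have "set_integrable (dA w) {u<..v} ?k" "set_integrable (dA w) {v<..T} ?k"
        using int[OF that(1)] that by (auto intro: set_integrable_subset)
      then have "(LINT s:{u<..v} \<union> {v<..T}|dA w. ?k s) = (LINT s:{u<..v}|dA w. ?k s) + I v"
        unfolding I_def by (intro set_integral_Un) auto
      moreover have "{u<..v} \<union> {v<..T} = {u<..T}" using that by auto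
      ultimately show ?thesis by (simp add: I_def)
    qed
    have I_left: "(I \<longlongrightarrow> I t) (at_left t)" if t: "?a < t" "t \<le> T" for t
    proof -
      show ?thesis
      proof (rule tendsto_at_left_sequentially[OF t(1)])
        fix u assume u: "\<And>i. u i < t" "\<And>i. ?a < u i" "u \<longlonglongrightarrow> t"
        have "(\<lambda>i. LINT s|dA w. indicator {u i<..T} s *\<^sub>R ?k s) \<longlonglongrightarrow> (LINT s|dA w. indicator {t<..T} s *\<^sub>R ?k s)"
        proof (rule integral_dominated_convergence)
          show "integrable (dA w) (\<lambda>s. norm (indicator {?a<..T} s *\<^sub>R ?k s))"
            using int[of ?a] by (intro integrable_norm) (simp add: set_integrable_def)
          show "(\<lambda>s. indicator {t<..T} s *\<^sub>R ?k s) \<in> borel_measurable (dA w)"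
            using int[of t] t by (auto simp: set_integrable_def)
          show "(\<lambda>s. indicator {u i<..T} s *\<^sub>R ?k s) \<in> borel_measurable (dA w)" for i
            using int[of "u i"] u(2)[of i] by (auto simp: set_integrable_def)
          show "AE s in dA w. norm (indicator {u i<..T} s *\<^sub>R ?k s) \<le> norm (indicator {?a<..T} s *\<^sub>R ?k s)" for i
            using u(2)[of i] by (intro AE_I2) (auto simp: indicator_def)
          show "AE s in dA w. (\<lambda>i. indicator {u i<..T} s *\<^sub>R ?k s) \<longlonglongrightarrow> indicator {t<..T} s *\<^sub>R ?k s"
            using continuous_increasing_path.AE_stieltjes_singleton[OF continuous_A_path[OF w], of t]
          proof eventually_elim
            case (elim s)
            have "\<forall>\<^sub>F i in sequentially. indicator {u i<..T} s *\<^sub>R ?k s = indicator {t<..T} s *\<^sub>R ?k s"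
            proof (cases "s < t")
              case True
              then have "\<forall>\<^sub>F i in sequentially. s < u i" using u(3) by (rule order_tendstoD[rotated])
              then show ?thesis by eventually_elim (use True in \<open>auto simp: indicator_def\<close>)
            next
              case False
              then have "u i < s" "t < s" for i using u(1)[of i] elim by auto
              then show ?thesis by (auto simp: indicator_def)
            qed
            then show ?case by (rule tendsto_eventually)
          qed
        qed
        then show "(\<lambda>i. I (u i)) \<longlonglongrightarrow> I t" unfolding I_def set_lebesgue_integral_def .
      qed
    qed
    show ?case
    proof
      assume Sn: "S n w \<le> ennreal T"
      have Sa: "S n w = ennreal ?a" using Sn by (rule S_eq_\<sigma>)
      define J0 where "J0 = (\<Sum>j\<in>{j\<in>jumps w. Suc n \<le> j}. Z w (\<sigma> j w) (X j w))"
      define y where "y t = \<xi> w - J0 + I t" for t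
      have J_before: "J t = J0" if "?a \<le> t" "t < ?b" for t
        using jumps_after_between[OF w that] by (simp add: J_def J0_def)
      have J0_none: "J0 = 0" if "ennreal T < S (Suc n) w"
        unfolding J0_def no_jumps_from_next[OF w that] by (rule sum.empty)
      have J_T: "J T = 0"
      proof -
        have "{j\<in>jumps w. T < \<sigma> j w} = {}" using \<sigma>_range(3) by (auto simp: not_less)
        then show ?thesis unfolding J_def by (simp only: sum.empty)
      qed
      have J_after: "J ?b = J0 - Z w ?b (X (Suc n) w)" if S': "S (Suc n) w \<le> ennreal T"
      proof -
        have "J0 = Z w ?b (X (Suc n) w) + J ?b"
          unfolding J0_def J_def jumps_from_next[OF w S'] using finite_jumps[OF w] by simp
        then show ?thesis by simp
      qed
      have b_T: "?b = T" if "ennreal T < S (Suc n) w" using that by (intro \<sigma>_eq_T) simp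
      have I_T: "I T = 0" by (simp add: I_def set_lebesgue_integral_def)
      have Y_before: "Y w t = y t" if "t \<in> {?a..<?b}" for t
        using eq[of t] J_before[of t] that Sa \<sigma>_range(3)[of "Suc n" w] by (auto simp: y_def ennreal_leI)
      have Y_T: "y T = \<xi> w \<and> Y w T = \<xi> w" if "ennreal T < S (Suc n) w"
        using J0_none[OF that] eq[of T] J_T I_T Sn \<sigma>_range(3)[of n w] by (simp add: y_def)
      have Y_a: "Y w ?a = y ?a"
      proof (cases "?a < ?b")
        case True then show ?thesis using Y_before by simp
      next
        case False
        then have "\<not> S n w < ennreal T" using \<sigma>_strict[OF w, of n] by blast
        then have "S n w = ennreal T" using Sn by simp
        then have "ennreal T < S (Suc n) w" "?a = T" using S_less[OF w Sn] \<sigma>_eq_T[of n w] by auto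
        then show ?thesis using Y_T by simp
      qed
      have left: "left_process Y (w, t) = y t" if t: "t \<in> {?a<..?b}" for t
      proof -
        have "(y \<longlongrightarrow> y t) (at_left t)"
          unfolding y_def using t \<sigma>_range(3)[of "Suc n" w] by (intro tendsto_intros I_left) auto
        moreover have "\<forall>\<^sub>F u in at_left t. u \<in> {?a<..<t}" using t by (intro eventually_at_leftI[of ?a]) auto
        then have "\<forall>\<^sub>F u in at_left t. y u = Y w u"
          by eventually_elim (use Y_before t in auto)
        ultimately have "(Y w \<longlongrightarrow> y t) (at_left t)" by (rule Lim_transform_eventually)
        then show ?thesis using t \<sigma>_range(2)[of n w] by (simp add: left_process_def left_limit_eq)
      qed
      have bound: "\<bar>y t\<bar> \<le> \<bar>\<xi> w - J0\<bar> + (LINT s|dA w. \<bar>indicator {?a<..T} s *\<^sub>R ?k s\<bar>)" if t: "?a \<le> t" for t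
      proof -
        have "\<bar>I t\<bar> \<le> (LINT s|dA w. \<bar>indicator {t<..T} s *\<^sub>R ?k s\<bar>)"
          unfolding I_def set_lebesgue_integral_def by (rule integral_abs_bound)
        also have "\<dots> \<le> (LINT s|dA w. \<bar>indicator {?a<..T} s *\<^sub>R ?k s\<bar>)"
          using int[of t] int[of ?a] t unfolding set_integrable_def
          by (intro integral_mono integrable_abs) (auto simp: indicator_def)
        finally show ?thesis unfolding y_def by linarith
      qed
      have fwd: "y t = y ?a - (LINT s:{?a<..t}|dA w. ?k s)" if "t \<in> {?a..?b}" for t
        using split[of ?a t] that \<sigma>_range(3)[of "Suc n" w] by (simp add: y_def)
      have bwd: "y t = y ?b + (LINT s:{t<..?b}|dA w. ?k s)" if "t \<in> {?a..?b}" for t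
        using split[of t ?b] that \<sigma>_range(3)[of "Suc n" w] by (simp add: y_def)
      have jump: "Z w ?b (X (Suc n) w) = Y w ?b - y ?b" if S': "S (Suc n) w \<le> ennreal T"
        using eq[of ?b] J_after[OF S'] ab \<sigma>_range(3)[of "Suc n" w] Sa by (simp add: y_def ennreal_leI)
      show "\<exists>y B. continuous_piece n Y Z w y B"
        unfolding continuous_piece_def
        by (rule exI[of _ y], rule exI[of _ "\<bar>\<xi> w - J0\<bar> + (LINT s|dA w. \<bar>indicator {?a<..T} s *\<^sub>R ?k s\<bar>)"])
          (intro conjI ballI impI int bound fwd bwd Y_before left Y_a jump Y_T[THEN conjunct1] Y_T[THEN conjunct2], auto)
    qed
  qed
qed

section \<open>Uniqueness\<close>

lemma solution_left_process: "solution_from n Y Z \<Longrightarrow> left_process Y \<in> borel_measurable PRE"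
  and solution_predictable: "solution_from n Y Z \<Longrightarrow> pred_process Z"
  by (auto simp: solution_from_def intro: left_process_measurable)

lemma predictable_diff: "pred_process Z \<Longrightarrow> pred_process Z' \<Longrightarrow> pred_process (\<lambda>w s x. Z w s x - Z' w s x)"
  by (rule predictableI, rule borel_measurable_diff) (erule predictableD)+

lemma predictable_add_process:
  "pred_process Z \<Longrightarrow> y \<in> borel_measurable PRE \<Longrightarrow> pred_process (\<lambda>w s x. Z w s x + y (w, s))"
proof (intro predictableI)
  assume Z: "pred_process Z" and y: "y \<in> borel_measurable PRE"
  have "(\<lambda>z. Z (fst (fst z)) (snd (fst z)) (snd z) + y (fst z)) \<in> borel_measurable (PRE \<Otimes>\<^sub>M borel)"
    by (rule borel_measurable_add[OF predictableD[OF Z] measurable_compose[OF measurable_fst y]])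
  then show "(\<lambda>z. Z (fst (fst z)) (snd (fst z)) (snd z) + y (fst (fst z), snd (fst z))) \<in> borel_measurable (PRE \<Otimes>\<^sub>M borel)" by simp
qed

lemma mark_norm_triangle:
  assumes w: "w \<in> \<Omega>" "s \<in> {0..T}" and Z: "pred_process Z" and y: "y \<in> borel_measurable PRE"
  shows "mark_norm Z w s \<le> mark_norm (\<lambda>w s x. Z w s x + y (w, s)) w s + ennreal \<bar>y (w, s)\<bar>"
proof -
  interpret \<phi>: prob_space "\<phi> w s" using \<phi>_prob w by simp
  have m: "(\<lambda>x. Z w s x + y (w, s)) \<in> borel_measurable (\<phi> w s)"
    using predictable_mark_measurable[OF predictable_add_process[OF Z y] w] sets_\<phi>[OF w] by (simp cong: measurable_cong_sets)
  have "mark_norm Z w s \<le> (\<integral>\<^sup>+x. ennreal \<bar>Z w s x + y (w, s)\<bar> + ennreal \<bar>y (w, s)\<bar> \<partial>\<phi> w s)"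
    unfolding mark_norm_def
    by (intro nn_integral_mono) (auto simp: ennreal_plus[symmetric] simp del: ennreal_plus intro!: ennreal_leI)
  also have "\<dots> = mark_norm (\<lambda>w s x. Z w s x + y (w, s)) w s + ennreal \<bar>y (w, s)\<bar>"
    unfolding mark_norm_def using m by (subst nn_integral_add) (auto simp: \<phi>.emeasure_space_1)
  finally show ?thesis .
qed

text \<open>By the compensator formula the mean of \<open>\<bar>Z\<bar>\<close> at the next point is its mean integral up to that point.\<close>

lemma mark_norm_zero_between:
  assumes Z: "pred_process Z"
    and zero: "AE w in M. S (Suc n) w \<le> ennreal T \<longrightarrow> Z w (\<sigma> (Suc n) w) (X (Suc n) w) = 0"
  shows "AE w in M. AE s in dA w. s \<in> {\<sigma> n w<..\<sigma> (Suc n) w} \<longrightarrow> mark_norm Z w s = 0"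
proof -
  let ?G = "\<lambda>z. ennreal \<bar>Z (fst (fst z)) (snd (fst z)) (snd z)\<bar>"
  have G: "?G \<in> borel_measurable (PRE \<Otimes>\<^sub>M borel)" using predictableD[OF Z] by simp
  have "(\<integral>\<^sup>+w. (\<integral>\<^sup>+s\<in>{\<sigma> n w<..\<sigma> (Suc n) w}. mark_norm Z w s \<partial>dA w) \<partial>M)
      = (\<integral>\<^sup>+w. (if S (Suc n) w \<le> ennreal T then ?G ((w, \<sigma> (Suc n) w), X (Suc n) w) else 0) \<partial>M)"
    unfolding step_compensator[OF G] by (simp add: mark_norm_def)
  also have "\<dots> = (\<integral>\<^sup>+w. 0 \<partial>M)"
    by (rule nn_integral_cong_AE) (use zero in \<open>auto elim: eventually_mono\<close>)
  finally have int0: "(\<integral>\<^sup>+w. (\<integral>\<^sup>+s\<in>{\<sigma> n w<..\<sigma> (Suc n) w}. mark_norm Z w s \<partial>dA w) \<partial>M) = 0" by simp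
  let ?k = "\<lambda>p. indicator (step n) p * mark_norm Z (fst p) (snd p)"
  have k: "?k \<in> borel_measurable PRE" using mark_norm_measurable[OF Z] by measurable
  have eq: "(\<integral>\<^sup>+s. ?k (w, s) \<partial>dA w) = (\<integral>\<^sup>+s\<in>{\<sigma> n w<..\<sigma> (Suc n) w}. mark_norm Z w s \<partial>dA w)" if "w \<in> \<Omega>" for w
    using that by (intro nn_integral_cong) (auto simp: indicator_def step_def space_dA)
  have "(\<integral>\<^sup>+w. (\<integral>\<^sup>+s. ?k (w, s) \<partial>dA w) \<partial>M) = 0" using int0 eq by (simp cong: nn_integral_cong_simp)
  then have "AE w in M. (\<integral>\<^sup>+s. ?k (w, s) \<partial>dA w) = 0"
    using F_measurable_M[OF nn_integral_\<nu>_measurable[OF k]] by (simp add: nn_integral_0_iff_AE)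
  then show ?thesis using AE_space
  proof eventually_elim
    case (elim w)
    then have "AE s in dA w. ?k (w, s) = 0"
      using dA_measurable[OF elim(2) k] by (simp add: nn_integral_0_iff_AE)
    then show ?case using AE_space
      by eventually_elim (use elim in \<open>auto simp: step_def space_dA indicator_def split: if_splits\<close>)
  qed
qed

text \<open>
  If two solutions agree at the next jump, the jump \<open>Z - Z'\<close> there is the difference of the left
  limits with the sign changed. By the compensator formula this holds almost everywhere between the
  two jumps, so that the driver becomes Lipschitz in the left limits alone.
\<close>

lemma mean_driver_difference:
  assumes sol: "solution_from n Y Z" and sol': "solution_from n Y' Z'"
    and agree: "AE w in M. S (Suc n) w \<le> ennreal T \<longrightarrow> Y w (\<sigma> (Suc n) w) = Y' w (\<sigma> (Suc n) w)"
  shows "AE w in M. AE s in dA w. S n w \<le> ennreal T \<longrightarrow> s \<in> {\<sigma> n w<..\<sigma> (Suc n) w} \<longrightarrow>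
    ennreal \<bar>mean_driver Y Z w s - mean_driver Y' Z' w s\<bar> \<le> ennreal (L + L') * ennreal \<bar>left_process Y (w, s) - left_process Y' (w, s)\<bar>"
proof -
  note Yl = solution_left_process[OF sol] solution_left_process[OF sol']
  note Z = solution_predictable[OF sol] solution_predictable[OF sol']
  define D where "D = (\<lambda>w s x. Z w s x - Z' w s x)"
  define yd where "yd = (\<lambda>p. left_process Y p - left_process Y' p)"
  have yd: "yd \<in> borel_measurable PRE" using Yl unfolding yd_def by measurable
  have D: "pred_process D" unfolding D_def by (rule predictable_diff[OF Z])
  have "AE w in M. S (Suc n) w \<le> ennreal T \<longrightarrow> D w (\<sigma> (Suc n) w) (X (Suc n) w) + yd (w, \<sigma> (Suc n) w) = 0"
    using path_between_jumps[OF sol] path_between_jumps[OF sol'] agree AE_space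
  proof eventually_elim
    case (elim w)
    show ?case
    proof
      assume S': "S (Suc n) w \<le> ennreal T"
      then have Sn: "S n w \<le> ennreal T" using S_Suc[OF elim(4)] order_trans by blast
      have "S n w < ennreal T" using S_less[OF elim(4) Sn] S' by simp
      then have b: "\<sigma> (Suc n) w \<in> {\<sigma> n w<..\<sigma> (Suc n) w}" using \<sigma>_strict[OF elim(4)] by simp
      from elim(1)[rule_format, OF Sn] obtain y B where "continuous_piece n Y Z w y B" by blast
      note y = continuous_pieceD(6)[OF this, OF b] continuous_pieceD(10)[OF this, OF S']
      from elim(2)[rule_format, OF Sn] obtain y' B' where "continuous_piece n Y' Z' w y' B'" by blast
      note y' = continuous_pieceD(6)[OF this, OF b] continuous_pieceD(10)[OF this, OF S']
      show "D w (\<sigma> (Suc n) w) (X (Suc n) w) + yd (w, \<sigma> (Suc n) w) = 0"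
        using y y' elim(3) S' by (simp add: D_def yd_def)
    qed
  qed
  from mark_norm_zero_between[OF predictable_add_process[OF D yd] this]
  show ?thesis using AE_driver_finite[OF sol] AE_driver_finite[OF sol'] AE_space
  proof eventually_elim
    case (elim w)
    note w = elim(4)
    let ?I = "\<lambda>Y Z s. \<integral>\<^sup>+x. ennreal \<bar>driver (left_process Y) Z ((w, s), x)\<bar> \<partial>\<phi> w s"
    have Im: "(\<lambda>s. ?I Y Z s) \<in> borel_measurable (dA w)" if "left_process Y \<in> borel_measurable PRE" "pred_process Z" for Y Z
      using dA_measurable[OF w \<phi>_nn_integral[of "\<lambda>z. ennreal \<bar>driver (left_process Y) Z z\<bar>"]] driver_measurable[OF that] by simp
    have Jm: "(\<lambda>s. ?I Y Z s * indicator {\<sigma> n w<..T} s) \<in> borel_measurable (dA w)"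
      if "left_process Y \<in> borel_measurable PRE" "pred_process Z" for Y Z
      using Im[OF that] Ioc_dA[OF w] \<sigma>_range(2) by (intro borel_measurable_times_ennreal borel_measurable_indicator) auto
    have fin: "AE s in dA w. ?I Y Z s * indicator {\<sigma> n w<..T} s \<noteq> \<infinity>" "AE s in dA w. ?I Y' Z' s * indicator {\<sigma> n w<..T} s \<noteq> \<infinity>"
      using elim(2,3) nn_integral_noteq_infinite[OF Jm[OF Yl(1) Z(1)]] nn_integral_noteq_infinite[OF Jm[OF Yl(2) Z(2)]]
      by (simp_all add: less_top[symmetric])
    from elim(1) fin show ?case using AE_space
    proof eventually_elim
      case (elim s)
      show ?case
      proof (intro impI)
        assume s: "s \<in> {\<sigma> n w<..\<sigma> (Suc n) w}"
        have sT: "s \<in> {0..T}" using elim(4) space_dA[OF w] by simp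
        have dm: "(\<lambda>x. driver (left_process Y) Z ((w, s), x)) \<in> borel_measurable (\<phi> w s)"
          if "left_process Y \<in> borel_measurable PRE" "pred_process Z" for Y Z
          using predictable_mark_section[OF driver_measurable[OF that] w sT] sets_\<phi>[OF w sT]
          by (simp cong: measurable_cong_sets)
        have i: "integrable (\<phi> w s) (\<lambda>x. driver (left_process Y) Z ((w, s), x))"
          "integrable (\<phi> w s) (\<lambda>x. driver (left_process Y') Z' ((w, s), x))"
          using elim(2,3) s sT dm[OF Yl(1) Z(1)] dm[OF Yl(2) Z(2)] by (auto simp: integrable_iff_bounded less_top)
        have "ennreal \<bar>mean_driver Y Z w s - mean_driver Y' Z' w s\<bar>
          = ennreal (norm (LINT x|\<phi> w s. driver (left_process Y) Z ((w, s), x) - driver (left_process Y') Z' ((w, s), x)))"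
          unfolding mean_driver_def using i by simp
        also have "\<dots> \<le> (\<integral>\<^sup>+x. ennreal \<bar>driver (left_process Y) Z ((w, s), x) - driver (left_process Y') Z' ((w, s), x)\<bar> \<partial>\<phi> w s)"
          using integral_norm_bound_ennreal[OF Bochner_Integration.integrable_diff[OF i]] by simp
        also have "\<dots> \<le> ennreal (L' * \<bar>yd (w, s)\<bar>) + ennreal L * mark_norm D w s"
          using driver_lipschitz[OF w sT Z Yl] by (simp add: yd_def D_def)
        also have "\<dots> \<le> ennreal (L' * \<bar>yd (w, s)\<bar>) + ennreal L * ennreal \<bar>yd (w, s)\<bar>"
        proof -
          have "mark_norm D w s \<le> mark_norm (\<lambda>w s x. D w s x + yd (w, s)) w s + ennreal \<bar>yd (w, s)\<bar>"
            by (rule mark_norm_triangle[OF w sT D yd])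
          moreover have "mark_norm (\<lambda>w s x. D w s x + yd (w, s)) w s = 0" by (rule elim(1)[rule_format, OF s])
          ultimately have "mark_norm D w s \<le> ennreal \<bar>yd (w, s)\<bar>" by (simp only: add_0_left)
          from mult_left_mono[OF this zero_le] show ?thesis by (rule add_left_mono)
        qed
        also have "\<dots> = ennreal (L + L') * ennreal \<bar>left_process Y (w, s) - left_process Y' (w, s)\<bar>"
          unfolding yd_def by (rule ennreal_linear_combination) (use L_nonneg in auto)
        finally show "ennreal \<bar>mean_driver Y Z w s - mean_driver Y' Z' w s\<bar> \<le> ennreal (L + L') * ennreal \<bar>left_process Y (w, s) - left_process Y' (w, s)\<bar>" .
      qed
    qed
  qed
qed

lemma unique_between_jumps:
  assumes sol: "solution_from n Y Z" and sol': "solution_from n Y' Z'"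
    and agree: "AE w in M. S (Suc n) w \<le> ennreal T \<longrightarrow> Y w (\<sigma> (Suc n) w) = Y' w (\<sigma> (Suc n) w)"
    and A2: "AE w in M. real_cond_exp M (pre_sigma (S n)) (indicator {w \<in> \<Omega>. S (Suc n) w > ennreal T}) w > 0"
  shows "AE w in M. S n w \<le> ennreal T \<longrightarrow>
     Y w (\<sigma> n w) = Y' w (\<sigma> n w) \<and> (\<forall>t\<in>{\<sigma> n w..<\<sigma> (Suc n) w}. Y w t = Y' w t) \<and>
     (ennreal T < S (Suc n) w \<longrightarrow> Y w T = Y' w T)"
proof -
  have K: "0 \<le> L + L'" using L_nonneg by simp
  \<comment> \<open>Gronwall's inequality at a fixed \<open>w\<close>: backwards if no jump follows, and then forwards in any case.\<close>
  have path: "AE w in M. S n w \<le> ennreal T \<longrightarrow>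
     (ennreal T < S (Suc n) w \<longrightarrow> Y w (\<sigma> n w) = Y' w (\<sigma> n w)) \<and>
     (Y w (\<sigma> n w) = Y' w (\<sigma> n w) \<longrightarrow> (\<forall>t\<in>{\<sigma> n w..<\<sigma> (Suc n) w}. Y w t = Y' w t)) \<and>
     (ennreal T < S (Suc n) w \<longrightarrow> Y w T = Y' w T)"
    using path_between_jumps[OF sol] path_between_jumps[OF sol'] mean_driver_difference[OF sol sol' agree] AE_space
  proof eventually_elim
    case (elim w)
    note w = elim(4)
    interpret continuous_increasing_path T "A w" by (rule continuous_A_path[OF w])
    let ?a = "\<sigma> n w" and ?b = "\<sigma> (Suc n) w"
    let ?k = "mean_driver Y Z w" and ?k' = "mean_driver Y' Z' w"
    show ?case
    proof (intro impI)
      assume Sn: "S n w \<le> ennreal T"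
      from elim(1)[rule_format, OF Sn] obtain y B where piece: "continuous_piece n Y Z w y B" by blast
      note k = continuous_pieceD(1)[OF piece] and y = continuous_pieceD(2-9)[OF piece]
      from elim(2)[rule_format, OF Sn] obtain y' B' where piece': "continuous_piece n Y' Z' w y' B'" by blast
      note k' = continuous_pieceD(1)[OF piece'] and y' = continuous_pieceD(2-9)[OF piece']
      let ?d = "\<lambda>t. y t - y' t"
      have ab: "0 \<le> ?a" "?a \<le> ?b" "?b \<le> T" using \<sigma>_range \<sigma>_mono[OF w, of n "Suc n"] by auto
      have d_bound: "\<bar>?d t\<bar> \<le> B + B'" if "t \<in> {?a..?b}" for t using y(1)[OF that] y'(1)[OF that] by linarith
      have k_diff: "(\<integral>\<^sup>+s\<in>{u<..v}. ennreal \<bar>?k s - ?k' s\<bar> \<partial>dA w) \<le> ennreal (L + L') * (\<integral>\<^sup>+s\<in>{u<..v}. ennreal \<bar>?d s\<bar> \<partial>dA w)"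
        if "?a \<le> u" "v \<le> ?b" for u v
      proof -
        have m: "(\<lambda>s. left_process Y (w, s) - left_process Y' (w, s)) \<in> borel_measurable (dA w)"
          using dA_measurable[OF w solution_left_process[OF sol]] dA_measurable[OF w solution_left_process[OF sol']] by measurable
        have "{u<..v} \<in> sets (dA w)" using that ab by (intro Ioc_dA[OF w]) auto
        with m have m': "(\<lambda>s. ennreal \<bar>left_process Y (w, s) - left_process Y' (w, s)\<bar> * indicator {u<..v} s) \<in> borel_measurable (dA w)"
          by measurable
        have "(\<integral>\<^sup>+s\<in>{u<..v}. ennreal \<bar>?k s - ?k' s\<bar> \<partial>dA w)
          \<le> (\<integral>\<^sup>+s. ennreal (L + L') * (ennreal \<bar>left_process Y (w, s) - left_process Y' (w, s)\<bar> * indicator {u<..v} s) \<partial>dA w)"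
          by (rule nn_integral_mono_AE) (use elim(3) Sn that in \<open>auto elim!: eventually_mono simp: indicator_def\<close>)
        also have "\<dots> = ennreal (L + L') * (\<integral>\<^sup>+s. ennreal \<bar>left_process Y (w, s) - left_process Y' (w, s)\<bar> * indicator {u<..v} s \<partial>dA w)"
          using m' by (rule nn_integral_cmult)
        also have "(\<integral>\<^sup>+s. ennreal \<bar>left_process Y (w, s) - left_process Y' (w, s)\<bar> * indicator {u<..v} s \<partial>dA w)
            = (\<integral>\<^sup>+s\<in>{u<..v}. ennreal \<bar>?d s\<bar> \<partial>dA w)"
          using that y(5) y'(5) by (intro nn_integral_cong) (auto simp: indicator_def)
        finally show ?thesis .
      qed
      have sub: "set_integrable (dA w) {u<..v} ?k" "set_integrable (dA w) {u<..v} ?k'" if "?a \<le> u" "v \<le> ?b" for u v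
      proof -
        have "{u<..v} \<in> sets (dA w)" using that ab by (intro Ioc_dA[OF w]) auto
        moreover have "{u<..v} \<subseteq> {?a<..T}" using that ab by auto
        ultimately have * : "{u<..v} \<in> sets (dA w)" "{u<..v} \<subseteq> {?a<..T}" .
        show "set_integrable (dA w) {u<..v} ?k" "set_integrable (dA w) {u<..v} ?k'"
          using set_integrable_subset[OF k *] set_integrable_subset[OF k' *] by simp_all
      qed
      show "(ennreal T < S (Suc n) w \<longrightarrow> Y w ?a = Y' w ?a) \<and> (Y w ?a = Y' w ?a \<longrightarrow> (\<forall>t\<in>{?a..<?b}. Y w t = Y' w t)) \<and>
          (ennreal T < S (Suc n) w \<longrightarrow> Y w T = Y' w T)"
      proof (intro conjI impI)
        assume S': "ennreal T < S (Suc n) w"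
        then have b: "?b = T" by (intro \<sigma>_eq_T) simp
        have "\<bar>?d ?a\<bar> \<le> 2 * 0 * exp (2 * (L + L') * A w T)"
        proof (rule backward_gronwall[of ?a ?b 0 "L + L'" ?d "B + B'"])
          fix t assume t: "t \<in> {?a..?b}"
          have "?d t = (LINT s:{t<..?b}|dA w. ?k s) - (LINT s:{t<..?b}|dA w. ?k' s)"
            using y(3)[OF t] y'(3)[OF t] y(7)[OF S'] y'(7)[OF S'] b by simp
          then show "ennreal \<bar>?d t\<bar> \<le> ennreal 0 + ennreal (L + L') * (\<integral>\<^sup>+s\<in>{t<..?b}. ennreal \<bar>?d s\<bar> \<partial>dA w)"
            using set_integral_diff_bound[OF sub, of t ?b] k_diff[of t ?b] t by (auto intro: order_trans)
        qed (use ab K d_bound in auto)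
        then show "Y w ?a = Y' w ?a" using y(6) y'(6) by simp
      next
        assume eq: "Y w ?a = Y' w ?a"
        have d0: "\<bar>?d t\<bar> \<le> 2 * 0 * exp (2 * (L + L') * A w T)" if t: "t \<in> {?a<..?b}" for t
        proof (rule forward_gronwall[of ?a ?b 0 "L + L'" ?d "B + B'"])
          fix t assume t: "t \<in> {?a<..?b}"
          then have "t \<in> {?a..?b}" by simp
          then have "\<bar>?d t\<bar> = \<bar>(LINT s:{?a<..t}|dA w. ?k s) - (LINT s:{?a<..t}|dA w. ?k' s)\<bar>"
            using y(2)[of t] y'(2)[of t] y(6) y'(6) eq by simp
          then show "ennreal \<bar>?d t\<bar> \<le> ennreal 0 + ennreal (L + L') * (\<integral>\<^sup>+s\<in>{?a<..t}. ennreal \<bar>?d s\<bar> \<partial>dA w)"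
            using set_integral_diff_bound[OF sub, of ?a t] k_diff[of ?a t] t by (auto intro: order_trans)
        qed (use ab K d_bound t in auto)
        show "\<forall>t\<in>{?a..<?b}. Y w t = Y' w t"
        proof
          fix t assume t: "t \<in> {?a..<?b}"
          show "Y w t = Y' w t"
          proof (cases "t = ?a")
            case False
            then have "t \<in> {?a<..?b}" using t by simp
            from d0[OF this] show ?thesis using y(4)[OF t] y'(4)[OF t] by simp
          qed (use eq in simp)
        qed
      next
        assume "ennreal T < S (Suc n) w"
        then show "Y w T = Y' w T" using y(8) y'(8) by simp
      qed
    qed
  qed
  \<comment> \<open>Whether the two values at \<open>S n\<close> differ is known at \<open>S n\<close>, and a later jump is never certain.\<close>
  define D where "D = {w \<in> \<Omega>. S n w \<le> ennreal T \<and> Y w (\<sigma> n w) \<noteq> Y' w (\<sigma> n w)}"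
  have D_pre: "D \<in> sets (pre_sigma (S n))"
  proof -
    have m: "(\<lambda>w. if S n w \<le> ennreal T then V w (enn2real (S n w)) else 0) \<in> borel_measurable (pre_sigma (S n))"
      if "adapted F T V" "\<forall>w\<in>\<Omega>. cadlag T (V w)" for V
      using value_at_stopping_time[OF that(1) _ stopping_time_S] that(2) by blast
    note m = m[of Y] m[of Y']
    have "{w \<in> space (pre_sigma (S n)). (if S n w \<le> ennreal T then Y w (enn2real (S n w)) else 0)
         \<noteq> (if S n w \<le> ennreal T then Y' w (enn2real (S n w)) else 0)} \<in> sets (pre_sigma (S n))"
      using m sol sol' by (intro borel_measurable_neq) (auto simp: solution_from_def)
    also have "{w \<in> space (pre_sigma (S n)). (if S n w \<le> ennreal T then Y w (enn2real (S n w)) else 0)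
         \<noteq> (if S n w \<le> ennreal T then Y' w (enn2real (S n w)) else 0)} = D"
      by (auto simp: D_def space_pre_sigma \<sigma>_def min_absorb1)
    finally show ?thesis .
  qed
  interpret sub: finite_measure_subalgebra M "pre_sigma (S n)"
    using pre_sigma_subset_M by unfold_locales (auto simp: subalgebra_def space_pre_sigma)
  have DM: "D \<in> sets M" using D_pre pre_sigma_subset_M by auto
  have SM: "{w \<in> \<Omega>. S (Suc n) w > ennreal T} \<in> sets M" using S_measurable_M[of "Suc n"] by measurable
  let ?c = "real_cond_exp M (pre_sigma (S n)) (indicator {w \<in> \<Omega>. S (Suc n) w > ennreal T})"
  have ind: "integrable M (indicator {w \<in> \<Omega>. S (Suc n) w > ennreal T} :: _ \<Rightarrow> real)"
    by (intro integrable_real_indicator SM) (simp add: emeasure_eq_measure)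
  have "(LINT w:D|M. ?c w) = (LINT w:D|M. indicator {w \<in> \<Omega>. S (Suc n) w > ennreal T} w)"
    by (rule sub.real_cond_exp_intA[OF ind D_pre, symmetric])
  also have "\<dots> = 0"
  proof -
    have "AE w in M. \<not> (w \<in> D \<and> w \<in> {w \<in> \<Omega>. S (Suc n) w > ennreal T})"
      using path unfolding D_def by eventually_elim blast
    then have "AE w in M. indicator D w *\<^sub>R indicator {w \<in> \<Omega>. S (Suc n) w > ennreal T} w = (0 :: real)"
      by eventually_elim (simp only: indicator_def split: if_split, simp)
    then show ?thesis unfolding set_lebesgue_integral_def by (rule integral_eq_zero_AE)
  qed
  finally have "(LINT w|M. indicator D w *\<^sub>R ?c w) = 0" unfolding set_lebesgue_integral_def .
  moreover have "integrable M (\<lambda>w. indicator D w *\<^sub>R ?c w)"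
    using sub.real_cond_exp_int(1)[OF ind] DM by (intro integrable_mult_indicator)
  moreover have "AE w in M. 0 \<le> indicator D w *\<^sub>R ?c w"
    using A2 by eventually_elim (auto simp: indicator_def)
  ultimately have "AE w in M. indicator D w *\<^sub>R ?c w = 0"
    by (simp add: integral_nonneg_eq_0_iff_AE)
  then have "AE w in M. w \<notin> D"
    using A2 by eventually_elim (auto simp: indicator_def split: if_splits)
  then show ?thesis using path AE_space
    unfolding D_def by eventually_elim blast
qed

text \<open>  Backward induction, starting at a jump that almost surely never comes.\<close>

lemma unique_from:
  assumes A2: "\<And>n. AE w in M. real_cond_exp M (pre_sigma (S n)) (indicator {w \<in> \<Omega>. S (Suc n) w > ennreal T}) w > 0"
    and last: "AE w in M. S N w = \<infinity>" and n: "n \<le> N"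
    and sol: "solution_from n Y Z" "solution_from n Y' Z'"
  shows "AE w in M. \<forall>t\<in>{0..T}. S n w \<le> ennreal t \<longrightarrow> Y w t = Y' w t"
  using n sol
proof (induction n rule: inc_induct)
  case base
  show ?case using last by eventually_elim (auto simp: top_unique)
next
  case (step n)
  have IH: "AE w in M. \<forall>t\<in>{0..T}. S (Suc n) w \<le> ennreal t \<longrightarrow> Y w t = Y' w t"
    using step by (intro step.IH solution_from_Suc)
  then have "AE w in M. S (Suc n) w \<le> ennreal T \<longrightarrow> Y w (\<sigma> (Suc n) w) = Y' w (\<sigma> (Suc n) w)"
    by eventually_elim (use \<sigma>_range(1) S_eq_\<sigma> in \<open>simp del: atLeastAtMost_iff\<close>)
  from unique_between_jumps[OF step.prems this A2] IH AE_space
  show ?case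
  proof eventually_elim
    case (elim w)
    show ?case
    proof (intro ballI impI)
      fix t assume t: "t \<in> {0..T}" "S n w \<le> ennreal t"
      show "Y w t = Y' w t"
      proof (cases "S (Suc n) w \<le> ennreal t")
        case True then show ?thesis using elim(2) t by blast
      next
        case False
        have Sn: "S n w \<le> ennreal T" using t ennreal_leI[of t T] by (auto intro: order_trans)
        have "\<sigma> n w \<le> t" using \<sigma>_le_iff[OF t(1), of n w] Sn t by simp
        consider "t < \<sigma> (Suc n) w" | "t = T" "ennreal T < S (Suc n) w"
          using \<sigma>_le_iff[OF t(1), of "Suc n" w] False t by force
        then show ?thesis
          by cases (use elim(1) Sn \<open>\<sigma> n w \<le> t\<close> in auto)
      qed
    qed
  qed
qed

end

section \<open>Integrability of solutions when the compensator is bounded\<close>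

locale bounded_bsde = bsde M T \<Delta> S X F A \<phi> f L L' \<xi>
  for M :: "'w measure" and T :: real and \<Delta> :: "'e::topological_space"
    and S :: "nat \<Rightarrow> 'w \<Rightarrow> ennreal" and X :: "nat \<Rightarrow> 'w \<Rightarrow> 'e" and F :: "ennreal \<Rightarrow> 'w measure"
    and A :: "'w \<Rightarrow> real \<Rightarrow> real" and \<phi> :: "'w \<Rightarrow> real \<Rightarrow> 'e measure"
    and f :: "'w \<Rightarrow> real \<Rightarrow> 'e \<Rightarrow> real \<Rightarrow> ('e \<Rightarrow> real) \<Rightarrow> real" and L L' :: real and \<xi> :: "'w \<Rightarrow> real" +
  fixes C :: real
  assumes A_bounded: "w \<in> space M \<Longrightarrow> A w T \<le> C"
    and \<xi>_integrable: "integrable M \<xi>"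
    and f0_integrable: "(\<integral>\<^sup>+w. \<integral>\<^sup>+s. f0 w s \<partial>dA w \<partial>M) < \<infinity>"
begin

lemma A_le_C: "w \<in> \<Omega> \<Longrightarrow> 0 \<le> t \<Longrightarrow> t \<le> T \<Longrightarrow> A w t \<le> C"
  using A_le[of w t T] A_bounded[of w] by linarith

lemma A_at_\<sigma>_measurable: "(\<lambda>w. A w (\<sigma> n w)) \<in> borel_measurable M"
proof -
  have "adapted F T A"
    unfolding adapted_def using PRE_slice[OF A_predictable] by auto
  moreover have "cadlag T (A w)" if "w \<in> \<Omega>" for w using A_path[OF that] by (simp add: increasing_path_def)
  ultimately have "(\<lambda>w. A w (enn2real (min (S n w) (ennreal T)))) \<in> borel_measurable (F (ennreal T))"
    using T_pos by (intro value_at_stopping_time_F stopping_time_S) auto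
  then show ?thesis unfolding \<sigma>_def by (rule F_measurable_M)
qed

lemma S_sets_M [measurable]: "{w \<in> \<Omega>. S n w \<le> ennreal T} \<in> sets M" "{w \<in> \<Omega>. ennreal T < S n w} \<in> sets M"
  using S_measurable_M[of n] by measurable

text \<open>
  With a bounded compensator the point process survives without a further jump until \<open>T\<close> with
  conditional probability at least \<open>exp (- C)\<close>. The reason is that \<open>exp A\<close>, killed at the next jump,
  is a martingale: its growth \<open>exp A dA\<close> compensates its loss \<open>exp A d\<mu>\<close>.
\<close>

lemma survival_bounded:
  fixes W :: "'w \<Rightarrow> ennreal"
  assumes W: "W \<in> borel_measurable (pre_sigma (S n))" and bound: "\<And>w. W w \<le> ennreal j"
  shows "(\<integral>\<^sup>+w. W w * indicator {w\<in>\<Omega>. S n w \<le> ennreal T} w \<partial>M)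
    \<le> ennreal (exp C) * (\<integral>\<^sup>+w. W w * indicator (gap n (ennreal T)) w \<partial>M)"
proof -
  let ?E = "{w\<in>\<Omega>. S n w \<le> ennreal T}" and ?E' = "{w\<in>\<Omega>. S (Suc n) w \<le> ennreal T}" and ?G = "gap n (ennreal T)"
  have WM [measurable]: "W \<in> borel_measurable M"
    using W pre_sigma_subset_M by (auto simp: measurable_def space_pre_sigma)
  have [measurable]: "?G \<in> sets M"
  proof -
    have "?G = ?E \<inter> {w \<in> \<Omega>. ennreal T < S (Suc n) w}" by (auto simp: gap_def)
    then show ?thesis by simp
  qed
  let ?a = "\<lambda>w. ennreal (exp (A w (\<sigma> n w)))" and ?b = "\<lambda>w. ennreal (exp (A w (\<sigma> (Suc n) w)))"
  note [measurable] = A_at_\<sigma>_measurable[of n] A_at_\<sigma>_measurable[of "Suc n"]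
  \<comment> \<open>The integrand \<open>W exp A\<close> on the stretch after \<open>S n\<close>; against \<open>dA\<close> it integrates to the growth of \<open>W exp A\<close>.\<close>
  let ?g = "\<lambda>z. (if fst z \<in> after (S n) then W (fst (fst z)) else 0) * ennreal (exp (A (fst (fst z)) (snd (fst z))))"
  have "(\<lambda>x. (if x \<in> after (S n) then W (fst x) else 0) * ennreal (exp (A (fst x) (snd x)))) \<in> borel_measurable PRE"
    using after_measurable[OF stopping_time_S W, of 0] A_predictable by (simp add: case_prod_unfold)
  from measurable_compose[OF measurable_fst this]
  have "?g \<in> borel_measurable (PRE \<Otimes>\<^sub>M borel)" .
  note comp = step_compensator[OF this, of n]
  let ?R = "\<integral>\<^sup>+w. W w * indicator ?E w * (?b w - ?a w) \<partial>M"
  have "(\<integral>\<^sup>+w. W w * indicator ?E' w * ?b w \<partial>M)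
      = (\<integral>\<^sup>+w. (if S (Suc n) w \<le> ennreal T then ?g ((w, \<sigma> (Suc n) w), X (Suc n) w) else 0) \<partial>M)"
  proof (rule nn_integral_cong)
    fix w assume w: "w \<in> \<Omega>"
    show "W w * indicator ?E' w * ?b w = (if S (Suc n) w \<le> ennreal T then ?g ((w, \<sigma> (Suc n) w), X (Suc n) w) else 0)"
    proof (cases "S (Suc n) w \<le> ennreal T")
      case True
      then have "S n w \<le> ennreal T" using S_Suc[OF w] order_trans by blast
      then have "S n w < S (Suc n) w" by (rule S_less[OF w])
      then have "S n w < ennreal T" using True by (rule less_le_trans)
      then have "(w, \<sigma> (Suc n) w) \<in> after (S n)"
        using \<sigma>_strict[OF w, of n] \<sigma>_less_iff[OF \<sigma>_range(1), of n w "Suc n" w] w \<sigma>_range[of "Suc n" w] by (simp add: after_def)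
      then show ?thesis using w True by simp
    qed (use w in simp)
  qed
  also have "\<dots> = ?R"
    unfolding comp
  proof (rule nn_integral_cong)
    fix w assume w: "w \<in> \<Omega>"
    interpret path: continuous_increasing_path T "A w" by (rule continuous_A_path[OF w])
    have ab: "0 \<le> \<sigma> n w" "\<sigma> n w \<le> \<sigma> (Suc n) w" "\<sigma> (Suc n) w \<le> T" using \<sigma>_range \<sigma>_mono[OF w] by auto
    have "(\<integral>\<^sup>+s\<in>{\<sigma> n w<..\<sigma> (Suc n) w}. (\<integral>\<^sup>+x. ?g ((w, s), x) \<partial>\<phi> w s) \<partial>dA w)
      = (\<integral>\<^sup>+s. (W w * indicator ?E w) * (ennreal (exp (A w s)) * indicator {\<sigma> n w<..\<sigma> (Suc n) w} s) \<partial>dA w)"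
    proof (rule nn_integral_cong)
      fix s assume "s \<in> space (dA w)"
      then have s: "s \<in> {0..T}" using space_dA[OF w] by simp
      interpret p: prob_space "\<phi> w s" by (rule \<phi>_prob[OF w s])
      show "(\<integral>\<^sup>+x. ?g ((w, s), x) \<partial>\<phi> w s) * indicator {\<sigma> n w<..\<sigma> (Suc n) w} s
        = (W w * indicator ?E w) * (ennreal (exp (A w s)) * indicator {\<sigma> n w<..\<sigma> (Suc n) w} s)"
      proof (cases "s \<in> {\<sigma> n w<..\<sigma> (Suc n) w}")
        case True
        then have l: "S n w < ennreal s" using \<sigma>_less_iff[OF s, of n w] by simp
        then have "(w, s) \<in> after (S n)" using w s by (simp add: after_def)
        moreover have "ennreal s \<le> ennreal T" using s by (intro ennreal_leI) simp
        then have "S n w \<le> ennreal T" using l by (meson less_imp_le order_trans)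
        ultimately show ?thesis using True w by (simp add: p.emeasure_space_1)
      qed simp
    qed
    also have "\<dots> = (W w * indicator ?E w) * (\<integral>\<^sup>+s\<in>{\<sigma> n w<..\<sigma> (Suc n) w}. ennreal (exp (A w s)) \<partial>dA w)"
    proof (rule nn_integral_cmult)
      have "{\<sigma> n w<..\<sigma> (Suc n) w} \<in> sets (dA w)" using ab by (intro Ioc_dA[OF w])
      then show "(\<lambda>s. ennreal (exp (A w s)) * indicator {\<sigma> n w<..\<sigma> (Suc n) w} s) \<in> borel_measurable (dA w)"
        using path.a_measurable by measurable
    qed
    also have "(\<integral>\<^sup>+s\<in>{\<sigma> n w<..\<sigma> (Suc n) w}. ennreal (exp (A w s)) \<partial>dA w) = ennreal (exp (A w (\<sigma> (Suc n) w)) - exp (A w (\<sigma> n w)))"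
      using ab by (intro path.nn_integral_stieltjes_derivative[where g=exp and G=exp]) (auto intro!: derivative_eq_intros)
    also have "\<dots> = ?b w - ?a w" by (rule ennreal_minus[symmetric]) simp
    finally show "(\<integral>\<^sup>+s\<in>{\<sigma> n w<..\<sigma> (Suc n) w}. (\<integral>\<^sup>+x. ?g ((w, s), x) \<partial>\<phi> w s) \<partial>dA w) = W w * indicator ?E w * (?b w - ?a w)" .
  qed
  finally have R: "(\<integral>\<^sup>+w. W w * indicator ?E' w * ?b w \<partial>M) = ?R" .
  have b_le: "?b w \<le> ennreal (exp C)" if "w \<in> \<Omega>" for w
    using A_le_C[OF that] \<sigma>_range[of "Suc n" w] by (intro ennreal_leI) auto
  have R_fin: "?R \<noteq> \<infinity>"
  proof -
    have "?R \<le> (\<integral>\<^sup>+w. ennreal j * ennreal (exp C) \<partial>M)"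
    proof (rule nn_integral_mono)
      fix w assume w: "w \<in> \<Omega>"
      have "W w * indicator ?E w \<le> ennreal j" using bound[of w] by (simp add: indicator_def)
      moreover have "?b w - ?a w \<le> ennreal (exp C)" using b_le[OF w] by (meson diff_le_self_ennreal order_trans)
      ultimately show "W w * indicator ?E w * (?b w - ?a w) \<le> ennreal j * ennreal (exp C)" by (rule mult_mono) auto
    qed
    also have "\<dots> < \<infinity>" by (simp add: emeasure_space_1 ennreal_mult_less_top)
    finally show ?thesis by simp
  qed
  have split: "W w * indicator ?E w * (?b w - ?a w) + W w * indicator ?E w * ?a w
     = W w * indicator ?E' w * ?b w + W w * indicator ?G w * ?b w" if w: "w \<in> \<Omega>" for w
  proof -
    have "A w (\<sigma> n w) \<le> A w (\<sigma> (Suc n) w)"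
      using \<sigma>_range \<sigma>_mono[OF w, of n "Suc n"] by (intro A_le[OF w]) auto
    then have "(?b w - ?a w) + ?a w = ?b w" by (intro diff_add_cancel_ennreal ennreal_leI) simp
    then have "W w * indicator ?E w * (?b w - ?a w) + W w * indicator ?E w * ?a w = W w * indicator ?E w * ?b w"
      by (simp only: distrib_left[symmetric])
    also have "\<dots> = W w * (indicator ?E' w + indicator ?G w) * ?b w"
    proof -
      have "S n w \<le> S (Suc n) w" by (rule S_Suc[OF w])
      then have "S (Suc n) w \<le> ennreal T \<Longrightarrow> S n w \<le> ennreal T" by (rule order_trans)
      then show ?thesis using w by (cases "S (Suc n) w \<le> ennreal T") (simp_all add: indicator_def gap_def not_le[symmetric] del: not_le)
    qed
    finally show ?thesis by (simp only: distrib_left distrib_right)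
  qed
  have "?R + (\<integral>\<^sup>+w. W w * indicator ?E w * ?a w \<partial>M)
    = (\<integral>\<^sup>+w. W w * indicator ?E w * (?b w - ?a w) + W w * indicator ?E w * ?a w \<partial>M)"
    by (intro nn_integral_add[symmetric]) measurable
  also have "\<dots> = (\<integral>\<^sup>+w. W w * indicator ?E' w * ?b w + W w * indicator ?G w * ?b w \<partial>M)"
    using split by (rule nn_integral_cong)
  also have "\<dots> = ?R + (\<integral>\<^sup>+w. W w * indicator ?G w * ?b w \<partial>M)"
    unfolding R[symmetric] by (intro nn_integral_add) measurable
  finally have eq: "(\<integral>\<^sup>+w. W w * indicator ?E w * ?a w \<partial>M) = (\<integral>\<^sup>+w. W w * indicator ?G w * ?b w \<partial>M)"
    using R_fin by (simp add: ennreal_add_left_cancel)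
  have "(\<integral>\<^sup>+w. W w * indicator ?E w \<partial>M) \<le> (\<integral>\<^sup>+w. W w * indicator ?E w * ?a w \<partial>M)"
  proof (rule nn_integral_mono)
    fix w assume w: "w \<in> \<Omega>"
    have "1 \<le> ?a w" using A_nonneg[OF w, of "\<sigma> n w"] \<sigma>_range[of n w] ennreal_leI[of 1 "exp (A w (\<sigma> n w))"] by simp
    from mult_left_mono[OF this zero_le, of "W w * indicator ?E w"]
    show "W w * indicator ?E w \<le> W w * indicator ?E w * ?a w" by simp
  qed
  also have "\<dots> = (\<integral>\<^sup>+w. W w * indicator ?G w * ?b w \<partial>M)" by (rule eq)
  also have "\<dots> \<le> (\<integral>\<^sup>+w. ennreal (exp C) * (W w * indicator ?G w) \<partial>M)"
  proof (rule nn_integral_mono)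
    fix w assume w: "w \<in> \<Omega>"
    from mult_right_mono[OF b_le[OF w] zero_le, of "W w * indicator ?G w"]
    show "W w * indicator ?G w * ?b w \<le> ennreal (exp C) * (W w * indicator ?G w)" by (simp add: mult.commute)
  qed
  also have "\<dots> = ennreal (exp C) * (\<integral>\<^sup>+w. W w * indicator ?G w \<partial>M)"
    by (rule nn_integral_cmult) measurable
  finally show ?thesis .
qed

text \<open>
  Monotone convergence extends the inequality to unbounded \<open>W\<close>; for bounded \<open>W\<close> the term common to both
  sides of the balance is finite and can be subtracted.
\<close>

lemma survival:
  fixes W :: "'w \<Rightarrow> ennreal"
  assumes W: "W \<in> borel_measurable (pre_sigma (S n))"
  shows "(\<integral>\<^sup>+w. W w * indicator {w\<in>\<Omega>. S n w \<le> ennreal T} w \<partial>M)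
    \<le> ennreal (exp C) * (\<integral>\<^sup>+w. W w * indicator (gap n (ennreal T)) w \<partial>M)"
proof -
  let ?E = "{w\<in>\<Omega>. S n w \<le> ennreal T}"
  let ?W = "\<lambda>(j::nat) w. min (W w) (of_nat j)"
  have WM [measurable]: "W \<in> borel_measurable M"
    using W pre_sigma_subset_M by (auto simp: measurable_def space_pre_sigma)
  have inc: "incseq (\<lambda>j w. ?W j w * indicator ?E w)"
    by (intro incseq_SucI le_funI mult_right_mono min.mono) auto
  have sup: "(SUP j. ?W j w) = W w" for w
  proof (cases "W w = \<top>")
    case True then show ?thesis by (simp add: ennreal_SUP_of_nat_eq_top)
  next
    case False
    then obtain j :: nat where j: "W w \<le> of_nat j"
      by (metis ennreal_Ex_less_of_nat less_imp_le less_top)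
    show ?thesis
    proof (rule antisym)
      show "(SUP j. ?W j w) \<le> W w" by (rule SUP_least) simp
      show "W w \<le> (SUP j. ?W j w)" using j by (intro SUP_upper2[of j]) (auto simp: min_absorb1)
    qed
  qed
  have "(\<integral>\<^sup>+w. W w * indicator ?E w \<partial>M) = (\<integral>\<^sup>+w. (SUP j. ?W j w * indicator ?E w) \<partial>M)"
    by (simp only: SUP_mult_right_ennreal[symmetric] sup)
  also have "\<dots> = (SUP j. \<integral>\<^sup>+w. ?W j w * indicator ?E w \<partial>M)"
    by (rule nn_integral_monotone_convergence_SUP[OF inc]) measurable
  also have "\<dots> \<le> ennreal (exp C) * (\<integral>\<^sup>+w. W w * indicator (gap n (ennreal T)) w \<partial>M)"
  proof (rule SUP_least)
    fix j
    have "(\<integral>\<^sup>+w. ?W j w * indicator ?E w \<partial>M) \<le> ennreal (exp C) * (\<integral>\<^sup>+w. ?W j w * indicator (gap n (ennreal T)) w \<partial>M)"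
      by (rule survival_bounded[where j="real j"]) (use W in \<open>auto simp: ennreal_of_nat_eq_real_of_nat\<close>)
    also have "\<dots> \<le> ennreal (exp C) * (\<integral>\<^sup>+w. W w * indicator (gap n (ennreal T)) w \<partial>M)"
      by (intro mult_left_mono nn_integral_mono mult_right_mono) auto
    finally show "(\<integral>\<^sup>+w. ?W j w * indicator ?E w \<partial>M) \<le> ennreal (exp C) * (\<integral>\<^sup>+w. W w * indicator (gap n (ennreal T)) w \<partial>M)" .
  qed
  finally show ?thesis .
qed

lemma step_integral_measurable:
  fixes k :: "'w \<times> real \<Rightarrow> ennreal"
  assumes k: "k \<in> borel_measurable PRE"
  shows "(\<lambda>w. \<integral>\<^sup>+s\<in>{\<sigma> n w<..\<sigma> (Suc n) w}. k (w, s) \<partial>dA w) \<in> borel_measurable M"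
proof -
  have "(\<lambda>p. indicator (step n) p * k p) \<in> borel_measurable PRE" using k by measurable
  from F_measurable_M[OF nn_integral_\<nu>_measurable[OF this]]
  show ?thesis
  proof (rule measurable_cong[THEN iffD1, rotated])
    fix w assume w: "w \<in> \<Omega>"
    show "(\<integral>\<^sup>+s. indicator (step n) (w, s) * k (w, s) \<partial>dA w) = (\<integral>\<^sup>+s\<in>{\<sigma> n w<..\<sigma> (Suc n) w}. k (w, s) \<partial>dA w)"
      using w by (intro nn_integral_cong) (auto simp: indicator_def step_def space_dA)
  qed
qed

lemma mean_driver_bound:
  assumes sol: "solution_from n Y Z" and w: "w \<in> \<Omega>" and s: "s \<in> {0..T}"
  shows "ennreal \<bar>mean_driver Y Z w s\<bar> \<le> ennreal (L + L') * ennreal \<bar>left_process Y (w, s)\<bar>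
    + (ennreal L * mark_norm (\<lambda>w s x. Z w s x + left_process Y (w, s)) w s + f0 w s)"
proof -
  note Yl = solution_left_process[OF sol] and Z = solution_predictable[OF sol]
  let ?y = "left_process Y (w, s)" and ?r = "mark_norm (\<lambda>w s x. Z w s x + left_process Y (w, s)) w s"
  have "ennreal \<bar>mean_driver Y Z w s\<bar> \<le> (\<integral>\<^sup>+x. ennreal \<bar>driver (left_process Y) Z ((w, s), x)\<bar> \<partial>\<phi> w s)"
  proof (cases "integrable (\<phi> w s) (\<lambda>x. driver (left_process Y) Z ((w, s), x))")
    case True
    from integral_norm_bound_ennreal[OF this] show ?thesis by (simp add: mean_driver_def)
  next
    case False then show ?thesis by (simp add: mean_driver_def not_integrable_integral_eq)
  qed
  also have "\<dots> \<le> ennreal (L' * \<bar>?y\<bar>) + ennreal L * mark_norm Z w s + f0 w s"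
    by (rule driver_bound[OF w s Z Yl])
  also have "\<dots> \<le> ennreal (L' * \<bar>?y\<bar>) + ennreal L * (?r + ennreal \<bar>?y\<bar>) + f0 w s"
    by (intro add_right_mono add_left_mono mult_left_mono mark_norm_triangle[OF w s Z Yl] zero_le)
  also have "\<dots> = (ennreal (L' * \<bar>?y\<bar>) + ennreal L * ennreal \<bar>?y\<bar>) + (ennreal L * ?r + f0 w s)"
    by (simp only: distrib_left ac_simps)
  also have "ennreal (L' * \<bar>?y\<bar>) + ennreal L * ennreal \<bar>?y\<bar> = ennreal (L + L') * ennreal \<bar>?y\<bar>"
    by (rule ennreal_linear_combination) (use L_nonneg in auto)
  finally show ?thesis .
qed

text \<open>
  The process \<open>Z + Y\<^sub>-\<close> is the value to which \<open>Y\<close> would jump. Its integral up to the next jump has the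
  same mean as \<open>\<bar>Y\<bar>\<close> at that jump, and it controls the driver. Gronwall's inequality then controls
  \<open>Y\<close> at \<open>S n\<close> if no jump follows, survival transfers this bound to all \<open>w\<close>, and Gronwall's inequality in
  the forward direction controls \<open>Y\<close> up to the next jump.
\<close>

lemma estimate_between_jumps:
  assumes sol: "solution_from n Y Z"
    and next_fin: "(\<integral>\<^sup>+w. (if S (Suc n) w \<le> ennreal T then ennreal \<bar>Y w (\<sigma> (Suc n) w)\<bar> else 0) \<partial>M) < \<infinity>"
  shows "(\<integral>\<^sup>+w. (if S n w \<le> ennreal T then ennreal \<bar>Y w (\<sigma> n w)\<bar> else 0) \<partial>M) < \<infinity>"
    and "(\<integral>\<^sup>+w. (\<integral>\<^sup>+s\<in>{\<sigma> n w<..\<sigma> (Suc n) w}. ennreal \<bar>left_process Y (w, s)\<bar> \<partial>dA w) \<partial>M) < \<infinity>"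
    and "(\<integral>\<^sup>+w. (\<integral>\<^sup>+s\<in>{\<sigma> n w<..\<sigma> (Suc n) w}. mark_norm Z w s \<partial>dA w) \<partial>M) < \<infinity>"
proof -
  note Yl = solution_left_process[OF sol] and Z = solution_predictable[OF sol]
  let ?a = "\<sigma> n" and ?b = "\<sigma> (Suc n)"
  \<comment> \<open>The value to which \<open>Y\<close> would jump; it is \<open>Y\<close> itself at the next jump.\<close>
  define r where "r = (\<lambda>w s x. Z w s x + left_process Y (w, s))"
  have r: "pred_process r" unfolding r_def by (rule predictable_add_process[OF Z Yl])
  define g where "g p = ennreal L * mark_norm r (fst p) (snd p) + f0 (fst p) (snd p)" for p
  have g [measurable]: "g \<in> borel_measurable PRE"
    unfolding g_def using mark_norm_measurable[OF r] f0_measurable by measurable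
  define R where "R w = (\<integral>\<^sup>+s\<in>{?a w<..?b w}. mark_norm r w s \<partial>dA w)" for w
  define V where "V w = (\<integral>\<^sup>+s\<in>{?a w<..?b w}. g (w, s) \<partial>dA w)" for w
  have [measurable]: "V \<in> borel_measurable M" "R \<in> borel_measurable M"
    unfolding V_def R_def using step_integral_measurable[OF g] step_integral_measurable[OF mark_norm_measurable[OF r]] by simp_all
  have ER: "(\<integral>\<^sup>+w. R w \<partial>M) < \<infinity>"
  proof -
    let ?G = "\<lambda>z. ennreal \<bar>r (fst (fst z)) (snd (fst z)) (snd z)\<bar>"
    have "?G \<in> borel_measurable (PRE \<Otimes>\<^sub>M borel)" using predictableD[OF r] by simp
    from step_compensator[OF this, of n]
    have "(\<integral>\<^sup>+w. R w \<partial>M) = (\<integral>\<^sup>+w. (if S (Suc n) w \<le> ennreal T then ?G ((w, ?b w), X (Suc n) w) else 0) \<partial>M)"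
      by (simp add: R_def mark_norm_def)
    also have "\<dots> = (\<integral>\<^sup>+w. (if S (Suc n) w \<le> ennreal T then ennreal \<bar>Y w (?b w)\<bar> else 0) \<partial>M)"
    proof (rule nn_integral_cong_AE)
      show "AE w in M. (if S (Suc n) w \<le> ennreal T then ?G ((w, ?b w), X (Suc n) w) else 0)
        = (if S (Suc n) w \<le> ennreal T then ennreal \<bar>Y w (?b w)\<bar> else 0)"
        using path_between_jumps[OF sol] AE_space
      proof eventually_elim
        case (elim w)
        show ?case
        proof (cases "S (Suc n) w \<le> ennreal T")
          case True
          then have Sn: "S n w \<le> ennreal T" using S_Suc[OF elim(2)] order_trans by blast
          then obtain y B where piece: "continuous_piece n Y Z w y B" using elim(1) by blast
          have "S n w < ennreal T" using S_less[OF elim(2) Sn] True by (rule less_le_trans)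
          then have "?b w \<in> {?a w<..?b w}" using \<sigma>_strict[OF elim(2)] by simp
          from continuous_pieceD(6)[OF piece this] continuous_pieceD(10)[OF piece True]
          show ?thesis by (simp add: r_def)
        qed simp
      qed
    qed
    finally show ?thesis using next_fin by simp
  qed
  have V_le: "V w \<le> ennreal L * R w + (\<integral>\<^sup>+s. f0 w s \<partial>dA w)" if w: "w \<in> \<Omega>" for w
  proof -
    have I: "{?a w<..?b w} \<in> sets (dA w)" using \<sigma>_range by (intro Ioc_dA[OF w]) auto
    have m: "mark_norm r w \<in> borel_measurable (dA w)" "f0 w \<in> borel_measurable (dA w)"
      using dA_measurable[OF w mark_norm_measurable[OF r]] dA_measurable[OF w f0_measurable] by simp_all
    have "V w = (\<integral>\<^sup>+s. ennreal L * (mark_norm r w s * indicator {?a w<..?b w} s) + f0 w s * indicator {?a w<..?b w} s \<partial>dA w)"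
      unfolding V_def g_def by (intro nn_integral_cong) (auto simp: indicator_def)
    also have "\<dots> = ennreal L * R w + (\<integral>\<^sup>+s\<in>{?a w<..?b w}. f0 w s \<partial>dA w)"
      unfolding R_def using I m by (subst nn_integral_add) (auto intro!: nn_integral_cmult)
    also have "\<dots> \<le> ennreal L * R w + (\<integral>\<^sup>+s. f0 w s \<partial>dA w)"
      by (intro add_left_mono nn_integral_mono) (auto simp: indicator_def)
    finally show ?thesis .
  qed
  have f0m: "(\<lambda>w. \<integral>\<^sup>+s. f0 w s \<partial>dA w) \<in> borel_measurable M"
    using F_measurable_M[OF nn_integral_\<nu>_measurable[OF f0_measurable]] by simp
  have EV: "(\<integral>\<^sup>+w. V w \<partial>M) < \<infinity>"
  proof -
    have "(\<integral>\<^sup>+w. V w \<partial>M) \<le> (\<integral>\<^sup>+w. ennreal L * R w + (\<integral>\<^sup>+s. f0 w s \<partial>dA w) \<partial>M)"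
      by (rule nn_integral_mono[OF V_le])
    also have "\<dots> = ennreal L * (\<integral>\<^sup>+w. R w \<partial>M) + (\<integral>\<^sup>+w. \<integral>\<^sup>+s. f0 w s \<partial>dA w \<partial>M)"
      using f0m by (simp add: nn_integral_add nn_integral_cmult)
    also have "\<dots> < \<infinity>" using ER f0_integrable by (simp add: ennreal_mult_less_top)
    finally show ?thesis .
  qed
  define K where "K = L + L'"
  have K: "0 \<le> K" using L_nonneg by (simp add: K_def)
  have C: "0 \<le> C"
  proof -
    obtain w where "w \<in> \<Omega>" using not_empty by blast
    then show ?thesis using A_bounded[of w] A_nonneg[of w T] T_pos by simp
  qed
  define c where "c = ennreal (2 * exp (2 * K * C))"
  have paths: "AE w in M. (w \<in> gap n (ennreal T) \<longrightarrow> ennreal \<bar>Y w (?a w)\<bar> \<le> c * (ennreal \<bar>\<xi> w\<bar> + V w)) \<and>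
     (S n w \<le> ennreal T \<longrightarrow> (\<forall>s\<in>{?a w<..?b w}. ennreal \<bar>left_process Y (w, s)\<bar> \<le> c * (ennreal \<bar>Y w (?a w)\<bar> + V w)))"
  proof -
    have "AE w in M. V w \<noteq> \<infinity>" using EV by (intro nn_integral_noteq_infinite) auto
    then show ?thesis using path_between_jumps[OF sol] AE_space
    proof eventually_elim
      case (elim w)
      note w = elim(3)
      interpret path: continuous_increasing_path T "A w" by (rule continuous_A_path[OF w])
      define v where "v = enn2real (V w)"
      have v: "0 \<le> v" "ennreal v = V w" using elim(1) by (auto simp: v_def less_top)
      have ab: "0 \<le> ?a w" "?a w \<le> ?b w" "?b w \<le> T" using \<sigma>_range \<sigma>_mono[OF w, of n "Suc n"] by auto
      have k_bound: "(\<integral>\<^sup>+s\<in>{u<..v'}. ennreal \<bar>mean_driver Y Z w s\<bar> \<partial>dA w)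
          \<le> ennreal v + ennreal K * (\<integral>\<^sup>+s\<in>{u<..v'}. ennreal \<bar>left_process Y (w, s)\<bar> \<partial>dA w)"
        if "?a w \<le> u" "v' \<le> ?b w" for u v'
      proof -
        have I: "{u<..v'} \<in> sets (dA w)" using that ab by (intro Ioc_dA[OF w]) auto
        have m: "(\<lambda>s. left_process Y (w, s)) \<in> borel_measurable (dA w)" "(\<lambda>s. g (w, s)) \<in> borel_measurable (dA w)"
          using dA_measurable[OF w Yl] dA_measurable[OF w g] by simp_all
        have "(\<integral>\<^sup>+s\<in>{u<..v'}. ennreal \<bar>mean_driver Y Z w s\<bar> \<partial>dA w)
          \<le> (\<integral>\<^sup>+s. g (w, s) * indicator {u<..v'} s + ennreal K * (ennreal \<bar>left_process Y (w, s)\<bar> * indicator {u<..v'} s) \<partial>dA w)"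
        proof (rule nn_integral_mono)
          fix s assume "s \<in> space (dA w)"
          then have s: "s \<in> {0..T}" using space_dA[OF w] by simp
          show "ennreal \<bar>mean_driver Y Z w s\<bar> * indicator {u<..v'} s
            \<le> g (w, s) * indicator {u<..v'} s + ennreal K * (ennreal \<bar>left_process Y (w, s)\<bar> * indicator {u<..v'} s)"
            using mean_driver_bound[OF sol w s] unfolding r_def[symmetric]
            by (cases "s \<in> {u<..v'}") (simp_all add: g_def K_def add.commute)
        qed
        also have "\<dots> = (\<integral>\<^sup>+s\<in>{u<..v'}. g (w, s) \<partial>dA w) + ennreal K * (\<integral>\<^sup>+s\<in>{u<..v'}. ennreal \<bar>left_process Y (w, s)\<bar> \<partial>dA w)"
          using I m by (subst nn_integral_add) (auto intro!: nn_integral_cmult)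
        also have "\<dots> \<le> ennreal v + ennreal K * (\<integral>\<^sup>+s\<in>{u<..v'}. ennreal \<bar>left_process Y (w, s)\<bar> \<partial>dA w)"
          unfolding v(2) V_def using that by (intro add_right_mono nn_integral_mono) (auto simp: indicator_def)
        finally show ?thesis .
      qed
      have c_le: "ennreal (2 * (x + v) * exp (2 * K * A w T)) \<le> c * (ennreal x + V w)" if "0 \<le> x" for x
      proof -
        have "2 * (x + v) * exp (2 * K * A w T) \<le> 2 * (x + v) * exp (2 * K * C)"
          using that v(1) K A_bounded[OF w] by (intro mult_left_mono) (auto intro!: mult_left_mono)
        then have "ennreal (2 * (x + v) * exp (2 * K * A w T)) \<le> ennreal (2 * exp (2 * K * C) * (x + v))"
          by (intro ennreal_leI) (simp add: algebra_simps)
        also have "\<dots> = c * ennreal (x + v)" unfolding c_def using that v(1) by (intro ennreal_mult) auto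
        also have "ennreal (x + v) = ennreal x + V w" unfolding v(2)[symmetric] using that v(1) by (rule ennreal_plus)
        finally show ?thesis .
      qed
      show ?case
      proof (cases "S n w \<le> ennreal T")
        case True
        then obtain y B where piece: "continuous_piece n Y Z w y B" using elim(2) by blast
        note k = continuous_pieceD(1)[OF piece] and y = continuous_pieceD(2-9)[OF piece]
        have sub: "set_integrable (dA w) {u<..v'} (mean_driver Y Z w)" if "?a w \<le> u" "v' \<le> ?b w" for u v'
        proof -
          have "{u<..v'} \<in> sets (dA w)" using that ab by (intro Ioc_dA[OF w]) auto
          moreover have "{u<..v'} \<subseteq> {?a w<..T}" using that ab by auto
          ultimately show ?thesis by (rule set_integrable_subset[OF k])
        qed
        have y_int: "(\<integral>\<^sup>+s\<in>{u<..v'}. ennreal \<bar>left_process Y (w, s)\<bar> \<partial>dA w) = (\<integral>\<^sup>+s\<in>{u<..v'}. ennreal \<bar>y s\<bar> \<partial>dA w)"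
          if "?a w \<le> u" "v' \<le> ?b w" for u v'
          using y(5) that by (intro nn_integral_cong) (auto simp: indicator_def)
        have increment: "ennreal \<bar>x + i\<bar> \<le> ennreal (\<bar>x\<bar> + v) + ennreal K * (\<integral>\<^sup>+s\<in>{u<..v'}. ennreal \<bar>y s\<bar> \<partial>dA w)"
          if u: "?a w \<le> u" "v' \<le> ?b w" and i: "\<bar>i\<bar> = \<bar>LINT s:{u<..v'}|dA w. mean_driver Y Z w s\<bar>" for x i u v'
        proof -
          have "ennreal \<bar>x + i\<bar> \<le> ennreal (\<bar>x\<bar> + \<bar>i\<bar>)" by (intro ennreal_leI) simp
          also have "\<dots> = ennreal \<bar>x\<bar> + ennreal \<bar>i\<bar>" by (intro ennreal_plus) auto
          also have "\<dots> \<le> ennreal \<bar>x\<bar> + (ennreal v + ennreal K * (\<integral>\<^sup>+s\<in>{u<..v'}. ennreal \<bar>y s\<bar> \<partial>dA w))"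
            unfolding i using order_trans[OF set_integral_bound[OF sub[OF u]] k_bound[OF u]] unfolding y_int[OF u] by (rule add_left_mono)
          also have "\<dots> = ennreal (\<bar>x\<bar> + v) + ennreal K * (\<integral>\<^sup>+s\<in>{u<..v'}. ennreal \<bar>y s\<bar> \<partial>dA w)"
            using v(1) by (simp only: ennreal_plus abs_ge_zero add.assoc)
          finally show ?thesis .
        qed
        have "ennreal \<bar>left_process Y (w, t)\<bar> \<le> c * (ennreal \<bar>Y w (?a w)\<bar> + V w)" if t: "t \<in> {?a w<..?b w}" for t
        proof -
          have "\<bar>y t\<bar> \<le> 2 * (\<bar>y (?a w)\<bar> + v) * exp (2 * K * A w T)"
          proof (rule path.forward_gronwall[of "?a w" "?b w" "\<bar>y (?a w)\<bar> + v" K y B])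
            fix t assume t: "t \<in> {?a w<..?b w}"
            then have "y t = y (?a w) + - (LINT s:{?a w<..t}|dA w. mean_driver Y Z w s)" using y(2)[of t] by simp
            then show "ennreal \<bar>y t\<bar> \<le> ennreal (\<bar>y (?a w)\<bar> + v) + ennreal K * (\<integral>\<^sup>+s\<in>{?a w<..t}. ennreal \<bar>y s\<bar> \<partial>dA w)"
              using increment[of "?a w" t "- (LINT s:{?a w<..t}|dA w. mean_driver Y Z w s)" "y (?a w)"] t by simp
          qed (use ab v(1) K y(1) t in auto)
          then have "ennreal \<bar>y t\<bar> \<le> ennreal (2 * (\<bar>y (?a w)\<bar> + v) * exp (2 * K * A w T))" by (rule ennreal_leI)
          also have "\<dots> \<le> c * (ennreal \<bar>y (?a w)\<bar> + V w)" by (rule c_le) simp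
          finally show ?thesis using y(5)[OF t] y(6) by simp
        qed
        moreover have "ennreal \<bar>Y w (?a w)\<bar> \<le> c * (ennreal \<bar>\<xi> w\<bar> + V w)" if "w \<in> gap n (ennreal T)"
        proof -
          have S': "ennreal T < S (Suc n) w" using that by (simp add: gap_def)
          then have b: "?b w = T" by (intro \<sigma>_eq_T) simp
          have "\<bar>y (?a w)\<bar> \<le> 2 * (\<bar>\<xi> w\<bar> + v) * exp (2 * K * A w T)"
          proof (rule path.backward_gronwall[of "?a w" "?b w" "\<bar>\<xi> w\<bar> + v" K y B])
            fix t assume t: "t \<in> {?a w..?b w}"
            then have "y t = \<xi> w + (LINT s:{t<..?b w}|dA w. mean_driver Y Z w s)" using y(3)[of t] y(7)[OF S'] b by simp
            then show "ennreal \<bar>y t\<bar> \<le> ennreal (\<bar>\<xi> w\<bar> + v) + ennreal K * (\<integral>\<^sup>+s\<in>{t<..?b w}. ennreal \<bar>y s\<bar> \<partial>dA w)"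
              using increment[of t "?b w" "LINT s:{t<..?b w}|dA w. mean_driver Y Z w s" "\<xi> w"] t by simp
          qed (use ab v(1) K y(1) in auto)
          then have "ennreal \<bar>y (?a w)\<bar> \<le> ennreal (2 * (\<bar>\<xi> w\<bar> + v) * exp (2 * K * A w T))" by (rule ennreal_leI)
          also have "\<dots> \<le> c * (ennreal \<bar>\<xi> w\<bar> + V w)" by (rule c_le) simp
          finally show ?thesis using y(6) by simp
        qed
        ultimately show ?thesis by blast
      qed (simp add: gap_def)
    qed
  qed
  let ?Ya = "\<lambda>w. if S n w \<le> ennreal T then ennreal \<bar>Y w (?a w)\<bar> else 0"
  have "(\<lambda>w. if S n w \<le> ennreal T then Y w (enn2real (S n w)) else 0) \<in> borel_measurable (pre_sigma (S n))"
    using sol by (intro value_at_stopping_time stopping_time_S) (auto simp: solution_from_def)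
  then have "(\<lambda>w. ennreal \<bar>if S n w \<le> ennreal T then Y w (enn2real (S n w)) else 0\<bar>) \<in> borel_measurable (pre_sigma (S n))"
    by measurable
  also have "(\<lambda>w. ennreal \<bar>if S n w \<le> ennreal T then Y w (enn2real (S n w)) else 0\<bar>) = ?Ya"
    by (auto simp: fun_eq_iff \<sigma>_def min_absorb1)
  finally have Ya: "?Ya \<in> borel_measurable (pre_sigma (S n))" .
  then have YaM [measurable]: "?Ya \<in> borel_measurable M"
    using pre_sigma_subset_M by (auto simp: measurable_def space_pre_sigma)
  have \<xi>M [measurable]: "\<xi> \<in> borel_measurable M" using \<xi>_integrable by simp
  have E\<xi>: "(\<integral>\<^sup>+w. ennreal \<bar>\<xi> w\<bar> \<partial>M) < \<infinity>" using \<xi>_integrable by (simp add: integrable_iff_bounded)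
  show fin1: "(\<integral>\<^sup>+w. ?Ya w \<partial>M) < \<infinity>"
  proof -
    have "(\<integral>\<^sup>+w. ?Ya w \<partial>M) = (\<integral>\<^sup>+w. ?Ya w * indicator {w\<in>\<Omega>. S n w \<le> ennreal T} w \<partial>M)"
      by (intro nn_integral_cong) (auto simp: indicator_def)
    also have "\<dots> \<le> ennreal (exp C) * (\<integral>\<^sup>+w. ?Ya w * indicator (gap n (ennreal T)) w \<partial>M)"
      by (rule survival[OF Ya])
    also have "\<dots> \<le> ennreal (exp C) * (\<integral>\<^sup>+w. c * (ennreal \<bar>\<xi> w\<bar> + V w) \<partial>M)"
    proof (intro mult_left_mono nn_integral_mono_AE)
      show "AE w in M. ?Ya w * indicator (gap n (ennreal T)) w \<le> c * (ennreal \<bar>\<xi> w\<bar> + V w)"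
        using paths by eventually_elim (simp add: indicator_def)
    qed simp
    also have "\<dots> = ennreal (exp C) * (c * ((\<integral>\<^sup>+w. ennreal \<bar>\<xi> w\<bar> \<partial>M) + (\<integral>\<^sup>+w. V w \<partial>M)))"
      by (simp add: nn_integral_cmult nn_integral_add)
    also have "\<dots> < \<infinity>" using E\<xi> EV by (simp add: ennreal_mult_less_top c_def)
    finally show ?thesis .
  qed
  show fin2: "(\<integral>\<^sup>+w. (\<integral>\<^sup>+s\<in>{?a w<..?b w}. ennreal \<bar>left_process Y (w, s)\<bar> \<partial>dA w) \<partial>M) < \<infinity>"
  proof -
    have "(\<integral>\<^sup>+w. (\<integral>\<^sup>+s\<in>{?a w<..?b w}. ennreal \<bar>left_process Y (w, s)\<bar> \<partial>dA w) \<partial>M)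
      \<le> (\<integral>\<^sup>+w. ennreal C * (c * (?Ya w + V w)) \<partial>M)"
    proof (rule nn_integral_mono_AE)
      show "AE w in M. (\<integral>\<^sup>+s\<in>{?a w<..?b w}. ennreal \<bar>left_process Y (w, s)\<bar> \<partial>dA w) \<le> ennreal C * (c * (?Ya w + V w))"
        using paths AE_space
      proof eventually_elim
        case (elim w)
        note w = elim(2)
        have I: "{?a w<..?b w} \<in> sets (dA w)" using \<sigma>_range by (intro Ioc_dA[OF w]) auto
        have "(\<integral>\<^sup>+s\<in>{?a w<..?b w}. ennreal \<bar>left_process Y (w, s)\<bar> \<partial>dA w)
          \<le> (\<integral>\<^sup>+s. c * (?Ya w + V w) * indicator {?a w<..?b w} s \<partial>dA w)"
        proof (rule nn_integral_mono)
          fix s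
          show "ennreal \<bar>left_process Y (w, s)\<bar> * indicator {?a w<..?b w} s \<le> c * (?Ya w + V w) * indicator {?a w<..?b w} s"
          proof (cases "s \<in> {?a w<..?b w}")
            case True
            have "S n w \<le> ennreal T"
            proof (rule ccontr)
              assume "\<not> S n w \<le> ennreal T"
              then have "?a w = T" by (intro \<sigma>_eq_T) simp
              then show False using True \<sigma>_range(3)[of "Suc n" w] by simp
            qed
            then show ?thesis using elim(1) True by simp
          qed simp
        qed
        also have "\<dots> = c * (?Ya w + V w) * emeasure (dA w) {?a w<..?b w}"
          using I by (rule nn_integral_cmult_indicator)
        also have "\<dots> \<le> c * (?Ya w + V w) * ennreal C"
        proof (intro mult_left_mono)
          have ab: "0 \<le> ?a w" "?a w \<le> ?b w" "?b w \<le> T" using \<sigma>_range \<sigma>_mono[OF w, of n "Suc n"] by auto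
          show "emeasure (dA w) {?a w<..?b w} \<le> ennreal C"
            unfolding emeasure_dA_Ioc[OF w ab] using A_nonneg[OF w, of "?a w"] A_le_C[OF w, of "?b w"] ab by (intro ennreal_leI) simp
        qed simp
        finally show ?case by (simp add: mult_ac)
      qed
    qed
    also have "\<dots> = ennreal C * (c * ((\<integral>\<^sup>+w. ?Ya w \<partial>M) + (\<integral>\<^sup>+w. V w \<partial>M)))"
      using YaM by (subst nn_integral_cmult, simp, subst nn_integral_cmult, simp, subst nn_integral_add) auto
    also have "\<dots> < \<infinity>" using fin1 EV by (simp add: ennreal_mult_less_top c_def)
    finally show ?thesis .
  qed
  show "(\<integral>\<^sup>+w. (\<integral>\<^sup>+s\<in>{?a w<..?b w}. mark_norm Z w s \<partial>dA w) \<partial>M) < \<infinity>"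
  proof -
    let ?I = "\<lambda>w. \<integral>\<^sup>+s\<in>{?a w<..?b w}. ennreal \<bar>left_process Y (w, s)\<bar> \<partial>dA w"
    have Im: "?I \<in> borel_measurable M"
      using step_integral_measurable[of "\<lambda>p. ennreal \<bar>left_process Y p\<bar>" n] Yl by simp
    have "(\<integral>\<^sup>+w. (\<integral>\<^sup>+s\<in>{?a w<..?b w}. mark_norm Z w s \<partial>dA w) \<partial>M) \<le> (\<integral>\<^sup>+w. R w + ?I w \<partial>M)"
    proof (rule nn_integral_mono)
      fix w assume w: "w \<in> \<Omega>"
      have I: "{?a w<..?b w} \<in> sets (dA w)" using \<sigma>_range by (intro Ioc_dA[OF w]) auto
      have m: "mark_norm r w \<in> borel_measurable (dA w)" "(\<lambda>s. left_process Y (w, s)) \<in> borel_measurable (dA w)"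
        using dA_measurable[OF w mark_norm_measurable[OF r]] dA_measurable[OF w Yl] by simp_all
      have "(\<integral>\<^sup>+s\<in>{?a w<..?b w}. mark_norm Z w s \<partial>dA w)
        \<le> (\<integral>\<^sup>+s. mark_norm r w s * indicator {?a w<..?b w} s + ennreal \<bar>left_process Y (w, s)\<bar> * indicator {?a w<..?b w} s \<partial>dA w)"
      proof (rule nn_integral_mono)
        fix s assume "s \<in> space (dA w)"
        then have s: "s \<in> {0..T}" using space_dA[OF w] by simp
        from mark_norm_triangle[OF w s Z Yl]
        show "mark_norm Z w s * indicator {?a w<..?b w} s
          \<le> mark_norm r w s * indicator {?a w<..?b w} s + ennreal \<bar>left_process Y (w, s)\<bar> * indicator {?a w<..?b w} s"
          unfolding r_def by (cases "s \<in> {?a w<..?b w}") simp_all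
      qed
      also have "\<dots> = R w + ?I w" unfolding R_def using I m by (intro nn_integral_add) auto
      finally show "(\<integral>\<^sup>+s\<in>{?a w<..?b w}. mark_norm Z w s \<partial>dA w) \<le> R w + ?I w" .
    qed
    also have "\<dots> = (\<integral>\<^sup>+w. R w \<partial>M) + (\<integral>\<^sup>+w. ?I w \<partial>M)" using Im by (intro nn_integral_add) auto
    also have "\<dots> < \<infinity>" using ER fin2 by simp
    finally show ?thesis .
  qed
qed

subsection \<open>Summation over the jumps\<close>

lemma estimate_from:
  assumes last: "AE w in M. S N w = \<infinity>" and n: "n \<le> N" and sol: "solution_from n Y Z"
  shows "(\<integral>\<^sup>+w. (if S n w \<le> ennreal T then ennreal \<bar>Y w (\<sigma> n w)\<bar> else 0) \<partial>M) < \<infinity> \<and>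
    (\<forall>k\<in>{n..<N}. (\<integral>\<^sup>+w. (\<integral>\<^sup>+s\<in>{\<sigma> k w<..\<sigma> (Suc k) w}. ennreal \<bar>left_process Y (w, s)\<bar> \<partial>dA w) \<partial>M) < \<infinity> \<and>
      (\<integral>\<^sup>+w. (\<integral>\<^sup>+s\<in>{\<sigma> k w<..\<sigma> (Suc k) w}. mark_norm Z w s \<partial>dA w) \<partial>M) < \<infinity>)"
  using n sol
proof (induction n rule: inc_induct)
  case base
  have "(\<integral>\<^sup>+w. (if S N w \<le> ennreal T then ennreal \<bar>Y w (\<sigma> N w)\<bar> else 0) \<partial>M) = (\<integral>\<^sup>+w. 0 \<partial>M)"
    by (rule nn_integral_cong_AE) (use last in \<open>auto elim!: eventually_mono simp: top_unique\<close>)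
  then show ?case by simp
next
  case (step n)
  note IH = step.IH[OF solution_from_Suc[OF step.prems]]
  note est = estimate_between_jumps[OF step.prems conjunct1[OF IH]]
  have "{n..<N} = insert n {Suc n..<N}" using step.hyps by auto
  then show ?case using est IH by simp
qed

lemma steps_cover:
  assumes w: "w \<in> \<Omega>" and last: "S N w = \<infinity>" and s: "s \<in> {0<..T}"
  shows "\<exists>k<N. s \<in> {\<sigma> k w<..\<sigma> (Suc k) w}"
proof -
  have "s \<le> \<sigma> j w \<Longrightarrow> \<exists>k<j. s \<in> {\<sigma> k w<..\<sigma> (Suc k) w}" for j
  proof (induction j)
    case 0 then show ?case using s \<sigma>_0[OF w] by simp
  next
    case (Suc j) then show ?case by (cases "s \<le> \<sigma> j w") (auto intro: less_SucI)
  qed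
  moreover have "\<sigma> N w = T" using last by (intro \<sigma>_eq_T) simp
  ultimately show ?thesis using s by simp
qed

lemma nn_integral_steps:
  fixes G :: "'w \<times> real \<Rightarrow> ennreal"
  assumes last: "AE w in M. S N w = \<infinity>" and G: "G \<in> borel_measurable PRE"
    and fin: "\<And>k. k < N \<Longrightarrow> (\<integral>\<^sup>+w. (\<integral>\<^sup>+s\<in>{\<sigma> k w<..\<sigma> (Suc k) w}. G (w, s) \<partial>dA w) \<partial>M) < \<infinity>"
  shows "(\<integral>\<^sup>+w. (\<integral>\<^sup>+s. G (w, s) \<partial>dA w) \<partial>M) < \<infinity>"
proof -
  have "(\<integral>\<^sup>+w. (\<integral>\<^sup>+s. G (w, s) \<partial>dA w) \<partial>M) \<le> (\<integral>\<^sup>+w. (\<Sum>k<N. \<integral>\<^sup>+s\<in>{\<sigma> k w<..\<sigma> (Suc k) w}. G (w, s) \<partial>dA w) \<partial>M)"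
  proof (rule nn_integral_mono_AE)
    show "AE w in M. (\<integral>\<^sup>+s. G (w, s) \<partial>dA w) \<le> (\<Sum>k<N. \<integral>\<^sup>+s\<in>{\<sigma> k w<..\<sigma> (Suc k) w}. G (w, s) \<partial>dA w)"
      using last AE_space
    proof eventually_elim
      case (elim w)
      note w = elim(2)
      have m: "(\<lambda>s. G (w, s) * indicator {\<sigma> k w<..\<sigma> (Suc k) w} s) \<in> borel_measurable (dA w)" for k
        using dA_measurable[OF w G] Ioc_dA[OF w \<sigma>_range(2) \<sigma>_range(3)]
        by (intro borel_measurable_times_ennreal borel_measurable_indicator) auto
      have "(\<integral>\<^sup>+s. G (w, s) \<partial>dA w) = (\<integral>\<^sup>+s\<in>{0<..T}. G (w, s) \<partial>dA w)"
        by (rule nn_integral_dA_pos[OF w, symmetric])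
      also have "\<dots> \<le> (\<integral>\<^sup>+s. (\<Sum>k<N. G (w, s) * indicator {\<sigma> k w<..\<sigma> (Suc k) w} s) \<partial>dA w)"
      proof (rule nn_integral_mono)
        fix s
        show "G (w, s) * indicator {0<..T} s \<le> (\<Sum>k<N. G (w, s) * indicator {\<sigma> k w<..\<sigma> (Suc k) w} s)"
        proof (cases "s \<in> {0<..T}")
          case True
          then obtain k where k: "k < N" "s \<in> {\<sigma> k w<..\<sigma> (Suc k) w}" using steps_cover[OF w elim(1)] by blast
          have "G (w, s) * indicator {\<sigma> k w<..\<sigma> (Suc k) w} s \<le> (\<Sum>k<N. G (w, s) * indicator {\<sigma> k w<..\<sigma> (Suc k) w} s)"
            using k by (intro member_le_sum) auto
          then show ?thesis using k True by simp
        qed simp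
      qed
      also have "\<dots> = (\<Sum>k<N. \<integral>\<^sup>+s\<in>{\<sigma> k w<..\<sigma> (Suc k) w}. G (w, s) \<partial>dA w)"
        using m by (rule nn_integral_sum)
      finally show ?case .
    qed
  qed
  also have "\<dots> = (\<Sum>k<N. \<integral>\<^sup>+w. (\<integral>\<^sup>+s\<in>{\<sigma> k w<..\<sigma> (Suc k) w}. G (w, s) \<partial>dA w) \<partial>M)"
    using step_integral_measurable[OF G] by (rule nn_integral_sum)
  also have "\<dots> < \<infinity>" using fin by (simp add: ennreal_sum_less_top)
  finally show ?thesis .
qed

text \<open>
  \<open>Y\<close> differs from its left limits at the jump times only, and these carry no mass of \<open>dA\<close>.
\<close>

lemma solution_integrable:
  assumes last: "AE w in M. S N w = \<infinity>" and sol: "solution_from 0 Y Z"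
  shows "(\<integral>\<^sup>+w. (\<integral>\<^sup>+s. ennreal \<bar>Y w s\<bar> \<partial>dA w) \<partial>M) < \<infinity>"
    and "(\<integral>\<^sup>+w. (\<integral>\<^sup>+s. mark_norm Z w s \<partial>dA w) \<partial>M) < \<infinity>"
proof -
  note Yl = solution_left_process[OF sol] and Z = solution_predictable[OF sol]
  note est = estimate_from[OF last _ sol]
  show "(\<integral>\<^sup>+w. (\<integral>\<^sup>+s. mark_norm Z w s \<partial>dA w) \<partial>M) < \<infinity>"
    using nn_integral_steps[OF last mark_norm_measurable[OF Z]] est by simp
  have "AE w in M. \<forall>k. S k w \<le> ennreal T \<longrightarrow> (\<exists>y B. continuous_piece k Y Z w y B)"
    unfolding AE_all_countable
  proof
    fix k
    have "solution_from k Y Z" by (induction k) (use sol solution_from_Suc in auto)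
    then show "AE w in M. S k w \<le> ennreal T \<longrightarrow> (\<exists>y B. continuous_piece k Y Z w y B)" by (rule path_between_jumps)
  qed
  then have "AE w in M. (\<integral>\<^sup>+s. ennreal \<bar>Y w s\<bar> \<partial>dA w) = (\<integral>\<^sup>+s. ennreal \<bar>left_process Y (w, s)\<bar> \<partial>dA w)"
    using last AE_space
  proof eventually_elim
    case (elim w)
    note w = elim(3)
    interpret path: continuous_increasing_path T "A w" by (rule continuous_A_path[OF w])
    have "AE s in dA w. \<forall>k. s \<noteq> \<sigma> k w"
      unfolding AE_all_countable using path.AE_stieltjes_singleton by blast
    then have "AE s in dA w. Y w s = left_process Y (w, s)"
      using dA_pos[OF w] AE_space
    proof eventually_elim
      case (elim s)
      then have "s \<in> {0<..T}" using space_dA[OF w] by simp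
      then obtain k where k: "s \<in> {\<sigma> k w<..\<sigma> (Suc k) w}" using steps_cover[OF w \<open>S N w = \<infinity>\<close>] by blast
      have "S k w \<le> ennreal T"
      proof (rule ccontr)
        assume "\<not> S k w \<le> ennreal T"
        then have "\<sigma> k w = T" by (intro \<sigma>_eq_T) simp
        then show False using k \<sigma>_range(3)[of "Suc k" w] by simp
      qed
      then obtain y B where piece: "continuous_piece k Y Z w y B"
        using \<open>\<forall>k. S k w \<le> ennreal T \<longrightarrow> (\<exists>y B. continuous_piece k Y Z w y B)\<close> by blast
      have "s \<in> {\<sigma> k w..<\<sigma> (Suc k) w}" using k elim(1) by (simp add: order.strict_iff_order)
      from continuous_pieceD(5)[OF piece this] continuous_pieceD(6)[OF piece k] show ?case by simp
    qed
    then show ?case by (intro nn_integral_cong_AE) (auto elim: eventually_mono)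
  qed
  then have "(\<integral>\<^sup>+w. (\<integral>\<^sup>+s. ennreal \<bar>Y w s\<bar> \<partial>dA w) \<partial>M) = (\<integral>\<^sup>+w. (\<integral>\<^sup>+s. ennreal \<bar>left_process Y (w, s)\<bar> \<partial>dA w) \<partial>M)"
    by (rule nn_integral_cong_AE)
  also have "\<dots> < \<infinity>"
    using nn_integral_steps[OF last, of "\<lambda>p. ennreal \<bar>left_process Y p\<bar>"] Yl est by simp
  finally show "(\<integral>\<^sup>+w. (\<integral>\<^sup>+s. ennreal \<bar>Y w s\<bar> \<partial>dA w) \<partial>M) < \<infinity>" .
qed

section \<open>Existence\<close>

subsection \<open>The driver as a random function of one real variable\<close>

text \<open>
  Up to the next jump the solution jumps to the known value \<open>r\<close>, so that \<open>Z = r - Y\<^sub>-\<close> and the driver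
  is a Lipschitz function of \<open>Y\<^sub>-\<close> alone. The arguments \<open>u\<close> and \<open>v'\<close> separate its two occurrences: joint
  measurability is known in \<open>v'\<close>, and follows in \<open>u\<close> from continuity.
\<close>

definition jump_driver :: "('w \<Rightarrow> real \<Rightarrow> 'e \<Rightarrow> real) \<Rightarrow> real \<Rightarrow> real \<Rightarrow> 'w \<times> real \<Rightarrow> real" where
  "jump_driver r u v' p = (LINT x|\<phi> (fst p) (snd p). driver (\<lambda>_. v') (\<lambda>w s x. r w s x - u) (p, x))"

lemma const_predictable: "pred_process (\<lambda>_ _ _. c)"
  by (intro predictableI) simp

lemma jump_driver_measurable:
  assumes r: "pred_process r"
  shows "(\<lambda>z. jump_driver r u (snd z) (fst z)) \<in> borel_measurable (PRE \<Otimes>\<^sub>M borel)"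
proof -
  have "pred_process (\<lambda>w s x. r w s x - u)" by (rule predictable_diff[OF r const_predictable])
  then have "predictable \<Omega> F T (borel \<Otimes>\<^sub>M borel) (\<lambda>w t (x, y). f w t x y (\<lambda>x. r w t x - u))"
    using generator by (simp add: bsde_generator_def)
  then have m1: "(\<lambda>z. f (fst (fst z)) (snd (fst z)) (fst (snd z)) (snd (snd z)) (\<lambda>x. r (fst (fst z)) (snd (fst z)) x - u))
      \<in> borel_measurable (PRE \<Otimes>\<^sub>M (borel \<Otimes>\<^sub>M borel))"
    by (simp add: predictable_def case_prod_unfold)
  have m2: "(\<lambda>z. (fst (fst z), (snd z, snd (fst z)))) \<in> (PRE \<Otimes>\<^sub>M (borel :: real measure)) \<Otimes>\<^sub>M (borel :: 'e measure) \<rightarrow>\<^sub>M PRE \<Otimes>\<^sub>M (borel \<Otimes>\<^sub>M borel)"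
    by measurable
  have a: "(\<lambda>z. f (fst (fst (fst z))) (snd (fst (fst z))) (snd z) (snd (fst z)) (\<lambda>x. r (fst (fst (fst z))) (snd (fst (fst z))) x - u))
      \<in> borel_measurable ((PRE \<Otimes>\<^sub>M (borel :: real measure)) \<Otimes>\<^sub>M borel)"
    using measurable_compose[OF m2 m1] unfolding fst_conv snd_conv .
  have b: "(\<lambda>z. \<phi> (fst (fst z)) (snd (fst z))) \<in> PRE \<Otimes>\<^sub>M (borel :: real measure) \<rightarrow>\<^sub>M subprob_algebra borel"
    by (rule measurable_compose[OF measurable_fst \<phi>_kernel])
  from integral_measurable_kernel[OF a b] show ?thesis by (simp add: jump_driver_def[abs_def] driver_def)
qed

lemma jump_driver_integrable:
  assumes w: "w \<in> \<Omega>" and s: "s \<in> {0..T}" and r: "pred_process r"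
    and fin: "mark_norm r w s < \<infinity>" "f0 w s < \<infinity>"
  shows "integrable (\<phi> w s) (\<lambda>x. driver (\<lambda>_. v') (\<lambda>w s x. r w s x - u) ((w, s), x))"
proof -
  have p: "pred_process (\<lambda>w s x. r w s x - u)" by (rule predictable_diff[OF r const_predictable])
  have "mark_norm (\<lambda>w s x. r w s x - u) w s \<le> mark_norm r w s + ennreal \<bar>u\<bar>"
    using mark_norm_triangle[OF w s p, of "\<lambda>_. u"] by simp
  also have "\<dots> < \<infinity>" using fin by simp
  finally have f: "mark_norm (\<lambda>w s x. r w s x - u) w s < \<infinity>" .
  have "(\<integral>\<^sup>+x. ennreal \<bar>driver (\<lambda>_. v') (\<lambda>w s x. r w s x - u) ((w, s), x)\<bar> \<partial>\<phi> w s)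
    \<le> ennreal (L' * \<bar>v'\<bar>) + ennreal L * mark_norm (\<lambda>w s x. r w s x - u) w s + f0 w s"
    using driver_bound[OF w s p, of "\<lambda>_. v'"] by simp
  also have "\<dots> < \<infinity>" using f fin by (simp add: ennreal_mult_less_top)
  finally show ?thesis
    using predictable_mark_section[OF driver_measurable[OF _ p, of "\<lambda>_. v'"] w s] sets_\<phi>[OF w s]
    by (intro integrableI_bounded) (simp_all cong: measurable_cong_sets)
qed

lemma jump_driver_lipschitz:
  assumes w: "w \<in> \<Omega>" and s: "s \<in> {0..T}" and r: "pred_process r"
    and fin: "mark_norm r w s < \<infinity>" "f0 w s < \<infinity>"
  shows "\<bar>jump_driver r u v' (w, s) - jump_driver r u' v'' (w, s)\<bar> \<le> L' * \<bar>v' - v''\<bar> + L * \<bar>u - u'\<bar>"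
proof -
  interpret \<phi>: prob_space "\<phi> w s" by (rule \<phi>_prob[OF w s])
  let ?d = "driver (\<lambda>_. v') (\<lambda>w s x. r w s x - u)" and ?e = "driver (\<lambda>_. v'') (\<lambda>w s x. r w s x - u')"
  have p: "pred_process (\<lambda>w s x. r w s x - u)" for u by (rule predictable_diff[OF r const_predictable])
  note i = jump_driver_integrable[OF w s r fin, of v' u] jump_driver_integrable[OF w s r fin, of v'' u']
  have "ennreal \<bar>jump_driver r u v' (w, s) - jump_driver r u' v'' (w, s)\<bar> = ennreal (norm (LINT x|\<phi> w s. ?d ((w, s), x) - ?e ((w, s), x)))"
    unfolding jump_driver_def using i by simp
  also have "\<dots> \<le> (\<integral>\<^sup>+x. ennreal \<bar>?d ((w, s), x) - ?e ((w, s), x)\<bar> \<partial>\<phi> w s)"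
    using integral_norm_bound_ennreal[OF Bochner_Integration.integrable_diff[OF i]] by simp
  also have "\<dots> \<le> ennreal (L' * \<bar>v' - v''\<bar>) + ennreal L * mark_norm (\<lambda>w s x. (r w s x - u) - (r w s x - u')) w s"
    using driver_lipschitz[OF w s p p, of "\<lambda>_. v'" "\<lambda>_. v''"] by simp
  also have "mark_norm (\<lambda>w s x. (r w s x - u) - (r w s x - u')) w s = ennreal \<bar>u - u'\<bar>"
    by (simp add: mark_norm_def \<phi>.emeasure_space_1 abs_minus_commute)
  also have "ennreal (L' * \<bar>v' - v''\<bar>) + ennreal L * ennreal \<bar>u - u'\<bar> = ennreal (L' * \<bar>v' - v''\<bar> + L * \<bar>u - u'\<bar>)"
    using L_nonneg by (subst ennreal_plus) (auto intro: ennreal_mult[symmetric])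
  finally show ?thesis using L_nonneg by (subst (asm) ennreal_le_iff) auto
qed

lemma jump_driver_zero:
  assumes w: "w \<in> \<Omega>" and s: "s \<in> {0..T}" and r: "pred_process r"
  shows "ennreal \<bar>jump_driver r 0 0 (w, s)\<bar> \<le> ennreal L * mark_norm r w s + f0 w s"
proof -
  let ?d = "driver (\<lambda>_. 0) r"
  have "ennreal \<bar>jump_driver r 0 0 (w, s)\<bar> \<le> (\<integral>\<^sup>+x. ennreal \<bar>?d ((w, s), x)\<bar> \<partial>\<phi> w s)"
  proof (cases "integrable (\<phi> w s) (\<lambda>x. ?d ((w, s), x))")
    case True
    from integral_norm_bound_ennreal[OF this] show ?thesis by (simp add: jump_driver_def)
  next
    case False then show ?thesis by (simp add: jump_driver_def not_integrable_integral_eq)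
  qed
  also have "\<dots> \<le> ennreal L * mark_norm r w s + f0 w s"
    using driver_bound[OF w s r, of "\<lambda>_. 0"] by simp
  finally show ?thesis .
qed

text \<open>
  The driver is continuous in \<open>u\<close>, so that \<open>u\<close> may be replaced by dyadic approximations of \<open>v'\<close>, of which
  there are countably many.
\<close>

lemma diagonal_jump_driver_measurable:
  assumes r: "pred_process r" and G: "G \<in> sets PRE"
    and G_fin: "\<And>p. p \<in> G \<Longrightarrow> mark_norm r (fst p) (snd p) < \<infinity> \<and> f0 (fst p) (snd p) < \<infinity>"
  shows "(\<lambda>z. indicator G (fst z) * jump_driver r (snd z) (snd z) (fst z)) \<in> borel_measurable (PRE \<Otimes>\<^sub>M borel)"
proof (rule borel_measurable_LIMSEQ_real)
  fix k :: nat
  have "(\<lambda>z. jump_driver r (of_int i / 2 ^ k) (snd z) (fst z)) \<in> borel_measurable (PRE \<Otimes>\<^sub>M borel)" for i :: int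
    by (rule jump_driver_measurable[OF r])
  then have "(\<lambda>z. jump_driver r (of_int \<lfloor>2 ^ k * snd z\<rfloor> / 2 ^ k) (snd z) (fst z)) \<in> borel_measurable (PRE \<Otimes>\<^sub>M borel)"
    by (rule measurable_compose_countable) measurable
  then show "(\<lambda>z. indicator G (fst z) * jump_driver r (of_int \<lfloor>2 ^ k * snd z\<rfloor> / 2 ^ k) (snd z) (fst z)) \<in> borel_measurable (PRE \<Otimes>\<^sub>M borel)"
    using G by measurable
next
  fix z assume z: "z \<in> space (PRE \<Otimes>\<^sub>M (borel :: real measure))"
  obtain w s v' where zz: "z = ((w, s), v')" by (metis prod.collapse)
  have w: "w \<in> \<Omega>" "s \<in> {0..T}" using z zz by (auto simp: space_pair_measure)
  show "(\<lambda>k. indicator G (fst z) * jump_driver r (of_int \<lfloor>2 ^ k * snd z\<rfloor> / 2 ^ k) (snd z) (fst z))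
     \<longlonglongrightarrow> indicator G (fst z) * jump_driver r (snd z) (snd z) (fst z)"
  proof (cases "(w, s) \<in> G")
    case True
    then have fin: "mark_norm r w s < \<infinity>" "f0 w s < \<infinity>" using G_fin[of "(w, s)"] by auto
    have b: "\<bar>jump_driver r (of_int \<lfloor>2 ^ k * v'\<rfloor> / 2 ^ k) v' (w, s) - jump_driver r v' v' (w, s)\<bar> \<le> L * (1/2) ^ k" for k :: nat
    proof -
      have "\<bar>of_int \<lfloor>2 ^ k * v'\<rfloor> / 2 ^ k - v'\<bar> \<le> (1/2) ^ k"
      proof -
        have "of_int \<lfloor>2 ^ k * v'\<rfloor> / 2 ^ k - v' = (of_int \<lfloor>2 ^ k * v'\<rfloor> - 2 ^ k * v') / 2 ^ k" by (simp add: field_simps)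
        moreover have "\<bar>of_int \<lfloor>2 ^ k * v'\<rfloor> - 2 ^ k * v'\<bar> \<le> 1" by linarith
        ultimately show ?thesis by (simp add: power_one_over divide_right_mono)
      qed
      then have "L * \<bar>of_int \<lfloor>2 ^ k * v'\<rfloor> / 2 ^ k - v'\<bar> \<le> L * (1/2) ^ k" using L_nonneg by (intro mult_left_mono)
      then show ?thesis using jump_driver_lipschitz[OF w r fin, of "of_int \<lfloor>2 ^ k * v'\<rfloor> / 2 ^ k" v' v' v'] by simp
    qed
    have "(\<lambda>k. L * (1/2) ^ k) \<longlonglongrightarrow> L * 0" by (intro tendsto_intros LIMSEQ_power_zero) auto
    then have "(\<lambda>k. L * (1/2) ^ k) \<longlonglongrightarrow> 0" by simp
    then have "(\<lambda>k. jump_driver r (of_int \<lfloor>2 ^ k * v'\<rfloor> / 2 ^ k) v' (w, s)) \<longlonglongrightarrow> jump_driver r v' v' (w, s)"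
      by (rule LIM_zero_cancel[OF Lim_null_comparison[rotated]]) (use b in \<open>auto intro!: always_eventually\<close>)
    then show ?thesis using True by (simp add: zz)
  qed (simp add: zz)
qed

subsection \<open>From one jump to the previous one\<close>

lemma before_stopping_measurable:
  fixes W :: "'w \<Rightarrow> real"
  assumes W: "W \<in> borel_measurable (pre_sigma \<tau>)" and \<tau>: "stopping_time F \<tau>"
  shows "(\<lambda>w. if \<tau> w \<le> t then W w else 0) \<in> borel_measurable (F t)"
proof (rule borel_measurableI_le)
  fix c
  have "{w \<in> space (pre_sigma \<tau>). W w \<le> c} \<in> sets (pre_sigma \<tau>)" using W by measurable
  from sets_pre_sigmaD[OF \<tau> this, of t]
  have "{w \<in> \<Omega>. W w \<le> c \<and> \<tau> w \<le> t} \<in> sets (F t)" by (simp add: space_pre_sigma conj_assoc)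
  moreover have "{w \<in> \<Omega>. \<tau> w \<le> t} \<in> sets (F t)" using stopping_timeD[OF \<tau>, of t] by (simp add: pred_def space_F)
  moreover have "\<Omega> \<in> sets (F t)" using sets.top[of "F t"] by (simp add: space_F)
  moreover have "{w \<in> space (F t). (if \<tau> w \<le> t then W w else 0) \<le> c}
    = {w \<in> \<Omega>. W w \<le> c \<and> \<tau> w \<le> t} \<union> (if 0 \<le> c then \<Omega> - {w \<in> \<Omega>. \<tau> w \<le> t} else {})"
    by (auto simp: space_F)
  ultimately show "{w \<in> space (F t). (if \<tau> w \<le> t then W w else 0) \<le> c} \<in> sets (F t)" by auto
qed

text \<open>
  If \<open>v\<close> is known at \<open>S n\<close> and bounds the increasing process \<open>V\<close> when no further jump arrives, it
  bounds \<open>V\<close> up to the next jump in any case: by survival, no jump arrives with positive probability after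
  \<open>V\<close> has exceeded \<open>v\<close>.
\<close>

lemma level_not_exceeded:
  fixes V :: "'w \<times> real \<Rightarrow> ennreal"
  assumes V: "V \<in> borel_measurable PRE" and v: "v \<in> borel_measurable (H n)"
    and mono: "\<And>w s t. w \<in> \<Omega> \<Longrightarrow> s \<le> t \<Longrightarrow> V (w, s) \<le> V (w, t)"
    and end_bound: "AE w in M. w \<in> gap n (ennreal T) \<longrightarrow> V (w, T) \<le> ennreal (v w)"
  shows "AE w in M. \<forall>s. \<sigma> n w < s \<longrightarrow> s < \<sigma> (Suc n) w \<longrightarrow> V (w, s) \<le> ennreal (v w)"
proof -
  have "AE w in M. w \<in> gap n (ennreal (of_rat q)) \<longrightarrow> V (w, of_rat q) \<le> ennreal (v w)"
    if q: "0 \<le> (of_rat q :: real)" "of_rat q \<le> T" for q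
  proof -
    let ?q = "of_rat q :: real" and ?t = "ennreal (of_rat q)"
    have v_pre: "v \<in> borel_measurable (pre_sigma (S n))" by (rule H_measurable_pre_sigma[OF v])
    have [measurable]: "(\<lambda>w. if S n w \<le> ?t then v w else 0) \<in> borel_measurable (F ?t)"
      by (rule before_stopping_measurable[OF v_pre stopping_time_S])
    have [measurable]: "(\<lambda>w. V (w, ?q)) \<in> borel_measurable (F ?t)" by (rule PRE_slice[OF V q])
    define E where "E = {w \<in> space (F ?t). ennreal (if S n w \<le> ?t then v w else 0) < V (w, ?q)}"
    have "E \<in> sets (F ?t)" unfolding E_def by measurable
    then have "E \<in> trace_events ?t" using F_subset_trace by blast
    then obtain C0 where C0: "C0 \<in> sets (H n)" "E \<inter> gap n ?t = C0 \<inter> gap n ?t"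
      unfolding trace_events_def by blast
    define D where "D = C0 \<inter> {w \<in> \<Omega>. S n w \<le> ?t}"
    have "{w \<in> space (pre_sigma (S n)). S n w \<le> ?t} \<in> sets (pre_sigma (S n))"
      using measurable_stopping_time_pre_sigma[OF stopping_time_S, of n] by measurable
    then have D: "D \<in> sets (pre_sigma (S n))"
      unfolding D_def using C0(1) H_pre_sigma by (auto simp: space_pre_sigma)
    then have DM: "D \<in> sets M" using pre_sigma_subset_M by auto
    have tT: "?t \<le> ennreal T" using q by (intro ennreal_leI)
    have "(\<integral>\<^sup>+w. indicator D w * indicator {w\<in>\<Omega>. S n w \<le> ennreal T} w \<partial>M)
      \<le> ennreal (exp C) * (\<integral>\<^sup>+w. indicator D w * indicator (gap n (ennreal T)) w \<partial>M)"
      by (rule survival) (use D in simp)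
    also have "(\<integral>\<^sup>+w. indicator D w * indicator (gap n (ennreal T)) w \<partial>M) = (\<integral>\<^sup>+w. 0 \<partial>M)"
    proof (rule nn_integral_cong_AE)
      show "AE w in M. indicator D w * indicator (gap n (ennreal T)) w = (0 :: ennreal)"
        using end_bound
      proof eventually_elim
        case (elim w)
        have "\<not> (w \<in> D \<and> w \<in> gap n (ennreal T))"
        proof
          assume *: "w \<in> D \<and> w \<in> gap n (ennreal T)"
          then have Sn: "S n w \<le> ?t" "w \<in> \<Omega>" "ennreal T < S (Suc n) w" by (auto simp: D_def gap_def)
          then have "w \<in> gap n ?t" using tT by (auto simp: gap_def intro: le_less_trans)
          then have "w \<in> E" using C0(2) * by (auto simp: D_def)
          then have "ennreal (v w) < V (w, ?q)" using Sn by (simp add: E_def)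
          also have "\<dots> \<le> V (w, T)" by (rule mono[OF Sn(2) q(2)])
          finally show False using elim * by simp
        qed
        then show ?case by (auto simp: indicator_def)
      qed
    qed
    finally have "(\<integral>\<^sup>+w. indicator D w * indicator {w\<in>\<Omega>. S n w \<le> ennreal T} w \<partial>M) = 0" by simp
    then have "AE w in M. indicator D w * indicator {w\<in>\<Omega>. S n w \<le> ennreal T} w = (0 :: ennreal)"
      using DM by (subst (asm) nn_integral_0_iff_AE) auto
    then show ?thesis using AE_space
    proof eventually_elim
      case (elim w)
      show ?case
      proof
        assume g: "w \<in> gap n ?t"
        then have Sn: "S n w \<le> ?t" by (simp add: gap_def)
        then have "S n w \<le> ennreal T" using tT by (rule order_trans)
        then have "w \<notin> D" using elim by (auto simp: indicator_def split: if_splits)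
        then have "w \<notin> E" using C0(2) g Sn elim(2) by (auto simp: D_def)
        then show "V (w, ?q) \<le> ennreal (v w)" using Sn elim(2) by (simp add: E_def space_F not_less)
      qed
    qed
  qed
  then have "AE w in M. \<forall>q\<in>{q. 0 \<le> (of_rat q :: real) \<and> of_rat q \<le> T}. w \<in> gap n (ennreal (of_rat q)) \<longrightarrow> V (w, of_rat q) \<le> ennreal (v w)"
    by (subst AE_ball_countable) auto
  then show ?thesis using AE_space
  proof eventually_elim
    case (elim w)
    show ?case
    proof (intro allI impI)
      fix s assume s: "\<sigma> n w < s" "s < \<sigma> (Suc n) w"
      obtain q where q: "s < of_rat q" "of_rat q < \<sigma> (Suc n) w" using of_rat_dense[OF s(2)] by blast
      have q1: "0 \<le> (of_rat q :: real)" "of_rat q \<le> T" using s q \<sigma>_range(2)[of n w] \<sigma>_range(3)[of "Suc n" w] by linarith+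
      then have q0: "of_rat q \<in> {0..T}" by (simp only: atLeastAtMost_iff simp_thms)
      have "S n w \<le> ennreal (of_rat q)" using \<sigma>_less_iff[OF q0, of n w] s q by simp
      moreover have "ennreal (of_rat q) < S (Suc n) w"
      proof -
        have "ennreal (of_rat q) < ennreal (\<sigma> (Suc n) w)" using q(2) q1(1) by (intro ennreal_lessI) linarith+
        also have "\<dots> \<le> S (Suc n) w" by (simp add: \<sigma>_ennreal)
        finally show ?thesis .
      qed
      ultimately have "w \<in> gap n (ennreal (of_rat q))" using elim(2) by (simp add: gap_def)
      then have "V (w, of_rat q) \<le> ennreal (v w)" using elim(1) q1 by blast
      moreover have "V (w, s) \<le> V (w, of_rat q)" by (rule mono[OF elim(2)]) (use q in simp)
      ultimately show "V (w, s) \<le> ennreal (v w)" by (rule order_trans[rotated])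
    qed
  qed
qed

text \<open>
  A function of \<open>n + 1\<close> points becomes predictable when the first \<open>n\<close> points are kept, which are known after
  \<open>S n\<close>, and the last one is replaced by an arbitrary time and mark.
\<close>

lemma next_value_predictable:
  assumes c: "c \<in> borel_measurable (H (Suc n))"
  obtains r where "pred_process r"
    "\<And>w. w \<in> \<Omega> \<Longrightarrow> S (Suc n) w \<le> ennreal T \<Longrightarrow> r w (\<sigma> (Suc n) w) (X (Suc n) w) = c w"
proof -
  obtain r0 where r0: "r0 \<in> borel_measurable (H n \<Otimes>\<^sub>M (borel \<Otimes>\<^sub>M borel))"
    "\<And>w. w \<in> \<Omega> \<Longrightarrow> c w = r0 (w, S (Suc n) w, X (Suc n) w)"
    using next_point_function[OF c] by blast
  define r where "r w s x = (if (w, s) \<in> after (S n) then r0 (w, ennreal s, x) else 0)" for w s x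
  let ?D = "after (S n) \<times> (UNIV :: 'e set)"
  have A: "after (S n) \<in> sets PRE" by (rule after_PRE[OF stopping_time_S])
  have D: "?D \<in> sets (PRE \<Otimes>\<^sub>M (borel :: 'e measure))" using A by auto
  let ?R = "restrict_space (PRE \<Otimes>\<^sub>M (borel :: 'e measure)) ?D"
  have "sets (H n) \<subseteq> sets (pre_sigma (S n))" by (rule H_pre_sigma)
  then have id: "(\<lambda>w. w) \<in> pre_sigma (S n) \<rightarrow>\<^sub>M H n"
    using sets.sets_into_space[of _ "H n"] by (auto intro!: measurableI simp: space_pre_sigma Int_absorb2)
  have "fst \<in> ?R \<rightarrow>\<^sub>M restrict_space PRE (after (S n))"
    by (rule measurable_restrict_space3[OF measurable_fst]) auto
  from measurable_compose[OF this measurable_compose[OF fst_after_measurable[OF stopping_time_S] id]]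
  have 1: "(\<lambda>z. fst (fst z)) \<in> ?R \<rightarrow>\<^sub>M H n" by simp
  have "(\<lambda>z. (ennreal (snd (fst z)), snd z)) \<in> PRE \<Otimes>\<^sub>M (borel :: 'e measure) \<rightarrow>\<^sub>M borel \<Otimes>\<^sub>M borel" by measurable
  then have 2: "(\<lambda>z. (ennreal (snd (fst z)), snd z)) \<in> ?R \<rightarrow>\<^sub>M borel \<Otimes>\<^sub>M borel" by (rule measurable_restrict_space1)
  from measurable_compose[OF measurable_Pair[OF 1 2] r0(1)]
  have "(\<lambda>z. if z \<in> ?D then r0 (fst (fst z), ennreal (snd (fst z)), snd z) else 0) \<in> borel_measurable (PRE \<Otimes>\<^sub>M borel)"
    using D by (subst measurable_restrict_space_iff[symmetric]) (auto intro!: sets.Int)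
  then have "pred_process r"
    by (intro predictableI) (simp add: r_def mem_Times_iff)
  moreover have "r w (\<sigma> (Suc n) w) (X (Suc n) w) = c w" if w: "w \<in> \<Omega>" and S': "S (Suc n) w \<le> ennreal T" for w
  proof -
    have "S n w \<le> ennreal T" using S_Suc[OF w] S' by (rule order_trans)
    then have "S n w < S (Suc n) w" by (rule S_less[OF w])
    then have "(w, \<sigma> (Suc n) w) \<in> after (S n)"
      using w \<sigma>_range[of "Suc n" w] S_eq_\<sigma>[OF S'] by (simp add: after_def)
    then show ?thesis using r0(2)[OF w] S_eq_\<sigma>[OF S'] by (simp add: r_def)
  qed
  ultimately show thesis by (rule that)
qed

text \<open>
  The random equation is solved for every \<open>w\<close>, which needs an integrable driver for every \<open>w\<close>. It is
  therefore cut off predictably, as soon as the integral \<open>V\<close> of its size exceeds the value which, by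
  the first \<open>n\<close> points, it will have when no further jump arrives. By \<open>level_not_exceeded\<close>, this almost
  surely changes nothing up to the next jump.
\<close>

lemma cutoff_driver:
  assumes r: "pred_process r"
    and fin: "(\<integral>\<^sup>+w. (\<integral>\<^sup>+s\<in>{\<sigma> n w<..\<sigma> (Suc n) w}. mark_norm r w s \<partial>dA w) \<partial>M) < \<infinity>"
  obtains h where "h \<in> borel_measurable (PRE \<Otimes>\<^sub>M borel)"
    "\<And>w s v v'. w \<in> \<Omega> \<Longrightarrow> s \<in> {0..T} \<Longrightarrow> \<bar>h ((w, s), v) - h ((w, s), v')\<bar> \<le> (L + L') * \<bar>v - v'\<bar>"
    "\<And>w. w \<in> \<Omega> \<Longrightarrow> integrable (dA w) (\<lambda>s. h ((w, s), 0))"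
    "\<And>p v'. p \<notin> step n \<Longrightarrow> h (p, v') = 0"
    "AE w in M. AE s in dA w. s \<in> {\<sigma> n w<..\<sigma> (Suc n) w} \<longrightarrow> (\<forall>v'. h ((w, s), v') = jump_driver r v' v' (w, s))"
proof -
  define g where "g p = indicator (step n) p * (ennreal L * mark_norm r (fst p) (snd p) + f0 (fst p) (snd p))" for p
  define V where "V = (\<lambda>(w, t). \<integral>\<^sup>+s\<in>{0<..t}. g (w, s) \<partial>dA w)"
  note [measurable] = mark_norm_measurable[OF r] f0_measurable
  have g [measurable]: "g \<in> borel_measurable PRE" unfolding g_def[abs_def] by measurable
  have V [measurable]: "V \<in> borel_measurable PRE" unfolding V_def by (rule nn_integral_process[OF g])
  have V_mono: "V (w, s) \<le> V (w, t)" if "s \<le> t" for w s t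
    unfolding V_def case_prod_conv using that by (intro nn_integral_mono) (auto simp: indicator_def)
  have r_fin: "AE w in M. (\<integral>\<^sup>+s\<in>{\<sigma> n w<..\<sigma> (Suc n) w}. mark_norm r w s \<partial>dA w) \<noteq> \<infinity>"
    using step_integral_measurable[OF mark_norm_measurable[OF r], of n] fin by (intro nn_integral_noteq_infinite) auto
  have V_fin: "AE w in M. V (w, T) < \<infinity>"
    using r_fin AE_f0 AE_space
  proof eventually_elim
    case (elim w)
    note w = elim(3)
    have m: "mark_norm r w \<in> borel_measurable (dA w)" "f0 w \<in> borel_measurable (dA w)"
      using dA_measurable[OF w mark_norm_measurable[OF r]] dA_measurable[OF w f0_measurable] by simp_all
    have I: "{\<sigma> n w<..\<sigma> (Suc n) w} \<in> sets (dA w)" using \<sigma>_range by (intro Ioc_dA[OF w]) auto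
    have "V (w, T) \<le> (\<integral>\<^sup>+s. ennreal L * (mark_norm r w s * indicator {\<sigma> n w<..\<sigma> (Suc n) w} s) + f0 w s \<partial>dA w)"
      unfolding V_def case_prod_conv by (intro nn_integral_mono) (auto simp: indicator_def g_def step_def)
    also have "\<dots> = ennreal L * (\<integral>\<^sup>+s\<in>{\<sigma> n w<..\<sigma> (Suc n) w}. mark_norm r w s \<partial>dA w) + (\<integral>\<^sup>+s. f0 w s \<partial>dA w)"
      using m I by (subst nn_integral_add) (auto simp: nn_integral_cmult)
    also have "\<dots> < \<infinity>" using elim by (simp add: ennreal_mult_less_top less_top)
    finally show ?case .
  qed
  have "(\<lambda>w. enn2real (V (w, T))) \<in> borel_measurable (F (ennreal T))"
    using PRE_slice[OF V, of T] T_pos by simp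
  from trace_function[OF this, of n] obtain v
    where v: "v \<in> borel_measurable (H n)" "\<And>w. w \<in> gap n (ennreal T) \<Longrightarrow> enn2real (V (w, T)) = v w" by blast
  have level: "AE w in M. \<forall>s. \<sigma> n w < s \<longrightarrow> s < \<sigma> (Suc n) w \<longrightarrow> V (w, s) \<le> ennreal (v w)"
  proof (rule level_not_exceeded[OF V v(1) V_mono])
    show "AE w in M. w \<in> gap n (ennreal T) \<longrightarrow> V (w, T) \<le> ennreal (v w)"
      using V_fin by eventually_elim (auto simp flip: v(2))
  qed
  have vm: "(\<lambda>w. ennreal (v w)) \<in> borel_measurable (pre_sigma (S n))"
    using H_measurable_pre_sigma[OF v(1)] by measurable
  have [measurable]: "(\<lambda>p. if p \<in> after (S n) then ennreal (v (fst p)) else 0) \<in> borel_measurable PRE"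
    by (rule after_measurable[OF stopping_time_S vm]) simp
  \<comment> \<open>The points where the driver is kept; there it is finite, and its integral has not exceeded the level.\<close>
  define G where "G = {p \<in> space PRE. p \<in> step n \<and> mark_norm r (fst p) (snd p) < \<infinity> \<and> f0 (fst p) (snd p) < \<infinity>
    \<and> V p \<le> (if p \<in> after (S n) then ennreal (v (fst p)) else 0)}"
  have G: "G \<in> sets PRE" unfolding G_def by measurable
  have G_fin: "mark_norm r (fst p) (snd p) < \<infinity> \<and> f0 (fst p) (snd p) < \<infinity>" if "p \<in> G" for p
    using that by (simp add: G_def)
  have G_step: "p \<in> step n" if "p \<in> G" for p using that by (simp add: G_def)
  define h where "h z = indicator G (fst z) * jump_driver r (snd z) (snd z) (fst z)" for z
  have h: "h \<in> borel_measurable (PRE \<Otimes>\<^sub>M borel)"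
    unfolding h_def[abs_def] by (rule diagonal_jump_driver_measurable[OF r G G_fin])
  show thesis
  proof (rule that[of h, OF h])
    fix w s v v' assume w: "w \<in> \<Omega>" and s: "s \<in> {0..T}"
    show "\<bar>h ((w, s), v) - h ((w, s), v')\<bar> \<le> (L + L') * \<bar>v - v'\<bar>"
    proof (cases "(w, s) \<in> G")
      case True
      then have f: "mark_norm r w s < \<infinity>" "f0 w s < \<infinity>" using G_fin[of "(w, s)"] by auto
      from jump_driver_lipschitz[OF w s r f, of v v v' v'] True show ?thesis by (simp add: h_def algebra_simps)
    qed (use L_nonneg in \<open>simp add: h_def\<close>)
  next
    fix w assume w: "w \<in> \<Omega>"
    interpret path: continuous_increasing_path T "A w" by (rule continuous_A_path[OF w])
    have hm: "(\<lambda>s. h ((w, s), 0)) \<in> borel_measurable (dA w)"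
      by (rule dA_measurable[OF w]) (rule measurable_compose[OF _ h], measurable)
    show "integrable (dA w) (\<lambda>s. h ((w, s), 0))"
    proof (rule integrableI_bounded[OF hm])
      have "(\<integral>\<^sup>+s. ennreal (norm (h ((w, s), 0))) \<partial>dA w)
        \<le> (\<integral>\<^sup>+s. g (w, s) * indicator {s. (\<integral>\<^sup>+u\<in>{0<..s}. g (w, u) \<partial>dA w) \<le> ennreal (v w)} s \<partial>dA w)"
      proof (rule nn_integral_mono)
        fix s assume "s \<in> space (dA w)"
        then have s: "s \<in> {0..T}" using space_dA[OF w] by simp
        show "ennreal (norm (h ((w, s), 0))) \<le> g (w, s) * indicator {s. (\<integral>\<^sup>+u\<in>{0<..s}. g (w, u) \<partial>dA w) \<le> ennreal (v w)} s"
        proof (cases "(w, s) \<in> G")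
          case True
          then have "V (w, s) \<le> ennreal (v w)" "(w, s) \<in> step n" by (auto simp: G_def step_eq)
          then show ?thesis using jump_driver_zero[OF w s r] True by (simp add: h_def g_def V_def)
        qed (simp add: h_def)
      qed
      also have "\<dots> \<le> ennreal (v w)"
        by (rule path.nn_integral_below_level) (rule dA_measurable[OF w g])
      also have "\<dots> < \<infinity>" by simp
      finally show "(\<integral>\<^sup>+s. ennreal (norm (h ((w, s), 0))) \<partial>dA w) < \<infinity>" .
    qed
  next
    fix p v' assume "p \<notin> step n"
    then show "h (p, v') = 0" using G_step[of p] by (auto simp: h_def indicator_def)
  next
    show "AE w in M. AE s in dA w. s \<in> {\<sigma> n w<..\<sigma> (Suc n) w} \<longrightarrow> (\<forall>v'. h ((w, s), v') = jump_driver r v' v' (w, s))"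
      using r_fin AE_f0 level AE_space
    proof eventually_elim
      case (elim w)
      note w = elim(4)
      have m: "mark_norm r w \<in> borel_measurable (dA w)" "f0 w \<in> borel_measurable (dA w)"
        using dA_measurable[OF w mark_norm_measurable[OF r]] dA_measurable[OF w f0_measurable] by simp_all
      have I: "{\<sigma> n w<..\<sigma> (Suc n) w} \<in> sets (dA w)" using \<sigma>_range by (intro Ioc_dA[OF w]) auto
      have "AE s in dA w. mark_norm r w s * indicator {\<sigma> n w<..\<sigma> (Suc n) w} s \<noteq> \<infinity>"
        using m I elim(1) by (intro nn_integral_noteq_infinite) auto
      moreover have "AE s in dA w. f0 w s \<noteq> \<infinity>" using m elim(2) by (intro nn_integral_noteq_infinite) auto
      moreover have "AE s in dA w. s \<noteq> \<sigma> (Suc n) w"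
        by (rule continuous_increasing_path.AE_stieltjes_singleton[OF continuous_A_path[OF w]])
      ultimately show ?case using AE_space
      proof eventually_elim
        case (elim s)
        then have s: "s \<in> {0..T}" using space_dA[OF w] by simp
        show ?case
        proof
          assume sI: "s \<in> {\<sigma> n w<..\<sigma> (Suc n) w}"
          then have st: "(w, s) \<in> step n" using w s by (simp add: step_def)
          have "V (w, s) \<le> ennreal (v w)" using \<open>\<forall>s. \<sigma> n w < s \<longrightarrow> s < \<sigma> (Suc n) w \<longrightarrow> V (w, s) \<le> ennreal (v w)\<close> sI elim by simp
          then have "(w, s) \<in> G" using elim st sI w s by (auto simp: G_def step_eq less_top)
          then show "\<forall>v'. h ((w, s), v') = jump_driver r v' v' (w, s)" by (simp add: h_def)
        qed
      qed
    qed
  qed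
qed

text \<open>
  One step of the backward construction. The value \<open>c\<close> at \<open>S n\<close> is found by solving the equation backwards
  from \<open>\<xi>\<close> as if no further jump arrived. Started from \<open>c\<close>, the forward solution is predictable, and by
  uniqueness it ends in \<open>\<xi>\<close> when indeed no jump arrives; when one does, \<open>Z\<close> lifts it to the next value.
\<close>

lemma extend_solution:
  assumes sol: "solution_from (Suc n) Y' Z'"
    and c': "c' \<in> borel_measurable (H (Suc n))"
    and Y'_c': "\<And>w. w \<in> \<Omega> \<Longrightarrow> S (Suc n) w \<le> ennreal T \<Longrightarrow> Y' w (\<sigma> (Suc n) w) = c' w"
    and fin: "(\<integral>\<^sup>+w. (if S (Suc n) w \<le> ennreal T then ennreal \<bar>Y' w (\<sigma> (Suc n) w)\<bar> else 0) \<partial>M) < \<infinity>"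
  obtains Y Z c where "solution_from n Y Z" "c \<in> borel_measurable (H n)"
    "\<And>w. w \<in> \<Omega> \<Longrightarrow> S n w \<le> ennreal T \<Longrightarrow> Y w (\<sigma> n w) = c w"
proof -
  have K: "0 \<le> L + L'" using L_nonneg by simp
  have Z': "pred_process Z'" using sol by (rule solution_predictable)
  obtain r where r: "pred_process r"
    "\<And>w. w \<in> \<Omega> \<Longrightarrow> S (Suc n) w \<le> ennreal T \<Longrightarrow> r w (\<sigma> (Suc n) w) (X (Suc n) w) = c' w"
    using next_value_predictable[OF c'] by blast
  have r_fin: "(\<integral>\<^sup>+w. (\<integral>\<^sup>+s\<in>{\<sigma> n w<..\<sigma> (Suc n) w}. mark_norm r w s \<partial>dA w) \<partial>M) < \<infinity>"
  proof -
    have m: "(\<lambda>z. ennreal \<bar>r (fst (fst z)) (snd (fst z)) (snd z)\<bar>) \<in> borel_measurable (PRE \<Otimes>\<^sub>M borel)"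
      using predictableD[OF r(1)] by measurable
    have "(\<integral>\<^sup>+w. (\<integral>\<^sup>+s\<in>{\<sigma> n w<..\<sigma> (Suc n) w}. mark_norm r w s \<partial>dA w) \<partial>M)
      = (\<integral>\<^sup>+w. (if S (Suc n) w \<le> ennreal T then ennreal \<bar>r w (\<sigma> (Suc n) w) (X (Suc n) w)\<bar> else 0) \<partial>M)"
      using step_compensator[OF m, of n, unfolded fst_conv snd_conv] unfolding mark_norm_def by (rule sym)
    also have "\<dots> = (\<integral>\<^sup>+w. (if S (Suc n) w \<le> ennreal T then ennreal \<bar>Y' w (\<sigma> (Suc n) w)\<bar> else 0) \<partial>M)"
      by (intro nn_integral_cong) (auto simp: r(2) Y'_c')
    finally show ?thesis using fin by simp
  qed
  obtain h where h: "h \<in> borel_measurable (PRE \<Otimes>\<^sub>M borel)"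
    and lip: "\<And>w s v v'. w \<in> \<Omega> \<Longrightarrow> s \<in> {0..T} \<Longrightarrow> \<bar>h ((w, s), v) - h ((w, s), v')\<bar> \<le> (L + L') * \<bar>v - v'\<bar>"
    and h_int: "\<And>w. w \<in> \<Omega> \<Longrightarrow> integrable (dA w) (\<lambda>s. h ((w, s), 0))"
    and h_zero: "\<And>p v'. p \<notin> step n \<Longrightarrow> h (p, v') = 0"
    and h_AE: "AE w in M. AE s in dA w. s \<in> {\<sigma> n w<..\<sigma> (Suc n) w} \<longrightarrow> (\<forall>v'. h ((w, s), v') = jump_driver r v' v' (w, s))"
    using cutoff_driver[OF r(1) r_fin] by blast
  \<comment> \<open>The solution as if no jump followed. It looks ahead, and is only compared on the gap.\<close>
  obtain b Bb where b: "(\<lambda>w. b (w, \<sigma> n w)) \<in> borel_measurable (F (ennreal T))"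
    "\<And>w t. w \<in> \<Omega> \<Longrightarrow> t \<in> {0..T} \<Longrightarrow> \<bar>b (w, t)\<bar> \<le> Bb w"
    "\<And>w. w \<in> \<Omega> \<Longrightarrow> integrable (dA w) (\<lambda>s. h ((w, s), b (w, s)))"
    "\<And>w t. w \<in> \<Omega> \<Longrightarrow> t \<in> {0..T} \<Longrightarrow> b (w, t) = \<xi> w + (LINT s:{t<..T}|dA w. h ((w, s), b (w, s)))"
    using backward_equation[OF h K lip h_int \<xi>_F \<sigma>_F[of n] \<sigma>_range(1)] by blast
  obtain c where c: "c \<in> borel_measurable (H n)" "\<And>w. w \<in> gap n (ennreal T) \<Longrightarrow> b (w, \<sigma> n w) = c w"
    using trace_function[OF b(1)] by blast
  have c_pre: "c \<in> borel_measurable (pre_sigma (S n))" by (rule H_measurable_pre_sigma[OF c(1)])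
  define \<eta> where "\<eta> = (\<lambda>p. if p \<in> after (S n) then c (fst p) else 0)"
  have \<eta>: "\<eta> \<in> borel_measurable PRE" unfolding \<eta>_def by (rule after_measurable[OF stopping_time_S c_pre]) simp
  obtain y B where y: "y \<in> borel_measurable PRE"
    and y_bound: "\<And>w t. w \<in> \<Omega> \<Longrightarrow> t \<in> {0..T} \<Longrightarrow> \<bar>y (w, t)\<bar> \<le> B w"
    and y_int: "\<And>w. w \<in> \<Omega> \<Longrightarrow> integrable (dA w) (\<lambda>s. - h ((w, s), y (w, s)))"
    and y_eq: "\<And>w t. w \<in> \<Omega> \<Longrightarrow> t \<in> {0..T} \<Longrightarrow> y (w, t) = \<eta> (w, t) + (LINT s:{0<..t}|dA w. - h ((w, s), y (w, s)))"
  proof (rule forward_equation[of "\<lambda>z. - h z" "L + L'" \<eta> "\<lambda>w. \<bar>c w\<bar>"])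
    show "(\<lambda>z. - h z) \<in> borel_measurable (PRE \<Otimes>\<^sub>M borel)" using h by measurable
    show "\<bar>- h ((w, s), v) - - h ((w, s), v')\<bar> \<le> (L + L') * \<bar>v - v'\<bar>" if "w \<in> \<Omega>" "s \<in> {0..T}" for w s v v'
      using lip[OF that, of v' v] by (simp add: abs_minus_commute)
    show "integrable (dA w) (\<lambda>s. - h ((w, s), 0))" if "w \<in> \<Omega>" for w using h_int[OF that] by simp
    show "\<bar>\<eta> (w, t)\<bar> \<le> \<bar>c w\<bar>" for w t by (simp add: \<eta>_def)
  qed (use K \<eta> in auto)
  let ?k = "\<lambda>w s. h ((w, s), y (w, s))"
  have k_int: "integrable (dA w) (?k w)" if "w \<in> \<Omega>" for w using y_int[OF that] by simp
  have k_set: "set_integrable (dA w) U (?k w)" if "w \<in> \<Omega>" "U \<in> sets (dA w)" for w U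
    unfolding set_integrable_def using k_int[OF that(1)] that(2) by (rule integrable_mult_indicator[rotated])
  define W where "W = (\<lambda>(w, t). LINT s:{0<..t}|dA w. ?k w s)"
  have W_cont: "continuous_on {0..T} (\<lambda>t. W (w, t))" if "w \<in> \<Omega>" for w
    unfolding W_def case_prod_conv
    by (rule continuous_increasing_path.integral_until_continuous[OF continuous_A_path[OF that] k_int[OF that]])
  have W_PRE: "W \<in> borel_measurable PRE"
    unfolding W_def by (rule integral_process) (rule measurable_compose[OF _ h], use y in measurable)
  have W_before: "W (w, t) = 0" if "w \<in> \<Omega>" "t \<le> \<sigma> n w" for w t
  proof -
    have "indicator {0<..t} s *\<^sub>R ?k w s = 0" for s
      using that h_zero[of "(w, s)"] by (auto simp: step_def indicator_def)
    then show ?thesis unfolding W_def case_prod_conv set_lebesgue_integral_def by (simp only: integral_zero)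
  qed
  have W_diff: "(LINT s:{u<..t}|dA w. ?k w s) = W (w, t) - W (w, u)" if w: "w \<in> \<Omega>" and "0 \<le> u" "u \<le> t" "t \<le> T" for w u t
  proof -
    have "(LINT s:{0<..u} \<union> {u<..t}|dA w. ?k w s) = (LINT s:{0<..u}|dA w. ?k w s) + (LINT s:{u<..t}|dA w. ?k w s)"
      by (rule set_integral_Un) (use that in \<open>auto intro!: k_set Ioc_dA[OF w]\<close>)
    moreover have "{0<..u} \<union> {u<..t} = {0<..t}" using that by auto
    ultimately show ?thesis by (simp add: W_def)
  qed
  have y_after: "y (w, t) = c w - W (w, t)" if w: "w \<in> \<Omega>" and t: "\<sigma> n w < t" "t \<le> T" for w t
  proof -
    have tT: "t \<in> {0..T}" using t \<sigma>_range(2)[of n w] by simp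
    have "(w, t) \<in> after (S n)" using w tT \<sigma>_less_iff[OF tT, of n w] t by (simp add: after_def)
    then show ?thesis using y_eq[OF w tT] by (simp add: \<eta>_def W_def set_lebesgue_integral_def)
  qed
  \<comment> \<open>Without a further jump, \<open>b\<close> solves the forward equation started in \<open>c\<close>, so that it coincides with \<open>y\<close>.\<close>
  have no_jump: "c w - W (w, T) = \<xi> w" if gap: "w \<in> gap n (ennreal T)" for w
  proof -
    have w: "w \<in> \<Omega>" using gap by (simp add: gap_def)
    let ?a = "\<sigma> n w"
    have a: "0 \<le> ?a" "?a \<le> T" by (rule \<sigma>_range)+
    let ?l = "\<lambda>s. h ((w, s), b (w, s))"
    have l_set: "set_integrable (dA w) {u<..t} ?l" if "0 \<le> u" "t \<le> T" for u t
      unfolding set_integrable_def by (rule integrable_mult_indicator[OF Ioc_dA[OF w that] b(3)[OF w]])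
    have b_T: "b (w, T) = \<xi> w" using b(4)[OF w, of T] T_pos by (simp add: set_lebesgue_integral_def)
    show ?thesis
    proof (cases "?a = T")
      case True
      then show ?thesis using W_before[OF w, of T] c(2)[OF gap] b_T by simp
    next
      case False
      interpret path: continuous_increasing_path T "A w" by (rule continuous_A_path[OF w])
      have "\<bar>y (w, T) - b (w, T)\<bar> \<le> 2 * 0 * exp (2 * (L + L') * A w T)"
      proof (rule path.forward_gronwall[of ?a T 0 "L + L'" "\<lambda>t. y (w, t) - b (w, t)" "B w + Bb w"])
        fix t assume t: "t \<in> {?a<..T}"
        then have t0: "0 \<le> t" "t \<le> T" "t \<in> {0..T}" using a by auto
        have "(LINT s:{?a<..t} \<union> {t<..T}|dA w. ?l s) = (LINT s:{?a<..t}|dA w. ?l s) + (LINT s:{t<..T}|dA w. ?l s)"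
          by (rule set_integral_Un) (use t a in \<open>auto intro!: l_set\<close>)
        moreover have "{?a<..t} \<union> {t<..T} = {?a<..T}" using t by auto
        ultimately have "b (w, t) = c w - (LINT s:{?a<..t}|dA w. ?l s)"
          using b(4)[OF w t0(3)] b(4)[OF w \<sigma>_range(1)[of n w]] c(2)[OF gap] by simp
        moreover have "y (w, t) = c w - (LINT s:{?a<..t}|dA w. ?k w s)"
          using y_after[OF w, of t] W_diff[OF w, of ?a t] W_before[OF w, of ?a] t a by simp
        ultimately have "\<bar>y (w, t) - b (w, t)\<bar> = \<bar>(LINT s:{?a<..t}|dA w. ?k w s) - (LINT s:{?a<..t}|dA w. ?l s)\<bar>" by simp
        then have "ennreal \<bar>y (w, t) - b (w, t)\<bar> \<le> (\<integral>\<^sup>+s\<in>{?a<..t}. ennreal \<bar>?k w s - ?l s\<bar> \<partial>dA w)"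
          using set_integral_diff_bound[OF k_set[OF w Ioc_dA[OF w a(1) t0(2)]] l_set[OF a(1) t0(2)]] by simp
        also have "\<dots> \<le> (\<integral>\<^sup>+s. ennreal (L + L') * (ennreal \<bar>y (w, s) - b (w, s)\<bar> * indicator {?a<..t} s) \<partial>dA w)"
        proof (rule nn_integral_mono)
          fix s assume "s \<in> space (dA w)"
          then have "s \<in> {0..T}" using space_dA[OF w] by simp
          from ennreal_leI[OF lip[OF w this, of "y (w, s)" "b (w, s)"]]
          show "ennreal \<bar>?k w s - ?l s\<bar> * indicator {?a<..t} s \<le> ennreal (L + L') * (ennreal \<bar>y (w, s) - b (w, s)\<bar> * indicator {?a<..t} s)"
            using K by (auto simp: indicator_def ennreal_mult)
        qed
        also have "\<dots> = ennreal (L + L') * (\<integral>\<^sup>+s\<in>{?a<..t}. ennreal \<bar>y (w, s) - b (w, s)\<bar> \<partial>dA w)"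
        proof (rule nn_integral_cmult)
          have "continuous_on {0..T} (\<lambda>u. b (w, 0) - (LINT s:{0<..u}|dA w. ?l s))"
            by (intro continuous_intros path.integral_until_continuous b(3)[OF w])
          moreover have "b (w, 0) - (LINT s:{0<..u}|dA w. ?l s) = b (w, u)" if u: "u \<in> {0..T}" for u
          proof -
            have "(LINT s:{0<..u} \<union> {u<..T}|dA w. ?l s) = (LINT s:{0<..u}|dA w. ?l s) + (LINT s:{u<..T}|dA w. ?l s)"
              by (rule set_integral_Un) (use u in \<open>auto intro!: l_set\<close>)
            moreover have "{0<..u} \<union> {u<..T} = {0<..T}" using u by auto
            ultimately show ?thesis using b(4)[OF w u] b(4)[OF w, of 0] T_pos by simp
          qed
          ultimately have "continuous_on {0..T} (\<lambda>u. b (w, u))" by (rule continuous_on_eq)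
          from borel_measurable_continuous_on_restrict[OF this]
          have [measurable]: "(\<lambda>u. b (w, u)) \<in> borel_measurable (dA w)"
            using sets_dA[OF w] by (simp cong: measurable_cong_sets)
          note [measurable] = dA_measurable[OF w y] Ioc_dA[OF w a(1) t0(2)]
          show "(\<lambda>s. ennreal \<bar>y (w, s) - b (w, s)\<bar> * indicator {?a<..t} s) \<in> borel_measurable (dA w)" by measurable
        qed
        finally show "ennreal \<bar>y (w, t) - b (w, t)\<bar> \<le> ennreal 0 + ennreal (L + L') * (\<integral>\<^sup>+s\<in>{?a<..t}. ennreal \<bar>y (w, s) - b (w, s)\<bar> \<partial>dA w)"
          by simp
      next
        fix t assume t: "t \<in> {?a<..T}"
        then have "t \<in> {0..T}" using a by auto
        then show "\<bar>y (w, t) - b (w, t)\<bar> \<le> B w + Bb w"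
          using y_bound[OF w, of t] b(2)[OF w, of t] by linarith
      qed (use a K False in auto)
      then show ?thesis using y_after[OF w, of T] b_T False a by simp
    qed
  qed
  define Y where "Y w t = (if S (Suc n) w \<le> ennreal t then Y' w t else if S n w \<le> ennreal t then c w - W (w, t) else 0)" for w t
  define Z where "Z w s x = indicator (after (S (Suc n))) (w, s) * Z' w s x + indicator (step n) (w, s) * (r w s x - y (w, s))" for w s x
  have Y_adapted: "adapted F T Y"
    unfolding adapted_def
  proof
    fix t assume t: "t \<in> {0..T}"
    have [measurable]: "Measurable.pred (F (ennreal t)) (\<lambda>w. S k w \<le> ennreal t)" for k
      using stopping_timeD[OF stopping_time_S] .
    have [measurable]: "(\<lambda>w. Y' w t) \<in> borel_measurable (F (ennreal t))" using sol t by (auto simp: solution_from_def adapted_def)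
    have [measurable]: "(\<lambda>w. if S n w \<le> ennreal t then c w else 0) \<in> borel_measurable (F (ennreal t))"
      by (rule before_stopping_measurable[OF c_pre stopping_time_S])
    have [measurable]: "(\<lambda>w. W (w, t)) \<in> borel_measurable (F (ennreal t))" using PRE_slice[OF W_PRE, of t] t by simp
    have "(\<lambda>w. if S (Suc n) w \<le> ennreal t then Y' w t
        else if S n w \<le> ennreal t then (if S n w \<le> ennreal t then c w else 0) - W (w, t) else 0) \<in> borel_measurable (F (ennreal t))"
      by measurable
    then show "(\<lambda>w. Y w t) \<in> borel_measurable (F (ennreal t))" by (simp add: Y_def cong: if_cong)
  qed
  have Y_cadlag: "cadlag T (Y w)" if w: "w \<in> \<Omega>" for w
  proof -
    have "cadlag T (\<lambda>t. c w - W (w, t))" by (intro continuous_cadlag continuous_intros W_cont[OF w])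
    moreover have "cadlag T (\<lambda>_. 0)" by (intro continuous_cadlag continuous_intros)
    moreover have "cadlag T (Y' w)" using sol w by (simp add: solution_from_def)
    ultimately show ?thesis unfolding Y_def[abs_def] by (intro cadlag_switch)
  qed
  have Z_pred: "pred_process Z"
  proof (rule predictableI)
    note [measurable] = predictableD[OF Z'] predictableD[OF r(1)] y after_PRE[OF stopping_time_S]
    show "(\<lambda>z. Z (fst (fst z)) (snd (fst z)) (snd z)) \<in> borel_measurable (PRE \<Otimes>\<^sub>M borel)"
      unfolding Z_def prod.collapse by measurable
  qed
  have Yl: "left_process Y \<in> borel_measurable PRE" by (rule left_process_measurable[OF Y_adapted Y_cadlag])
  have Z_after: "Z w s = Z' w s" if "w \<in> \<Omega>" "\<sigma> (Suc n) w < s" "s \<le> T" for w s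
  proof -
    have "s \<in> {0..T}" using that \<sigma>_range(2)[of "Suc n" w] by simp
    then have "(w, s) \<in> after (S (Suc n))" using that \<sigma>_less_iff[of s "Suc n" w] by (simp add: after_def)
    then show ?thesis by (simp add: Z_def step_eq fun_eq_iff)
  qed
  have Z_step: "Z w s = (\<lambda>x. r w s x - y (w, s))" if "w \<in> \<Omega>" "s \<in> {\<sigma> n w<..\<sigma> (Suc n) w}" for w s
  proof -
    have "s \<in> {0..T}" using that \<sigma>_range[of "Suc n" w] \<sigma>_range(2)[of n w] by simp
    then have "(w, s) \<in> step n" using that by (simp add: step_def)
    then show ?thesis by (simp add: Z_def step_eq fun_eq_iff)
  qed
  have Z_fin: "AE w in M. (\<integral>\<^sup>+s\<in>{\<sigma> n w<..T}. mark_norm Z w s \<partial>dA w) < \<infinity>"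
  proof -
    have "AE w in M. (\<integral>\<^sup>+s\<in>{\<sigma> n w<..\<sigma> (Suc n) w}. mark_norm r w s \<partial>dA w) \<noteq> \<infinity>"
      using step_integral_measurable[OF mark_norm_measurable[OF r(1)], of n] r_fin by (intro nn_integral_noteq_infinite) auto
    moreover have "AE w in M. (\<integral>\<^sup>+s\<in>{\<sigma> (Suc n) w<..T}. mark_norm Z' w s \<partial>dA w) < \<infinity>" using sol by (simp add: solution_from_def)
    ultimately show ?thesis using AE_space
    proof eventually_elim
      case (elim w)
      note w = elim(3)
      interpret finite_measure "dA w" using finite_dA[OF w] .
      have m: "mark_norm r w \<in> borel_measurable (dA w)" "mark_norm Z' w \<in> borel_measurable (dA w)"
        using dA_measurable[OF w mark_norm_measurable[OF r(1)]] dA_measurable[OF w mark_norm_measurable[OF Z']] by simp_all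
      have I: "{\<sigma> n w<..\<sigma> (Suc n) w} \<in> sets (dA w)" "{\<sigma> (Suc n) w<..T} \<in> sets (dA w)"
        using \<sigma>_range by (intro Ioc_dA[OF w]; auto)+
      have "(\<integral>\<^sup>+s\<in>{\<sigma> n w<..T}. mark_norm Z w s \<partial>dA w)
        \<le> (\<integral>\<^sup>+s. mark_norm Z' w s * indicator {\<sigma> (Suc n) w<..T} s + (mark_norm r w s * indicator {\<sigma> n w<..\<sigma> (Suc n) w} s + ennreal (B w)) \<partial>dA w)"
      proof (rule nn_integral_mono)
        fix s assume "s \<in> space (dA w)"
        then have s: "s \<in> {0..T}" using space_dA[OF w] by simp
        show "mark_norm Z w s * indicator {\<sigma> n w<..T} s
          \<le> mark_norm Z' w s * indicator {\<sigma> (Suc n) w<..T} s + (mark_norm r w s * indicator {\<sigma> n w<..\<sigma> (Suc n) w} s + ennreal (B w))"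
        proof (cases "\<sigma> (Suc n) w < s")
          case True
          then have "mark_norm Z w s = mark_norm Z' w s" using Z_after[OF w, of s] s by (simp add: mark_norm_def)
          then show ?thesis using True s by (simp add: indicator_def)
        next
          case False
          show ?thesis
          proof (cases "\<sigma> n w < s")
            case True
            have "mark_norm Z w s = mark_norm (\<lambda>w s x. r w s x - y (w, s)) w s"
              using Z_step[OF w, of s] True False by (simp add: mark_norm_def)
            also have "\<dots> \<le> mark_norm r w s + ennreal \<bar>y (w, s)\<bar>"
              using mark_norm_triangle[OF w s predictable_add_process[OF r(1) borel_measurable_uminus[OF y]] y] by simp
            also have "\<dots> \<le> mark_norm r w s + ennreal (B w)" using y_bound[OF w s] by (intro add_left_mono ennreal_leI)
            finally show ?thesis using True False s by (simp add: indicator_def)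
          qed simp
        qed
      qed
      also have "\<dots> = (\<integral>\<^sup>+s\<in>{\<sigma> (Suc n) w<..T}. mark_norm Z' w s \<partial>dA w) + ((\<integral>\<^sup>+s\<in>{\<sigma> n w<..\<sigma> (Suc n) w}. mark_norm r w s \<partial>dA w) + ennreal (B w) * emeasure (dA w) (space (dA w)))"
        using m I by (subst nn_integral_add, simp, simp, subst nn_integral_add) auto
      also have "\<dots> < \<infinity>"
      proof -
        have "emeasure (dA w) (space (dA w)) < \<top>"
          using emeasure_finite[of "space (dA w)"] by (simp only: less_top[symmetric] not_False_eq_True)
        then show ?thesis using elim by (simp add: ennreal_mult_less_top less_top)
      qed
      finally show ?case .
    qed
  qed
  have Y_between: "Y w t = c w - W (w, t)" if "S n w \<le> ennreal t" "ennreal t < S (Suc n) w" for w t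
    using that by (auto simp: Y_def dest: leD)
  have left_after: "left_limit (Y w) s = left_limit (Y' w) s"
    if w: "w \<in> \<Omega>" and t: "S (Suc n) w \<le> ennreal t" "0 \<le> t" "t < s" "s \<le> T" for w s t
  proof (rule left_limit_cong)
    show "cadlag T (Y' w)" using sol w by (simp add: solution_from_def)
    have "\<forall>\<^sub>F u in at_left s. u \<in> {t<..<s}" using t by (intro eventually_at_leftI[of t]) auto
    then show "\<forall>\<^sub>F u in at_left s. Y' w u = Y w u"
    proof eventually_elim
      case (elim u)
      then have "ennreal t \<le> ennreal u" by (intro ennreal_leI) simp
      with t(1) have "S (Suc n) w \<le> ennreal u" by (rule order_trans)
      then show ?case by (simp add: Y_def)
    qed
  qed (use t in simp)
  have left_step: "left_process Y (w, s) = y (w, s)" if w: "w \<in> \<Omega>" and s: "s \<in> {\<sigma> n w<..\<sigma> (Suc n) w}" for w s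
  proof -
    have s0: "0 < s" "s \<le> T" using s \<sigma>_range(2)[of n w] \<sigma>_range(3)[of "Suc n" w] by auto
    have cont: "continuous_on {0..T} (\<lambda>t. c w - W (w, t))" by (intro continuous_intros W_cont[OF w])
    have "left_limit (Y w) s = left_limit (\<lambda>t. c w - W (w, t)) s"
    proof (rule left_limit_cong[OF continuous_cadlag[OF cont]])
      have "\<forall>\<^sub>F u in at_left s. u \<in> {\<sigma> n w<..<s}" using s by (intro eventually_at_leftI[of "\<sigma> n w"]) auto
      then show "\<forall>\<^sub>F u in at_left s. c w - W (w, u) = Y w u"
      proof eventually_elim
        case (elim u)
        then have u: "u \<in> {0..T}" "u < T" using s0 \<sigma>_range(2)[of n w] by auto
        have "S n w \<le> ennreal u" using \<sigma>_le_iff[OF u(1), of n w] u elim by simp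
        moreover have "\<not> S (Suc n) w \<le> ennreal u" using \<sigma>_le_iff[OF u(1), of "Suc n" w] u elim s by simp
        ultimately show ?case by (simp add: Y_def)
      qed
    qed (use s0 in simp)
    also have "\<dots> = c w - W (w, s)" by (intro left_limit_eq continuous_at_left[OF cont]) (use s0 in simp)
    also have "\<dots> = y (w, s)" using y_after[OF w, of s] s s0 by simp
    finally show ?thesis using s0 by (simp add: left_process_def)
  qed
  have mean_step: "AE w in M. AE s in dA w. s \<in> {\<sigma> n w<..\<sigma> (Suc n) w} \<longrightarrow> mean_driver Y Z w s = ?k w s"
    using h_AE AE_space
  proof eventually_elim
    case (elim w)
    note w = elim(2)
    show ?case
      using elim(1)
    proof eventually_elim
      case (elim s)
      show ?case
      proof
        assume s: "s \<in> {\<sigma> n w<..\<sigma> (Suc n) w}"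
        have "mean_driver Y Z w s = jump_driver r (y (w, s)) (y (w, s)) (w, s)"
          unfolding mean_driver_def jump_driver_def driver_def fst_conv snd_conv left_step[OF w s] Z_step[OF w s] ..
        then show "mean_driver Y Z w s = ?k w s" using elim s by simp
      qed
    qed
  qed
  have "AE w in M. \<forall>t\<in>{0..T}. S (Suc n) w \<le> ennreal t \<longrightarrow>
        Y' w t + (LINT (s, x):{t<..T} \<times> UNIV|\<mu> w. Z' w s x) =
        \<xi> w + (LINT (s, x):{t<..T} \<times> UNIV|\<nu> w. f w s x (left_limit (Y' w) s) (Z' w s))"
    using sol by (simp add: solution_from_def)
  then have equation: "AE w in M. \<forall>t\<in>{0..T}. S n w \<le> ennreal t \<longrightarrow>
        Y w t + (LINT (s, x):{t<..T} \<times> UNIV|\<mu> w. Z w s x) =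
        \<xi> w + (LINT (s, x):{t<..T} \<times> UNIV|\<nu> w. f w s x (left_limit (Y w) s) (Z w s))"
    using mean_step Z_fin AE_f0 AE_space
  proof eventually_elim
    case (elim w)
    note w = elim(5)
    let ?a = "\<sigma> n w" and ?b = "\<sigma> (Suc n) w" and ?m = "mean_driver Y Z w"
    have ab: "0 \<le> ?a" "?a \<le> ?b" "?b \<le> T" using \<sigma>_range \<sigma>_mono[OF w, of n "Suc n"] by auto
    obtain D where D: "\<And>t. t \<in> {0..T} \<Longrightarrow> \<bar>Y w t\<bar> \<le> D" using cadlag_bounded[OF Y_cadlag[OF w]] by blast
    have fin: "(\<integral>\<^sup>+s\<in>{?a<..T}. (\<integral>\<^sup>+x. ennreal \<bar>driver (left_process Y) Z ((w, s), x)\<bar> \<partial>\<phi> w s) \<partial>dA w) < \<infinity>"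
      by (rule driver_integral_finite[OF w ab(1) Z_pred Yl left_process_bounded[of Y w D, OF Y_cadlag[OF w] D] elim(3,4)])
    note ints = equation_integrals[OF w ab(1) _ Yl Z_pred fin]
    have late: "Y w t + (LINT (s, x):{t<..T} \<times> UNIV|\<mu> w. Z w s x) =
        \<xi> w + (LINT (s, x):{t<..T} \<times> UNIV|\<nu> w. f w s x (left_limit (Y w) s) (Z w s))"
      if t: "t \<in> {0..T}" "S (Suc n) w \<le> ennreal t" for t
    proof -
      have "ennreal t \<le> ennreal T" using t by (intro ennreal_leI) simp
      with t(2) have "S (Suc n) w \<le> ennreal T" by (rule order_trans)
      then have bt: "?b \<le> t" using \<sigma>_le_iff[OF t(1), of "Suc n" w] t(2) by simp
      have "(LINT (s, x):{t<..T} \<times> UNIV|\<mu> w. Z w s x) = (LINT (s, x):{t<..T} \<times> UNIV|\<mu> w. Z' w s x)"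
        unfolding set_lebesgue_integral_def
        by (intro Bochner_Integration.integral_cong refl) (use bt in \<open>auto simp: indicator_def Z_after[OF w]\<close>)
      moreover have "(LINT (s, x):{t<..T} \<times> UNIV|\<nu> w. f w s x (left_limit (Y w) s) (Z w s))
          = (LINT (s, x):{t<..T} \<times> UNIV|\<nu> w. f w s x (left_limit (Y' w) s) (Z' w s))"
        unfolding set_lebesgue_integral_def
        by (intro Bochner_Integration.integral_cong refl)
          (use bt t in \<open>auto simp: indicator_def Z_after[OF w] left_after[OF w t(2)]\<close>)
      moreover have "Y w t = Y' w t" using t by (simp add: Y_def)
      ultimately show ?thesis using elim(1) t by simp
    qed
    have m_before: "(LINT s:{t<..?b}|dA w. ?m s) = W (w, ?b) - W (w, t)" if t: "?a \<le> t" "t \<le> ?b" for t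
    proof -
      have "(LINT s:{t<..?b}|dA w. ?m s) = (LINT s:{t<..?b}|dA w. ?k w s)"
        unfolding set_lebesgue_integral_def
      proof (rule integral_cong_AE)
        have I: "{t<..?b} \<in> sets (dA w)" using t ab by (intro Ioc_dA[OF w]) auto
        show "(\<lambda>s. indicator {t<..?b} s *\<^sub>R ?k w s) \<in> borel_measurable (dA w)"
          using k_set[OF w I] by (auto simp: set_integrable_def)
        have "set_integrable (dA w) {t<..?b} ?m"
          using I t ab by (intro set_integrable_subset[OF ints(1)[of t]]) auto
        then show "(\<lambda>s. indicator {t<..?b} s *\<^sub>R ?m s) \<in> borel_measurable (dA w)"
          by (auto simp: set_integrable_def)
        show "AE s in dA w. indicator {t<..?b} s *\<^sub>R ?m s = indicator {t<..?b} s *\<^sub>R ?k w s"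
          using elim(2) by eventually_elim (use t in \<open>auto simp: indicator_def\<close>)
      qed
      also have "\<dots> = W (w, ?b) - W (w, t)" using t ab by (intro W_diff[OF w]) auto
      finally show ?thesis .
    qed
    show ?case
    proof (intro ballI impI)
      fix t assume t: "t \<in> {0..T}" "S n w \<le> ennreal t"
      show "Y w t + (LINT (s, x):{t<..T} \<times> UNIV|\<mu> w. Z w s x) =
        \<xi> w + (LINT (s, x):{t<..T} \<times> UNIV|\<nu> w. f w s x (left_limit (Y w) s) (Z w s))"
      proof (cases "S (Suc n) w \<le> ennreal t")
        case True then show ?thesis by (rule late[OF t(1)])
      next
        case False
        then have Yt: "Y w t = c w - W (w, t)" using t by (intro Y_between) auto
        have tT: "ennreal t \<le> ennreal T" using t by (intro ennreal_leI) simp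
        have Sn: "S n w \<le> ennreal T" using t(2) tT by (rule order_trans)
        have at: "?a \<le> t" using \<sigma>_le_iff[OF t(1), of n w] Sn t(2) by simp
        note ints_t = ints[OF at]
        show ?thesis
        proof (cases "S (Suc n) w \<le> ennreal T")
          case True
          have tb: "t < ?b" using \<sigma>_le_iff[OF t(1), of "Suc n" w] True False by simp
          note ints_b = ints[OF ab(2)]
          have "(LINT s:{t<..?b} \<union> {?b<..T}|dA w. ?m s) = (LINT s:{t<..?b}|dA w. ?m s) + (LINT s:{?b<..T}|dA w. ?m s)"
            using tb ab t by (intro set_integral_Un set_integrable_subset[OF ints_t(1)] Ioc_dA[OF w]) auto
          moreover have "{t<..?b} \<union> {?b<..T} = {t<..T}" using tb ab by auto
          ultimately have I: "(LINT s:{t<..T}|dA w. ?m s) = W (w, ?b) - W (w, t) + (LINT s:{?b<..T}|dA w. ?m s)"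
            using m_before[OF at] tb by simp
          have J: "(\<Sum>j\<in>{j\<in>jumps w. t < \<sigma> j w}. Z w (\<sigma> j w) (X j w))
            = Z w ?b (X (Suc n) w) + (\<Sum>j\<in>{j\<in>jumps w. ?b < \<sigma> j w}. Z w (\<sigma> j w) (X j w))"
            unfolding jumps_after_between[OF w at tb] jumps_from_next[OF w True] using finite_jumps[OF w] by simp
          have b_step: "?b \<in> {?a<..?b}" using at tb by simp
          have "Z w ?b (X (Suc n) w) = Y w ?b - (c w - W (w, ?b))"
            using Z_step[OF w b_step] r(2)[OF w True] Y'_c'[OF w True] y_after[OF w, of ?b] at tb ab S_eq_\<sigma>[OF True]
            by (simp add: Y_def)
          moreover have "Y w ?b + (\<Sum>j\<in>{j\<in>jumps w. ?b < \<sigma> j w}. Z w (\<sigma> j w) (X j w)) = \<xi> w + (LINT s:{?b<..T}|dA w. ?m s)"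
            using late[OF \<sigma>_range(1)[of "Suc n" w]] S_eq_\<sigma>[OF True] unfolding ints_b(2,3) by simp
          ultimately show ?thesis unfolding ints_t(2,3) I J Yt by simp
        next
          case False
          then have S': "ennreal T < S (Suc n) w" by simp
          then have b: "?b = T" by (intro \<sigma>_eq_T) simp
          have gap: "w \<in> gap n (ennreal T)" using w Sn S' by (simp add: gap_def)
          have "{j\<in>jumps w. t < \<sigma> j w} = {}"
          proof (cases "t = T")
            case True then show ?thesis using \<sigma>_range(3) by (auto simp: not_less)
          next
            case False
            then have "t < ?b" using b t by simp
            from jumps_after_between[OF w at this] show ?thesis using no_jumps_from_next[OF w S'] by simp
          qed
          then have J: "(\<Sum>j\<in>{j\<in>jumps w. t < \<sigma> j w}. Z w (\<sigma> j w) (X j w)) = 0" by (simp only: sum.empty)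
          have "(LINT s:{t<..T}|dA w. ?m s) = W (w, T) - W (w, t)" using m_before[OF at] t b by simp
          then show ?thesis unfolding ints_t(2,3) J Yt using no_jump[OF gap] by simp
        qed
      qed
    qed
  qed
  have start: "Y w (\<sigma> n w) = c w" if w: "w \<in> \<Omega>" and Sn: "S n w \<le> ennreal T" for w
  proof -
    have "S n w = ennreal (\<sigma> n w)" by (rule S_eq_\<sigma>[OF Sn])
    moreover have "S n w < S (Suc n) w" by (rule S_less[OF w Sn])
    ultimately show ?thesis using W_before[OF w, of "\<sigma> n w"] by (auto simp: Y_def dest: leD)
  qed
  show thesis
  proof (rule that[of Y Z c, OF _ c(1) start])
    show "solution_from n Y Z"
      unfolding solution_from_def using Y_adapted Y_cadlag Z_pred Z_fin equation by blast
  qed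
qed

text \<open>
  Backward induction. The induction carries along that the value at \<open>S n\<close> is a function of the first \<open>n\<close>
  points, because the previous step has to predict it.
\<close>

lemma solution_exists:
  assumes last: "AE w in M. S N w = \<infinity>"
  shows "\<exists>Y Z. solution_from 0 Y Z"
proof -
  have "\<exists>Y Z c. solution_from n Y Z \<and> c \<in> borel_measurable (H n) \<and>
      (\<forall>w\<in>\<Omega>. S n w \<le> ennreal T \<longrightarrow> Y w (\<sigma> n w) = c w)" if "n \<le> N" for n
    using that
  proof (induction n rule: inc_induct)
    case base
    have "AE w in M. \<forall>t\<in>{0..T}. S N w \<le> ennreal t \<longrightarrow> P w t" for P
      using last by eventually_elim (auto simp: top_unique)
    then have "solution_from N (\<lambda>_ _. 0) (\<lambda>_ _ _. 0)"
      by (simp add: solution_from_def adapted_def zero_predictable continuous_cadlag mark_norm_def)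
    then show ?case by (intro exI[of _ "\<lambda>_ _. 0"] exI[of _ "\<lambda>_ _ _. 0"] exI[of _ "\<lambda>_. 0"]) simp
  next
    case (step n)
    then obtain Y Z c where Y: "solution_from (Suc n) Y Z" "c \<in> borel_measurable (H (Suc n))"
      "\<And>w. w \<in> \<Omega> \<Longrightarrow> S (Suc n) w \<le> ennreal T \<Longrightarrow> Y w (\<sigma> (Suc n) w) = c w" by blast
    have "(\<integral>\<^sup>+w. (if S (Suc n) w \<le> ennreal T then ennreal \<bar>Y w (\<sigma> (Suc n) w)\<bar> else 0) \<partial>M) < \<infinity>"
      using estimate_from[OF last _ Y(1)] step.hyps by simp
    from extend_solution[OF Y this] show ?case by metis
  qed
  from this[of 0] show ?thesis by blast
qed

end

section \<open>Compensators that are continuous almost surely\<close>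

context increasing_process
begin

text \<open>
  The continuous part of \<open>A\<close> is obtained by integrating the predictable set of times at which \<open>A\<close> does not
  jump; it is continuous on every path because that measure has no atoms.
\<close>

lemma continuous_part:
  obtains A' where "(\<lambda>(w, t). A' w t) \<in> borel_measurable PRE"
    "\<And>w. w \<in> \<Omega> \<Longrightarrow> A' w 0 = 0" "\<And>w. w \<in> \<Omega> \<Longrightarrow> mono_on {0..T} (A' w)"
    "\<And>w. w \<in> \<Omega> \<Longrightarrow> continuous_on {0..T} (A' w)"
    "\<And>w t. w \<in> \<Omega> \<Longrightarrow> continuous_on {0..T} (A w) \<Longrightarrow> t \<in> {0..T} \<Longrightarrow> A' w t = A w t"
proof -
  have cad: "cadlag T (A w)" if "w \<in> \<Omega>" for w using increasing_path.a_cadlag[OF A_path[OF that]] .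
  have "adapted F T A"
    unfolding adapted_def using PRE_slice[OF A_predictable] by auto
  then have [measurable]: "left_process A \<in> borel_measurable PRE" by (rule left_process_measurable) (rule cad)
  note [measurable] = A_predictable
  \<comment> \<open>The times at which \<open>A\<close> does not jump.\<close>
  define G where "G = {p \<in> space PRE. left_process A p = (case p of (w, t) \<Rightarrow> A w t)}"
  have G [measurable]: "G \<in> sets PRE" unfolding G_def by measurable
  define V where "V = (\<lambda>(w, t). \<integral>\<^sup>+s\<in>{0<..t}. indicator G (w, s) \<partial>dA w)"
  have V: "V \<in> borel_measurable PRE" unfolding V_def by (rule nn_integral_process) simp
  let ?A' = "\<lambda>w t. enn2real (V (w, t))"
  have Gs: "(\<lambda>s. indicator G (w, s) :: ennreal) \<in> borel_measurable (dA w)" if w: "w \<in> \<Omega>" for w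
    by (rule dA_measurable[OF w]) simp
  have cdf: "?A' w t = cdf (distr (density (dA w) (\<lambda>s. indicator G (w, s))) borel id) t"
    if w: "w \<in> \<Omega>" and t: "t \<in> {0..T}" for w t
  proof -
    have id: "id \<in> borel_measurable (dA w)" using sets_dA[OF w] by (simp add: measurable_restrict_space1 cong: measurable_cong_sets)
    have s: "id -` {..t} \<inter> space (dA w) \<in> sets (dA w)" using id by (rule measurable_sets) simp
    have "V (w, t) = (\<integral>\<^sup>+s\<in>(id -` {..t} \<inter> space (dA w)). indicator G (w, s) \<partial>dA w)"
      unfolding V_def case_prod_conv
    proof (rule nn_integral_cong_AE)
      show "AE s in dA w. indicator G (w, s) * indicator {0<..t} s
          = (indicator G (w, s) * indicator (id -` {..t} \<inter> space (dA w)) s :: ennreal)"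
        using dA_pos[OF w] AE_space by eventually_elim (simp add: indicator_def)
    qed
    also have "\<dots> = emeasure (density (dA w) (\<lambda>s. indicator G (w, s))) (id -` {..t} \<inter> space (dA w))"
      using Gs[OF w] s by (rule emeasure_density[symmetric])
    also have "\<dots> = emeasure (distr (density (dA w) (\<lambda>s. indicator G (w, s))) borel id) {..t}"
      using id by (subst emeasure_distr) auto
    finally show ?thesis by (simp add: cdf_def2 measure_def)
  qed
  have fin: "finite_measure (density (dA w) (\<lambda>s. indicator G (w, s)))" if w: "w \<in> \<Omega>" for w
  proof
    interpret finite_measure "dA w" using finite_dA[OF w] .
    have "emeasure (density (dA w) (\<lambda>s. indicator G (w, s))) (space (dA w)) = (\<integral>\<^sup>+s\<in>space (dA w). indicator G (w, s) \<partial>dA w)"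
      using Gs[OF w] by (rule emeasure_density) simp
    also have "\<dots> \<le> (\<integral>\<^sup>+s. 1 \<partial>dA w)" by (intro nn_integral_mono) (auto simp: indicator_def)
    also have "\<dots> < \<infinity>" by (simp add: less_top[symmetric])
    finally show "emeasure (density (dA w) (\<lambda>s. indicator G (w, s))) (space (density (dA w) (\<lambda>s. indicator G (w, s)))) \<noteq> \<infinity>" by simp
  qed
  have no_atom: "emeasure (dA w) {s} = 0" if w: "w \<in> \<Omega>" and s: "(w, s) \<in> G" for w s
  proof (cases "0 < s")
    case True
    have sT: "s \<in> {0<..T}" using s True by (auto simp: G_def)
    obtain l where l: "(A w \<longlongrightarrow> l) (at_left s)" using cad[OF w] sT unfolding cadlag_def by blast
    moreover have "l = A w s" using s True left_limit_eq[OF l] by (simp add: G_def left_process_def)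
    ultimately have "((\<lambda>u. ennreal (A w s - A w u)) \<longlongrightarrow> ennreal (A w s - A w s)) (at_left s)"
      by (intro tendsto_intros) simp
    moreover have "\<forall>\<^sub>F u in at_left s. u \<in> {0<..<s}" using True by (intro eventually_at_leftI[of 0]) auto
    then have "\<forall>\<^sub>F u in at_left s. emeasure (dA w) {s} \<le> ennreal (A w s - A w u)"
    proof eventually_elim
      case (elim u)
      have "emeasure (dA w) {s} \<le> emeasure (dA w) {u<..s}"
        using elim sT by (intro emeasure_mono Ioc_dA[OF w]) auto
      then show ?case using emeasure_dA_Ioc[OF w, of u s] elim sT by simp
    qed
    ultimately have "emeasure (dA w) {s} \<le> ennreal (A w s - A w s)" by (intro tendsto_lowerbound) auto
    then show ?thesis by simp
  next
    case False
    then have "s = 0" using s by (auto simp: G_def)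
    then show ?thesis using increasing_path.emeasure_stieltjes_0[OF A_path[OF w]] by simp
  qed
  have cont: "continuous_on {0..T} (?A' w)" if w: "w \<in> \<Omega>" for w
  proof -
    let ?N = "density (dA w) (\<lambda>s. indicator G (w, s))" and ?m = "distr (density (dA w) (\<lambda>s. indicator G (w, s))) borel id"
    have id: "id \<in> borel_measurable ?N" using sets_dA[OF w] by (simp add: measurable_restrict_space1 cong: measurable_cong_sets)
    interpret m: finite_borel_measure ?m
      using finite_measure.finite_measure_distr[OF fin[OF w] id] by (simp add: finite_borel_measure_def finite_borel_measure_axioms_def)
    have "isCont (cdf ?m) t" for t
    proof -
      have s: "{t} \<inter> {0..T} \<in> sets (dA w)" using sets_dA[OF w] by (auto simp: sets_restrict_space_iff)
      have "emeasure ?m {t} = emeasure ?N ({t} \<inter> {0..T})"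
        using id space_dA[OF w] by (subst emeasure_distr) auto
      also have "\<dots> = (\<integral>\<^sup>+s\<in>({t} \<inter> {0..T}). indicator G (w, s) \<partial>dA w)" using Gs[OF w] s by (rule emeasure_density)
      also have "\<dots> = (\<integral>\<^sup>+s. indicator G (w, t) * indicator ({t} \<inter> {0..T}) s \<partial>dA w)"
        by (intro nn_integral_cong) (auto simp: indicator_def)
      also have "\<dots> = indicator G (w, t) * emeasure (dA w) ({t} \<inter> {0..T})" using s by (rule nn_integral_cmult_indicator)
      also have "\<dots> = 0"
      proof (cases "(w, t) \<in> G")
        case True
        then have "{t} \<inter> {0..T} = {t}" by (auto simp: G_def)
        then show ?thesis using no_atom[OF w True] by simp
      qed simp
      finally show ?thesis unfolding m.isCont_cdf by (simp add: measure_def)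
    qed
    then have "continuous_on {0..T} (cdf ?m)" by (intro continuous_at_imp_continuous_on) auto
    then show ?thesis by (rule continuous_on_eq) (simp add: cdf[OF w])
  qed
  show thesis
  proof (rule that[of ?A'])
    have "(\<lambda>p. enn2real (V p)) \<in> borel_measurable PRE" using V by measurable
    then show "(\<lambda>(w, t). ?A' w t) \<in> borel_measurable PRE" by (simp add: case_prod_unfold)
    show "?A' w 0 = 0" for w by (simp add: V_def)
    fix w assume w: "w \<in> \<Omega>"
    show "continuous_on {0..T} (?A' w)" by (rule cont[OF w])
    show "mono_on {0..T} (?A' w)"
    proof (rule mono_onI)
      fix s t assume st: "s \<in> {0..T}" "t \<in> {0..T}" "s \<le> t"
      interpret finite_measure "dA w" using finite_dA[OF w] .
      have "V (w, t) \<le> (\<integral>\<^sup>+s. 1 \<partial>dA w)"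
        unfolding V_def case_prod_conv by (intro nn_integral_mono) (auto simp: indicator_def)
      also have "\<dots> < \<top>" by (simp add: less_top[symmetric])
      finally have "V (w, t) < \<top>" .
      moreover have "V (w, s) \<le> V (w, t)"
        unfolding V_def case_prod_conv using st by (intro nn_integral_mono) (auto simp: indicator_def)
      ultimately show "?A' w s \<le> ?A' w t" by (rule enn2real_mono[rotated])
    qed
    fix t assume c: "continuous_on {0..T} (A w)" and t: "t \<in> {0..T}"
    have inG: "(w, s) \<in> G" if s: "0 < s" "s \<le> t" for s
    proof -
      have "(A w \<longlongrightarrow> A w s) (at_left s)" by (rule continuous_at_left[OF c]) (use s t in auto)
      from left_limit_eq[OF this] show ?thesis using w s t by (simp add: G_def left_process_def)
    qed
    have "V (w, t) = (\<integral>\<^sup>+s. indicator {0<..t} s \<partial>dA w)"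
      unfolding V_def case_prod_conv by (intro nn_integral_cong) (auto simp: indicator_def inG)
    also have "\<dots> = emeasure (dA w) {0<..t}" using t by (intro nn_integral_indicator Ioc_dA[OF w]) auto
    also have "\<dots> = ennreal (A w t)" using emeasure_dA_Ioc[OF w, of 0 t] t A_zero[OF w] by simp
    finally show "?A' w t = A w t" using A_nonneg[OF w, of t] t by simp
  qed
qed

end

lemma stieltjes_cong:
  assumes "0 < T" "\<And>t. t \<in> {0..T} \<Longrightarrow> a t = a' t" shows "stieltjes T a = stieltjes T a'"
proof -
  have "(\<lambda>t. a (max 0 (min T t))) = (\<lambda>t. a' (max 0 (min T t)))" using assms by (intro ext) auto
  then show ?thesis by (simp add: stieltjes_def)
qed

text \<open>
  The equation sees \<open>A\<close> only through its Stieltjes measures, so that \<open>A\<close> may be replaced by any predictable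
  process which almost surely has the same ones.
\<close>

lemma compensator_transfer:
  assumes comp: "disintegrated_compensator M T S X F A \<phi>"
    and st: "AE w in M. stieltjes T (A' w) = stieltjes T (A w)"
    and path: "\<And>w. w \<in> space M \<Longrightarrow> A' w 0 = 0 \<and> mono_on {0..T} (A' w) \<and> cadlag T (A' w)"
    and pred: "(\<lambda>(w, t). A' w t) \<in> borel_measurable (predictable_sigma (space M) F T)"
  shows "disintegrated_compensator M T S X F A' \<phi>"
proof -
  have "(\<integral>\<^sup>+w. (\<integral>\<^sup>+(t, x). G w t x \<partial>disintegrated_measure T A' \<phi> w) \<partial>M)
    = (\<integral>\<^sup>+w. (\<integral>\<^sup>+(t, x). G w t x \<partial>disintegrated_measure T A \<phi> w) \<partial>M)" for G :: "_ \<Rightarrow> _ \<Rightarrow> _ \<Rightarrow> ennreal"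
    by (rule nn_integral_cong_AE, use st in eventually_elim) (simp add: disintegrated_measure_def)
  then show ?thesis using comp path pred by (simp add: disintegrated_compensator_def)
qed

lemma generator_transfer:
  assumes gen: "bsde_generator M T F A \<phi> L L' f"
    and st: "AE w in M. stieltjes T (A' w) = stieltjes T (A w)"
  shows "bsde_generator M T F A' \<phi> L L' f"
proof -
  have "AE w in M. (\<integral>\<^sup>+(t, x). ennreal \<bar>f w t x 0 (\<lambda>_. 0)\<bar> \<partial>disintegrated_measure T A \<phi> w) < \<infinity>"
    using gen by (simp add: bsde_generator_def)
  then have "AE w in M. (\<integral>\<^sup>+(t, x). ennreal \<bar>f w t x 0 (\<lambda>_. 0)\<bar> \<partial>disintegrated_measure T A' \<phi> w) < \<infinity>"
    using st by eventually_elim (simp add: disintegrated_measure_def)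
  then show ?thesis using gen unfolding bsde_generator_def by blast
qed

lemma solution_transfer:
  assumes st: "AE w in M. stieltjes T (A' w) = stieltjes T (A w)"
  shows "bsde_solution M T S X F A' \<phi> f \<xi> Y Z \<longleftrightarrow> bsde_solution M T S X F A \<phi> f \<xi> Y Z"
proof -
  have "(AE w in M. P (disintegrated_measure T A' \<phi> w) w) \<longleftrightarrow> (AE w in M. P (disintegrated_measure T A \<phi> w) w)" for P
  proof
    assume "AE w in M. P (disintegrated_measure T A' \<phi> w) w"
    then show "AE w in M. P (disintegrated_measure T A \<phi> w) w"
      using st by eventually_elim (simp add: disintegrated_measure_def)
  next
    assume "AE w in M. P (disintegrated_measure T A \<phi> w) w"
    then show "AE w in M. P (disintegrated_measure T A' \<phi> w) w"
      using st by eventually_elim (simp add: disintegrated_measure_def)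
  qed
  note this[of "\<lambda>m w. (\<integral>\<^sup>+(t, x). ennreal \<bar>Z w t x\<bar> \<partial>m) < \<infinity>"]
    this[of "\<lambda>m w. \<forall>t\<in>{0..T}. Y w t + (LINT (s, x):{t<..T} \<times> UNIV|jump_measure T S X w. Z w s x) =
        \<xi> w + (LINT (s, x):{t<..T} \<times> UNIV|m. f w s x (left_limit (Y w) s) (Z w s))"]
  then show ?thesis unfolding bsde_solution_def by blast
qed

section \<open>Uniqueness and existence\<close>

theorem theorem2:
  fixes M :: "'w measure" and T :: real
    and \<iota> :: "'e::topological_space \<Rightarrow> 'p::polish_space" and \<Delta> :: 'e
    and S :: "nat \<Rightarrow> 'w \<Rightarrow> ennreal" and X :: "nat \<Rightarrow> 'w \<Rightarrow> 'e"
    and F :: "ennreal \<Rightarrow> 'w measure"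
    and A :: "'w \<Rightarrow> real \<Rightarrow> real" and \<phi> :: "'w \<Rightarrow> real \<Rightarrow> 'e measure"
    and L L' :: real and f :: "'w \<Rightarrow> real \<Rightarrow> 'e \<Rightarrow> real \<Rightarrow> ('e \<Rightarrow> real) \<Rightarrow> real"
    and \<xi> :: "'w \<Rightarrow> real" and m :: nat
  assumes "prob_space M" and "0 < T"
    and "lusin_embedding \<iota>"
    and "multivariate_point_process M T \<Delta> S X"
    and "generated_filtration (space M) S X F"
    and "disintegrated_compensator M T S X F A \<phi>"
    and A1: "AE \<omega> in M. continuous_on {0..T} (A \<omega>)"
    and A2: "\<And>n. AE \<omega> in M.
      real_cond_exp M (filtration.pre_sigma (space M) F (S n))
        (indicator {\<omega> \<in> space M. S (Suc n) \<omega> > ennreal T}) \<omega> > 0"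
    and "\<xi> \<in> borel_measurable (F (ennreal T))"
    and "0 \<le> L" and "0 \<le> L'" and "bsde_generator M T F A \<phi> L L' f"
    and "measure M {\<omega> \<in> space M. S (Suc m) \<omega> = \<infinity>} = 1"
  shows "(\<forall>Y Z Y' Z'.
            bsde_solution M T S X F A \<phi> f \<xi> Y Z \<longrightarrow> bsde_solution M T S X F A \<phi> f \<xi> Y' Z' \<longrightarrow>
            (AE \<omega> in M. \<forall>t\<in>{0..T}. Y \<omega> t = Y' \<omega> t)) \<and>
         ((\<exists>C. AE \<omega> in M. A \<omega> T \<le> C) \<longrightarrow>
          integrable M \<xi> \<longrightarrow>
          (\<integral>\<^sup>+\<omega>. (\<integral>\<^sup>+(s, x). ennreal \<bar>f \<omega> s x 0 (\<lambda>_. 0)\<bar>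
                     \<partial>disintegrated_measure T A \<phi> \<omega>) \<partial>M) < \<infinity> \<longrightarrow>
          (\<exists>Y Z. bsde_solution M T S X F A \<phi> f \<xi> Y Z) \<and>
          (\<forall>Y Z. bsde_solution M T S X F A \<phi> f \<xi> Y Z \<longrightarrow>
             (\<integral>\<^sup>+\<omega>. (\<integral>\<^sup>+t. ennreal \<bar>Y \<omega> t\<bar> \<partial>stieltjes T (A \<omega>)) \<partial>M) < \<infinity> \<and>
             (\<integral>\<^sup>+\<omega>. (\<integral>\<^sup>+(t, x). ennreal \<bar>Z \<omega> t x\<bar>
                        \<partial>disintegrated_measure T A \<phi> \<omega>) \<partial>M) < \<infinity>))"
proof -
  have pp: "point_process M T \<Delta> S X F"
    using assms(1,2,4,5) by (simp add: point_process_def point_process_axioms_def)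
  have cpp: "compensated_point_process M T \<Delta> S X F A \<phi>"
    using pp assms(6) by (simp add: compensated_point_process_def compensated_point_process_axioms_def)
  interpret compensated_point_process M T \<Delta> S X F A \<phi> by (rule cpp)
  have last: "AE \<omega> in M. S (Suc m) \<omega> = \<infinity>"
  proof -
    have "{\<omega> \<in> space M. S (Suc m) \<omega> = \<infinity>} \<in> sets M" using S_measurable_M[of "Suc m"] by measurable
    from AE_in_set_eq_1[OF this] assms(13) have "AE \<omega> in M. \<omega> \<in> {\<omega> \<in> space M. S (Suc m) \<omega> = \<infinity>}" by simp
    then show ?thesis by eventually_elim simp
  qed
  obtain A' where A': "(\<lambda>(\<omega>, t). A' \<omega> t) \<in> borel_measurable PRE"
    "\<And>\<omega>. \<omega> \<in> \<Omega> \<Longrightarrow> A' \<omega> 0 = 0" "\<And>\<omega>. \<omega> \<in> \<Omega> \<Longrightarrow> mono_on {0..T} (A' \<omega>)"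
    "\<And>\<omega>. \<omega> \<in> \<Omega> \<Longrightarrow> continuous_on {0..T} (A' \<omega>)"
    "\<And>\<omega> t. \<omega> \<in> \<Omega> \<Longrightarrow> continuous_on {0..T} (A \<omega>) \<Longrightarrow> t \<in> {0..T} \<Longrightarrow> A' \<omega> t = A \<omega> t"
    using continuous_part by blast
  have A'_eq: "AE \<omega> in M. \<forall>t\<in>{0..T}. A' \<omega> t = A \<omega> t"
    using A1 AE_space by eventually_elim (simp add: A'(5))
  \<comment> \<open>A version of \<open>A\<close> with continuous paths leads to an equivalent equation.\<close>
  have version: "(AE \<omega> in M. stieltjes T (B \<omega>) = stieltjes T (A \<omega>)) \<and> bsde M T \<Delta> S X F B \<phi> f L L' \<xi>"
    if B: "(\<lambda>(\<omega>, t). B \<omega> t) \<in> borel_measurable PRE" "\<And>\<omega>. \<omega> \<in> \<Omega> \<Longrightarrow> B \<omega> 0 = 0"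
      "\<And>\<omega>. \<omega> \<in> \<Omega> \<Longrightarrow> mono_on {0..T} (B \<omega>)" "\<And>\<omega>. \<omega> \<in> \<Omega> \<Longrightarrow> continuous_on {0..T} (B \<omega>)"
      and B_eq: "AE \<omega> in M. \<forall>t\<in>{0..T}. B \<omega> t = A \<omega> t" for B
  proof
    show st: "AE \<omega> in M. stieltjes T (B \<omega>) = stieltjes T (A \<omega>)"
      using B_eq by eventually_elim (intro stieltjes_cong, auto simp: T_pos)
    have "disintegrated_compensator M T S X F B \<phi>"
      using B(2-4) by (intro compensator_transfer[OF compensator st _ B(1)] conjI continuous_cadlag) auto
    moreover have "bsde_generator M T F B \<phi> L L' f" by (rule generator_transfer[OF assms(12) st])
    ultimately show "bsde M T \<Delta> S X F B \<phi> f L L' \<xi>"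
      using pp B(4) assms(9-11)
      by (simp add: bsde_def bsde_axioms_def compensated_point_process_def compensated_point_process_axioms_def)
  qed
  show ?thesis
  proof (intro conjI allI impI)
    fix Y Z Y' Z'
    assume sol: "bsde_solution M T S X F A \<phi> f \<xi> Y Z" "bsde_solution M T S X F A \<phi> f \<xi> Y' Z'"
    note v = version[OF A'(1-4) A'_eq]
    interpret b: bsde M T \<Delta> S X F A' \<phi> f L L' \<xi> using v by simp
    have "b.solution_from 0 Y Z" "b.solution_from 0 Y' Z'"
      unfolding b.solution_from_0 using sol by (simp_all add: solution_transfer[OF v[THEN conjunct1]])
    from b.unique_from[OF A2 last _ this] AE_space
    show "AE \<omega> in M. \<forall>t\<in>{0..T}. Y \<omega> t = Y' \<omega> t" by (auto elim!: eventually_elim2 simp: S_0)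
  next
    assume bounded: "\<exists>C. AE \<omega> in M. A \<omega> T \<le> C" and \<xi>: "integrable M \<xi>"
      and f0: "(\<integral>\<^sup>+\<omega>. (\<integral>\<^sup>+(s, x). ennreal \<bar>f \<omega> s x 0 (\<lambda>_. 0)\<bar> \<partial>disintegrated_measure T A \<phi> \<omega>) \<partial>M) < \<infinity>"
    from bounded obtain C0 where C0: "AE \<omega> in M. A \<omega> T \<le> C0" by blast
    \<comment> \<open>A cap below \<open>0\<close> would spoil \<open>B \<omega> 0 = 0\<close>.\<close>
    define C where "C = max 0 C0"
    define B where "B \<omega> t = min C (A' \<omega> t)" for \<omega> t
    have B_eq: "AE \<omega> in M. \<forall>t\<in>{0..T}. B \<omega> t = A \<omega> t"
      using A'_eq C0 AE_space
    proof eventually_elim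
      case (elim \<omega>)
      show ?case
      proof
        fix t assume t: "t \<in> {0..T}"
        then have "A \<omega> t \<le> C" using A_le[OF elim(3), of t T] elim(2) by (simp add: C_def)
        then show "B \<omega> t = A \<omega> t" using elim(1) t by (simp add: B_def)
      qed
    qed
    have B1: "(\<lambda>(\<omega>, t). B \<omega> t) \<in> borel_measurable PRE"
      using A'(1) unfolding B_def case_prod_unfold by measurable
    have "0 \<le> C" by (simp add: C_def)
    note v = version[OF B1 _ _ _ B_eq]
    have v: "(AE \<omega> in M. stieltjes T (B \<omega>) = stieltjes T (A \<omega>)) \<and> bsde M T \<Delta> S X F B \<phi> f L L' \<xi>"
    proof (rule v)
      fix \<omega> assume \<omega>: "\<omega> \<in> \<Omega>"
      show "B \<omega> 0 = 0" using A'(2)[OF \<omega>] \<open>0 \<le> C\<close> by (simp add: B_def)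
      show "mono_on {0..T} (B \<omega>)"
        unfolding B_def by (intro mono_onI min.mono order_refl mono_onD[OF A'(3)[OF \<omega>]])
      show "continuous_on {0..T} (B \<omega>)"
        unfolding B_def by (intro continuous_intros continuous_on_min A'(4)[OF \<omega>])
    qed
    interpret b: bsde M T \<Delta> S X F B \<phi> f L L' \<xi> using v by simp
    have nu: "AE \<omega> in M. disintegrated_measure T B \<phi> \<omega> = disintegrated_measure T A \<phi> \<omega>"
      using v[THEN conjunct1] by eventually_elim (simp add: disintegrated_measure_def)
    have "(\<integral>\<^sup>+\<omega>. \<integral>\<^sup>+s. b.f0 \<omega> s \<partial>stieltjes T (B \<omega>) \<partial>M) < \<infinity>"
    proof -
      have "(\<integral>\<^sup>+\<omega>. \<integral>\<^sup>+s. b.f0 \<omega> s \<partial>stieltjes T (B \<omega>) \<partial>M)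
        = (\<integral>\<^sup>+\<omega>. (\<integral>\<^sup>+(s, x). ennreal \<bar>f \<omega> s x 0 (\<lambda>_. 0)\<bar> \<partial>disintegrated_measure T B \<phi> \<omega>) \<partial>M)"
        by (intro nn_integral_cong) (simp add: b.nn_integral_f0)
      also have "\<dots> = (\<integral>\<^sup>+\<omega>. (\<integral>\<^sup>+(s, x). ennreal \<bar>f \<omega> s x 0 (\<lambda>_. 0)\<bar> \<partial>disintegrated_measure T A \<phi> \<omega>) \<partial>M)"
        by (rule nn_integral_cong_AE, use nu in eventually_elim) simp
      finally show ?thesis using f0 by simp
    qed
    then interpret b: bounded_bsde M T \<Delta> S X F B \<phi> f L L' \<xi> C
      using v \<xi> by (simp add: bounded_bsde_def bounded_bsde_axioms_def B_def)
    have sol_iff: "b.solution_from 0 Y Z \<longleftrightarrow> bsde_solution M T S X F A \<phi> f \<xi> Y Z" for Y Z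
      unfolding b.solution_from_0 by (rule solution_transfer[OF v[THEN conjunct1]])
    show "\<exists>Y Z. bsde_solution M T S X F A \<phi> f \<xi> Y Z"
      using b.solution_exists[OF last] by (simp add: sol_iff)
    fix Y Z assume "bsde_solution M T S X F A \<phi> f \<xi> Y Z"
    then have sol: "b.solution_from 0 Y Z" by (simp add: sol_iff)
    note fin = b.solution_integrable[OF last sol]
    have "(\<integral>\<^sup>+\<omega>. (\<integral>\<^sup>+t. ennreal \<bar>Y \<omega> t\<bar> \<partial>stieltjes T (A \<omega>)) \<partial>M) = (\<integral>\<^sup>+\<omega>. (\<integral>\<^sup>+t. ennreal \<bar>Y \<omega> t\<bar> \<partial>stieltjes T (B \<omega>)) \<partial>M)"
      by (rule nn_integral_cong_AE, use v[THEN conjunct1] in eventually_elim) simp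
    then show "(\<integral>\<^sup>+\<omega>. (\<integral>\<^sup>+t. ennreal \<bar>Y \<omega> t\<bar> \<partial>stieltjes T (A \<omega>)) \<partial>M) < \<infinity>" using fin(1) by simp
    have "(\<integral>\<^sup>+\<omega>. (\<integral>\<^sup>+(t, x). ennreal \<bar>Z \<omega> t x\<bar> \<partial>disintegrated_measure T A \<phi> \<omega>) \<partial>M)
      = (\<integral>\<^sup>+\<omega>. (\<integral>\<^sup>+(t, x). ennreal \<bar>Z \<omega> t x\<bar> \<partial>disintegrated_measure T B \<phi> \<omega>) \<partial>M)"
      by (rule nn_integral_cong_AE, use nu in eventually_elim) simp
    also have "\<dots> = (\<integral>\<^sup>+\<omega>. (\<integral>\<^sup>+s. b.mark_norm Z \<omega> s \<partial>stieltjes T (B \<omega>)) \<partial>M)"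
      by (intro nn_integral_cong b.nn_integral_mark_norm[OF b.solution_predictable[OF sol]])
    finally show "(\<integral>\<^sup>+\<omega>. (\<integral>\<^sup>+(t, x). ennreal \<bar>Z \<omega> t x\<bar> \<partial>disintegrated_measure T A \<phi> \<omega>) \<partial>M) < \<infinity>" using fin(2) by simp
  qed
qed

end
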